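(* Let $\vec\mu=(\mu_1,\mu_2)$ be an Angelesco system with $\Delta_1<\Delta_2$, let $\vec\kappa\in\mathbb R^2$ with $\kappa_1+\kappa_2=1$, and let $\rho_O$ be the spectral measure of $\delta^{(O)}$ with respect to $\mathcal J_{\vec\kappa}$. Then $\operatorname{supp}\rho_O\subseteq\Delta_1\cup\Delta_2\cup E_{\vec\varkappa}$ and, for every $Y\in\mathcal V$, $$d\,\Im G(Y,O)^+(x)=\pi\,\Psi_Y(O;x)\,d\rho_O(x),$$ where $\Psi(O;E)=l(E)/L_{(1,1)}(E)$ for $E\in E_{\vec\varkappa}$, $$\Psi(O;x)=S_O^{-1}(x)\left(\Lambda^{(0)}(x)\frac{\varkappa_k}{\|\mu_k\|}+(-1)^k\,\widehat\mu_{3-k}(x)\Big(\Lambda^{(2)}(x)\frac{\varkappa_1}{\|\mu_1\|}-\Lambda^{(1)}(x)\frac{\varkappa_2}{\|\mu_2\|}\Big)\right),\quad x\in\Delta_k,\ k\in\{1,2\},$$ and $\Psi(O;x)=0$ otherwise. Furthermore, $$\mathcal J_{\vec\kappa}\Psi(O;x)=x\Psi(O;x)\quad\text{and}\quad \delta_Y^{(O)}=\int\Psi_Y(O;x)\,d\rho_O(x)\quad (Y\in\mathcal V).$$ Finally, suppose that for each $k\in\{1,2\}$: $\operatorname{supp}\mu_k=\Delta_k$, $\mu_k$ is absolutely continuous, its density $\mu_k'$ is Dini-continuous on $\Delta_k$ and vanishes at the endpoints of $\Delta_k$, $\mu_k'(x)>0$ in the interior of $\Delta_k$, and $(\mu_k')^{-1}\in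 L^p(\Delta_k)$ for some $p>1$. Then $$d\rho_O(x)=S_O(x)|L_{\vec\varkappa}(x)|^{-2}d\mu^\star(x)+\sum_{E\in E_{\vec\varkappa}}\frac{L_{(1,1)}(E)}{L_{\vec\varkappa}'(E)}\,d\delta_E(x).$$
   Context: Angelesco system: $\mu_1,\mu_2$ are finite positive Borel measures on $\mathbb R$ with compact supports of infinite cardinality; $\Delta_i=[\alpha_i,\beta_i]$ is the convex hull of $\operatorname{supp}\mu_i$; $\Delta_1\cap\Delta_2=\varnothing$, labelled so that $\beta_1<\alpha_2$ (written $\Delta_1<\Delta_2$). $\mu^\star=\chi_{\Delta_1}\mu_1+\chi_{\Delta_2}\mu_2$, $\|\mu_k\|=\mu_k(\mathbb R)$, $\widehat\mu(z)=\int\frac{d\mu(x)}{z-x}$. Multiple orthogonality. For $\vec n=(n_1,n_2)\in\mathbb Z_+^2\setminus\{(0,0)\}$, $A^{(1)}_{\vec n},A^{(2)}_{\vec n}$ are the polynomials with $\deg A_{\vec n}^{(k)}\le n_k-1$ ($A_{\vec n}^{(k)}=0$ if $n_k=0$), $\int x^m(A_{\vec n}^{(1)}d\mu_1+A_{\vec n}^{(2)}d\mu_2)=0$ for $0\le m\le|\vec n|-2$ and $=1$ for $m=|\vec n|-1$; $P_{\vec n}$ is the monic polynomial of degree $|\vec n|=n_1+n_2$ with $\int P_{\vec n}x^md\mu_k=0$, $0\le m<n_k$, $k=1,2$. Angelesco systems are perfect (these polynomials exist uniquely for all $\vec n$), and there are uniformly bounded real recurrence coefficients with $xP_{\vec n}=P_{\vec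 n+\vec e_i}+b_{\vec n,i}P_{\vec n}+a_{\vec n,1}P_{\vec n-\vec e_1}+a_{\vec n,2}P_{\vec n-\vec e_2}$, $i\in\{1,2\}$ ($\vec e_1=(1,0)$, $\vec e_2=(0,1)$; terms with negative indices are $0$), where $a_{\vec n,i}>0$ for $\vec n\in\mathbb N^2$. Set $A_{\vec n}^{(0)}(z)=\sum_{k=1}^2\int\frac{A_{\vec n}^{(k)}(z)-A_{\vec n}^{(k)}(x)}{z-x}d\mu_k(x)$ and $L_{\vec n}(z)=\int\frac{A^{(1)}_{\vec n}(x)d\mu_1(x)+A^{(2)}_{\vec n}(x)d\mu_2(x)}{z-x}$. Tree and operator. $\mathcal V$ is the vertex set of the infinite rooted binary tree with root $O$: each $Y$ has two children $Y_{(ch),1},Y_{(ch),2}$; $Y_{(p)}$ is the parent of $Y\ne O$. $\Pi:\mathcal V\to\mathbb N^2$ is given by $\Pi(O)=(1,1)$, $\Pi(Y_{(ch),i})=\Pi(Y)+\vec e_i$; $\iota_Y=i$ if $Y$ is the $i$-th child of its parent. Functions are extended by $f_{O_{(p)}}=0$. $V_O=\kappa_1b_{(0,1),1}+\kappa_2b_{(1,0),2}$, $W_O=1$; $V_Y=b_{\Pi(Y_{(p)}),\iota_Y}$, $W_Y=a_{\Pi(Y_{(p)}),\iota_Y}>0$ for $Y\neq O$; $$(\mathcal J_{\vec\kappa}f)_Y=V_Yf_Y+W_Y^{1/2}f_{Y_{(p)}}+W_{Y_{(ch),1}}^{1/2}f_{Y_{(ch),1}}+W_{Y_{(ch),2}}^{1/2}f_{Y_{(ch),2}}.$$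 It is a bounded self-adjoint operator on $\ell^2(\mathcal V)$, and it acts by the same formula on arbitrary functions on $\mathcal V$. $\delta^{(Y)}$ is the Kronecker delta at $Y$. The spectral measure $\rho_O$ is given by $\langle(\mathcal J_{\vec\kappa}-z)^{-1}\delta^{(O)},\delta^{(O)}\rangle=\int\frac{d\rho_O(x)}{x-z}$. $G(Y,O;z)=\langle(\mathcal J_{\vec\kappa}-z)^{-1}\delta^{(O)},\delta^{(Y)}\rangle$, and $\Im G(Y,O)^+$ is the (signed) measure that is the weak$^*$ limit of $\Im G(Y,O;x+iy)\,dx$ as $y\to0^+$. Functions. $m_Y=\prod_{Z\in\mathrm{path}(Y,O)}W_Z^{-1/2}$ (both ends included); $\Lambda^{(k)}_Y=m_Y^{-1}A^{(k)}_{\Pi(Y)}$, $k\in\{0,1,2\}$; $l_Y=m_Y^{-1}L_{\Pi(Y)}$; $l(z),\Lambda^{(k)}(z),\Psi(O;x)$ are functions on $\mathcal V$ with values $l_Y(z)$, $\Lambda^{(k)}_Y(z)$, $\Psi_Y(O;x)$. $\vec\varkappa=(\varkappa_1,\varkappa_2)=(\kappa_2,\kappa_1)$, $L_{\vec\varkappa}(z)=\varkappa_1\|\mu_1\|^{-1}\widehat\mu_1(z)+\varkappa_2\|\mu_2\|^{-1}\widehat\mu_2(z)$, $E_{\vec\varkappa}=\{E\in\mathbb R\setminus(\Delta_1\cup\Delta_2):L_{\vec\varkappa}(E)=0\}$ (it has at most one element). $\Xi_{\vec\mu}=\|\mu_2\|^{-1}\int t\,d\mu_2(t)-\|\mu_1\|^{-1}\int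 t\,d\mu_1(t)>0$, and $S_O(x)=(\Xi_{\vec\mu}\|\mu_1\|\|\mu_2\|)^{-1}\big(\widehat\mu_1(x)\chi_{\Delta_2}(x)-\widehat\mu_2(x)\chi_{\Delta_1}(x)\big)>0$ on $\Delta_1\cup\Delta_2$. In the last part $|L_{\vec\varkappa}(x)|$ for $x\in\mathbb R$ is the modulus of the continuous boundary value of $L_{\vec\varkappa}$ from the upper half-plane. Dini-continuous means that the modulus of continuity $w$ satisfies $\int_0^1 w(t)t^{-1}dt<\infty$. *)

theory Defs
  imports "HOL-Probability.Probability" "HOL-Computational_Algebra.Polynomial"
begin

datatype ix = One | Two

lemma UNIV_ix: "(UNIV :: ix set) = {One, Two}"
  using ix.exhaust by auto

instance ix :: finite
  by standard (simp add: UNIV_ix)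

fun other :: "ix \<Rightarrow> ix" where
  "other One = Two"
| "other Two = One"

fun ix_num :: "ix \<Rightarrow> nat" where
  "ix_num One = 1"
| "ix_num Two = 2"

definition msupport :: "real measure \<Rightarrow> real set" where
  "msupport M = {x. \<forall>U. open U \<and> x \<in> U \<longrightarrow> emeasure M U > 0}"

definition Delta :: "(ix \<Rightarrow> real measure) \<Rightarrow> ix \<Rightarrow> real set" where
  "Delta \<mu> k = convex hull (msupport (\<mu> k))"

definition angelesco :: "(ix \<Rightarrow> real measure) \<Rightarrow> bool" where
  "angelesco \<mu> \<longleftrightarrow>
     (\<forall>k. finite_measure (\<mu> k) \<and> sets (\<mu> k) = sets borel \<and>
          compact (msupport (\<mu> k)) \<and> infinite (msupport (\<mu> k))) \<and>
     (\<forall>x \<in> Delta \<mu> One. \<forall>y \<in> Delta \<mu> Two. x < y)"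

definition mass :: "(ix \<Rightarrow> real measure) \<Rightarrow> ix \<Rightarrow> real" where
  "mass \<mu> k = measure (\<mu> k) UNIV"

definition mu_star :: "(ix \<Rightarrow> real measure) \<Rightarrow> real measure" where
  "mu_star \<mu> = measure_of UNIV (sets borel) (\<lambda>A. \<Sum>k\<in>UNIV. emeasure (\<mu> k) (A \<inter> Delta \<mu> k))"

text \<open>The type of \<open>z\<close> is left open: the function is used on the real line (off the support) and in
  the complex plane.\<close>

definition markov :: "real measure \<Rightarrow> 'a \<Rightarrow> 'a :: {real_normed_field, banach, second_countable_topology}" where
  "markov M z = (LINT x|M. 1 / (z - of_real x))"

type_synonym mindex = "ix \<Rightarrow> nat"

definition msize :: "mindex \<Rightarrow> nat" where
  "msize n = (\<Sum>k\<in>UNIV. n k)"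

definition inc :: "mindex \<Rightarrow> ix \<Rightarrow> mindex" where
  "inc n i = n(i := n i + 1)"

definition dec :: "mindex \<Rightarrow> ix \<Rightarrow> mindex" where
  "dec n i = n(i := n i - 1)"

definition unit_ix :: "ix \<Rightarrow> mindex" where
  "unit_ix i = (\<lambda>j. if j = i then 1 else 0)"

definition is_type_I :: "(ix \<Rightarrow> real measure) \<Rightarrow> mindex \<Rightarrow> (ix \<Rightarrow> real poly) \<Rightarrow> bool" where
  "is_type_I \<mu> n A \<longleftrightarrow>
     (\<forall>k. if n k = 0 then A k = 0 else degree (A k) \<le> n k - 1) \<and>
     (\<forall>m. m + 1 < msize n \<longrightarrow> (\<Sum>k\<in>UNIV. LINT x|\<mu> k. x ^ m * poly (A k) x) = 0) \<and>
     (\<forall>m. m + 1 = msize n \<longrightarrow> (\<Sum>k\<in>UNIV. LINT x|\<mu> k. x ^ m * poly (A k) x) = 1)"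

text \<open>Angelesco systems are perfect, so that for them the following descriptions determine
  unique objects (the type I polynomials for \<open>n \<noteq> 0\<close>).\<close>

definition type_I :: "(ix \<Rightarrow> real measure) \<Rightarrow> mindex \<Rightarrow> ix \<Rightarrow> real poly" where
  "type_I \<mu> n = (THE A. is_type_I \<mu> n A)"

definition type_II :: "(ix \<Rightarrow> real measure) \<Rightarrow> mindex \<Rightarrow> real poly" where
  "type_II \<mu> n = (THE P. degree P = msize n \<and> lead_coeff P = 1 \<and>
     (\<forall>k. \<forall>m < n k. (LINT x|\<mu> k. poly P x * x ^ m) = 0))"

text \<open>Coefficients \<open>a n k\<close> belonging to a term with a negative index do not matter in the
  recurrences; they are set to zero, which makes the coefficients unique.\<close>

definition is_recurrence ::
  "(ix \<Rightarrow> real measure) \<Rightarrow> (mindex \<Rightarrow> ix \<Rightarrow> real) \<Rightarrow> (mindex \<Rightarrow> ix \<Rightarrow> real) \<Rightarrow> bool" where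
  "is_recurrence \<mu> a b \<longleftrightarrow>
     (\<forall>n i. [:0, 1:] * type_II \<mu> n =
        type_II \<mu> (inc n i) + smult (b n i) (type_II \<mu> n) +
        (\<Sum>k\<in>UNIV. if n k = 0 then 0 else smult (a n k) (type_II \<mu> (dec n k)))) \<and>
     (\<forall>n k. n k = 0 \<longrightarrow> a n k = 0)"

definition rec_a :: "(ix \<Rightarrow> real measure) \<Rightarrow> mindex \<Rightarrow> ix \<Rightarrow> real" where
  "rec_a \<mu> = (THE a. \<exists>b. is_recurrence \<mu> a b)"

definition rec_b :: "(ix \<Rightarrow> real measure) \<Rightarrow> mindex \<Rightarrow> ix \<Rightarrow> real" where
  "rec_b \<mu> = (THE b. \<exists>a. is_recurrence \<mu> a b)"

text \<open>The value on the diagonal is the removable one; it matters when \<open>z\<close> is an atom of the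
  measure integrated against.\<close>

definition div_diff :: "real poly \<Rightarrow> real \<Rightarrow> real \<Rightarrow> real" where
  "div_diff p z x = (if x = z then poly (pderiv p) z else (poly p z - poly p x) / (z - x))"

definition type_I_0 :: "(ix \<Rightarrow> real measure) \<Rightarrow> mindex \<Rightarrow> real \<Rightarrow> real" where
  "type_I_0 \<mu> n z = (\<Sum>k\<in>UNIV. LINT x|\<mu> k. div_diff (type_I \<mu> n k) z x)"

definition Lfun :: "(ix \<Rightarrow> real measure) \<Rightarrow> mindex \<Rightarrow> 'a \<Rightarrow>
    'a :: {real_normed_field, banach, second_countable_topology}" where
  "Lfun \<mu> n z = (\<Sum>k\<in>UNIV. LINT x|\<mu> k. of_real (poly (type_I \<mu> n k) x) / (z - of_real x))"

text \<open>A vertex is the list of child labels met on the way from the root, the last one first: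
  the root is \<open>[]\<close>, the \<open>i\<close>-th child of \<open>Y\<close> is \<open>i # Y\<close>, the parent of \<open>Y \<noteq> []\<close> is \<open>tl Y\<close>, and
  \<open>hd Y\<close> says which child of its parent \<open>Y\<close> is.\<close>

type_synonym vertex = "ix list"

primrec proj :: "vertex \<Rightarrow> mindex" where
  "proj [] = (\<lambda>_. 1)"
| "proj (i # Y) = inc (proj Y) i"

definition Vpot :: "(ix \<Rightarrow> real measure) \<Rightarrow> (ix \<Rightarrow> real) \<Rightarrow> vertex \<Rightarrow> real" where
  "Vpot \<mu> \<kappa> Y =
     (if Y = [] then \<kappa> One * rec_b \<mu> (unit_ix Two) One + \<kappa> Two * rec_b \<mu> (unit_ix One) Two
      else rec_b \<mu> (proj (tl Y)) (hd Y))"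

definition Wpot :: "(ix \<Rightarrow> real measure) \<Rightarrow> vertex \<Rightarrow> real" where
  "Wpot \<mu> Y = (if Y = [] then 1 else rec_a \<mu> (proj (tl Y)) (hd Y))"

definition jacobi :: "(ix \<Rightarrow> real measure) \<Rightarrow> (ix \<Rightarrow> real) \<Rightarrow>
    (vertex \<Rightarrow> 'a :: real_vector) \<Rightarrow> vertex \<Rightarrow> 'a" where
  "jacobi \<mu> \<kappa> f Y =
     Vpot \<mu> \<kappa> Y *\<^sub>R f Y +
     (if Y = [] then 0 else sqrt (Wpot \<mu> Y) *\<^sub>R f (tl Y)) +
     (\<Sum>i\<in>UNIV. sqrt (Wpot \<mu> (i # Y)) *\<^sub>R f (i # Y))"

definition ell2 :: "(vertex \<Rightarrow> complex) set" where
  "ell2 = {f. (\<lambda>Y. (cmod (f Y))\<^sup>2) summable_on UNIV}"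

definition ell2_inner :: "(vertex \<Rightarrow> complex) \<Rightarrow> (vertex \<Rightarrow> complex) \<Rightarrow> complex" where
  "ell2_inner f g = (\<Sum>\<^sub>\<infinity>Y. f Y * cnj (g Y))"

definition kron :: "vertex \<Rightarrow> vertex \<Rightarrow> 'a :: zero_neq_one" where
  "kron Y Z = (if Z = Y then 1 else 0)"

text \<open>The inverse of the bijection \<open>f \<mapsto> J f - z f\<close> of the square summable functions, where
  \<open>J\<close> is self-adjoint and \<open>z\<close> is off its spectrum.\<close>

definition resolvent ::
  "(ix \<Rightarrow> real measure) \<Rightarrow> (ix \<Rightarrow> real) \<Rightarrow> complex \<Rightarrow> (vertex \<Rightarrow> complex) \<Rightarrow> vertex \<Rightarrow> complex" where
  "resolvent \<mu> \<kappa> z = the_inv_into ell2 (\<lambda>f Y. jacobi \<mu> \<kappa> f Y - z * f Y)"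

definition Green :: "(ix \<Rightarrow> real measure) \<Rightarrow> (ix \<Rightarrow> real) \<Rightarrow> vertex \<Rightarrow> vertex \<Rightarrow> complex \<Rightarrow> complex" where
  "Green \<mu> \<kappa> Y Z z = ell2_inner (resolvent \<mu> \<kappa> z (kron Z)) (kron Y)"

definition is_spectral_measure ::
  "(ix \<Rightarrow> real measure) \<Rightarrow> (ix \<Rightarrow> real) \<Rightarrow> vertex \<Rightarrow> real measure \<Rightarrow> bool" where
  "is_spectral_measure \<mu> \<kappa> Y \<rho> \<longleftrightarrow>
     finite_measure \<rho> \<and> sets \<rho> = sets borel \<and>
     (\<forall>z. Im z \<noteq> 0 \<longrightarrow> Green \<mu> \<kappa> Y Y z = (LINT x|\<rho>. 1 / (of_real x - z)))"

text \<open>The measures \<open>h y x dx\<close> on the line converge weak* (against the continuous functions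
  vanishing at infinity) to the signed measure \<open>g d\<rho>\<close> as \<open>y\<close> decreases to \<open>0\<close>.\<close>

definition weak_star_limit :: "(real \<Rightarrow> real \<Rightarrow> real) \<Rightarrow> real measure \<Rightarrow> (real \<Rightarrow> real) \<Rightarrow> bool" where
  "weak_star_limit h \<rho> g \<longleftrightarrow>
     (\<forall>y > 0. integrable lborel (h y)) \<and> integrable \<rho> g \<and>
     (\<forall>f. continuous_on UNIV f \<and> (f \<longlongrightarrow> 0) at_infinity \<longrightarrow>
        ((\<lambda>y. LINT x|lborel. f x * h y x) \<longlongrightarrow> (LINT x|\<rho>. f x * g x)) (at_right 0))"

primrec mfac :: "(ix \<Rightarrow> real measure) \<Rightarrow> vertex \<Rightarrow> real" where
  "mfac \<mu> [] = 1 / sqrt (Wpot \<mu> [])"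
| "mfac \<mu> (i # Y) = 1 / sqrt (Wpot \<mu> (i # Y)) * mfac \<mu> Y"

definition Lam :: "(ix \<Rightarrow> real measure) \<Rightarrow> ix \<Rightarrow> real \<Rightarrow> vertex \<Rightarrow> real" where
  "Lam \<mu> k x Y = poly (type_I \<mu> (proj Y) k) x / mfac \<mu> Y"

definition Lam0 :: "(ix \<Rightarrow> real measure) \<Rightarrow> real \<Rightarrow> vertex \<Rightarrow> real" where
  "Lam0 \<mu> x Y = type_I_0 \<mu> (proj Y) x / mfac \<mu> Y"

definition lfun :: "(ix \<Rightarrow> real measure) \<Rightarrow> real \<Rightarrow> vertex \<Rightarrow> real" where
  "lfun \<mu> x Y = Lfun \<mu> (proj Y) x / mfac \<mu> Y"

definition vkappa :: "(ix \<Rightarrow> real) \<Rightarrow> ix \<Rightarrow> real" where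
  "vkappa \<kappa> k = \<kappa> (other k)"

definition Lkap :: "(ix \<Rightarrow> real measure) \<Rightarrow> (ix \<Rightarrow> real) \<Rightarrow> 'a \<Rightarrow>
    'a :: {real_normed_field, banach, second_countable_topology}" where
  "Lkap \<mu> \<kappa> z = (\<Sum>k\<in>UNIV. of_real (vkappa \<kappa> k / mass \<mu> k) * markov (\<mu> k) z)"

definition Eset :: "(ix \<Rightarrow> real measure) \<Rightarrow> (ix \<Rightarrow> real) \<Rightarrow> real set" where
  "Eset \<mu> \<kappa> = {E. E \<notin> Delta \<mu> One \<union> Delta \<mu> Two \<and> Lkap \<mu> \<kappa> E = 0}"

definition Xi :: "(ix \<Rightarrow> real measure) \<Rightarrow> real" where
  "Xi \<mu> = (LINT t|\<mu> Two. t) / mass \<mu> Two - (LINT t|\<mu> One. t) / mass \<mu> One"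

definition S_O :: "(ix \<Rightarrow> real measure) \<Rightarrow> real \<Rightarrow> real" where
  "S_O \<mu> x = (markov (\<mu> One) x * indicator (Delta \<mu> Two) x -
              markov (\<mu> Two) x * indicator (Delta \<mu> One) x) / (Xi \<mu> * mass \<mu> One * mass \<mu> Two)"

definition Psi_on :: "(ix \<Rightarrow> real measure) \<Rightarrow> (ix \<Rightarrow> real) \<Rightarrow> ix \<Rightarrow> real \<Rightarrow> vertex \<Rightarrow> real" where
  "Psi_on \<mu> \<kappa> k x Y = inverse (S_O \<mu> x) *
     (Lam0 \<mu> x Y * (vkappa \<kappa> k / mass \<mu> k) +
      (- 1) ^ ix_num k * markov (\<mu> (other k)) x *
        (Lam \<mu> Two x Y * (vkappa \<kappa> One / mass \<mu> One) -
         Lam \<mu> One x Y * (vkappa \<kappa> Two / mass \<mu> Two)))"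

definition Psi :: "(ix \<Rightarrow> real measure) \<Rightarrow> (ix \<Rightarrow> real) \<Rightarrow> real \<Rightarrow> vertex \<Rightarrow> real" where
  "Psi \<mu> \<kappa> x Y =
     (if x \<in> Eset \<mu> \<kappa> then lfun \<mu> x Y / Lfun \<mu> (\<lambda>_. 1) x
      else if x \<in> Delta \<mu> One then Psi_on \<mu> \<kappa> One x Y
      else if x \<in> Delta \<mu> Two then Psi_on \<mu> \<kappa> Two x Y
      else 0)"

text \<open>The modulus is extended-valued, so that unbounded functions are not Dini-continuous.\<close>

definition modulus :: "real set \<Rightarrow> (real \<Rightarrow> real) \<Rightarrow> real \<Rightarrow> ennreal" where
  "modulus D f t = (SUP (x, y) \<in> {(x, y). x \<in> D \<and> y \<in> D \<and> \<bar>x - y\<bar> \<le> t}. ennreal \<bar>f x - f y\<bar>)"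

definition Dini_on :: "real set \<Rightarrow> (real \<Rightarrow> real) \<Rightarrow> bool" where
  "Dini_on D f \<longleftrightarrow> (\<integral>\<^sup>+t\<in>{0<..1}. (modulus D f t / ennreal t) \<partial>lborel) < \<infinity>"

text \<open>Here \<open>D\<close> is a compact interval, so its frontier consists of its endpoints; the values of the
  density \<open>w\<close> off \<open>D\<close> are irrelevant.\<close>

definition regular_on :: "real set \<Rightarrow> real measure \<Rightarrow> bool" where
  "regular_on D M \<longleftrightarrow> msupport M = D \<and>
     (\<exists>w. M = density lborel (\<lambda>x. ennreal (indicator D x * w x)) \<and>
        Dini_on D w \<and> (\<forall>x \<in> frontier D. w x = 0) \<and> (\<forall>x \<in> interior D. w x > 0) \<and>
        (\<exists>p > 1. set_integrable lborel D (\<lambda>x. inverse (w x) powr p)))"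

definition upper_boundary_value :: "(complex \<Rightarrow> complex) \<Rightarrow> real \<Rightarrow> complex" where
  "upper_boundary_value f x = Lim (at (of_real x) within {z. Im z > 0}) f"

end

theory Submission
  imports Defs "HOL-Complex_Analysis.Complex_Analysis"
begin

text \<open>Counting sign changes shows that an Angelesco system is perfect, and this yields the
  nearest-neighbour recurrences. For nonreal \<open>z\<close> the conjugated functions of the second kind satisfy
  \<open>(J - z) l = - L\<^sub>\<kappa>(z) \<delta>\<^sub>O\<close>; a real combination of consecutive functions of the second kind has
  no nonreal zeros, and Green's identity turns this into square summability, so that
  \<open>G(Y, O; z) = - l\<^sub>Y(z) / L\<^sub>\<kappa>(z)\<close>.

  The function \<open>G(Y, O; \<cdot>)\<close> is affine in \<open>G(O, O; \<cdot>)\<close>, with coefficients that are analytic across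
  \<open>\<Delta>\<^sub>1\<close> (respectively \<open>\<Delta>\<^sub>2\<close>). Hence \<open>G(Y, O; z)\<close> and the Cauchy transform of \<open>\<Psi>\<^sub>Y d\<rho>\<^sub>O\<close> differ by an
  entire function that vanishes at infinity, and Liouville's theorem identifies them. The weak limit is then
  the Poisson integral of \<open>\<Psi>\<^sub>Y d\<rho>\<^sub>O\<close>, and the behaviour at infinity gives the integral of \<open>\<Psi>\<^sub>Y\<close>.

  For regular systems the Cauchy transforms have continuous boundary values, so that Stieltjes inversion
  gives the density inside the intervals and residues give the point mass. Endpoints carry no mass:
  since \<open>1/\<mu>\<^sub>k'\<close> is integrable, \<open>Im L\<^sub>\<kappa>(c + iy) / y\<close> is unbounded as \<open>y\<close> tends to zero there.\<close>

text \<open>For general measures the Green's function need not have boundary values on the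
  intervals, so \<open>Psi\<close> cannot be read off as a quotient of boundary values. It is
  recognised instead as the coefficient \<open>\<beta>\<close> in G(Y,O;z) =
  \<open>\<alpha>\<close>(z) + \<open>\<beta>\<close>(z) G(O,O;z). There is one such relation for
  each interval: eliminating the Markov function that is singular there leaves a division by the
  other one, which has no zeros off its own interval. Whether an analytic \<open>\<beta>\<close>
  multiplies a density or its Cauchy transform makes a difference that is analytic across the
  interval; this fact replaces boundary values. The sign counts serve twice: with weight 1 for
  perfectness, and with weight 1/|z-x|^2 to exclude nonreal zeros. Objects defined by
  \<open>THE\<close> (polynomials, recurrence coefficients) or by \<open>the_inv_into\<close>
  (resolvent) become accessible only through uniqueness, which accounts for much of the
  algebra.\<close>

lemma sum_ix: "(\<Sum>k\<in>UNIV. f k) = f One + f Two"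
  by (simp add: UNIV_ix)

lemma all_ix: "(\<forall>k. P k) \<longleftrightarrow> P One \<and> P Two"
  by (metis ix.exhaust)

text \<open>Gaussian elimination over arbitrary finite index sets, so that the unknowns or equations
  of a moment problem can be indexed by pairs (interval, exponent) without renumbering.\<close>

lemma homogeneous_system_solvable:
  fixes F :: "'r \<Rightarrow> 'c \<Rightarrow> real"
  assumes "finite R" "finite C" "card R < card C"
  shows "\<exists>c. (\<exists>j\<in>C. c j \<noteq> 0) \<and> (\<forall>i\<in>R. (\<Sum>j\<in>C. F i j * c j) = 0)"
  using assms
proof (induction R arbitrary: C F rule: finite_induct)
  case empty
  then obtain j where "j \<in> C" by (metis card_gt_0_iff card.empty all_not_in_conv)
  then show ?case by (intro exI[of _ "\<lambda>_. 1"]) auto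
next
  case (insert r R)
  show ?case
  proof (cases "\<forall>j\<in>C. F r j = 0")
    case True
    from insert.IH[of C F] insert.prems insert.hyps obtain c
      where "\<exists>j\<in>C. c j \<noteq> 0" "\<forall>i\<in>R. (\<Sum>j\<in>C. F i j * c j) = 0" by auto
    with True show ?thesis by (intro exI[of _ c]) auto
  next
    case False
    then obtain p where p: "p \<in> C" "F r p \<noteq> 0" by blast
    define C' where "C' = C - {p}"
    have "card R < card C'" using insert.prems insert.hyps p by (simp add: C'_def)
    \<comment> \<open>Equation r is used to eliminate the pivot unknown p; the reduced system has
      one row and one column less.\<close>
    with insert.IH[of C' "\<lambda>i j. F i j - F i p * F r j / F r p"] insert.prems obtain c where
      c: "\<exists>j\<in>C'. c j \<noteq> 0" "\<forall>i\<in>R. (\<Sum>j\<in>C'. (F i j - F i p * F r j / F r p) * c j) = 0"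
      by (auto simp: C'_def)
    define q where "q = - (\<Sum>j\<in>C'. F r j * c j) / F r p"
    define d where "d = c(p := q)"
    have *: "(\<Sum>j\<in>C. F i j * d j) = F i p * q + (\<Sum>j\<in>C'. F i j * c j)" for i
    proof -
      have "(\<Sum>j\<in>C. F i j * d j) = F i p * d p + (\<Sum>j\<in>C'. F i j * d j)"
        using p insert.prems by (simp add: C'_def sum.remove)
      also have "(\<Sum>j\<in>C'. F i j * d j) = (\<Sum>j\<in>C'. F i j * c j)"
        by (rule sum.cong) (auto simp: d_def C'_def)
      finally show ?thesis by (simp add: d_def)
    qed
    have "(\<Sum>j\<in>C. F i j * d j) = 0" if "i \<in> R" for i
    proof -
      have "0 = (\<Sum>j\<in>C'. F i j * c j - F i p / F r p * (F r j * c j))"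
        using c(2) that by (simp add: algebra_simps)
      also have "\<dots> = (\<Sum>j\<in>C'. F i j * c j) - F i p / F r p * (\<Sum>j\<in>C'. F r j * c j)"
        by (simp add: sum_subtractf sum_distrib_left)
      finally show ?thesis unfolding * q_def by (simp add: field_simps)
    qed
    moreover have "(\<Sum>j\<in>C. F r j * d j) = 0"
      unfolding * q_def using p by simp
    moreover have "\<exists>j\<in>C. d j \<noteq> 0" using c(1) by (auto simp: d_def C'_def)
    ultimately show ?thesis by (intro exI[of _ d]) auto
  qed
qed

text \<open>The right-hand side becomes an extra column \<open>None\<close>. The enlarged system has
  more unknowns than equations, and by injectivity its nonzero solution cannot vanish at
  \<open>None\<close>, so it can be normalised there.\<close>

lemma square_system_solvable:
  fixes F :: "'r \<Rightarrow> 'c \<Rightarrow> real"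
  assumes fin: "finite R" "finite C" "card R = card C"
    and inj: "\<And>c. (\<forall>i\<in>R. (\<Sum>j\<in>C. F i j * c j) = 0) \<Longrightarrow> (\<forall>j\<in>C. c j = 0)"
  shows "\<exists>c. \<forall>i\<in>R. (\<Sum>j\<in>C. F i j * c j) = r i"
proof -
  define F' where "F' = (\<lambda>i j. case j of None \<Rightarrow> - r i | Some j \<Rightarrow> F i j)"
  have "card R < card (insert None (Some ` C))"
    using fin by (subst card_insert_disjoint) (auto simp: card_image)
  from homogeneous_system_solvable[OF fin(1) _ this, of F'] fin obtain c where
    c: "\<exists>j\<in>insert None (Some ` C). c j \<noteq> 0" and
    "\<forall>i\<in>R. (\<Sum>j\<in>insert None (Some ` C). F' i j * c j) = 0" by auto
  then have eq: "\<forall>i\<in>R. (\<Sum>j\<in>C. F i j * c (Some j)) = c None * r i"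
    using fin by (subst (asm) sum.insert) (auto simp: sum.reindex F'_def mult.commute)
  have "c None \<noteq> 0"
  proof
    assume 0: "c None = 0"
    with eq inj[of "\<lambda>j. c (Some j)"] have "\<forall>j\<in>C. c (Some j) = 0" by simp
    with 0 c show False by auto
  qed
  with eq show ?thesis
    by (intro exI[of _ "\<lambda>j. c (Some j) / c None"])
       (auto simp: sum_divide_distrib[symmetric])
qed

section \<open>Sign changes of polynomials\<close>

definition root_poly :: "real set \<Rightarrow> real poly" where
  "root_poly Z = (\<Prod>z\<in>Z. [:- z, 1:])"

lemma poly_root_poly: "poly (root_poly Z) x = (\<Prod>z\<in>Z. x - z)"
  by (simp add: root_poly_def poly_prod)

lemma degree_root_poly: "degree (root_poly Z) = card Z"
  by (cases "finite Z") (simp_all add: root_poly_def degree_prod_eq_sum_degree)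

lemma lead_coeff_root_poly: "lead_coeff (root_poly Z) = 1"
  by (simp add: root_poly_def lead_coeff_prod)

lemma root_poly_nonzero [simp]: "root_poly Z \<noteq> 0"
  using lead_coeff_root_poly[of Z] by auto

lemma poly_root_poly_eq_0_iff: "finite Z \<Longrightarrow> poly (root_poly Z) x = 0 \<longleftrightarrow> x \<in> Z"
  by (auto simp: poly_root_poly)

lemma root_poly_union:
  "finite A \<Longrightarrow> finite B \<Longrightarrow> A \<inter> B = {} \<Longrightarrow> root_poly (A \<union> B) = root_poly A * root_poly B"
  by (simp add: root_poly_def prod.union_disjoint)

lemma poly_constant_sign:
  fixes Q :: "real poly"
  assumes "\<And>x. x \<in> {a..b} \<Longrightarrow> poly Q x \<noteq> 0"
  obtains s :: real where "s = 1 \<or> s = - 1" "\<And>x. x \<in> {a..b} \<Longrightarrow> 0 < s * poly Q x"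
proof (cases "\<exists>x\<in>{a..b}. poly Q x > 0")
  case True
  then obtain x where x: "x \<in> {a..b}" "poly Q x > 0" by blast
  have "0 < 1 * poly Q y" if "y \<in> {a..b}" for y
  proof (rule ccontr)
    assume "\<not> ?thesis"
    then have "poly Q y < 0" using assms[OF that] by auto
    with x have "x \<noteq> y" by auto
    then have "\<exists>z. min x y < z \<and> z < max x y \<and> poly Q z = 0"
      using poly_IVT_neg[of x y Q] poly_IVT_pos[of y x Q] \<open>poly Q y < 0\<close> x
      by (cases "x < y") (auto simp: min_def max_def)
    then show False using assms x that by (auto simp: min_def max_def split: if_splits)
  qed
  with that[of 1] show ?thesis by auto
next
  case False
  then have "0 < (- 1) * poly Q y" if "y \<in> {a..b}" for y
    using assms[OF that] that by force
  with that[of "-1"] show ?thesis by blast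
qed

text \<open>Z collects the zeros of odd multiplicity: each linear factor that is split off toggles
  the membership of its root. Multiplication by \<open>root_poly Z\<close> then makes every
  multiplicity in the interval even.\<close>

lemma sign_changes:
  fixes Q :: "real poly"
  assumes "Q \<noteq> 0"
  shows "\<exists>Z s. finite Z \<and> Z \<subseteq> {a..b} \<and> (\<forall>z\<in>Z. poly Q z = 0) \<and> (s = 1 \<or> s = (- 1 :: real)) \<and>
      (\<forall>x\<in>{a..b}. 0 \<le> s * (poly Q x * poly (root_poly Z) x))"
  using assms
proof (induction "degree Q" arbitrary: Q rule: less_induct)
  case less
  show ?case
  proof (cases "\<exists>z\<in>{a..b}. poly Q z = 0")
    case False
    then obtain s :: real where "s = 1 \<or> s = - 1" "\<And>x. x \<in> {a..b} \<Longrightarrow> 0 < s * poly Q x"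
      using poly_constant_sign[of a b Q] by blast
    then show ?thesis
      by (intro exI[of _ "{}"] exI[of _ s]) (auto simp: root_poly_def intro: less_imp_le)
  next
    case True
    then obtain z where z: "z \<in> {a..b}" "poly Q z = 0" by blast
    then obtain R where Q: "Q = [:- z, 1:] * R" by (metis poly_eq_0_iff_dvd dvdE)
    with less.prems have R: "R \<noteq> 0" by auto
    then have "degree R < degree Q" by (simp add: Q degree_mult_eq del: mult_pCons_left)
    from less.hyps[OF this R] obtain Z s where
      Z: "finite Z" "Z \<subseteq> {a..b}" "\<forall>z\<in>Z. poly R z = 0" and s: "s = 1 \<or> s = (- 1 :: real)"
      and pos: "\<forall>x\<in>{a..b}. 0 \<le> s * (poly R x * poly (root_poly Z) x)" by blast
    show ?thesis
    proof (cases "z \<in> Z")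
      case True
      then have "poly (root_poly Z) x = (x - z) * poly (root_poly (Z - {z})) x" for x
        using Z by (simp add: poly_root_poly prod.remove)
      moreover have "poly Q x = (x - z) * poly R x" for x by (simp add: Q algebra_simps)
      ultimately have "\<forall>x\<in>{a..b}. 0 \<le> s * (poly Q x * poly (root_poly (Z - {z})) x)"
        using pos by (simp add: mult_ac)
      with Z s show ?thesis by (intro exI[of _ "Z - {z}"] exI[of _ s]) (auto simp: Q)
    next
      case False
      have "0 \<le> s * (poly Q x * poly (root_poly (insert z Z)) x)" if "x \<in> {a..b}" for x
      proof -
        have "s * (poly Q x * poly (root_poly (insert z Z)) x) =
            (x - z)\<^sup>2 * (s * (poly R x * poly (root_poly Z) x))"
          using Z False by (simp add: Q poly_root_poly power2_eq_square algebra_simps)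
        also have "0 \<le> \<dots>" using pos that by (intro mult_nonneg_nonneg[OF zero_le_power2]) blast
        finally show ?thesis .
      qed
      with Z s z show ?thesis by (intro exI[of _ "insert z Z"] exI[of _ s]) (auto simp: Q)
    qed
  qed
qed

lemma monic_eq_root_poly:
  fixes P :: "real poly"
  assumes "finite Z" "\<forall>z\<in>Z. poly P z = 0" "degree P = card Z" "lead_coeff P = 1"
  shows "P = root_poly Z"
proof (rule ccontr)
  assume ne: "P \<noteq> root_poly Z"
  define D where "D = P - root_poly Z"
  have D: "D \<noteq> 0" using ne by (simp add: D_def)
  have "degree D \<le> card Z" unfolding D_def
    by (rule degree_diff_le) (simp_all add: assms degree_root_poly)
  moreover have "coeff D (card Z) = 0"
    using assms(3,4) lead_coeff_root_poly[of Z] by (simp add: D_def degree_root_poly)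
  ultimately have "degree D < card Z"
    using D by (metis le_neq_implies_less leading_coeff_0_iff)
  moreover have "card Z \<le> card {x. poly D x = 0}"
    using assms(1,2) by (intro card_mono poly_roots_finite[OF D])
      (auto simp: D_def poly_root_poly_eq_0_iff)
  moreover have "card {x. poly D x = 0} \<le> degree D" using D by (rule card_poly_roots_bound)
  ultimately show False by linarith
qed

lemma card_roots_le_degree:
  fixes P :: "real poly"
  assumes "P \<noteq> 0" "\<forall>z\<in>Z. poly P z = 0"
  shows "card Z \<le> degree P"
proof -
  have "card Z \<le> card {x. poly P x = 0}"
    using assms by (intro card_mono poly_roots_finite) auto
  also have "\<dots> \<le> degree P" using assms by (simp add: card_poly_roots_bound)
  finally show ?thesis .
qed

section \<open>Multiple orthogonal polynomials of an Angelesco system\<close>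

lemma msupport_complement_null:
  assumes "sets M = sets borel"
  shows "emeasure M (- msupport M) = 0"
proof -
  define F where "F = {U. open U \<and> emeasure M U = 0}"
  have "- msupport M = \<Union>F"
    by (auto simp: msupport_def F_def zero_less_iff_neq_zero)
  moreover obtain F' where F': "F' \<subseteq> F" "countable F'" "\<Union>F' = \<Union>F"
    using Lindelof[of F] by (auto simp: F_def)
  moreover have "(\<Union>U\<in>F'. U) \<in> null_sets M"
    using F' assms by (intro null_sets_UN') (auto simp: F_def null_sets_def)
  ultimately show ?thesis by (auto simp: null_sets_def)
qed

text \<open>For d = 0 this forces p = 0, which matches the convention for type I polynomials with n
  k = 0 without a case distinction.\<close>

definition deg_less :: "real poly \<Rightarrow> nat \<Rightarrow> bool" where
  "deg_less p d \<longleftrightarrow> (\<forall>i\<ge>d. coeff p i = 0)"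

lemma deg_less_iff: "deg_less p d \<longleftrightarrow> p = 0 \<or> degree p < d"
  unfolding deg_less_def
  by (metis coeff_0 coeff_eq_0 leading_coeff_0_iff linorder_not_le order_less_le_trans)

lemma deg_less_mono: "deg_less p d \<Longrightarrow> d \<le> e \<Longrightarrow> deg_less p e"
  by (auto simp: deg_less_def)

lemma deg_less_monom: "i < d \<Longrightarrow> deg_less (monom c i) d"
  by (auto simp: deg_less_def)

lemma deg_less_pCons: "deg_less p d \<Longrightarrow> deg_less (pCons c p) (Suc d)"
  by (auto simp: deg_less_def coeff_pCons split: nat.splits)

lemma deg_less_linear:
  "deg_less p d \<Longrightarrow> deg_less q d \<Longrightarrow> deg_less (p + q) d"
  "deg_less p d \<Longrightarrow> deg_less q d \<Longrightarrow> deg_less (p - q) d"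
  "deg_less p d \<Longrightarrow> deg_less (smult c p) d"
  "deg_less 0 d"
  by (auto simp: deg_less_def)

lemma deg_less_sum: "(\<And>i. i \<in> I \<Longrightarrow> deg_less (f i) d) \<Longrightarrow> deg_less (\<Sum>i\<in>I. f i) d"
  by (auto simp: deg_less_def coeff_sum intro!: sum.neutral)

lemma deg_less_expand: "deg_less p d \<Longrightarrow> p = (\<Sum>i<d. monom (coeff p i) i)"
  by (rule poly_eqI) (auto simp: coeff_sum deg_less_def)

lemma msize_alt: "msize n = n One + n Two"
  by (simp add: msize_def sum_ix)

lemma msize_inc [simp]: "msize (inc n i) = Suc (msize n)"
  by (cases i) (auto simp: msize_alt inc_def)

lemma msize_dec [simp]: "n i > 0 \<Longrightarrow> msize (dec n i) = msize n - 1"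
  by (cases i) (auto simp: msize_alt dec_def)

lemma inc_dec [simp]: "n i > 0 \<Longrightarrow> inc (dec n i) i = n"
  by (auto simp: inc_def dec_def)

lemma dec_inc [simp]: "dec (inc n i) i = n"
  by (auto simp: inc_def dec_def)

lemma le_msize: "n k \<le> msize n"
  by (cases k) (auto simp: msize_alt)

locale angelesco_system =
  fixes \<mu> :: "ix \<Rightarrow> real measure"
  assumes angelesco: "angelesco \<mu>"
begin

abbreviation "\<Delta> \<equiv> Delta \<mu>"

definition lo :: "ix \<Rightarrow> real" where "lo k = Inf (\<Delta> k)"
definition hi :: "ix \<Rightarrow> real" where "hi k = Sup (\<Delta> k)"

lemma finite_measure_mu: "finite_measure (\<mu> k)"
  and sets_mu [simp, measurable_cong]: "sets (\<mu> k) = sets borel"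
  and infinite_msupport: "infinite (msupport (\<mu> k))"
  using angelesco by (auto simp: angelesco_def)

sublocale fin: finite_measure "\<mu> k" for k
  by (rule finite_measure_mu)

lemma space_mu [simp]: "space (\<mu> k) = UNIV"
  using sets_eq_imp_space_eq[OF sets_mu[of k]] by simp

lemma msupport_subset: "msupport (\<mu> k) \<subseteq> \<Delta> k"
  by (simp add: Delta_def hull_subset)

lemma Delta_eq: "\<Delta> k = {lo k..hi k}" and lo_less_hi: "lo k < hi k"
proof -
  have "compact (msupport (\<mu> k))" using angelesco by (simp add: angelesco_def)
  then have "compact (\<Delta> k)" by (simp add: Delta_def compact_convex_hull)
  moreover have "connected (\<Delta> k)" by (simp add: Delta_def convex_connected)
  ultimately obtain a b where ab: "\<Delta> k = {a..b}"
    using connected_compact_interval_1[of "\<Delta> k"] by metis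
  have "infinite (\<Delta> k)" using infinite_msupport msupport_subset finite_subset by blast
  then have "a < b" unfolding ab by (simp add: infinite_Icc_iff)
  with ab show "\<Delta> k = {lo k..hi k}" "lo k < hi k" by (auto simp: lo_def hi_def)
qed

lemma hi_less_lo: "hi One < lo Two"
proof -
  have "hi One \<in> \<Delta> One" "lo Two \<in> \<Delta> Two"
    using lo_less_hi[of One] lo_less_hi[of Two] by (auto simp: Delta_eq)
  then show ?thesis using angelesco by (simp add: angelesco_def)
qed

lemma Delta_disjoint: "\<Delta> One \<inter> \<Delta> Two = {}"
  using hi_less_lo by (auto simp: Delta_eq)

lemma compact_Delta: "compact (\<Delta> k)" and closed_Delta: "closed (\<Delta> k)"
  by (auto simp: Delta_eq)

lemma AE_mu: "AE x in \<mu> k. x \<in> \<Delta> k"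
proof -
  have "emeasure (\<mu> k) (- msupport (\<mu> k)) = 0"
    by (rule msupport_complement_null) simp
  moreover have "msupport (\<mu> k) \<in> sets borel"
    using angelesco by (auto simp: angelesco_def intro!: borel_closed compact_imp_closed)
  then have "- msupport (\<mu> k) \<in> sets (\<mu> k)" by simp
  ultimately show ?thesis
    using msupport_subset[of k] by (intro AE_I[of _ _ "- msupport (\<mu> k)"]) auto
qed

lemma not_AE_finite:
  assumes "finite F"
  shows "\<not> (AE x in \<mu> k. x \<in> F)"
proof
  assume AE: "AE x in \<mu> k. x \<in> F"
  have "F \<in> sets borel" using assms by (intro borel_closed finite_imp_closed)
  with AE have "emeasure (\<mu> k) (- F) = 0"
    by (subst (asm) AE_iff_measurable[of "- F"]) auto
  moreover obtain x where "x \<in> msupport (\<mu> k)" "x \<notin> F"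
    using infinite_msupport assms by (meson finite_subset subsetI)
  moreover have "open (- F)" using assms by (simp add: finite_imp_closed open_Compl)
  ultimately show False by (fastforce simp: msupport_def)
qed

lemma integrable_mu:
  fixes f :: "real \<Rightarrow> 'b :: {banach, second_countable_topology}"
  assumes "continuous_on (\<Delta> k) f" "f \<in> borel_measurable borel"
  shows "integrable (\<mu> k) f"
proof -
  have "bounded (f ` \<Delta> k)"
    using assms(1) compact_Delta by (intro compact_imp_bounded compact_continuous_image)
  then obtain B where "\<And>x. x \<in> \<Delta> k \<Longrightarrow> norm (f x) \<le> B" by (auto simp: bounded_iff)
  with AE_mu[of k] have "AE x in \<mu> k. norm (f x) \<le> B" by (auto elim: eventually_mono)
  with assms(2) show ?thesis by (intro fin.integrable_const_bound) simp_all
qed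

lemma integrable_mu_continuous:
  fixes f :: "real \<Rightarrow> 'b :: {banach, second_countable_topology}"
  shows "continuous_on UNIV f \<Longrightarrow> integrable (\<mu> k) f"
  by (intro integrable_mu borel_measurable_continuous_onI) (auto intro: continuous_on_subset)

text \<open>This is where the infinite support enters: an integral equal to zero would concentrate
  the measure on the finitely many zeros of f.\<close>

lemma integral_mu_pos:
  fixes f :: "real \<Rightarrow> real"
  assumes "continuous_on (\<Delta> k) f" "f \<in> borel_measurable borel"
    and nonneg: "\<And>x. x \<in> \<Delta> k \<Longrightarrow> 0 \<le> f x" and fin: "finite {x \<in> \<Delta> k. f x = 0}"
  shows "0 < (LINT x|\<mu> k. f x)"
proof -
  have int: "integrable (\<mu> k) f" by (rule integrable_mu[OF assms(1,2)])
  have ae: "AE x in \<mu> k. 0 \<le> f x" using AE_mu[of k] by eventually_elim (use nonneg in auto)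
  have "(LINT x|\<mu> k. f x) \<noteq> 0"
  proof
    assume "(LINT x|\<mu> k. f x) = 0"
    then have "AE x in \<mu> k. f x = 0" using integral_nonneg_eq_0_iff_AE[OF int ae] by simp
    then have "AE x in \<mu> k. x \<in> {x \<in> \<Delta> k. f x = 0}"
      using AE_mu[of k] by eventually_elim auto
    then show False using not_AE_finite fin by blast
  qed
  then show ?thesis using integral_nonneg_AE[OF ae] by linarith
qed

text \<open>The weight is 1 for ordinary moments and 1/|z-x|^2 when nonreal zeros are excluded; s
  records the sign of p on the interval.\<close>

lemma weighted_integral_pos:
  assumes "p \<noteq> 0" "\<And>x. x \<in> \<Delta> k \<Longrightarrow> 0 \<le> s * poly p x" "s = 1 \<or> s = - 1"
    and w: "continuous_on UNIV w" "\<And>x. 0 < w x"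
  shows "0 < s * (LINT x|\<mu> k. w x * poly p x)"
proof -
  have "continuous_on UNIV (\<lambda>x. s * (w x * poly p x))"
    using w by (intro continuous_intros)
  moreover have "finite {x \<in> \<Delta> k. s * (w x * poly p x) = 0}"
    using w(2) assms(3) by (intro finite_subset[OF _ poly_roots_finite[OF assms(1)]])
      (auto simp: less_imp_neq[symmetric])
  ultimately have "0 < (LINT x|\<mu> k. s * (w x * poly p x))"
    using assms(2) w(2) by (intro integral_mu_pos borel_measurable_continuous_onI)
      (auto intro: continuous_on_subset simp: mult.left_commute[of s] less_imp_le zero_le_mult_iff)
  then show ?thesis by simp
qed

definition mom :: "ix \<Rightarrow> real poly \<Rightarrow> real" where
  "mom k p = (LINT x|\<mu> k. poly p x)"

lemma integrable_poly: "integrable (\<mu> k) (\<lambda>x. poly p x)"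
  by (intro integrable_mu_continuous continuous_intros)

lemma mom_linear:
  "mom k (p + q) = mom k p + mom k q"
  "mom k (p - q) = mom k p - mom k q"
  "mom k (smult c p) = c * mom k p"
  "mom k 0 = 0"
  by (simp_all add: mom_def integrable_poly)

lemma mom_sum: "mom k (\<Sum>i\<in>I. f i) = (\<Sum>i\<in>I. mom k (f i))"
  by (induction I rule: infinite_finite_induct) (auto simp: mom_linear)

lemma mom_expand:
  assumes "deg_less q d"
  shows "mom k (p * q) = (\<Sum>i<d. coeff q i * mom k (p * monom 1 i))"
proof -
  have "p * q = (\<Sum>i<d. smult (coeff q i) (p * monom 1 i))"
    using arg_cong[OF deg_less_expand[OF assms], of "(*) p"]
    by (simp add: sum_distrib_left smult_monom flip: mult_smult_right)
  then show ?thesis by (simp add: mom_sum mom_linear)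
qed

lemma mom_pos:
  assumes "p \<noteq> 0" "\<And>x. x \<in> \<Delta> k \<Longrightarrow> 0 \<le> s * poly p x" "s = 1 \<or> s = - 1"
  shows "0 < s * mom k p"
  using weighted_integral_pos[OF assms, where w = "\<lambda>_. 1"] by (simp add: mom_def)

definition orthogonal :: "mindex \<Rightarrow> real poly \<Rightarrow> bool" where
  "orthogonal n P \<longleftrightarrow> (\<forall>k. \<forall>m < n k. mom k (P * monom 1 m) = 0)"

lemma orthogonalD: "orthogonal n P \<Longrightarrow> deg_less q (n k) \<Longrightarrow> mom k (P * q) = 0"
  by (subst mom_expand) (auto simp: orthogonal_def intro!: sum.neutral)

text \<open>P times the polynomial of its sign changes has constant sign, hence a nonzero integral;
  orthogonality would make that integral vanish if there were fewer than n k sign changes.\<close>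

lemma orthogonal_roots:
  assumes "P \<noteq> 0" "orthogonal n P"
  shows "\<exists>Z. finite Z \<and> Z \<subseteq> \<Delta> k \<and> n k \<le> card Z \<and> (\<forall>z\<in>Z. poly P z = 0)"
proof -
  from sign_changes[OF assms(1), of "lo k" "hi k"] obtain Z s where
    Z: "finite Z" "Z \<subseteq> \<Delta> k" "\<forall>z\<in>Z. poly P z = 0" and s: "s = 1 \<or> s = - 1" and
    pos: "\<forall>x\<in>\<Delta> k. 0 \<le> s * (poly P x * poly (root_poly Z) x)"
    unfolding Delta_eq by blast
  have "0 < s * mom k (P * root_poly Z)"
    using assms(1) pos s by (intro mom_pos) auto
  then have "\<not> deg_less (root_poly Z) (n k)" using orthogonalD[OF assms(2)] by force
  then have "n k \<le> card Z" by (simp add: deg_less_iff degree_root_poly)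
  with Z show ?thesis by blast
qed

lemma orthogonal_degree:
  assumes "P \<noteq> 0" "orthogonal n P"
  shows "\<exists>Z. (\<forall>k. finite (Z k) \<and> Z k \<subseteq> \<Delta> k \<and> n k \<le> card (Z k) \<and> (\<forall>z\<in>Z k. poly P z = 0)) \<and>
    card (Z One \<union> Z Two) = card (Z One) + card (Z Two) \<and>
    card (Z One) + card (Z Two) \<le> degree P"
proof -
  from orthogonal_roots[OF assms] obtain Z where
    Z: "\<And>k. finite (Z k) \<and> Z k \<subseteq> \<Delta> k \<and> n k \<le> card (Z k) \<and> (\<forall>z\<in>Z k. poly P z = 0)"
    by metis
  moreover have "card (Z One \<union> Z Two) = card (Z One) + card (Z Two)"
    using Z[of One] Z[of Two] Delta_disjoint by (intro card_Un_disjoint) blast+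
  moreover have "card (Z One \<union> Z Two) \<le> degree P"
    using Z by (intro card_roots_le_degree[OF assms(1)]) auto
  ultimately show ?thesis by (intro exI[of _ Z]) auto
qed

text \<open>The zeros found in the two disjoint intervals add up to at least |n|, more than the
  degree allows. This is perfectness in the form used for type II.\<close>

lemma orthogonal_eq_0:
  assumes "orthogonal n P" "deg_less P (msize n)"
  shows "P = 0"
proof (rule ccontr)
  assume "P \<noteq> 0"
  from orthogonal_degree[OF this assms(1)] obtain Z where
    "(\<forall>k. finite (Z k) \<and> Z k \<subseteq> \<Delta> k \<and> n k \<le> card (Z k) \<and> (\<forall>z\<in>Z k. poly P z = 0)) \<and>
     card (Z One \<union> Z Two) = card (Z One) + card (Z Two) \<and>
     card (Z One) + card (Z Two) \<le> degree P" by (rule exE)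
  then have "n One \<le> card (Z One)" "n Two \<le> card (Z Two)" "card (Z One) + card (Z Two) \<le> degree P"
    by simp_all
  then have "msize n \<le> degree P" by (simp add: msize_alt)
  with assms(2) \<open>P \<noteq> 0\<close> show False by (simp add: deg_less_iff)
qed

definition is_type_II :: "mindex \<Rightarrow> real poly \<Rightarrow> bool" where
  "is_type_II n P \<longleftrightarrow> degree P = msize n \<and> lead_coeff P = 1 \<and> orthogonal n P"

lemma type_II_eq_The: "type_II \<mu> n = (THE P. is_type_II n P)"
  by (simp add: type_II_def is_type_II_def orthogonal_def mom_def poly_monom)

text \<open>The orthogonality conditions for the lower coefficients form a square linear system,
  whose injectivity is \<open>orthogonal_eq_0\<close>.\<close>

lemma is_type_II_exists: "\<exists>P. is_type_II n P"
proof -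
  define R where "R = (SIGMA k:UNIV. {..<n k})"
  define F where "F = (\<lambda>(k, j) m. mom k (monom 1 m * monom 1 j))"
  have F: "(\<Sum>m<msize n. F (k, j) m * c m) = mom k ((\<Sum>m<msize n. monom (c m) m) * monom 1 j)"
    for c k j
    by (simp add: F_def sum_distrib_right mom_sum mult.commute[of "mom k _"]
        flip: mom_linear(3)) (simp add: mult_monom smult_monom)
  have "\<exists>c. \<forall>i\<in>R. (\<Sum>m<msize n. F i m * c m) = - mom (fst i) (monom 1 (msize n) * monom 1 (snd i))"
  proof (rule square_system_solvable)
    show "finite R" "finite {..<msize n}" by (auto simp: R_def)
    show "card R = card {..<msize n}" by (simp add: R_def msize_def)
    fix c assume "\<forall>i\<in>R. (\<Sum>m<msize n. F i m * c m) = 0"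
    then have "orthogonal n (\<Sum>m<msize n. monom (c m) m)"
      by (auto simp: orthogonal_def R_def F)
    moreover have "deg_less (\<Sum>m<msize n. monom (c m) m) (msize n)"
      by (intro deg_less_sum deg_less_monom) auto
    ultimately have "(\<Sum>m<msize n. monom (c m) m) = 0" by (rule orthogonal_eq_0)
    then show "\<forall>j\<in>{..<msize n}. c j = 0"
      unfolding poly_eq_iff by (auto simp: coeff_sum) metis
  qed
  then obtain c where c: "\<And>k j. j < n k \<Longrightarrow> (\<Sum>m<msize n. F (k, j) m * c m) = - mom k (monom 1 (msize n) * monom 1 j)"
    by (force simp: R_def)
  define P where "P = monom 1 (msize n) + (\<Sum>m<msize n. monom (c m) m)"
  have coeffs: "coeff P i = (if i = msize n then 1 else if i < msize n then c i else 0)" for i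
    by (auto simp: P_def coeff_sum)
  then have "degree P = msize n"
    by (intro antisym degree_le le_degree) auto
  moreover have "orthogonal n P"
    using c by (auto simp: orthogonal_def P_def distrib_right mom_linear F)
  ultimately show ?thesis using coeffs by (auto simp: is_type_II_def)
qed

lemma is_type_II_unique: "is_type_II n P \<Longrightarrow> is_type_II n Q \<Longrightarrow> P = Q"
proof -
  assume PQ: "is_type_II n P" "is_type_II n Q"
  have "orthogonal n (P - Q)"
    using PQ by (auto simp: is_type_II_def orthogonal_def left_diff_distrib mom_linear)
  moreover have "coeff (P - Q) i = 0" if "i \<ge> msize n" for i
    using that PQ coeff_eq_0[of P i] coeff_eq_0[of Q i]
    by (cases "i = msize n") (auto simp: is_type_II_def)
  ultimately show "P = Q" using orthogonal_eq_0[of n "P - Q"] by (simp add: deg_less_def)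
qed

abbreviation "P \<equiv> type_II \<mu>"

lemma is_type_II: "is_type_II n (P n)"
  unfolding type_II_eq_The using is_type_II_exists is_type_II_unique by (metis theI)

lemma degree_P [simp]: "degree (P n) = msize n"
  and coeff_P [simp]: "coeff (P n) (msize n) = 1"
  and orthogonal_P: "orthogonal n (P n)"
  using is_type_II[of n] by (auto simp: is_type_II_def)

lemma deg_less_P: "msize n < d \<Longrightarrow> deg_less (P n) d"
  by (simp add: deg_less_iff)

text \<open>The degree is exhausted by n k zeros in each interval, so there are no further or
  multiple zeros. This fixes the sign of \<open>P n\<close> outside the intervals and of each factor
  on the other interval.\<close>

lemma P_factor:
  "\<exists>Z. (\<forall>k. finite (Z k) \<and> Z k \<subseteq> \<Delta> k \<and> card (Z k) = n k) \<and>
     P n = root_poly (Z One) * root_poly (Z Two)"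
proof -
  have "P n \<noteq> 0" using coeff_P[of n] by (metis coeff_0 zero_neq_one)
  from orthogonal_degree[OF this orthogonal_P] obtain Z where
    Z: "\<And>k. finite (Z k)" "\<And>k. Z k \<subseteq> \<Delta> k" "\<And>k. n k \<le> card (Z k)" "\<forall>k. \<forall>z\<in>Z k. poly (P n) z = 0"
    and c: "card (Z One \<union> Z Two) = card (Z One) + card (Z Two)"
      "card (Z One) + card (Z Two) \<le> msize n" by auto
  have "card (Z One) = n One" "card (Z Two) = n Two"
    using c Z(3)[of One] Z(3)[of Two] by (auto simp: msize_alt)
  moreover have "P n = root_poly (Z One \<union> Z Two)"
    using Z c calculation coeff_P[of n] by (intro monic_eq_root_poly) (auto simp: msize_alt simp del: coeff_P)
  moreover have "root_poly (Z One \<union> Z Two) = root_poly (Z One) * root_poly (Z Two)"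
    using Z Delta_disjoint by (intro root_poly_union) blast+
  ultimately show ?thesis using Z by (intro exI[of _ Z]) (auto simp: all_ix)
qed

lemma root_poly_pos_right:
  "(\<And>z. z \<in> Z \<Longrightarrow> z < x) \<Longrightarrow> 0 < poly (root_poly Z) x"
  by (auto simp: poly_root_poly intro!: prod_pos)

lemma root_poly_pos_left:
  assumes "\<And>z. z \<in> Z \<Longrightarrow> x < z"
  shows "0 < (- 1) ^ card Z * poly (root_poly Z) x"
proof -
  have "(- 1) ^ card Z * poly (root_poly Z) x = (\<Prod>z\<in>Z. z - x)"
    by (simp add: poly_root_poly flip: prod_constant prod.distrib)
  with assms show ?thesis by (auto intro!: prod_pos)
qed

lemma P_pos_right: "hi Two < x \<Longrightarrow> 0 < poly (P n) x"
proof -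
  assume x: "hi Two < x"
  obtain Z where Z: "\<forall>k. finite (Z k) \<and> Z k \<subseteq> \<Delta> k \<and> card (Z k) = n k" "P n = root_poly (Z One) * root_poly (Z Two)"
    using P_factor[of n] by blast
  have "z < x" if "z \<in> Z k" for z k
    using Z that x hi_less_lo lo_less_hi[of Two] by (cases k) (force simp: Delta_eq)+
  with Z show ?thesis by (auto intro!: mult_pos_pos root_poly_pos_right)
qed

lemma P_pos_left: "x < lo One \<Longrightarrow> 0 < (- 1) ^ msize n * poly (P n) x"
proof -
  assume x: "x < lo One"
  obtain Z where Z: "\<forall>k. finite (Z k) \<and> Z k \<subseteq> \<Delta> k \<and> card (Z k) = n k" "P n = root_poly (Z One) * root_poly (Z Two)"
    using P_factor[of n] by blast
  have "x < z" if "z \<in> Z k" for z k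
    using Z that x hi_less_lo lo_less_hi[of One] by (cases k) (force simp: Delta_eq)+
  then have "0 < ((- 1) ^ card (Z One) * poly (root_poly (Z One)) x) * ((- 1) ^ card (Z Two) * poly (root_poly (Z Two)) x)"
    by (intro mult_pos_pos root_poly_pos_left) auto
  with Z show ?thesis by (simp add: msize_alt power_add mult_ac)
qed

text \<open>The first moment of \<open>P n\<close> that orthogonality does not annihilate; ratios of
  these norming constants are the recurrence coefficients a.\<close>

definition h :: "mindex \<Rightarrow> ix \<Rightarrow> real" where
  "h n k = mom k (P n * monom 1 (n k))"

text \<open>By orthogonality the monomial may be replaced by the factor of \<open>P n\<close> with
  roots in interval k. That factor then occurs squared, and the other one has constant sign on
  interval k.\<close>

lemma h_sign: "0 < (if k = One then (- 1) ^ n Two else 1) * h n k"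
proof -
  obtain Z where Z: "\<And>k. finite (Z k)" "\<And>k. Z k \<subseteq> \<Delta> k" "\<And>k. card (Z k) = n k"
    and fac: "P n = root_poly (Z One) * root_poly (Z Two)"
    using P_factor[of n] by blast
  have "deg_less (root_poly (Z k) - monom 1 (n k)) (n k)"
    using Z(3)[of k] lead_coeff_root_poly[of "Z k"] degree_root_poly[of "Z k"] coeff_eq_0[of "root_poly (Z k)"]
    by (auto simp: deg_less_def)
  from orthogonalD[where n = n, OF orthogonal_P this] have "h n k = mom k (P n * root_poly (Z k))"
    by (simp add: h_def right_diff_distrib mom_linear)
  moreover have "0 < (if k = One then (- 1) ^ n Two else 1) * mom k (P n * root_poly (Z k))"
  proof (rule mom_pos)
    show "P n * root_poly (Z k) \<noteq> 0" by (simp add: fac)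
    fix x assume x: "x \<in> \<Delta> k"
    show "0 \<le> (if k = One then (- 1) ^ n Two else 1) * poly (P n * root_poly (Z k)) x"
    proof (cases k)
      case One
      then have "0 < (- 1) ^ card (Z Two) * poly (root_poly (Z Two)) x"
        using Z(2)[of Two] x hi_less_lo by (intro root_poly_pos_left) (auto simp: Delta_eq subset_iff)
      then have "0 \<le> (poly (root_poly (Z One)) x)\<^sup>2 * ((- 1) ^ n Two * poly (root_poly (Z Two)) x)"
        using Z(3) by simp
      also have "\<dots> = (- 1) ^ n Two * poly (P n * root_poly (Z One)) x"
        by (simp add: fac power2_eq_square mult_ac)
      finally show ?thesis using One by simp
    next
      case Two
      then have "0 < poly (root_poly (Z One)) x"
        using Z(2)[of One] x hi_less_lo by (intro root_poly_pos_right) (auto simp: Delta_eq subset_iff)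
      then have "0 \<le> (poly (root_poly (Z Two)) x)\<^sup>2 * poly (root_poly (Z One)) x"
        by simp
      also have "\<dots> = poly (P n * root_poly (Z Two)) x"
        by (simp add: fac power2_eq_square mult_ac)
      finally show ?thesis using Two by simp
    qed
  qed (auto simp: minus_one_power_iff)
  ultimately show ?thesis by simp
qed

lemma h_nonzero [simp]: "h n k \<noteq> 0"
  using h_sign[of k n] by auto

definition rc_a :: "mindex \<Rightarrow> ix \<Rightarrow> real" where
  "rc_a n k = (if n k = 0 then 0 else h n k / h (dec n k) k)"

definition rc_b :: "mindex \<Rightarrow> ix \<Rightarrow> real" where
  "rc_b n i = coeff (pCons 0 (P n) - P (inc n i)) (msize n)"

text \<open>The sign of \<open>h n k\<close> depends at most on \<open>n Two\<close>, and only for k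
  = One; hence passing to \<open>dec n k\<close> does not change it and the ratio is
  positive.\<close>

lemma rc_a_pos: "0 < n k \<Longrightarrow> 0 < rc_a n k"
proof -
  assume n: "0 < n k"
  define s :: real where "s = (if k = One then (- 1) ^ n Two else 1)"
  have "0 < s * h n k" using h_sign[of k n] by (simp add: s_def)
  moreover have "0 < s * h (dec n k) k"
    using h_sign[of k "dec n k"] by (auto simp: s_def dec_def split: if_splits)
  ultimately have "0 < (s * h n k) / (s * h (dec n k) k)" by (rule divide_pos_pos)
  moreover have "s \<noteq> 0" by (simp add: s_def)
  ultimately show ?thesis using n by (simp add: rc_a_def)
qed

lemma rc_a_nonneg: "0 \<le> rc_a n k"
  using rc_a_pos[of n k] by (cases "n k = 0") (auto simp: rc_a_def)

text \<open>Lowering n at j loses exactly one condition, the one with exponent n j - 1 on the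
  measure j.\<close>

lemma mom_dec_P:
  assumes "n j \<noteq> 0" "m < n k"
  shows "mom k (P (dec n j) * monom 1 m) = (if j = k \<and> Suc m = n k then h (dec n k) k else 0)"
proof (cases "j = k \<and> Suc m = n k")
  case True
  then have "m = dec n k k" by (auto simp: dec_def)
  with True show ?thesis by (simp add: h_def)
next
  case False
  then have "m < dec n j k" using assms by (auto simp: dec_def)
  then show ?thesis using orthogonal_P[of "dec n j"] False by (auto simp: orthogonal_def)
qed

text \<open>The remainder R has degree below |n| by the choice of \<open>rc_b\<close> and is
  orthogonal by the choice of \<open>rc_a\<close>, so it vanishes by perfectness.\<close>

lemma P_recurrence:
  "pCons 0 (P n) = P (inc n i) + smult (rc_b n i) (P n) + (\<Sum>k\<in>UNIV. smult (rc_a n k) (P (dec n k)))"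
proof -
  define R where "R = pCons 0 (P n) - P (inc n i) - smult (rc_b n i) (P n) - (\<Sum>k\<in>UNIV. smult (rc_a n k) (P (dec n k)))"
  have dec0: "coeff (smult (rc_a n k) (P (dec n k))) m = 0" if "m \<ge> msize n" for m k
  proof (cases "n k = 0")
    case False
    then have "msize (dec n k) < m" using that le_msize[of n k] by simp
    then show ?thesis by (simp add: coeff_eq_0)
  qed (simp add: rc_a_def)
  have "deg_less R (msize n)"
    unfolding deg_less_def
  proof (intro allI impI)
    fix m assume m: "msize n \<le> m"
    have 1: "coeff R m = coeff (pCons 0 (P n)) m - coeff (P (inc n i)) m - rc_b n i * coeff (P n) m"
      unfolding R_def using dec0[OF m] by (simp only: coeff_diff coeff_sum sum.neutral_const coeff_smult[of "rc_b n i"] diff_zero)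
    consider "m = msize n" | "m = Suc (msize n)" | "m > Suc (msize n)" using m by linarith
    then show "coeff R m = 0"
    proof cases
      case 1
      then show ?thesis using \<open>coeff R m = _\<close> by (simp add: rc_b_def)
    next
      case 2
      then have "coeff (P (inc n i)) m = 1" by (metis coeff_P msize_inc)
      then show ?thesis using \<open>coeff R m = _\<close> 2 by (simp add: coeff_eq_0)
    next
      case 3
      then show ?thesis using \<open>coeff R m = _\<close> by (cases m) (simp_all add: coeff_eq_0)
    qed
  qed
  moreover have "orthogonal n R"
    unfolding orthogonal_def
  proof (intro allI impI)
    fix k m assume m: "m < n k"
    have "pCons 0 (P n) * monom 1 m = P n * monom 1 (Suc m)"
      by (simp add: monom_Suc)
    then have x: "mom k (pCons 0 (P n) * monom 1 m) = (if Suc m = n k then h n k else 0)"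
      using m orthogonal_P[of n] by (auto simp: h_def orthogonal_def simp del: mult_pCons_left)
    have "m < inc n i k" using m by (auto simp: inc_def)
    then have y: "mom k (P (inc n i) * monom 1 m) = 0" "mom k (P n * monom 1 m) = 0"
      using m orthogonal_P[of n] orthogonal_P[of "inc n i"] unfolding orthogonal_def by blast+
    have "(\<Sum>j\<in>UNIV. rc_a n j * mom k (P (dec n j) * monom 1 m)) =
        (\<Sum>j\<in>UNIV. if j = k then (if Suc m = n k then h n k else 0) else 0)"
      using m mom_dec_P[of n _ m k] by (intro sum.cong) (auto simp: rc_a_def)
    with x y show "mom k (R * monom 1 m) = 0"
      unfolding R_def by (simp add: left_diff_distrib mom_linear sum_distrib_right mom_sum del: mult_pCons_left)
  qed
  ultimately have "R = 0" using orthogonal_eq_0 by blast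
  then show ?thesis by (simp add: R_def algebra_simps)
qed

lemma is_recurrence_rc: "is_recurrence \<mu> rc_a rc_b"
proof -
  have "(\<Sum>k\<in>UNIV. if n k = 0 then 0 else smult (rc_a n k) (P (dec n k))) = (\<Sum>k\<in>UNIV. smult (rc_a n k) (P (dec n k)))" for n
    by (intro sum.cong) (auto simp: rc_a_def)
  then show ?thesis
    using P_recurrence by (auto simp: is_recurrence_def rc_a_def)
qed

text \<open>The coefficient at x^|n| determines b; the pairing with x^(n k - 1) on the measure k
  then isolates a. For n k = 0 the value of a is fixed by the convention in
  \<open>is_recurrence\<close>.\<close>

lemma is_recurrence_unique:
  assumes "is_recurrence \<mu> a b"
  shows "a = rc_a" "b = rc_b"
proof -
  have a0: "a n k = 0" if "n k = 0" for n k using assms that by (auto simp: is_recurrence_def)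
  have rec: "pCons 0 (P n) = P (inc n i) + smult (b n i) (P n) + (\<Sum>k\<in>UNIV. smult (a n k) (P (dec n k)))" for n i
  proof -
    have "(\<Sum>k\<in>UNIV. if n k = 0 then 0 else smult (a n k) (P (dec n k))) = (\<Sum>k\<in>UNIV. smult (a n k) (P (dec n k)))"
      using a0 by (intro sum.cong) auto
    then show ?thesis using assms unfolding is_recurrence_def by simp (metis)
  qed
  have diff: "smult (b n i - rc_b n i) (P n) + (\<Sum>k\<in>UNIV. smult (a n k - rc_a n k) (P (dec n k))) = 0" for n i
    using rec[of n i] P_recurrence[of n i] by (simp add: smult_diff_left sum_subtractf algebra_simps)
  have b: "b n i = rc_b n i" for n i
  proof -
    have "coeff (smult (a n k - rc_a n k) (P (dec n k))) (msize n) = 0" for k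
    proof (cases "n k = 0")
      case False
      then have "msize (dec n k) < msize n" using le_msize[of n k] by simp
      then show ?thesis by (simp add: coeff_eq_0)
    qed (simp add: rc_a_def a0)
    then have "coeff (\<Sum>k\<in>UNIV. smult (a n k - rc_a n k) (P (dec n k))) (msize n) = 0"
      unfolding coeff_sum by (intro sum.neutral) blast
    with arg_cong[OF diff[of n i], of "\<lambda>p. coeff p (msize n)"] show ?thesis
      unfolding coeff_add by simp
  qed
  have a: "a n k = rc_a n k" for n k
  proof (cases "n k = 0")
    case False
    have "(\<Sum>j\<in>UNIV. smult (a n j - rc_a n j) (P (dec n j))) = 0"
      using diff[of n One] by (simp add: b)
    then have "mom k ((\<Sum>j\<in>UNIV. smult (a n j - rc_a n j) (P (dec n j))) * monom 1 (n k - 1)) = 0"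
      by (simp add: mom_linear)
    then have "(\<Sum>j\<in>UNIV. (a n j - rc_a n j) * mom k (P (dec n j) * monom 1 (n k - 1))) = 0"
      by (simp add: sum_distrib_right mom_sum mom_linear)
    also have "(\<Sum>j\<in>UNIV. (a n j - rc_a n j) * mom k (P (dec n j) * monom 1 (n k - 1))) =
        (\<Sum>j\<in>UNIV. if j = k then (a n k - rc_a n k) * h (dec n k) k else 0)"
      using False mom_dec_P[of n _ "n k - 1" k] a0[of n] by (intro sum.cong) (auto simp: rc_a_def)
    finally show ?thesis by simp
  qed (simp add: rc_a_def a0)
  show "a = rc_a" "b = rc_b" using a b by blast+
qed

lemma rec_a_eq: "rec_a \<mu> = rc_a"
  unfolding rec_a_def using is_recurrence_rc is_recurrence_unique by blast

lemma rec_b_eq: "rec_b \<mu> = rc_b"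
  unfolding rec_b_def using is_recurrence_rc is_recurrence_unique by blast

text \<open>To the right of all zeros every term on the right of the recurrence is nonnegative, so
  each of them is bounded by the whole sum.\<close>

lemma rc_b_less: "hi Two < x \<Longrightarrow> rc_b n i < x"
  and P_step_right: "hi Two < x \<Longrightarrow> poly (P (inc n i)) x \<le> (x - rc_b n i) * poly (P n) x"
  and rc_a_step_right: "hi Two < x \<Longrightarrow> rc_a n k * poly (P (dec n k)) x \<le> (x - rc_b n i) * poly (P n) x"
proof -
  assume x: "hi Two < x"
  have eq: "(x - rc_b n i) * poly (P n) x = poly (P (inc n i)) x + (\<Sum>k\<in>UNIV. rc_a n k * poly (P (dec n k)) x)"
    using arg_cong[OF P_recurrence[of n i], of "\<lambda>p. poly p x"] by (simp add: poly_sum algebra_simps)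
  have pos: "0 \<le> rc_a n k * poly (P (dec n k)) x" for k
    using rc_a_nonneg P_pos_right[OF x] by (intro mult_nonneg_nonneg) (auto intro: less_imp_le)
  show 1: "poly (P (inc n i)) x \<le> (x - rc_b n i) * poly (P n) x"
    using eq pos by (simp add: sum_nonneg)
  then have "0 < (x - rc_b n i) * poly (P n) x" using P_pos_right[OF x, of "inc n i"] by linarith
  then show "rc_b n i < x" using P_pos_right[OF x, of n] by (simp add: zero_less_mult_iff)
  show "rc_a n k * poly (P (dec n k)) x \<le> (x - rc_b n i) * poly (P n) x"
    using eq pos P_pos_right[OF x, of "inc n i"] member_le_sum[of k UNIV "\<lambda>k. rc_a n k * poly (P (dec n k)) x"]
    by simp
qed

lemma rc_b_greater: "x < lo One \<Longrightarrow> x < rc_b n i"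
proof -
  assume x: "x < lo One"
  define s :: real where "s = (- 1) ^ msize n"
  have eq: "(x - rc_b n i) * (s * poly (P n) x) = s * poly (P (inc n i)) x + (\<Sum>k\<in>UNIV. rc_a n k * (s * poly (P (dec n k)) x))"
    using arg_cong[OF P_recurrence[of n i], of "\<lambda>p. s * poly p x"]
    by (simp add: poly_sum sum_distrib_left algebra_simps)
  have "rc_a n k * (s * poly (P (dec n k)) x) \<le> 0" for k
  proof (cases "n k = 0")
    case False
    then have "s = - ((- 1) ^ msize (dec n k))"
      using le_msize[of n k] by (cases "msize n") (auto simp: s_def)
    then have "s * poly (P (dec n k)) x \<le> 0" using P_pos_left[OF x, of "dec n k"] by simp
    then show ?thesis using mult_nonneg_nonpos[OF rc_a_nonneg] by blast
  qed (simp add: rc_a_def)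
  moreover have "s * poly (P (inc n i)) x < 0"
    using P_pos_left[OF x, of "inc n i"] by (simp add: s_def)
  ultimately have "(x - rc_b n i) * (s * poly (P n) x) < 0"
    unfolding eq by (meson add_neg_nonpos sum_nonpos)
  moreover have "0 < s * poly (P n) x" using P_pos_left[OF x, of n] by (simp add: s_def)
  ultimately have "x - rc_b n i < 0" by (metis mult_less_0_iff order_less_asym)
  then show ?thesis by simp
qed

text \<open>Two steps of the recurrence at a point M to the right of the intervals bound a
  P_(n-e_k)(M) by (M - b)(M - b') P_(n-e_k)(M), and both b lie between m and M. The bound is needed
  for the boundary terms on the tree.\<close>

lemma rc_a_bounded: "\<exists>C. \<forall>n k. rc_a n k \<le> C"
proof -
  define M where "M = hi Two + 1"
  define m where "m = lo One - 1"
  have M: "hi Two < M" and m: "m < lo One" by (auto simp: M_def m_def)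
  have "rc_a n k \<le> (M - m)\<^sup>2" for n k
  proof (cases "n k = 0")
    case False
    have pos: "0 < poly (P (dec n k)) M" using P_pos_right[OF M] .
    have "m \<le> M" using hi_less_lo lo_less_hi[of One] lo_less_hi[of Two] by (simp add: M_def m_def)
    have "rc_a n k * poly (P (dec n k)) M \<le> (M - rc_b n One) * poly (P n) M"
      by (rule rc_a_step_right[OF M])
    also have "\<dots> \<le> (M - rc_b n One) * ((M - rc_b (dec n k) k) * poly (P (dec n k)) M)"
      using P_step_right[OF M, of "dec n k" k] rc_b_less[OF M, of n One] False
      by (intro mult_left_mono) auto
    also have "\<dots> \<le> (M - m) * ((M - m) * poly (P (dec n k)) M)"
      using pos rc_b_greater[OF m] rc_b_less[OF M]
      by (intro mult_mono mult_right_mono mult_nonneg_nonneg) (auto intro: less_imp_le simp: algebra_simps \<open>m \<le> M\<close>)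
    finally show ?thesis using pos by (simp add: power2_eq_square mult.assoc[symmetric])
  qed (simp add: rc_a_def)
  then show ?thesis by blast
qed

end

section \<open>Type I polynomials: perfectness and recurrence\<close>

context angelesco_system
begin

abbreviation "A \<equiv> type_I \<mu>"

text \<open>A nonzero \<open>B k\<close> has at most n k - 1 sign changes. If both components are
  nonzero, the product of the two sign-change polynomials has degree at most |n| - 2, and the spare
  degree can correct the relative sign between the intervals.\<close>

lemma weighted_sign_pattern:
  assumes deg: "\<And>k. deg_less (B k) (n k)" and ne: "B j \<noteq> 0"
    and w: "continuous_on UNIV w" "\<And>x. 0 < w x"
  shows "\<exists>p. deg_less p (msize n) \<and> 0 < (\<Sum>k\<in>UNIV. LINT x|\<mu> k. w x * poly (p * B k) x)"
proof -
  have "\<exists>Z s. finite Z \<and> Z \<subseteq> \<Delta> k \<and> (s = 1 \<or> s = (- 1 :: real)) \<and> (B k \<noteq> 0 \<longrightarrow> card Z < n k) \<and> card Z \<le> n k \<and>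
      (\<forall>x\<in>\<Delta> k. 0 \<le> s * (poly (B k) x * poly (root_poly Z) x))" for k
  proof (cases "B k = 0")
    case False
    from sign_changes[OF this, of "lo k" "hi k"] obtain Z s where
      Z: "finite Z" "Z \<subseteq> \<Delta> k" "\<forall>z\<in>Z. poly (B k) z = 0" "s = 1 \<or> s = - 1"
        "\<forall>x\<in>\<Delta> k. 0 \<le> s * (poly (B k) x * poly (root_poly Z) x)"
      unfolding Delta_eq by blast
    have "card Z \<le> degree (B k)" using False Z by (intro card_roots_le_degree)
    moreover have "degree (B k) < n k" using False deg[of k] by (auto simp: deg_less_iff)
    ultimately show ?thesis using Z by (intro exI[of _ Z] exI[of _ s]) auto
  next
    case True
    then show ?thesis by (intro exI[of _ "{}"] exI[of _ 1]) auto
  qed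
  then have "\<exists>Z s. \<forall>k. finite (Z k) \<and> Z k \<subseteq> \<Delta> k \<and> (s k = 1 \<or> s k = (- 1 :: real)) \<and> (B k \<noteq> 0 \<longrightarrow> card (Z k) < n k) \<and>
      card (Z k) \<le> n k \<and> (\<forall>x\<in>\<Delta> k. 0 \<le> s k * (poly (B k) x * poly (root_poly (Z k)) x))" by metis
  then obtain Z and s :: "ix \<Rightarrow> real" where "\<forall>k. finite (Z k) \<and> Z k \<subseteq> \<Delta> k \<and> (s k = 1 \<or> s k = - 1) \<and> (B k \<noteq> 0 \<longrightarrow> card (Z k) < n k) \<and>
      card (Z k) \<le> n k \<and> (\<forall>x\<in>\<Delta> k. 0 \<le> s k * (poly (B k) x * poly (root_poly (Z k)) x))" by (elim exE)
  then have Z: "finite (Z k)" "Z k \<subseteq> \<Delta> k" "s k = 1 \<or> s k = - 1" "B k \<noteq> 0 \<Longrightarrow> card (Z k) < n k"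
    "card (Z k) \<le> n k" "\<And>x. x \<in> \<Delta> k \<Longrightarrow> 0 \<le> s k * (poly (B k) x * poly (root_poly (Z k)) x)" for k
    by simp_all
  \<comment> \<open>A polynomial with prescribed signs on the two intervals; the linear factor, with its root in the
     gap, is only needed when both components are present.\<close>
  have "\<exists>p. p \<noteq> 0 \<and> deg_less p (msize n) \<and> (\<forall>k. B k \<noteq> 0 \<longrightarrow> (\<forall>x\<in>\<Delta> k. 0 \<le> poly (p * B k) x))"
  proof -
    define q where "q = root_poly (Z One) * root_poly (Z Two)"
    have dq: "degree q = card (Z One) + card (Z Two)"
      by (simp add: q_def degree_mult_eq degree_root_poly)
    have q0: "q \<noteq> 0" by (simp add: q_def)
    define c where "c = (hi One + lo Two) / 2"
    have c: "hi One < c" "c < lo Two" using hi_less_lo by (auto simp: c_def field_simps)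
    have sgn2: "0 < poly (root_poly (Z One)) x" if "x \<in> \<Delta> Two" for x
      using Z(2)[of One] that hi_less_lo by (intro root_poly_pos_right) (auto simp: Delta_eq subset_iff)
    \<comment> \<open>The first interval lies to the left of all roots in \<open>Z Two\<close>,
      whence the power of -1; on the second interval the factor with roots in \<open>Z One\<close>
      is positive, so there \<open>s Two\<close> is already the sign of q times
      \<open>B Two\<close>.\<close>
    define t where "t = s One * (- 1) ^ card (Z Two)"
    have t: "t = 1 \<or> t = - 1" using Z(3)[of One] by (auto simp: t_def minus_one_power_iff)
    have sgn1: "0 < (- 1) ^ card (Z Two) * poly (root_poly (Z Two)) x" if "x \<in> \<Delta> One" for x
      using Z(2)[of Two] that hi_less_lo by (intro root_poly_pos_left) (auto simp: Delta_eq subset_iff)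
    have one: "0 \<le> t * poly (q * B One) x" if "x \<in> \<Delta> One" for x
    proof -
      have "0 \<le> (s One * (poly (B One) x * poly (root_poly (Z One)) x)) * ((- 1) ^ card (Z Two) * poly (root_poly (Z Two)) x)"
        by (rule mult_nonneg_nonneg[OF Z(6)[OF that] less_imp_le[OF sgn1[OF that]]])
      then show ?thesis by (simp add: t_def q_def mult_ac)
    qed
    have two: "0 \<le> s Two * poly (q * B Two) x" if "x \<in> \<Delta> Two" for x
    proof -
      have "0 \<le> (s Two * (poly (B Two) x * poly (root_poly (Z Two)) x)) * poly (root_poly (Z One)) x"
        by (rule mult_nonneg_nonneg[OF Z(6)[OF that] less_imp_le[OF sgn2[OF that]]])
      then show ?thesis by (simp add: q_def mult_ac)
    qed
    consider "B One = 0" | "B Two = 0" | "B One \<noteq> 0" "B Two \<noteq> 0" "t = s Two" | "B One \<noteq> 0" "B Two \<noteq> 0" "t = - s Two"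
      using t Z(3)[of Two] by fastforce
    then show ?thesis
    proof cases
      case 1
      then have "B Two \<noteq> 0" using ne by (cases j) auto
      have "degree (smult (s Two) q) < msize n"
        using Z(4)[OF \<open>B Two \<noteq> 0\<close>] Z(5)[of One] degree_smult_le[of "s Two" q] by (simp add: dq msize_alt)
      with 1 two q0 Z(3)[of Two] show ?thesis
        by (intro exI[of _ "smult (s Two) q"]) (auto simp: deg_less_iff all_ix)
    next
      case 2
      then have "B One \<noteq> 0" using ne by (cases j) auto
      have "degree (smult t q) < msize n"
        using Z(4)[OF \<open>B One \<noteq> 0\<close>] Z(5)[of Two] degree_smult_le[of t q] by (simp add: dq msize_alt)
      with 2 one q0 t show ?thesis
        by (intro exI[of _ "smult t q"]) (auto simp: deg_less_iff all_ix)
    next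
      case 3
      have "degree (smult t q) < msize n"
        using Z(4)[OF 3(1)] Z(5)[of Two] degree_smult_le[of t q] by (simp add: dq msize_alt)
      with 3 one two q0 t show ?thesis
        by (intro exI[of _ "smult t q"]) (auto simp: deg_less_iff all_ix)
    next
      case 4
      define p where "p = smult (s Two) (q * [:- c, 1:])"
      have px: "poly (p * B k) x = s Two * ((x - c) * poly (q * B k) x)" for k x
        by (simp add: p_def algebra_simps)
      have "degree (q * [:- c, 1:]) = Suc (degree q)" using q0 by (subst degree_mult_eq) auto
      then have "degree p < msize n"
        using Z(4)[OF 4(1)] Z(4)[OF 4(2)] degree_smult_le[of "s Two" "q * [:- c, 1:]"]
        by (simp add: dq msize_alt p_def)
      moreover have "q * [:- c, 1:] \<noteq> 0" using q0 by (simp only: mult_eq_0_iff) simp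
      then have "p \<noteq> 0" using Z(3)[of Two] by (auto simp only: p_def smult_eq_0_iff)
      moreover have "0 \<le> poly (p * B Two) x" if x: "x \<in> \<Delta> Two" for x
      proof -
        have "0 \<le> (x - c) * (s Two * poly (q * B Two) x)"
          using x c by (intro mult_nonneg_nonneg[OF _ two[OF x]]) (simp add: Delta_eq)
        then show ?thesis unfolding px by (simp only: mult_ac)
      qed
      moreover have "0 \<le> poly (p * B One) x" if x: "x \<in> \<Delta> One" for x
      proof -
        have "0 \<le> (c - x) * (t * poly (q * B One) x)"
          using x c by (intro mult_nonneg_nonneg[OF _ one[OF x]]) (simp add: Delta_eq)
        then show ?thesis unfolding px by (simp only: 4(3)) (simp add: algebra_simps)
      qed
      ultimately show ?thesis by (intro exI[of _ p]) (auto simp: deg_less_iff all_ix)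
    qed
  qed
  then obtain p where p: "p \<noteq> 0" "deg_less p (msize n)"
    "\<And>k x. B k \<noteq> 0 \<Longrightarrow> x \<in> \<Delta> k \<Longrightarrow> 0 \<le> poly (p * B k) x" by blast
  have pos: "0 < (LINT x|\<mu> k. w x * poly (p * B k) x)" if "B k \<noteq> 0" for k
    using weighted_integral_pos[of "p * B k" k 1 w] that p w by simp
  then have nonneg: "0 \<le> (LINT x|\<mu> k. w x * poly (p * B k) x)" for k
    by (cases "B k = 0") (auto intro: less_imp_le)
  have "0 < (\<Sum>k\<in>UNIV. LINT x|\<mu> k. w x * poly (p * B k) x)"
    using pos[OF ne] nonneg by (intro sum_pos2[of _ j]) auto
  with p(2) show ?thesis by blast
qed

definition pairing :: "(ix \<Rightarrow> real poly) \<Rightarrow> real poly \<Rightarrow> real" where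
  "pairing B p = (\<Sum>k\<in>UNIV. mom k (p * B k))"

lemma pairing_linear:
  "pairing B (p + q) = pairing B p + pairing B q"
  "pairing B (p - q) = pairing B p - pairing B q"
  "pairing B (smult c p) = c * pairing B p"
  "pairing B 0 = 0"
  by (simp_all add: pairing_def sum_ix distrib_right left_diff_distrib mom_linear algebra_simps)

lemma pairing_sum: "pairing B (\<Sum>i\<in>I. f i) = (\<Sum>i\<in>I. pairing B (f i))"
  by (induction I rule: infinite_finite_induct) (auto simp: pairing_linear)

lemma pairing_expand: "deg_less p d \<Longrightarrow> pairing B p = (\<Sum>i<d. coeff p i * pairing B (monom 1 i))"
proof -
  assume "deg_less p d"
  then have "p = (\<Sum>i<d. smult (coeff p i) (monom 1 i))"
    using deg_less_expand[of p d] by (simp add: smult_monom)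
  then have "pairing B p = pairing B (\<Sum>i<d. smult (coeff p i) (monom 1 i))" by simp
  then show ?thesis by (simp only: pairing_sum pairing_linear)
qed

text \<open>Perfectness for type I: a form that annihilates all monomials below |n| also annihilates
  the polynomial of \<open>weighted_sign_pattern\<close>, on which it is positive unless B
  vanishes.\<close>

lemma pairing_eq_0:
  assumes "\<And>k. deg_less (B k) (n k)" "\<And>m. m < msize n \<Longrightarrow> pairing B (monom 1 m) = 0"
  shows "B k = 0"
proof (rule ccontr)
  assume "B k \<noteq> 0"
  from weighted_sign_pattern[of B n k "\<lambda>_. 1", OF assms(1) this] obtain p where
    p: "deg_less p (msize n)" "0 < pairing B p"
    by (auto simp: pairing_def mom_def)
  with pairing_expand[OF p(1), of B] assms(2) show False by simp
qed

definition is_type_I' :: "mindex \<Rightarrow> (ix \<Rightarrow> real poly) \<Rightarrow> bool" where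
  "is_type_I' n B \<longleftrightarrow> (\<forall>k. deg_less (B k) (n k)) \<and>
     (\<forall>m < msize n. pairing B (monom 1 m) = (if Suc m = msize n then 1 else 0))"

lemma is_type_I_iff: "is_type_I \<mu> n B \<longleftrightarrow> is_type_I' n B"
proof -
  have "(if n k = 0 then B k = 0 else degree (B k) \<le> n k - 1) \<longleftrightarrow> deg_less (B k) (n k)" for k
    by (auto simp: deg_less_iff)
  moreover have "pairing B (monom 1 m) = (\<Sum>k\<in>UNIV. LINT x|\<mu> k. x ^ m * poly (B k) x)" for m
    by (simp add: pairing_def mom_def poly_monom)
  ultimately show ?thesis
    unfolding is_type_I_def is_type_I'_def by (auto simp: less_Suc_eq_le[symmetric] Suc_lessI)
qed

lemma is_type_I'_exists: "\<exists>B. is_type_I' n B"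
proof -
  define C where "C = (SIGMA k:UNIV. {..<n k})"
  define F where "F = (\<lambda>m (k, j). mom k (monom 1 m * monom 1 j))"
  define B where "B = (\<lambda>(c :: ix \<times> nat \<Rightarrow> real) k. \<Sum>j<n k. monom (c (k, j)) j)"
  have F: "(\<Sum>i\<in>C. F m i * c i) = pairing (B c) (monom 1 m)" for c m
  proof -
    have "(\<Sum>i\<in>C. F m i * c i) = (\<Sum>k\<in>UNIV. \<Sum>j<n k. F m (k, j) * c (k, j))"
      unfolding C_def by (subst sum.Sigma) auto
    also have "\<dots> = (\<Sum>k\<in>UNIV. mom k (monom 1 m * B c k))"
    proof (rule sum.cong[OF refl])
      fix k
      have "deg_less (B c k) (n k)" by (auto simp: B_def intro!: deg_less_sum deg_less_monom)
      from mom_expand[OF this, of k "monom 1 m"]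
      show "(\<Sum>j<n k. F m (k, j) * c (k, j)) = mom k (monom 1 m * B c k)"
        by (simp add: F_def B_def coeff_sum mult.commute)
    qed
    finally show ?thesis by (simp add: pairing_def)
  qed
  have deg: "deg_less (B c k) (n k)" for c k
    by (auto simp: B_def intro!: deg_less_sum deg_less_monom)
  have "\<exists>c. \<forall>m\<in>{..<msize n}. (\<Sum>i\<in>C. F m i * c i) = (if Suc m = msize n then 1 else 0)"
  proof (rule square_system_solvable)
    show "finite C" "finite {..<msize n}" by (auto simp: C_def)
    show "card {..<msize n} = card C" by (simp add: C_def msize_def)
    fix c assume "\<forall>m\<in>{..<msize n}. (\<Sum>i\<in>C. F m i * c i) = 0"
    then have 0: "B c k = 0" for k by (intro pairing_eq_0[OF deg]) (auto simp: F)
    have "c (k, j) = 0" if "j < n k" for k j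
      using arg_cong[OF 0[of k], of "\<lambda>p. coeff p j"] that by (simp add: B_def coeff_sum)
    then show "\<forall>i\<in>C. c i = 0" by (auto simp: C_def)
  qed
  then obtain c where c: "\<And>m. m < msize n \<Longrightarrow> (\<Sum>i\<in>C. F m i * c i) = (if Suc m = msize n then 1 else 0)" by blast
  then show ?thesis
    using deg by (intro exI[of _ "B c"]) (simp add: is_type_I'_def F)
qed

lemma is_type_I'_unique: "is_type_I' n B \<Longrightarrow> is_type_I' n D \<Longrightarrow> B = D"
proof
  fix k assume BD: "is_type_I' n B" "is_type_I' n D"
  have "pairing (\<lambda>k. B k - D k) p = pairing B p - pairing D p" for p
    by (simp add: pairing_def right_diff_distrib mom_linear sum_subtractf)
  then have "B k - D k = 0"
    using BD by (intro pairing_eq_0[of "\<lambda>k. B k - D k" n]) (auto simp: is_type_I'_def deg_less_linear)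
  then show "B k = D k" by simp
qed

lemma is_type_I'_A: "is_type_I' n (A n)"
  unfolding type_I_def is_type_I_iff using is_type_I'_exists is_type_I'_unique by (metis theI)

lemma deg_less_A: "deg_less (A n k) (n k)"
  using is_type_I'_A[of n] by (simp add: is_type_I'_def)

lemma pairing_A:
  assumes "deg_less p (msize n)" "0 < msize n"
  shows "pairing (A n) p = coeff p (msize n - 1)"
proof -
  have "pairing (A n) p = (\<Sum>i<msize n. coeff p i * (if Suc i = msize n then 1 else 0))"
    using is_type_I'_A[of n] by (subst pairing_expand[OF assms(1)]) (simp add: is_type_I'_def)
  also have "\<dots> = (\<Sum>i<msize n. if i = msize n - 1 then coeff p i else 0)"
    using assms(2) by (intro sum.cong) auto
  finally show ?thesis using assms(2) by simp
qed

text \<open>Biorthogonality: the pairing of \<open>A (inc n k)\<close> with \<open>P n\<close> is 1,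
  and only the top term of its k-th component survives the orthogonality of
  \<open>P n\<close>.\<close>

lemma leading_A: "coeff (A (inc n k) k) (n k) * h n k = 1"
proof -
  have "coeff (A (inc n k) k) m = 0" if "m > n k" for m
    using deg_less_A[of "inc n k" k] that by (auto simp: deg_less_def inc_def)
  then have "deg_less (A (inc n k) k - monom (coeff (A (inc n k) k) (n k)) (n k)) (n k)"
    by (auto simp: deg_less_def)
  from orthogonalD[where n = n, OF orthogonal_P this]
  moreover have "P n * monom (coeff (A (inc n k) k) (n k)) (n k) = smult (coeff (A (inc n k) k) (n k)) (P n * monom 1 (n k))"
    by (subst mult_smult_right[symmetric]) (simp add: smult_monom)
  ultimately have 1: "mom k (P n * A (inc n k) k) = coeff (A (inc n k) k) (n k) * h n k"
    by (simp add: h_def right_diff_distrib mom_linear)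
  have "mom j (P n * A (inc n k) j) = 0" if "j \<noteq> k" for j
    using deg_less_A[of "inc n k" j] that by (intro orthogonalD[where n = n, OF orthogonal_P]) (simp add: inc_def)
  then have "(\<Sum>j\<in>UNIV. mom j (P n * A (inc n k) j)) = (\<Sum>j\<in>UNIV. if j = k then mom k (P n * A (inc n k) k) else 0)"
    by (intro sum.cong) auto
  then have "pairing (A (inc n k)) (P n) = mom k (P n * A (inc n k) k)"
    by (simp add: pairing_def)
  moreover have "pairing (A (inc n k)) (P n) = 1"
    by (subst pairing_A) (auto simp: deg_less_P)
  ultimately show ?thesis using 1 by simp
qed

text \<open>The transposed recurrence. In the remainder R the top coefficients 1/h cancel, because
  \<open>rc_a\<close> is a ratio of consecutive h, so each component has degree below n k. The form
  of R annihilates all polynomials of degree below |n| - 1 and also \<open>P (dec n j)\<close>,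
  hence everything of degree below |n|. The bound 2 on |n| keeps the index \<open>dec n j\<close>
  nonzero.\<close>

lemma A_recurrence:
  assumes n: "0 < n j" "2 \<le> msize n"
  shows "pCons 0 (A n k) = A (dec n j) k + smult (rc_b (dec n j) j) (A n k) +
    (\<Sum>i\<in>UNIV. smult (rc_a n i) (A (inc n i) k))"
proof -
  define b where "b = rc_b (dec n j) j"
  define R where "R = (\<lambda>k. pCons 0 (A n k) - A (dec n j) k - smult b (A n k) -
    (\<Sum>i\<in>UNIV. smult (rc_a n i) (A (inc n i) k)))"
  have sz: "msize (dec n j) = msize n - 1" using n by simp
  have degR: "deg_less (R k) (n k)" for k
    unfolding deg_less_def
  proof (intro allI impI)
    fix m assume m: "n k \<le> m"
    have "coeff (A (dec n j) k) m = 0" "coeff (A n k) m = 0"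
      using deg_less_A[of "dec n j" k] deg_less_A[of n k] m by (auto simp: deg_less_def dec_def split: if_splits)
    moreover have "coeff (A (inc n i) k) m = 0" if "i \<noteq> k \<or> m \<noteq> n k" for i
      using deg_less_A[of "inc n i" k] m that by (auto simp: deg_less_def inc_def split: if_splits)
    then have "(\<Sum>i\<in>UNIV. rc_a n i * coeff (A (inc n i) k) m) =
        (\<Sum>i\<in>UNIV. if i = k then (if m = n k then rc_a n k * coeff (A (inc n k) k) (n k) else 0) else 0)"
      by (intro sum.cong) auto
    ultimately have R: "coeff (R k) m = coeff (pCons 0 (A n k)) m - (if m = n k then rc_a n k * coeff (A (inc n k) k) (n k) else 0)"
      by (simp add: R_def coeff_sum)
    show "coeff (R k) m = 0"
    proof (cases "m = n k")
      case False
      then show ?thesis unfolding R using m deg_less_A[of n k] by (auto simp: deg_less_def coeff_pCons split: nat.split)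
    next
      case m: True
      show ?thesis
      proof (cases "n k = 0")
        case True
        then show ?thesis unfolding R by (simp add: m rc_a_def)
      next
        case False
        then have d: "Suc (dec n k k) = n k" by (simp add: dec_def)
        have "coeff (A (inc n k) k) (n k) = 1 / h n k"
          using leading_A[of n k] by (simp add: field_simps)
        moreover have "coeff (A n k) (dec n k k) = 1 / h (dec n k) k"
          using leading_A[of "dec n k" k] False by (simp add: field_simps)
        moreover have "coeff (pCons 0 (A n k)) (n k) = coeff (A n k) (dec n k k)"
          by (subst d[symmetric]) simp
        ultimately show ?thesis unfolding R using False by (simp add: m rc_a_def)
      qed
    qed
  qed
  have pair: "pairing R p = pairing (A n) (pCons 0 p) - pairing (A (dec n j)) p - b * pairing (A n) p -
      (\<Sum>i\<in>UNIV. rc_a n i * pairing (A (inc n i)) p)" for p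
  proof -
    have "p * pCons 0 (A n k) = pCons 0 p * A n k" for k by simp
    then have "mom k (p * R k) = mom k (pCons 0 p * A n k) - mom k (p * A (dec n j) k) - b * mom k (p * A n k) -
        (\<Sum>i\<in>UNIV. rc_a n i * mom k (p * A (inc n i) k))" for k
      unfolding R_def right_diff_distrib sum_distrib_left mult_smult_right mom_linear mom_sum by simp
    then show ?thesis
      unfolding pairing_def sum_ix by (simp only: distrib_left)
  qed
  have low: "pairing R q = 0" if q: "deg_less q (msize n - 1)" for q
  proof -
    have *: "coeff q i = 0" if "i \<ge> msize n - 1" for i using q that by (simp add: deg_less_def)
    obtain N where N: "msize n = Suc (Suc N)" using n by (metis Suc_le_D numeral_2_eq_2 Suc_le_mono)
    have "pairing (A n) (pCons 0 q) = coeff (pCons 0 q) (msize n - 1)"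
      using deg_less_pCons[OF q, of 0] n by (intro pairing_A) auto
    moreover have "pairing (A (dec n j)) q = coeff q (msize n - 1 - 1)"
      using q n sz by (subst pairing_A) auto
    moreover have "pairing (A n) q = coeff q (msize n - 1)"
      using q n by (intro pairing_A) (auto elim: deg_less_mono)
    moreover have "pairing (A (inc n i)) q = coeff q (msize n)" for i
      using q n by (subst pairing_A) (auto elim: deg_less_mono)
    ultimately show ?thesis unfolding pair using * N by simp
  qed
  \<comment> \<open>Monic of degree |n| - 1, so it supplies the one missing test polynomial, and its
    own recurrence is what produces the coefficient b.\<close>
  define p0 where "p0 = P (dec n j)"
  have p0: "pairing R p0 = 0"
  proof -
    have pA: "pairing (A n) p0 = 1"
      using n sz coeff_P[of "dec n j"] by (subst pairing_A) (auto simp: p0_def deg_less_P)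
    have "pairing (A (inc n i)) p0 = 0" for i
      using n sz by (subst pairing_A) (auto simp: p0_def deg_less_P coeff_eq_0)
    moreover have "pairing (A (dec n j)) p0 = 0"
      unfolding pairing_def p0_def by (intro sum.neutral ballI orthogonalD[OF orthogonal_P] deg_less_A)
    moreover have "pairing (A n) (pCons 0 p0) = b"
    proof -
      have "pairing (A n) (P n) = 0"
        unfolding pairing_def by (intro sum.neutral ballI orthogonalD[OF orthogonal_P] deg_less_A)
      moreover have "rc_a (dec n j) k * pairing (A n) (P (dec (dec n j) k)) = 0" for k
      proof (cases "dec n j k = 0")
        case False
        then have "msize (dec (dec n j) k) = msize n - 2" using n by simp
        then have "pairing (A n) (P (dec (dec n j) k)) = 0"
          using n by (subst pairing_A) (auto simp: deg_less_P coeff_eq_0)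
        then show ?thesis by simp
      qed (simp add: rc_a_def)
      then have "(\<Sum>k\<in>UNIV. rc_a (dec n j) k * pairing (A n) (P (dec (dec n j) k))) = 0"
        by (intro sum.neutral ballI)
      ultimately show ?thesis
        using arg_cong[OF P_recurrence[of "dec n j" j], of "pairing (A n)"] n pA
        by (simp add: pairing_linear pairing_sum p0_def b_def)
    qed
    ultimately show ?thesis by (simp add: pair pA)
  qed
  have "R k = 0"
  proof (rule pairing_eq_0[OF degR])
    fix m assume m: "m < msize n"
    define q where "q = monom 1 m - smult (coeff (monom 1 m) (msize n - 1)) p0"
    have "deg_less q (msize n - 1)"
      unfolding deg_less_def
    proof (intro allI impI)
      fix i assume i: "msize n - 1 \<le> i"
      have "coeff p0 (msize n - 1) = 1" unfolding p0_def sz[symmetric] by simp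
      moreover have "coeff p0 i = 0" if "i > msize n - 1"
        using that sz by (intro coeff_eq_0) (simp add: p0_def)
      ultimately show "coeff q i = 0" using i m by (cases "i = msize n - 1") (auto simp: q_def)
    qed
    from low[OF this] show "pairing R (monom 1 m) = 0"
      by (simp add: q_def pairing_linear p0)
  qed
  then show ?thesis by (simp add: R_def b_def algebra_simps)
qed

end

section \<open>Cauchy transforms\<close>

text \<open>Limits at a point of a first-countable space can be tested along sequences, which
  reduces the claim to the sequential dominated convergence theorem.\<close>

lemma integral_tendsto_at:
  fixes f :: "'t::first_countable_topology \<Rightarrow> 'a \<Rightarrow> 'b::{banach, second_countable_topology}"
  assumes meas: "\<And>t. t \<in> S \<Longrightarrow> t \<noteq> a \<Longrightarrow> f t \<in> borel_measurable M" and g: "g \<in> borel_measurable M"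
    and w: "integrable M w"
    and lim: "AE x in M. ((\<lambda>t. f t x) \<longlongrightarrow> g x) (at a within S)"
    and bound: "\<And>t. t \<in> S \<Longrightarrow> t \<noteq> a \<Longrightarrow> AE x in M. norm (f t x) \<le> w x"
  shows "((\<lambda>t. integral\<^sup>L M (f t)) \<longlongrightarrow> integral\<^sup>L M g) (at a within S)"
  unfolding tendsto_at_iff_sequentially comp_def
proof (intro allI impI)
  fix X assume X: "\<forall>i. X i \<in> S - {a}" "X \<longlonglongrightarrow> a"
  show "(\<lambda>i. integral\<^sup>L M (f (X i))) \<longlonglongrightarrow> integral\<^sup>L M g"
  proof (rule integral_dominated_convergence[OF g _ w])
    show "f (X i) \<in> borel_measurable M" for i using meas X by auto
    show "AE x in M. norm (f (X i) x) \<le> w x" for i using bound X by auto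
    show "AE x in M. (\<lambda>i. f (X i) x) \<longlonglongrightarrow> g x"
      using lim X by (auto simp: tendsto_at_iff_sequentially comp_def)
  qed
qed

text \<open>The denominator is z - x as in \<open>markov\<close>, whereas the resolvent has x - z;
  this is the source of the minus signs where the two meet.\<close>

definition cauchy_trans :: "real measure \<Rightarrow> (real \<Rightarrow> complex) \<Rightarrow> complex \<Rightarrow> complex" where
  "cauchy_trans M g z = (LINT x|M. g x / (z - of_real x))"

lemma integrable_cauchy_trans:
  fixes g :: "real \<Rightarrow> complex"
  assumes M: "sets M = sets borel" and g: "integrable M g" and K: "closed K" "AE x in M. x \<in> K"
    and z: "z \<notin> of_real ` K"
  shows "integrable M (\<lambda>x. g x / (z - of_real x))"
proof -
  note [measurable_cong] = M
  have [measurable]: "g \<in> borel_measurable M" using g by auto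
  have "closed (complex_of_real ` K)"
    using K(1) by (intro closed_injective_linear_image) (auto simp: linear_iff scaleR_conv_of_real inj_on_def)
  from separate_point_closed[OF this z] obtain d where
    d: "0 < d" "\<And>x. x \<in> K \<Longrightarrow> d \<le> dist z (of_real x)" by blast
  show ?thesis
  proof (rule Bochner_Integration.integrable_bound)
    show "integrable M (\<lambda>x. g x / of_real d)" using g by simp
    show "AE x in M. norm (g x / (z - of_real x)) \<le> norm (g x / of_real d)"
      using K(2)
    proof eventually_elim
      case (elim x)
      then have "d \<le> norm (z - of_real x)" using d(2)[of x] by (simp add: dist_norm)
      then have "norm (g x) / norm (z - of_real x) \<le> norm (g x) / d"
        using d(1) by (intro divide_left_mono mult_pos_pos) (linarith | simp)+
      then show ?case using d(1) by (simp add: norm_divide)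
    qed
  qed measurable
qed

lemma has_field_derivative_cauchy_trans:
  assumes M: "sets M = sets borel" and g: "integrable M g" and K: "closed K" "AE x in M. x \<in> K"
    and z: "z \<notin> of_real ` K"
  shows "(cauchy_trans M g has_field_derivative (LINT x|M. - g x / (z - of_real x)\<^sup>2)) (at z)"
proof -
  note [measurable_cong] = M
  have [measurable]: "g \<in> borel_measurable M" using g by auto
  have "closed (complex_of_real ` K)"
    using K(1) by (intro closed_injective_linear_image) (auto simp: linear_iff scaleR_conv_of_real inj_on_def)
  from separate_point_closed[OF this z] obtain d where
    d: "0 < d" "\<And>x. x \<in> K \<Longrightarrow> d \<le> dist z (of_real x)" by blast
  \<comment> \<open>Within distance d/2 of z all denominators stay at least d/2 in modulus, which
    gives the dominating constant 4/d^2 for the difference quotients.\<close>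
  define S where "S = ball (0 :: complex) (d / 2)"
  have far: "d / 2 \<le> norm (z + u - of_real x)" if "u \<in> S" "x \<in> K" for u x
  proof -
    have "d \<le> norm (z - of_real x)" using d(2)[OF that(2)] by (simp add: dist_norm)
    moreover have "norm (z - of_real x) \<le> norm (z + u - of_real x) + norm u"
      using norm_triangle_ineq4[of "z + u - of_real x" u] by simp
    ultimately show ?thesis using that(1) by (simp add: S_def)
  qed
  have "((\<lambda>u. LINT x|M. - g x / ((z + u - of_real x) * (z - of_real x))) \<longlongrightarrow> (LINT x|M. - g x / (z - of_real x)\<^sup>2)) (at 0 within S)"
  proof (rule integral_tendsto_at)
    show "integrable M (\<lambda>x. norm (g x) * (4 / d\<^sup>2))" using g by simp
    show "AE x in M. ((\<lambda>u. - g x / ((z + u - of_real x) * (z - of_real x))) \<longlongrightarrow> - g x / (z - of_real x)\<^sup>2) (at 0 within S)"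
      using K(2)
    proof eventually_elim
      case (elim x)
      then have "z - of_real x \<noteq> 0" using z by auto
      then show ?case
        by (auto intro!: tendsto_eq_intros simp: power2_eq_square)
    qed
    show "AE x in M. norm (- g x / ((z + u - of_real x) * (z - of_real x))) \<le> norm (g x) * (4 / d\<^sup>2)"
      if "u \<in> S" for u
      using K(2)
    proof eventually_elim
      case (elim x)
      have f0: "d / 2 \<le> norm (z - of_real x)" using far[of 0 x] elim d(1) by (simp add: S_def)
      have p: "0 < norm (z + u - of_real x)" "0 < norm (z - of_real x)"
        using far[OF that elim] f0 d(1) by linarith+
      have "d / 2 * (d / 2) \<le> norm (z + u - of_real x) * norm (z - of_real x)"
        using far[OF that elim] f0 d(1) by (intro mult_mono) auto
      then have "norm (g x) / (norm (z + u - of_real x) * norm (z - of_real x)) \<le> norm (g x) / (d / 2 * (d / 2))"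
        using p d(1) by (intro divide_left_mono mult_pos_pos) auto
      then show ?case by (simp add: norm_divide norm_mult power2_eq_square)
    qed
  qed measurable
  moreover have "eventually (\<lambda>u. (LINT x|M. - g x / ((z + u - of_real x) * (z - of_real x))) =
      (cauchy_trans M g (z + u) - cauchy_trans M g z) / u) (at 0 within S)"
    unfolding eventually_at_filter
  proof (intro always_eventually allI impI)
    fix u :: complex assume u: "u \<noteq> 0" "u \<in> S"
    have zu: "z + u \<notin> of_real ` K" using far[OF u(2)] d by force
    have "(cauchy_trans M g (z + u) - cauchy_trans M g z) / u =
        (LINT x|M. (g x / (z + u - of_real x) - g x / (z - of_real x)) / u)"
      unfolding cauchy_trans_def
      using integrable_cauchy_trans[OF M g K zu] integrable_cauchy_trans[OF M g K z] by simp
    also have "\<dots> = (LINT x|M. - g x / ((z + u - of_real x) * (z - of_real x)))"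
    proof (rule integral_cong_AE)
      show "AE x in M. (g x / (z + u - of_real x) - g x / (z - of_real x)) / u = - g x / ((z + u - of_real x) * (z - of_real x))"
        using K(2)
      proof eventually_elim
        case (elim x)
        then have "z - of_real x \<noteq> 0" "z + u - of_real x \<noteq> 0" using z zu by auto
        then have "g x / (z + u - of_real x) - g x / (z - of_real x) = - (u * g x) / ((z + u - of_real x) * (z - of_real x))"
          by (subst diff_frac_eq) (auto simp: algebra_simps)
        then show ?case using u by simp
      qed
    qed measurable
    finally show "(LINT x|M. - g x / ((z + u - of_real x) * (z - of_real x))) = (cauchy_trans M g (z + u) - cauchy_trans M g z) / u" ..
  qed
  ultimately have "((\<lambda>u. (cauchy_trans M g (z + u) - cauchy_trans M g z) / u) \<longlongrightarrow> (LINT x|M. - g x / (z - of_real x)\<^sup>2)) (at 0 within S)"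
    by (rule Lim_transform_eventually)
  moreover have "at 0 within S = at 0" using d by (intro at_within_open) (auto simp: S_def)
  ultimately show ?thesis by (simp add: DERIV_def)
qed

lemma holomorphic_cauchy_trans:
  assumes "sets M = sets borel" "integrable M g" "closed K" "AE x in M. x \<in> K"
  shows "cauchy_trans M g holomorphic_on - (of_real ` K)"
  using has_field_derivative_cauchy_trans[OF assms]
  by (auto simp: holomorphic_on_def field_differentiable_def intro: DERIV_subset)

lemma cauchy_trans_tendsto_0:
  assumes M: "sets M = sets borel" and g: "integrable M g" and K: "closed K" "bounded K" "AE x in M. x \<in> K"
  shows "(cauchy_trans M g \<longlongrightarrow> 0) at_infinity"
proof -
  obtain R where R: "0 < R" "\<And>x. x \<in> K \<Longrightarrow> \<bar>x\<bar> \<le> R"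
    using K(2) by (auto simp: bounded_pos)
  have "norm (cauchy_trans M g z) \<le> (LINT x|M. norm (g x)) * 2 * norm (inverse z)" if z: "2 * R \<le> norm z" for z
  proof -
    have far: "norm z / 2 \<le> norm (z - of_real x)" if "x \<in> K" for x
      using norm_triangle_ineq2[of z "of_real x"] R(2)[OF that] z by simp
    have "z \<notin> of_real ` K" using R z by force
    from integrable_cauchy_trans[OF M g K(1,3) this]
    have "norm (cauchy_trans M g z) \<le> (LINT x|M. norm (g x / (z - of_real x)))"
      unfolding cauchy_trans_def by (intro integral_norm_bound)
    also have "\<dots> \<le> (LINT x|M. norm (g x) * (2 * norm (inverse z)))"
    proof (rule integral_mono_AE)
      show "AE x in M. norm (g x / (z - of_real x)) \<le> norm (g x) * (2 * norm (inverse z))"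
        using K(3)
      proof eventually_elim
        case (elim x)
        have "norm (g x) / norm (z - of_real x) \<le> norm (g x) / (norm z / 2)"
          using far[OF elim] R z by (intro divide_left_mono mult_pos_pos) auto
        then show ?case by (simp add: norm_divide norm_inverse field_simps)
      qed
    qed (use g \<open>z \<notin> _\<close> in \<open>auto intro!: integrable_cauchy_trans[OF M g K(1,3)]\<close>)
    finally show ?thesis by simp
  qed
  then have "eventually (\<lambda>z. norm (cauchy_trans M g z) \<le> (LINT x|M. norm (g x)) * 2 * norm (inverse z)) at_infinity"
    by (auto simp: eventually_at_infinity)
  moreover have "((\<lambda>z::complex. (LINT x|M. norm (g x)) * 2 * norm (inverse z)) \<longlongrightarrow> 0) at_infinity"
    by (intro tendsto_mult_right_zero tendsto_norm_zero tendsto_inverse_0)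
  ultimately show ?thesis by (rule Lim_null_comparison)
qed

section \<open>Poisson integrals and Stieltjes inversion\<close>

lemma poisson_kernel_integral:
  "integrable lborel (\<lambda>x::real. inverse (1 + x\<^sup>2))" "(LINT x|lborel. inverse (1 + x\<^sup>2)) = pi"
  using integrable_inverse_1_plus_square LBINT_inverse_1_plus_square
  by (simp_all add: interval_lebesgue_integral_def set_integrable_def set_lebesgue_integral_def)

text \<open>The Poisson kernel of the half-plane without its factor 1/pi; the total mass is pi,
  which accounts for the factor pi in the weak limit.\<close>

definition poisson :: "real \<Rightarrow> real \<Rightarrow> real" where
  "poisson y s = y / (s\<^sup>2 + y\<^sup>2)"

lemma poisson_nonneg: "0 < y \<Longrightarrow> 0 \<le> poisson y s"
  by (simp add: poisson_def)

lemma poisson_measurable [measurable]: "poisson y \<in> borel_measurable borel"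
  unfolding poisson_def by measurable

lemma poisson_scale: "0 < y \<Longrightarrow> y * poisson y (y * s) = inverse (1 + s\<^sup>2)"
proof -
  assume y: "0 < y"
  have "y\<^sup>2 * s\<^sup>2 + y\<^sup>2 = y\<^sup>2 * (1 + s\<^sup>2)" by (simp add: algebra_simps)
  then show ?thesis using y by (simp add: poisson_def power_mult_distrib power2_eq_square[of y] inverse_eq_divide)
qed

lemma poisson_even: "poisson y (- s) = poisson y s"
  by (simp add: poisson_def)

text \<open>The substitution x = t + y s exchanges the concentrating kernel for a fixed weight, so
  that y tends to 0 only inside f.\<close>

lemma poisson_convolution:
  fixes f :: "real \<Rightarrow> real"
  assumes y: "0 < y"
  shows "(LINT x|lborel. f x * poisson y (t - x)) = (LINT s|lborel. f (t + y * s) * inverse (1 + s\<^sup>2))"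
    and "integrable lborel (\<lambda>x. f x * poisson y (t - x)) \<longleftrightarrow> integrable lborel (\<lambda>s. f (t + y * s) * inverse (1 + s\<^sup>2))"
proof -
  have eq: "f (t + y * s) * inverse (1 + s\<^sup>2) = y * (f (t + y * s) * poisson y (t - (t + y * s)))" for s
    using poisson_scale[OF y, of s] by (simp add: poisson_even)
  show "(LINT x|lborel. f x * poisson y (t - x)) = (LINT s|lborel. f (t + y * s) * inverse (1 + s\<^sup>2))"
    unfolding eq using y
    by (subst lborel_integral_real_affine[where c = y and t = t]) auto
  show "integrable lborel (\<lambda>x. f x * poisson y (t - x)) \<longleftrightarrow> integrable lborel (\<lambda>s. f (t + y * s) * inverse (1 + s\<^sup>2))"
    unfolding eq using y
    by (subst lborel_integrable_real_affine_iff[where c = y and t = t, symmetric]) auto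
qed

lemma poisson_total:
  assumes "0 < y"
  shows "integrable lborel (\<lambda>x. poisson y (t - x))" "(LINT x|lborel. poisson y (t - x)) = pi"
  using poisson_convolution[OF assms, of "\<lambda>_. 1" t] poisson_kernel_integral by simp_all

lemma Im_inverse_diff: "Im (1 / (of_real t - Complex x y)) = poisson y (t - x)"
  by (simp add: poisson_def Im_divide power2_eq_square)

lemma bounded_if_vanishing_at_infinity:
  fixes f :: "real \<Rightarrow> real"
  assumes "continuous_on UNIV f" "(f \<longlongrightarrow> 0) at_infinity"
  obtains B where "0 < B" "\<And>x. \<bar>f x\<bar> \<le> B"
proof -
  from assms(2) have "eventually (\<lambda>x. \<bar>f x\<bar> < 1) at_infinity"
    by (auto simp: tendsto_iff dist_norm dest: spec[of _ 1])
  then obtain R where R: "\<And>x. R \<le> norm x \<Longrightarrow> \<bar>f x\<bar> < 1" by (auto simp: eventually_at_infinity)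
  have "bounded (f ` cball 0 R)"
    using assms(1) by (intro compact_imp_bounded compact_continuous_image) (auto intro: continuous_on_subset)
  then obtain B where B: "0 < B" "\<And>x. x \<in> cball 0 R \<Longrightarrow> \<bar>f x\<bar> \<le> B" by (auto simp: bounded_pos)
  have "\<bar>f x\<bar> \<le> B + 1" for x
    using B(1) B(2)[of x] R[of x] by (cases "norm x \<le> R") (auto simp: not_le)
  with B that[of "B + 1"] show ?thesis by auto
qed

locale borel_finite_measure = finite_measure \<rho> for \<rho> :: "real measure" +
  assumes sets_rho [simp, measurable_cong]: "sets \<rho> = sets borel"
begin

lemma space_rho [simp]: "space \<rho> = UNIV"
  using sets_eq_imp_space_eq[OF sets_rho] by simp

text \<open>Fubini moves the kernel onto the test function, whose Poisson integrals converge
  pointwise to pi f and are uniformly bounded.\<close>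

lemma weak_star_limit_poisson:
  assumes psi: "integrable \<rho> \<psi>"
    and H: "\<And>x y. 0 < y \<Longrightarrow> H y x = (LINT t|\<rho>. \<psi> t * poisson y (t - x))"
  shows "weak_star_limit H \<rho> (\<lambda>x. pi * \<psi> x)"
  unfolding weak_star_limit_def
proof (intro conjI allI impI)
  interpret pair_sigma_finite \<rho> lborel by unfold_locales
  have [measurable]: "\<psi> \<in> borel_measurable borel" using psi by auto
  have int: "integrable (\<rho> \<Otimes>\<^sub>M lborel) (\<lambda>(t, x). f x * (\<psi> t * poisson y (t - x)))"
    if y: "0 < y" and f [measurable]: "f \<in> borel_measurable borel" and B: "\<And>x. \<bar>f x\<bar> \<le> B" for y B and f :: "real \<Rightarrow> real"
  proof (rule Bochner_Integration.integrable_bound)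
    show "integrable (\<rho> \<Otimes>\<^sub>M lborel) (\<lambda>(t, x). B * (\<psi> t * poisson y (t - x)))"
    proof (rule Fubini_integrable)
      show "AE t in \<rho>. integrable lborel (\<lambda>x. case (t, x) of (t, x) \<Rightarrow> B * (\<psi> t * poisson y (t - x)))"
        using poisson_total[OF y] by simp
      have "(LINT x|lborel. norm (B * (\<psi> t * poisson y (t - x)))) = \<bar>B\<bar> * \<bar>\<psi> t\<bar> * pi" for t
        using poisson_total(2)[OF y, of t] poisson_nonneg[OF y] by (simp add: abs_mult mult.assoc[symmetric])
      then show "integrable \<rho> (\<lambda>t. LINT x|lborel. norm (case (t, x) of (t, x) \<Rightarrow> B * (\<psi> t * poisson y (t - x))))"
        using psi by simp
    qed measurable
    show "AE p in \<rho> \<Otimes>\<^sub>M lborel. norm (case p of (t, x) \<Rightarrow> f x * (\<psi> t * poisson y (t - x))) \<le>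
        norm (case p of (t, x) \<Rightarrow> B * (\<psi> t * poisson y (t - x)))"
    proof (rule AE_I2)
      fix p :: "real \<times> real"
      obtain t x where p: "p = (t, x)" by (cases p)
      have "\<bar>f x\<bar> * \<bar>\<psi> t * poisson y (t - x)\<bar> \<le> \<bar>B\<bar> * \<bar>\<psi> t * poisson y (t - x)\<bar>"
        using B[of x] by (intro mult_right_mono) auto
      then show "norm (case p of (t, x) \<Rightarrow> f x * (\<psi> t * poisson y (t - x))) \<le>
          norm (case p of (t, x) \<Rightarrow> B * (\<psi> t * poisson y (t - x)))"
        by (simp only: p case_prod_conv real_norm_def abs_mult[of "f x"] abs_mult[of B])
    qed
  qed measurable
  have fub: "integrable lborel (\<lambda>x. f x * H y x)" 
    "(LINT x|lborel. f x * H y x) = (LINT t|\<rho>. \<psi> t * (LINT s|lborel. f (t + y * s) * inverse (1 + s\<^sup>2)))"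
    if y: "0 < y" and f: "f \<in> borel_measurable borel" and B: "\<And>x. \<bar>f x\<bar> \<le> B" for y B and f :: "real \<Rightarrow> real"
  proof -
    note I = int[OF y f B]
    show "integrable lborel (\<lambda>x. f x * H y x)"
      using integrable_snd[OF I] by (simp add: H[OF y])
    have "(LINT x|lborel. f x * H y x) = (LINT x|lborel. LINT t|\<rho>. f x * (\<psi> t * poisson y (t - x)))"
      by (simp add: H[OF y])
    also have "\<dots> = (LINT t|\<rho>. LINT x|lborel. f x * (\<psi> t * poisson y (t - x)))"
      using Fubini_integral[OF I] by simp
    also have "\<dots> = (LINT t|\<rho>. \<psi> t * (LINT x|lborel. f x * poisson y (t - x)))"
      by (simp add: mult.left_commute[of "f _"])
    finally show "(LINT x|lborel. f x * H y x) = (LINT t|\<rho>. \<psi> t * (LINT s|lborel. f (t + y * s) * inverse (1 + s\<^sup>2)))"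
      by (simp add: poisson_convolution[OF y])
  qed
  show "integrable lborel (H y)" if "0 < y" for y
    using fub(1)[OF that, of "\<lambda>_. 1" 1] by simp
  show "integrable \<rho> (\<lambda>x. pi * \<psi> x)" using psi by simp
  fix f :: "real \<Rightarrow> real" assume f: "continuous_on UNIV f \<and> (f \<longlongrightarrow> 0) at_infinity"
  then obtain B where B: "0 < B" "\<And>x. \<bar>f x\<bar> \<le> B" using bounded_if_vanishing_at_infinity by blast
  have [measurable]: "f \<in> borel_measurable borel" using f by (intro borel_measurable_continuous_onI) simp
  have bnd: "integrable lborel (\<lambda>s::real. B * inverse (1 + s\<^sup>2))" using poisson_kernel_integral by simp
  have b1: "\<bar>f (t + y * s) * inverse (1 + s\<^sup>2)\<bar> \<le> B * inverse (1 + s\<^sup>2)" for t y s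
    using B by (auto simp: abs_mult intro!: mult_right_mono)
  have inner: "((\<lambda>y. LINT s|lborel. f (t + y * s) * inverse (1 + s\<^sup>2)) \<longlongrightarrow> (LINT s|lborel. f t * inverse (1 + s\<^sup>2))) (at_right 0)" for t
  proof (rule integral_tendsto_at[OF _ _ bnd])
    have "isCont f t" using f by (simp add: continuous_on_eq_continuous_at)
    show "AE s in lborel. ((\<lambda>y. f (t + y * s) * inverse (1 + s\<^sup>2)) \<longlongrightarrow> f t * inverse (1 + s\<^sup>2)) (at_right 0)"
    proof (intro AE_I2 tendsto_mult tendsto_const isCont_tendsto_compose[OF \<open>isCont f t\<close>])
      show "((\<lambda>y. t + y * s) \<longlongrightarrow> t) (at_right 0)" for s by (auto intro!: tendsto_eq_intros)
    qed
  qed (use b1 in auto)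
  have "((\<lambda>y. LINT t|\<rho>. \<psi> t * (LINT s|lborel. f (t + y * s) * inverse (1 + s\<^sup>2))) \<longlongrightarrow>
      (LINT t|\<rho>. \<psi> t * (LINT s|lborel. f t * inverse (1 + s\<^sup>2)))) (at_right 0)"
  proof (rule integral_tendsto_at)
    show "integrable \<rho> (\<lambda>t. \<bar>\<psi> t\<bar> * (B * pi))" using psi by simp
    show "AE t in \<rho>. ((\<lambda>y. \<psi> t * (LINT s|lborel. f (t + y * s) * inverse (1 + s\<^sup>2))) \<longlongrightarrow>
        \<psi> t * (LINT s|lborel. f t * inverse (1 + s\<^sup>2))) (at_right 0)"
      using inner by (intro AE_I2 tendsto_mult tendsto_const)
    show "AE t in \<rho>. norm (\<psi> t * (LINT s|lborel. f (t + y * s) * inverse (1 + s\<^sup>2))) \<le> \<bar>\<psi> t\<bar> * (B * pi)" for y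
    proof (rule AE_I2)
      fix t
      have "\<bar>LINT s|lborel. f (t + y * s) * inverse (1 + s\<^sup>2)\<bar> \<le> (LINT s|lborel. \<bar>f (t + y * s) * inverse (1 + s\<^sup>2)\<bar>)"
        by (rule integral_abs_bound)
      also have "\<dots> \<le> (LINT s|lborel. B * inverse (1 + s\<^sup>2))"
        using b1 B by (intro integral_mono'[OF bnd]) auto
      finally show "norm (\<psi> t * (LINT s|lborel. f (t + y * s) * inverse (1 + s\<^sup>2))) \<le> \<bar>\<psi> t\<bar> * (B * pi)"
        using poisson_kernel_integral by (auto simp: abs_mult intro!: mult_left_mono)
    qed
  qed measurable
  also have "(LINT t|\<rho>. \<psi> t * (LINT s|lborel. f t * inverse (1 + s\<^sup>2))) = (LINT x|\<rho>. f x * (pi * \<psi> x))"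
    using poisson_kernel_integral by (simp add: mult_ac)
  finally show "((\<lambda>y. LINT x|lborel. f x * H y x) \<longlongrightarrow> (LINT x|\<rho>. f x * (pi * \<psi> x))) (at_right 0)"
    by (rule Lim_transform_eventually)
       (use fub(2)[of _ f B] B in \<open>auto simp: eventually_at_right_less intro!: eventually_mono[OF eventually_at_right_less]\<close>)
qed

text \<open>The integrals of f against H y have two limits: one through the weak limit of Poisson
  integrals, one through the bounded convergence of \<open>\<Phi>\<close> on K. The conclusion is
  stated with extended integrals since suprema of test functions are taken next.\<close>

lemma stieltjes_inversion_test:
  assumes H: "\<And>x y. 0 < y \<Longrightarrow> H y x = (LINT t|\<rho>. poisson y (t - x))"
    and K: "compact K" and cont: "continuous_on ({0..1} \<times> K) (\<lambda>(y, x). \<Phi> y x)"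
    and eq: "\<And>x y. 0 < y \<Longrightarrow> x \<in> K \<Longrightarrow> \<Phi> y x = H y x"
    and f: "continuous_on UNIV f" "\<And>x. x \<notin> K \<Longrightarrow> f x = 0" "\<And>x. 0 \<le> f x"
  shows "(\<integral>\<^sup>+x. ennreal (f x) \<partial>\<rho>) = (\<integral>\<^sup>+x. ennreal (f x) * ennreal (\<Phi> 0 x / pi) \<partial>lborel)"
proof -
  have Kc: "closed K" and Kb: "bounded K" using K by (auto simp: compact_imp_closed compact_imp_bounded)
  have [measurable]: "f \<in> borel_measurable borel" using f(1) by (rule borel_measurable_continuous_onI)
  have [measurable]: "K \<in> sets borel" using Kc by simp
  obtain R where R: "\<And>x. x \<in> K \<Longrightarrow> norm x \<le> R" using Kb by (auto simp: bounded_iff)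
  have "(f \<longlongrightarrow> 0) at_infinity"
    by (rule tendsto_eventually) (use R f(2) in \<open>force simp: eventually_at_infinity intro!: exI[of _ "R + 1"]\<close>)
  then obtain Bf where Bf: "0 < Bf" "\<And>x. \<bar>f x\<bar> \<le> Bf"
    using bounded_if_vanishing_at_infinity[OF f(1)] by blast
  have "bounded ((\<lambda>(y, x). \<Phi> y x) ` ({0..1} \<times> K))"
    using K cont by (intro compact_imp_bounded compact_continuous_image compact_Times) auto
  then obtain B where "\<forall>p\<in>{0..1} \<times> K. \<bar>case p of (y, x) \<Rightarrow> \<Phi> y x\<bar> \<le> B" by (auto simp: bounded_iff)
  then have B: "\<bar>\<Phi> y x\<bar> \<le> B" if "y \<in> {0..1}" "x \<in> K" for x y using that by auto
  have pt: "((\<lambda>y. \<Phi> y x) \<longlongrightarrow> \<Phi> 0 x) (at 0 within {0<..<1})" if "x \<in> K" for x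
  proof -
    have "continuous_on {0..1} (\<lambda>y. case (y, x) of (y, x) \<Rightarrow> \<Phi> y x)"
      using that by (intro continuous_on_compose2[OF cont]) (auto intro!: continuous_intros)
    then have "((\<lambda>y. \<Phi> y x) \<longlongrightarrow> \<Phi> 0 x) (at 0 within {0..1})" by (auto simp: continuous_on_def)
    then show ?thesis by (rule tendsto_within_subset) auto
  qed
  have cK: "continuous_on K (\<Phi> y)" if "y \<in> {0..1}" for y
  proof -
    have "continuous_on K (\<lambda>x. case (y, x) of (y, x) \<Rightarrow> \<Phi> y x)"
      using that by (intro continuous_on_compose2[OF cont]) (auto intro!: continuous_intros)
    then show ?thesis by simp
  qed
  \<comment> \<open>Nothing is known about \<open>\<Phi>\<close> off K, not even measurability, so
    it is cut off where f vanishes anyway.\<close>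
  define \<Phi>' where "\<Phi>' = (\<lambda>y x. indicator K x *\<^sub>R \<Phi> y x)"
  have meas: "\<Phi>' y \<in> borel_measurable lborel" if "y \<in> {0..1}" for y
    unfolding \<Phi>'_def using borel_measurable_continuous_on_indicator[OF \<open>K \<in> sets borel\<close> cK[OF that]] by simp
  have f\<Phi>: "f x * \<Phi>' y x = f x * \<Phi> y x" for x y
    by (cases "x \<in> K") (auto simp: \<Phi>'_def f)
  have intK: "integrable lborel (\<lambda>x. indicator K x * (Bf * B))"
    using emeasure_compact_finite[OF K] by (intro integrable_mult_left integrable_real_indicator) auto
  have lim: "((\<lambda>y. LINT x|lborel. f x * \<Phi>' y x) \<longlongrightarrow> (LINT x|lborel. f x * \<Phi>' 0 x)) (at 0 within {0<..<1})"
  proof (rule integral_tendsto_at[OF _ _ intK])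
    show "AE x in lborel. ((\<lambda>y. f x * \<Phi>' y x) \<longlongrightarrow> f x * \<Phi>' 0 x) (at 0 within {0<..<1})"
      unfolding \<Phi>'_def using pt by (intro AE_I2) (auto intro!: tendsto_intros simp: indicator_def)
    show "AE x in lborel. norm (f x * \<Phi>' y x) \<le> indicator K x * (Bf * B)" if "y \<in> {0<..<1}" for y
      using B[of y] Bf that by (intro AE_I2) (auto simp: \<Phi>'_def indicator_def abs_mult intro!: mult_mono)
  qed (use meas in auto)
  have "((\<lambda>y. LINT x|lborel. f x * H y x) \<longlongrightarrow> (LINT x|\<rho>. f x * (pi * 1))) (at_right 0)"
    using weak_star_limit_poisson[of "\<lambda>_. 1" H] H f(1) \<open>(f \<longlongrightarrow> 0) at_infinity\<close>
    by (auto simp: weak_star_limit_def)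
  then have "((\<lambda>y. LINT x|lborel. f x * H y x) \<longlongrightarrow> (LINT x|\<rho>. f x * (pi * 1))) (at 0 within {0<..<1})"
    by (rule tendsto_within_subset) auto
  then have "((\<lambda>y. LINT x|lborel. f x * \<Phi>' y x) \<longlongrightarrow> (LINT x|\<rho>. f x * (pi * 1))) (at 0 within {0<..<1})"
  proof (rule Lim_transform_eventually)
    have "f x * H y x = f x * \<Phi>' y x" if "0 < y" for x y
      using eq[OF that, of x] f(2)[of x] by (cases "x \<in> K") (auto simp: \<Phi>'_def)
    then have "(LINT x|lborel. f x * H y x) = (LINT x|lborel. f x * \<Phi>' y x)" if "0 < y" for y
      using that by (intro Bochner_Integration.integral_cong) auto
    then show "eventually (\<lambda>y. (LINT x|lborel. f x * H y x) = (LINT x|lborel. f x * \<Phi>' y x)) (at 0 within {0<..<1})"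
      unfolding eventually_at_filter by (intro always_eventually) auto
  qed
  moreover have "at 0 within {0<..<1::real} \<noteq> bot"
    by (simp add: at_within_eq_bot_iff islimpt_greaterThanLessThan1 trivial_limit_within flip: trivial_limit_def)
  ultimately have "(LINT x|\<rho>. f x * (pi * 1)) = (LINT x|lborel. f x * \<Phi>' 0 x)"
    using lim tendsto_unique by blast
  then have eq1: "(LINT x|\<rho>. f x) = (LINT x|lborel. f x * (\<Phi>' 0 x / pi))"
    by (simp add: field_simps)
  have nonneg: "0 \<le> \<Phi>' 0 x" for x
  proof (cases "x \<in> K")
    case True
    have "0 \<le> \<Phi> 0 x"
    proof (rule tendsto_lowerbound[OF pt[OF True]])
      show "at 0 within {0<..<1::real} \<noteq> bot" by fact
      show "eventually (\<lambda>y. 0 \<le> \<Phi> y x) (at 0 within {0<..<1})"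
        using eq[OF _ True] H poisson_nonneg by (auto simp: eventually_at_filter intro!: integral_nonneg_AE)
    qed
    then show ?thesis by (simp add: \<Phi>'_def)
  qed (simp add: \<Phi>'_def)
  have i1: "integrable \<rho> f" using Bf by (intro integrable_const_bound) auto
  have i2: "integrable lborel (\<lambda>x. f x * (\<Phi>' 0 x / pi))"
  proof (rule Bochner_Integration.integrable_bound)
    show "integrable lborel (\<lambda>x. indicator K x * (Bf * B))" by (rule intK)
    have "\<bar>f x * (\<Phi>' 0 x / pi)\<bar> \<le> \<bar>indicator K x * (Bf * B)\<bar>" for x
    proof (cases "x \<in> K")
      case True
      have "\<bar>\<Phi> 0 x\<bar> / pi \<le> \<bar>\<Phi> 0 x\<bar> / 1" using pi_gt3 by (intro divide_left_mono) auto
      then have "\<bar>\<Phi> 0 x\<bar> / pi \<le> B" using B[of 0, OF _ True] by simp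
      then have "\<bar>f x\<bar> * (\<bar>\<Phi> 0 x\<bar> / pi) \<le> Bf * B" using Bf by (intro mult_mono) auto
      also have "\<dots> \<le> \<bar>Bf * B\<bar>" by (rule abs_ge_self)
      finally show ?thesis using True by (simp add: \<Phi>'_def abs_mult)
    qed (simp add: \<Phi>'_def)
    then show "AE x in lborel. norm (f x * (\<Phi>' 0 x / pi)) \<le> norm (indicator K x * (Bf * B))" by simp
  qed (use meas[of 0] in measurable)
  have "(\<integral>\<^sup>+x. ennreal (f x) \<partial>\<rho>) = ennreal (LINT x|\<rho>. f x)"
    using i1 f(3) by (intro nn_integral_eq_integral) auto
  also have "\<dots> = (\<integral>\<^sup>+x. ennreal (f x * (\<Phi>' 0 x / pi)) \<partial>lborel)"
    unfolding eq1 using i2 f(3) nonneg by (intro nn_integral_eq_integral[symmetric]) auto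
  also have "\<dots> = (\<integral>\<^sup>+x. ennreal (f x) * ennreal (\<Phi> 0 x / pi) \<partial>lborel)"
    using f\<Phi>[of _ 0] f(3) by (intro nn_integral_cong) (metis ennreal_mult' times_divide_eq_right)
  finally show ?thesis .
qed

text \<open>Indicators of open subsets of I are increasing limits of continuous functions with
  compact support inside them; two measures that agree on open sets and are finite agree on all
  Borel sets.\<close>

lemma stieltjes_inversion:
  assumes H: "\<And>x y. 0 < y \<Longrightarrow> H y x = (LINT t|\<rho>. poisson y (t - x))"
    and I: "open I" "bounded I" and cont: "continuous_on ({0..} \<times> I) (\<lambda>(y, x). \<Phi> y x)"
    and eq: "\<And>x y. 0 < y \<Longrightarrow> x \<in> I \<Longrightarrow> \<Phi> y x = H y x"
    and B: "B \<in> sets borel"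
  shows "emeasure \<rho> (B \<inter> I) = (\<integral>\<^sup>+x. indicator (B \<inter> I) x * ennreal (\<Phi> 0 x / pi) \<partial>lborel)"
proof -
  have [measurable]: "I \<in> sets borel" using I by simp
  have c0: "continuous_on I (\<Phi> 0)"
  proof -
    have "continuous_on I (\<lambda>x. case (0, x) of (y, x) \<Rightarrow> \<Phi> y x)"
      by (intro continuous_on_compose2[OF cont]) (auto intro!: continuous_intros)
    then show ?thesis by simp
  qed
  have m0: "(\<lambda>x. indicator I x *\<^sub>R \<Phi> 0 x) \<in> borel_measurable borel"
    by (rule borel_measurable_continuous_on_indicator[OF _ c0]) simp
  define \<phi> where "\<phi> = (\<lambda>x. indicator I x * ennreal (\<Phi> 0 x / pi))"
  have "\<phi> = (\<lambda>x. ennreal ((indicator I x *\<^sub>R \<Phi> 0 x) / pi))"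
    by (auto simp: \<phi>_def indicator_def)
  then have [measurable]: "\<phi> \<in> borel_measurable borel" using m0 by simp
  define M1 where "M1 = density \<rho> (indicator I)"
  define M2 where "M2 = density lborel \<phi>"
  have open_eq: "emeasure M1 U = emeasure M2 U" if U: "open U" for U
  proof -
    define V where "V = U \<inter> I"
    have V: "open V" "bounded V" using U I by (auto simp: V_def intro: bounded_subset)
    \<comment> \<open>This matters because \<open>infdist\<close> to the empty set is 0 by
      convention.\<close>
    then have "- V \<noteq> {}" using not_bounded_UNIV by (metis Compl_UNIV_eq double_complement)
    have cl: "closed (- V)" using V by auto
    \<comment> \<open>A ramp in the distance to the complement: 0 where n times the distance is at
      most 1, and 1 where it is at least 2. Its support is therefore a compact subset of V.\<close>
    define f where "f = (\<lambda>n x. min 1 (max 0 (real n * infdist x (- V) - 1)))"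
    have test: "(\<integral>\<^sup>+x. ennreal (f n x) \<partial>\<rho>) = (\<integral>\<^sup>+x. ennreal (f n x) * ennreal (\<Phi> 0 x / pi) \<partial>lborel)" for n
    proof -
      define K where "K = {x. 1 \<le> real n * infdist x (- V)}"
      have "K \<subseteq> V"
      proof
        fix x assume "x \<in> K"
        then have "infdist x (- V) \<noteq> 0" by (auto simp: K_def)
        then show "x \<in> V" by (metis ComplI infdist_zero)
      qed
      moreover have "closed K" unfolding K_def
        by (intro closed_Collect_le continuous_intros)
      ultimately have "compact K" using V by (auto simp: compact_eq_bounded_closed intro: bounded_subset)
      moreover have "continuous_on ({0..1} \<times> K) (\<lambda>(y, x). \<Phi> y x)"
        using \<open>K \<subseteq> V\<close> by (intro continuous_on_subset[OF cont]) (auto simp: V_def)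
      ultimately show ?thesis
        using \<open>K \<subseteq> V\<close> by (intro stieltjes_inversion_test[OF H, where K = K])
          (auto simp: f_def K_def V_def intro!: continuous_intros eq)
    qed
    have f_incr: "incseq (\<lambda>n. ennreal (f n x))" for x
      unfolding f_def incseq_def
      by (intro allI impI ennreal_leI min.mono max.mono diff_mono mult_right_mono infdist_nonneg) auto
    have f_sup: "(SUP n. ennreal (f n x)) = indicator V x" for x
    proof (cases "x \<in> V")
      case False
      then have "infdist x (- V) = 0" by (simp add: infdist_zero)
      then show ?thesis using False by (simp add: f_def)
    next
      case True
      then have "infdist x (- V) > 0"
        using cl \<open>- V \<noteq> {}\<close> in_closed_iff_infdist_zero[OF cl \<open>- V \<noteq> {}\<close>, of x] infdist_nonneg[of x "- V"] by auto
      then obtain n where n: "2 < real n * infdist x (- V)" using reals_Archimedean3 by blast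
      then have "f n x = 1" by (simp add: f_def)
      then have "1 \<le> (SUP n. ennreal (f n x))" by (intro SUP_upper2[of n]) auto
      moreover have "(SUP n. ennreal (f n x)) \<le> 1" by (intro SUP_least) (auto simp: f_def)
      ultimately show ?thesis using True by simp
    qed
    have fm [measurable]: "f n \<in> borel_measurable borel" for n
      unfolding f_def by (intro borel_measurable_continuous_onI continuous_intros)
    have fV: "ennreal (f n x) * ennreal (\<Phi> 0 x / pi) = ennreal (f n x) * \<phi> x" for n x
      by (cases "x \<in> V") (auto simp: \<phi>_def V_def f_def infdist_zero indicator_def)
    have "emeasure M1 U = (\<integral>\<^sup>+x. indicator I x * indicator U x \<partial>\<rho>)"
      using U by (simp add: M1_def emeasure_density)
    also have "\<dots> = (\<integral>\<^sup>+x. indicator V x \<partial>\<rho>)"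
      by (intro nn_integral_cong) (auto simp: V_def indicator_def)
    also have "\<dots> = emeasure \<rho> V" using V by simp
    also have "\<dots> = (\<integral>\<^sup>+x. (SUP n. ennreal (f n x)) \<partial>\<rho>)" using V by (simp add: f_sup)
    also have "\<dots> = (SUP n. \<integral>\<^sup>+x. ennreal (f n x) \<partial>\<rho>)"
      using f_incr by (intro nn_integral_monotone_convergence_SUP) (auto simp: incseq_def le_fun_def)
    also have "\<dots> = (SUP n. \<integral>\<^sup>+x. ennreal (f n x) * \<phi> x \<partial>lborel)" by (simp only: test fV)
    also have "\<dots> = (\<integral>\<^sup>+x. (SUP n. ennreal (f n x) * \<phi> x) \<partial>lborel)"
      using f_incr by (intro nn_integral_monotone_convergence_SUP[symmetric])
        (auto simp: incseq_def le_fun_def intro!: mult_right_mono)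
    also have "\<dots> = (\<integral>\<^sup>+x. indicator V x * \<phi> x \<partial>lborel)"
      by (simp add: f_sup flip: SUP_mult_right_ennreal)
    also have "\<dots> = emeasure M2 U"
      using U by (simp add: M2_def emeasure_density) (auto intro!: nn_integral_cong simp: indicator_def V_def \<phi>_def)
    finally show ?thesis .
  qed
  have "M1 = M2"
  proof (rule measure_eqI_generator_eq[where \<Omega> = UNIV and E = "{U. open U}" and A = "\<lambda>_. UNIV"])
    show "Int_stable {U :: real set. open U}" by (auto simp: Int_stable_def)
    show "sets M1 = sigma_sets UNIV {U. open U}" "sets M2 = sigma_sets UNIV {U. open U}"
      by (auto simp: M1_def M2_def borel_def)
    have "emeasure M1 UNIV = (\<integral>\<^sup>+x. indicator I x \<partial>\<rho>)"
      by (simp add: M1_def emeasure_density)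
    also have "\<dots> = emeasure \<rho> I" by simp
    finally show "emeasure M1 UNIV \<noteq> \<infinity>" for i :: nat
      using emeasure_finite[of I] by simp
  qed (use open_eq in auto)
  then have "emeasure M1 (B \<inter> I) = emeasure M2 (B \<inter> I)" by simp
  moreover have "emeasure M1 (B \<inter> I) = emeasure \<rho> (B \<inter> I)"
  proof -
    have "emeasure M1 (B \<inter> I) = (\<integral>\<^sup>+x. indicator I x * indicator (B \<inter> I) x \<partial>\<rho>)"
      using B by (simp add: M1_def emeasure_density)
    also have "\<dots> = (\<integral>\<^sup>+x. indicator (B \<inter> I) x \<partial>\<rho>)"
      by (intro nn_integral_cong) (auto simp: indicator_def)
    also have "\<dots> = emeasure \<rho> (B \<inter> I)"
      using B by (intro nn_integral_indicator) simp
    finally show ?thesis .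
  qed
  moreover have "emeasure M2 (B \<inter> I) = (\<integral>\<^sup>+x. indicator (B \<inter> I) x * ennreal (\<Phi> 0 x / pi) \<partial>lborel)"
    using B by (simp add: M2_def emeasure_density) (auto intro!: nn_integral_cong simp: indicator_def \<phi>_def)
  ultimately show ?thesis by simp
qed

end

section \<open>Functions of the second kind\<close>

context angelesco_system
begin

definition cint :: "ix \<Rightarrow> real poly \<Rightarrow> 'b \<Rightarrow> 'b::{real_normed_field, banach, second_countable_topology}" where
  "cint k p z = (LINT x|\<mu> k. of_real (poly p x) / (z - of_real x))"

lemma integrable_cint:
  fixes z :: "'b::{real_normed_field, banach, second_countable_topology}"
  assumes "z \<notin> of_real ` \<Delta> k"
  shows "integrable (\<mu> k) (\<lambda>x. of_real (poly p x) / (z - of_real x))"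
proof (rule integrable_mu)
  show "continuous_on (\<Delta> k) (\<lambda>x. of_real (poly p x) / (z - of_real x))"
    using assms by (intro continuous_intros) auto
  have "(\<lambda>x. poly p x) \<in> borel_measurable borel"
    by (intro borel_measurable_continuous_onI continuous_intros)
  then show "(\<lambda>x. of_real (poly p x) / (z - of_real x)) \<in> borel_measurable borel"
    by measurable
qed

lemma markov_eq_cint: "markov (\<mu> k) z = cint k 1 z"
  by (simp add: markov_def cint_def)

lemma cint_linear:
  fixes z :: "'b::{real_normed_field, banach, second_countable_topology}"
  shows "z \<notin> of_real ` \<Delta> k \<Longrightarrow> cint k (p + q) z = cint k p z + cint k q z"
    "z \<notin> of_real ` \<Delta> k \<Longrightarrow> cint k (p - q) z = cint k p z - cint k q z"
    "cint k (smult c p) z = of_real c * cint k p z"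
    "cint k 0 z = 0"
  using integrable_cint[of z k p] integrable_cint[of z k q]
  by (simp_all add: cint_def add_divide_distrib diff_divide_distrib mult.assoc flip: times_divide_eq_right)

lemma cint_pCons:
  fixes z :: "'b::{real_normed_field, banach, second_countable_topology}"
  assumes z: "z \<notin> of_real ` \<Delta> k"
  shows "cint k (pCons a p) z = of_real a * markov (\<mu> k) z + z * cint k p z - of_real (mom k p)"
proof -
  have "cint k (pCons a p) z =
      (LINT x|\<mu> k. of_real a * (of_real (poly 1 x) / (z - of_real x)) + z * (of_real (poly p x) / (z - of_real x)) - of_real (poly p x))"
    unfolding cint_def
  proof (rule integral_cong_AE)
    have [measurable]: "(\<lambda>x. poly p x) \<in> borel_measurable borel" for p :: "real poly"
      by (intro borel_measurable_continuous_onI continuous_intros)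
    show "(\<lambda>x. of_real (poly (pCons a p) x) / (z - of_real x)) \<in> borel_measurable (\<mu> k)"
      "(\<lambda>x. of_real a * (of_real (poly 1 x) / (z - of_real x)) + z * (of_real (poly p x) / (z - of_real x)) - of_real (poly p x)) \<in> borel_measurable (\<mu> k)"
      by measurable
    show "AE x in \<mu> k. of_real (poly (pCons a p) x) / (z - of_real x) =
        of_real a * (of_real (poly 1 x) / (z - of_real x)) + z * (of_real (poly p x) / (z - of_real x)) - of_real (poly p x)"
      using AE_mu[of k]
    proof eventually_elim
      case (elim x)
      then have "z - of_real x \<noteq> 0" using z by auto
      moreover have "of_real (poly (pCons a p) x) = of_real a + z * of_real (poly p x) - (z - of_real x) * of_real (poly p x)"
        by (simp add: algebra_simps)
      ultimately show ?case by (simp only: add_divide_distrib diff_divide_distrib) simp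
    qed
  qed
  also have "\<dots> = of_real a * cint k 1 z + z * cint k p z - of_real (mom k p)"
    unfolding cint_def mom_def
    using integrable_cint[OF z, of 1] integrable_cint[OF z, of p] integrable_poly[of k p]
    by (simp add: integral_of_real del: poly_1 times_divide_eq_right)
  finally show ?thesis by (simp add: markov_eq_cint)
qed

lemma Lfun_eq_cint: "Lfun \<mu> n z = (\<Sum>k\<in>UNIV. cint k (A n k) z)"
  by (simp add: Lfun_def cint_def)

text \<open>Multiplication by z leaves the extra moments \<open>mom k (A n k)\<close>, whose sum
  over k is the orthogonality relation with m = 0; it vanishes because |n| is at least 2.\<close>

lemma Lfun_recurrence:
  fixes z :: "'b::{real_normed_field, banach, second_countable_topology}"
  assumes n: "0 < n j" "2 \<le> msize n" and z: "\<And>k. z \<notin> of_real ` \<Delta> k"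
  shows "z * Lfun \<mu> n z = Lfun \<mu> (dec n j) z + of_real (rc_b (dec n j) j) * Lfun \<mu> n z +
    (\<Sum>i\<in>UNIV. of_real (rc_a n i) * Lfun \<mu> (inc n i) z)"
proof -
  have "z * cint k (A n k) z = of_real (mom k (A n k)) + (cint k (A (dec n j) k) z + of_real (rc_b (dec n j) j) * cint k (A n k) z +
      (\<Sum>i\<in>UNIV. of_real (rc_a n i) * cint k (A (inc n i) k) z))" for k
    using cint_pCons[OF z[of k], of 0 "A n k"] z[of k]
    by (simp add: A_recurrence[OF n] cint_linear sum_ix)
  moreover have "(\<Sum>k\<in>UNIV. of_real (mom k (A n k))) = (0 :: 'b)"
  proof -
    have "pairing (A n) 1 = 0"
      using n by (subst pairing_A) (auto simp: deg_less_def coeff_1)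
    then show ?thesis by (simp add: pairing_def flip: of_real_sum)
  qed
  ultimately show ?thesis
    unfolding Lfun_eq_cint sum_distrib_left by (simp add: sum_ix algebra_simps)
qed

lemma div_diff_eq: "div_diff p z x = poly (synthetic_div p z) x"
proof -
  have eq: "[:- z, 1:] * synthetic_div p z + [:poly p z:] = p" by (rule synthetic_div_correct')
  show ?thesis
  proof (cases "x = z")
    case True
    have "pderiv p = pderiv ([:- z, 1:] * synthetic_div p z + [:poly p z:])" by (simp only: eq)
    then have "poly (pderiv p) z = poly (synthetic_div p z) z"
      by (simp only: pderiv_add pderiv_mult) (simp add: pderiv_pCons)
    with True show ?thesis by (simp add: div_diff_def)
  next
    case False
    have "poly p x = (x - z) * poly (synthetic_div p z) x + poly p z"
      using arg_cong[OF eq, of "\<lambda>q. poly q x"] by (simp add: algebra_simps)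
    with False show ?thesis by (simp add: div_diff_def field_simps)
  qed
qed

lemma div_diff_pCons: "div_diff (pCons a p) z x = z * div_diff p z x + poly p x"
  by (simp add: div_diff_def pderiv_pCons field_simps)

definition ddint :: "ix \<Rightarrow> real poly \<Rightarrow> real \<Rightarrow> real" where
  "ddint k p z = (LINT x|\<mu> k. div_diff p z x)"

lemma integrable_div_diff: "integrable (\<mu> k) (\<lambda>x. div_diff p z x)"
  by (simp add: div_diff_eq integrable_poly)

lemma div_diff_linear:
  "div_diff (p + q) z x = div_diff p z x + div_diff q z x"
  "div_diff (smult c p) z x = c * div_diff p z x"
  "div_diff 0 z x = 0"
  by (simp_all add: div_diff_def pderiv_add pderiv_smult diff_divide_distrib add_divide_distrib right_diff_distrib)

lemma ddint_linear:
  "ddint k (p + q) z = ddint k p z + ddint k q z"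
  "ddint k (smult c p) z = c * ddint k p z"
  "ddint k 0 z = 0"
  "ddint k (pCons a p) z = z * ddint k p z + mom k p"
  by (simp_all add: ddint_def div_diff_linear div_diff_pCons integrable_div_diff integrable_poly mom_def)

lemma type_I_0_recurrence:
  assumes n: "0 < n j" "2 \<le> msize n"
  shows "z * type_I_0 \<mu> n z = type_I_0 \<mu> (dec n j) z + rc_b (dec n j) j * type_I_0 \<mu> n z +
    (\<Sum>i\<in>UNIV. rc_a n i * type_I_0 \<mu> (inc n i) z)"
proof -
  have "z * ddint k (A n k) z + mom k (A n k) = ddint k (A (dec n j) k) z + rc_b (dec n j) j * ddint k (A n k) z +
      (\<Sum>i\<in>UNIV. rc_a n i * ddint k (A (inc n i) k) z)" for k
    using ddint_linear(4)[of k 0 "A n k" z] by (simp add: A_recurrence[OF n] ddint_linear(1-3) sum_ix)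
  moreover have "mom One (A n One) + mom Two (A n Two) = 0"
    using n pairing_A[of 1 n] by (auto simp: deg_less_def coeff_1 pairing_def sum_ix)
  ultimately show ?thesis
    unfolding type_I_0_def ddint_def[symmetric] sum_distrib_left sum_ix
    by (smt (verit) distrib_left)
qed

text \<open>One polynomial q has to serve the divided-difference integral and the Cauchy integrals
  over the reals and over the complex numbers; all three obey the same recursion in p.\<close>

lemma div_diff_int_poly:
  "\<exists>q. (\<forall>z. ddint k p z = poly q z) \<and>
    (\<forall>z::real. z \<notin> \<Delta> k \<longrightarrow> cint k p z = poly p z * markov (\<mu> k) z - poly q z) \<and>
    (\<forall>z::complex. z \<notin> of_real ` \<Delta> k \<longrightarrow> cint k p z =
      poly (map_poly of_real p) z * markov (\<mu> k) z - poly (map_poly of_real q) z)"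
proof (induction p)
  case 0
  then show ?case by (intro exI[of _ 0]) (simp add: ddint_linear cint_linear)
next
  case (pCons a p)
  then obtain q where q: "\<And>z. ddint k p z = poly q z"
    "\<And>z::real. z \<notin> \<Delta> k \<Longrightarrow> cint k p z = poly p z * markov (\<mu> k) z - poly q z"
    "\<And>z::complex. z \<notin> of_real ` \<Delta> k \<Longrightarrow> cint k p z =
      poly (map_poly of_real p) z * markov (\<mu> k) z - poly (map_poly of_real q) z" by blast
  have "cint k (pCons a p) z = poly (pCons a p) z * markov (\<mu> k) z - poly (pCons (mom k p) q) z"
    if "z \<notin> \<Delta> k" for z :: real
    using that cint_pCons[of z k a p] unfolding q(2)[OF that] by (simp add: algebra_simps)
  moreover have "cint k (pCons a p) z = poly (map_poly of_real (pCons a p)) z * markov (\<mu> k) z -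
      poly (map_poly of_real (pCons (mom k p) q)) z" if "z \<notin> of_real ` \<Delta> k" for z :: complex
    using cint_pCons[OF that, of a p] unfolding q(3)[OF that] by (simp add: map_poly_pCons algebra_simps)
  ultimately show ?case
    using q(1) by (intro exI[of _ "pCons (mom k p) q"]) (simp add: ddint_linear)
qed

text \<open>The polynomial behind A^(0): \<open>type_I_0\<close> is only a function on the real
  line, whereas its coefficients are needed to evaluate it at complex points.\<close>

definition T0 :: "mindex \<Rightarrow> real poly" where
  "T0 n = (SOME q. (\<forall>z. type_I_0 \<mu> n z = poly q z) \<and>
    (\<forall>z::real. (\<forall>k. z \<notin> \<Delta> k) \<longrightarrow> Lfun \<mu> n z = (\<Sum>k\<in>UNIV. poly (A n k) z * markov (\<mu> k) z) - poly q z) \<and>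
    (\<forall>z::complex. (\<forall>k. z \<notin> of_real ` \<Delta> k) \<longrightarrow> Lfun \<mu> n z =
      (\<Sum>k\<in>UNIV. poly (map_poly of_real (A n k)) z * markov (\<mu> k) z) - poly (map_poly of_real q) z))"

lemma T0: "type_I_0 \<mu> n x = poly (T0 n) x"
  and Lfun_eq_real: "(\<And>k. x \<notin> \<Delta> k) \<Longrightarrow>
    Lfun \<mu> n x = (\<Sum>k\<in>UNIV. poly (A n k) x * markov (\<mu> k) x) - poly (T0 n) x"
  and Lfun_eq_complex: "(\<And>k. z \<notin> of_real ` \<Delta> k) \<Longrightarrow> Lfun \<mu> n z =
    (\<Sum>k\<in>UNIV. poly (map_poly of_real (A n k)) z * markov (\<mu> k) z) - poly (map_poly of_real (T0 n)) (z :: complex)"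
proof -
  have "\<forall>k. \<exists>q. (\<forall>z. ddint k (A n k) z = poly q z) \<and>
    (\<forall>z::real. z \<notin> \<Delta> k \<longrightarrow> cint k (A n k) z = poly (A n k) z * markov (\<mu> k) z - poly q z) \<and>
    (\<forall>z::complex. z \<notin> of_real ` \<Delta> k \<longrightarrow> cint k (A n k) z =
      poly (map_poly of_real (A n k)) z * markov (\<mu> k) z - poly (map_poly of_real q) z)"
    using div_diff_int_poly by blast
  then obtain q where q: "\<forall>k. (\<forall>z. ddint k (A n k) z = poly (q k) z) \<and>
    (\<forall>z::real. z \<notin> \<Delta> k \<longrightarrow> cint k (A n k) z = poly (A n k) z * markov (\<mu> k) z - poly (q k) z) \<and>
    (\<forall>z::complex. z \<notin> of_real ` \<Delta> k \<longrightarrow> cint k (A n k) z =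
      poly (map_poly of_real (A n k)) z * markov (\<mu> k) z - poly (map_poly of_real (q k)) z)"
    by (rule choice[THEN exE])
  have map_add: "map_poly of_real (q One + q Two) = map_poly of_real (q One) + (map_poly of_real (q Two) :: complex poly)"
    by (rule poly_eqI) (simp add: coeff_map_poly)
  have "\<exists>q. (\<forall>z. type_I_0 \<mu> n z = poly q z) \<and>
    (\<forall>z::real. (\<forall>k. z \<notin> \<Delta> k) \<longrightarrow> Lfun \<mu> n z = (\<Sum>k\<in>UNIV. poly (A n k) z * markov (\<mu> k) z) - poly q z) \<and>
    (\<forall>z::complex. (\<forall>k. z \<notin> of_real ` \<Delta> k) \<longrightarrow> Lfun \<mu> n z =
      (\<Sum>k\<in>UNIV. poly (map_poly of_real (A n k)) z * markov (\<mu> k) z) - poly (map_poly of_real q) z)"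
    using q by (intro exI[of _ "q One + q Two"])
      (simp add: type_I_0_def ddint_def[symmetric] sum_ix Lfun_eq_cint map_add)
  then have *: "(\<forall>z. type_I_0 \<mu> n z = poly (T0 n) z) \<and>
    (\<forall>z::real. (\<forall>k. z \<notin> \<Delta> k) \<longrightarrow> Lfun \<mu> n z = (\<Sum>k\<in>UNIV. poly (A n k) z * markov (\<mu> k) z) - poly (T0 n) z) \<and>
    (\<forall>z::complex. (\<forall>k. z \<notin> of_real ` \<Delta> k) \<longrightarrow> Lfun \<mu> n z =
      (\<Sum>k\<in>UNIV. poly (map_poly of_real (A n k)) z * markov (\<mu> k) z) - poly (map_poly of_real (T0 n)) z)"
    unfolding T0_def by (rule someI_ex)
  show "type_I_0 \<mu> n x = poly (T0 n) x" using * by blast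
  show "(\<And>k. x \<notin> \<Delta> k) \<Longrightarrow>
    Lfun \<mu> n x = (\<Sum>k\<in>UNIV. poly (A n k) x * markov (\<mu> k) x) - poly (T0 n) x" using * by blast
  show "(\<And>k. z \<notin> of_real ` \<Delta> k) \<Longrightarrow> Lfun \<mu> n z =
    (\<Sum>k\<in>UNIV. poly (map_poly of_real (A n k)) z * markov (\<mu> k) z) - poly (map_poly of_real (T0 n)) z"
    using * by blast
qed

lemma cint_eq_cauchy_trans: "cint k p = cauchy_trans (\<mu> k) (\<lambda>x. of_real (poly p x))"
  by (simp add: cint_def cauchy_trans_def fun_eq_iff)

lemma integrable_of_real_poly: "integrable (\<mu> k) (\<lambda>x. complex_of_real (poly p x))"
  by (intro integrable_mu_continuous continuous_intros)

lemma holomorphic_cint: "(cint k p :: complex \<Rightarrow> complex) holomorphic_on - (of_real ` \<Delta> k)"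
  unfolding cint_eq_cauchy_trans
  by (rule holomorphic_cauchy_trans[OF sets_mu integrable_of_real_poly closed_Delta AE_mu])

lemma cint_tendsto_0: "((cint k p :: complex \<Rightarrow> complex) \<longlongrightarrow> 0) at_infinity"
  unfolding cint_eq_cauchy_trans
  by (rule cauchy_trans_tendsto_0[OF sets_mu integrable_of_real_poly closed_Delta _ AE_mu])
     (simp add: compact_imp_bounded compact_Delta)

lemma cint_cnj: "cint k p (cnj z) = cnj (cint k p z)"
proof -
  have "cint k p (cnj z) = (LINT x|\<mu> k. cnj (of_real (poly p x) / (z - of_real x)))"
    by (simp add: cint_def del: Bochner_Integration.integral_cnj)
  then show ?thesis unfolding cint_def by (simp only: Bochner_Integration.integral_cnj)
qed

lemma cint_of_real: "cint k p (complex_of_real x) = of_real (cint k p x)"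
  by (simp add: cint_def flip: integral_complex_of_real)

lemma Lfun_cnj: "Lfun \<mu> n (cnj z) = cnj (Lfun \<mu> n z)"
  by (simp add: Lfun_eq_cint cint_cnj)

lemma Lfun_of_real: "Lfun \<mu> n (complex_of_real x) = of_real (Lfun \<mu> n x)"
  by (simp add: Lfun_eq_cint cint_of_real)

lemma not_in_Delta_complex: "Im z \<noteq> 0 \<Longrightarrow> z \<notin> of_real ` S"
  by auto

lemma holomorphic_Lfun: "(Lfun \<mu> n :: complex \<Rightarrow> complex) holomorphic_on - (of_real ` (\<Delta> One \<union> \<Delta> Two))"
proof -
  have "(\<lambda>z. cint One (A n One) z + cint Two (A n Two) z :: complex) holomorphic_on - (of_real ` (\<Delta> One \<union> \<Delta> Two))"
    by (intro holomorphic_intros holomorphic_on_subset[OF holomorphic_cint]) auto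
  then show ?thesis by (simp add: Lfun_eq_cint[abs_def] sum_ix)
qed

text \<open>Each multiplication by z shifts the polynomials by one power and subtracts a moment. All
  these moments vanish except the last, which is 1, and the remaining Cauchy integrals tend to 0.
  For |n| = 0 there is no moment at all.\<close>

lemma Lfun_asymptotics: "((\<lambda>z::complex. z ^ msize n * Lfun \<mu> n z) \<longlongrightarrow> (if msize n = 0 then 0 else 1)) at_infinity"
proof -
  define q where "q = (\<lambda>m k. monom 1 m * A n k)"
  have qS: "q (Suc m) k = pCons 0 (q m k)" for m k by (simp add: q_def monom_Suc)
  have pw: "z ^ m * (\<Sum>k\<in>UNIV. cint k (q 0 k) z) = (\<Sum>k\<in>UNIV. cint k (q m k) z) + (if m = msize n \<and> 0 < m then 1 else 0)"
    if "\<And>k. z \<notin> of_real ` \<Delta> k" "m \<le> msize n" for z :: complex and m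
    using that(2)
  proof (induction m)
    case (Suc m)
    have "cint k (q (Suc m) k) z = z * cint k (q m k) z - of_real (mom k (q m k))" for k
      unfolding qS using that(1) by (simp add: cint_pCons)
    moreover have "pairing (A n) (monom 1 m) = (\<Sum>k\<in>UNIV. mom k (q m k))"
      by (simp add: pairing_def q_def)
    ultimately have "(\<Sum>k\<in>UNIV. cint k (q (Suc m) k) z) = z * (\<Sum>k\<in>UNIV. cint k (q m k) z) - of_real (pairing (A n) (monom 1 m))"
      by (simp add: sum_ix algebra_simps)
    moreover have "pairing (A n) (monom 1 m) = (if Suc m = msize n then 1 else 0)"
      using is_type_I'_A[of n] Suc.prems by (simp add: is_type_I'_def)
    moreover have "z ^ Suc m * (\<Sum>k\<in>UNIV. cint k (q 0 k) z) = z * (\<Sum>k\<in>UNIV. cint k (q m k) z)"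
      using Suc by simp
    ultimately show ?case using Suc.prems by (cases "Suc m = msize n") (simp_all add: algebra_simps)
  qed simp
  have "((\<lambda>z::complex. (\<Sum>k\<in>UNIV. cint k (q (msize n) k) z) + (if 0 < msize n then 1 else 0)) \<longlongrightarrow> 0 + 0 + (if 0 < msize n then 1 else 0)) at_infinity"
    unfolding sum_ix by (intro tendsto_add cint_tendsto_0 tendsto_const)
  then have "((\<lambda>z::complex. (\<Sum>k\<in>UNIV. cint k (q (msize n) k) z) + (if 0 < msize n then 1 else 0)) \<longlongrightarrow> (if msize n = 0 then 0 else 1)) at_infinity"
    by (cases "msize n = 0") simp_all
  moreover obtain R where R: "\<And>k x. x \<in> \<Delta> k \<Longrightarrow> \<bar>x\<bar> < R"
  proof
    show "\<bar>x\<bar> < \<bar>lo One\<bar> + \<bar>hi One\<bar> + \<bar>lo Two\<bar> + \<bar>hi Two\<bar> + 1" if "x \<in> \<Delta> k" for k x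
      using that by (cases k) (simp_all add: Delta_eq, arith+)
  qed
  have "eventually (\<lambda>z::complex. (\<Sum>k\<in>UNIV. cint k (q (msize n) k) z) + (if 0 < msize n then 1 else 0) = z ^ msize n * Lfun \<mu> n z) at_infinity"
    unfolding eventually_at_infinity
  proof (intro exI[of _ R] allI impI)
    fix z :: complex assume "R \<le> cmod z"
    then have "z \<notin> of_real ` \<Delta> k" for k using R[of _ k] by fastforce
    from pw[OF this order_refl] show "(\<Sum>k\<in>UNIV. cint k (q (msize n) k) z) + (if 0 < msize n then 1 else 0) = z ^ msize n * Lfun \<mu> n z"
      by (simp add: q_def Lfun_eq_cint)
  qed
  ultimately show ?thesis by (rule Lim_transform_eventually)
qed

text \<open>A zero of a real combination of consecutive functions of the second kind off the real line would
  raise the order of orthogonality, with respect to the measures weighted by \<open>1/\<bar>x - z\<bar>\<^sup>2\<close>, beyond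
  what the number of sign changes allows.\<close>

lemma Lfun_combination_nonzero:
  fixes z :: complex
  assumes z: "Im z \<noteq> 0" and cd: "c \<noteq> 0 \<or> d \<noteq> 0" and n: "0 < msize n"
  shows "of_real c * Lfun \<mu> n z + of_real d * Lfun \<mu> (inc n j) z \<noteq> 0"
proof
  assume zero: "of_real c * Lfun \<mu> n z + of_real d * Lfun \<mu> (inc n j) z = 0"
  define N where "N = msize n"
  define B where "B = (\<lambda>k. smult c (A n k) + smult d (A (inc n j) k))"
  define w where "w = (\<lambda>x::real. 1 / (cmod (z - of_real x))\<^sup>2)"
  have ne: "z - of_real x \<noteq> 0" for x using z by (auto simp: complex_eq_iff)
  have w: "continuous_on UNIV w" "0 < w x" for x
    using ne by (auto simp: w_def intro!: continuous_intros)
  have deg: "deg_less (B k) (inc n j k)" for k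
    using deg_less_A[of n k] deg_less_A[of "inc n j" k]
    by (auto simp: B_def deg_less_def inc_def split: if_splits)
  have pB: "pairing B p = c * pairing (A n) p + d * pairing (A (inc n j)) p" for p
    by (simp add: pairing_def B_def distrib_left mom_linear sum.distrib sum_distrib_left)
  have "\<exists>k. B k \<noteq> 0"
  proof (rule ccontr)
    assume "\<not> (\<exists>k. B k \<noteq> 0)"
    then have 0: "pairing B p = 0" for p by (simp add: pairing_def mom_linear)
    have "pairing (A n) (monom 1 (N - 1)) = 1" "pairing (A (inc n j)) (monom 1 (N - 1)) = 0"
      using n by (auto simp: N_def pairing_A deg_less_monom)
    with 0[of "monom 1 (N - 1)"] have "c = 0" by (simp add: pB)
    moreover have "pairing (A (inc n j)) (monom 1 N) = 1"
      by (auto simp: N_def pairing_A deg_less_monom)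
    ultimately show False using 0[of "monom 1 N"] cd by (simp add: pB)
  qed
  then obtain j' where "B j' \<noteq> 0" by blast
  from weighted_sign_pattern[of B "inc n j" j' w, OF deg this w] obtain p where
    p: "deg_less p (Suc N)" "0 < (\<Sum>k\<in>UNIV. LINT x|\<mu> k. w x * poly (p * B k) x)"
    by (auto simp: N_def)
  define F where "F = (\<lambda>p. \<Sum>k\<in>UNIV. LINT x|\<mu> k. w x * poly (p * B k) x)"
  have intw: "integrable (\<mu> k) (\<lambda>x. w x * poly p x)" for k p
    using w by (intro integrable_mu_continuous continuous_intros)
  have F_lin: "F (p + q) = F p + F q" "F (smult c p) = c * F p" "F 0 = 0" for p q c
    using intw[of _ "p * B _"] intw[of _ "q * B _"]
    by (simp_all add: F_def distrib_right distrib_left sum.distrib sum_distrib_left mult.left_commute[of _ c] flip: poly_mult)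
  have F_sum: "F (\<Sum>i\<in>I. f i) = (\<Sum>i\<in>I. F (f i))" if "finite I" for I and f :: "nat \<Rightarrow> real poly"
    using that by induction (auto simp: F_lin)
  \<comment> \<open>Since 1/(z - x) is \<open>cnj z\<close> - x times the weight, the assumed zero
    reads \<open>cnj z\<close> F(1) = F(x). F takes real values and z is nonreal, so both
    vanish.\<close>
  have base: "F 1 = 0 \<and> F [:0, 1:] = 0"
  proof -
    have e: "complex_of_real (poly p x) / (z - of_real x) = cnj z * of_real (w x * poly p x) - of_real (w x * poly ([:0, 1:] * p) x)" for p x
    proof -
      have "1 / (z - of_real x) = cnj (z - of_real x) * of_real (w x)"
        using complex_div_cnj[of 1 "z - of_real x"]
        by (simp only: w_def of_real_divide of_real_1 mult_1 times_divide_eq_right mult_1_right of_real_power)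
      then have "complex_of_real (poly p x) * (1 / (z - of_real x)) = of_real (poly p x) * (cnj (z - of_real x) * of_real (w x))" by simp
      then show ?thesis by (simp add: algebra_simps)
    qed
    have "cint k p z = cnj z * of_real (LINT x|\<mu> k. w x * poly p x) - of_real (LINT x|\<mu> k. w x * poly ([:0, 1:] * p) x)" for k p
      unfolding cint_def e using intw[of k p] intw[of k "[:0, 1:] * p"]
      by (simp del: poly_mult mult_pCons_left of_real_mult)
    then have "(\<Sum>k\<in>UNIV. cint k (B k) z) = cnj z * of_real (F 1) - of_real (F [:0, 1:])"
      unfolding F_def sum_ix by (simp only: mult_1_left of_real_add) (simp only: algebra_simps)
    moreover have "(\<Sum>k\<in>UNIV. cint k (B k) z) = 0"
      using zero z by (simp add: B_def Lfun_eq_cint sum_ix cint_linear not_in_Delta_complex algebra_simps)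
    ultimately have *: "cnj z * of_real (F 1) - of_real (F [:0, 1:]) = 0" by simp
    have "F 1 = 0" using arg_cong[OF *, of Im] z by simp
    with arg_cong[OF *, of Re] show ?thesis by simp
  qed
  \<comment> \<open>The quadratic is |z - x|^2 and cancels the weight, which turns this weighted
    moment into an ordinary one; that vanishes for m + 1 < N. Hence two vanishing weighted moments
    yield the next.\<close>
  have red: "F (monom 1 (Suc (Suc m))) = 0" if "F (monom 1 m) = 0" "F (monom 1 (Suc m)) = 0" "Suc m < N" for m
  proof -
    have "w x * poly ([:(cmod z)\<^sup>2, - 2 * Re z, 1:] * p) x = poly p x" for x p
    proof -
      have "poly [:(cmod z)\<^sup>2, - 2 * Re z, 1:] x = (cmod (z - of_real x))\<^sup>2"
        by (simp add: cmod_power2) (simp add: power2_eq_square algebra_simps)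
      moreover have "w x * (cmod (z - of_real x))\<^sup>2 = 1" using ne[of x] by (simp add: w_def)
      ultimately show ?thesis by (simp only: poly_mult mult.assoc[symmetric] mult_1_left)
    qed
    then have "F ([:(cmod z)\<^sup>2, - 2 * Re z, 1:] * monom 1 m) = pairing B (monom 1 m)"
      unfolding F_def pairing_def mom_def mult.assoc by (simp only:)
    also have "\<dots> = 0"
      using that(3) by (simp add: pB pairing_A deg_less_monom N_def[symmetric])
    finally have "F ([:(cmod z)\<^sup>2, - 2 * Re z, 1:] * monom 1 m) = 0" .
    moreover have "[:(cmod z)\<^sup>2, - 2 * Re z, 1:] * monom 1 m =
        monom 1 (Suc (Suc m)) + smult (- 2 * Re z) (monom 1 (Suc m)) + smult ((cmod z)\<^sup>2) (monom 1 m)"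
      by (simp add: monom_Suc)
    ultimately show ?thesis using that by (simp only: F_lin mult_zero_right add_0_right)
  qed
  have "F (monom 1 m) = 0 \<and> F (monom 1 (Suc m)) = 0" if "m < N" for m
    using that
  proof (induction m)
    case 0
    show ?case using base by (simp add: monom_Suc flip: one_pCons)
  next
    case (Suc m)
    then show ?case using red[of m] by simp
  qed
  then have "F (monom 1 m) = 0" if "m \<le> N" for m
    using that base by (cases m) auto
  moreover have "F p = (\<Sum>i<Suc N. coeff p i * F (monom 1 i))"
  proof -
    have "p = (\<Sum>i<Suc N. smult (coeff p i) (monom 1 i))"
      using deg_less_expand[OF p(1)] by (simp add: smult_monom)
    then have "F p = F (\<Sum>i<Suc N. smult (coeff p i) (monom 1 i))" by simp
    then show ?thesis by (simp only: F_sum[OF finite_lessThan] F_lin)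
  qed
  ultimately have "F p = 0" by simp
  with p(2) show False by (simp add: F_def)
qed

lemma Lfun_nonzero: "Im z \<noteq> 0 \<Longrightarrow> 0 < msize n \<Longrightarrow> Lfun \<mu> n z \<noteq> (0 :: complex)"
  using Lfun_combination_nonzero[of z 1 0 n] by auto

text \<open>If this product were real, with value r, then -r and |L_n|^2 would be real coefficients
  of a vanishing combination of the two functions.\<close>

lemma Lfun_Wronskian_nonzero:
  assumes z: "Im z \<noteq> 0" and n: "0 < msize n"
  shows "Im (Lfun \<mu> (inc n j) z * cnj (Lfun \<mu> n z)) \<noteq> 0"
proof
  assume im: "Im (Lfun \<mu> (inc n j) z * cnj (Lfun \<mu> n z)) = 0"
  define l where "l = Lfun \<mu> n z"
  have l: "l \<noteq> 0" using Lfun_nonzero[OF z n] by (simp add: l_def)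
  define r where "r = Re (Lfun \<mu> (inc n j) z * cnj l)"
  have "Lfun \<mu> (inc n j) z * cnj l = of_real r"
    using im by (simp add: complex_eq_iff r_def l_def)
  then have "of_real (- r) * l + of_real ((cmod l)\<^sup>2) * Lfun \<mu> (inc n j) z = 0"
    by (simp add: complex_norm_square mult_ac flip: of_real_power)
  then show False
    using Lfun_combination_nonzero[OF z, of "- r" "(cmod l)\<^sup>2" n j] l n by (simp add: l_def)
qed

text \<open>High up on the imaginary axis the ratio of the two functions behaves like 1/z, which
  fixes the sign; along a segment in the upper half-plane it cannot change without passing through
  0.\<close>

lemma Lfun_Wronskian_neg:
  assumes z: "0 < Im z" and n: "0 < msize n"
  shows "Im (Lfun \<mu> (inc n j) z * cnj (Lfun \<mu> n z)) < 0"
proof -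
  define N where "N = msize n"
  define W where "W = (\<lambda>z. Im (Lfun \<mu> (inc n j) z * cnj (Lfun \<mu> n z)))"
  define r where "r = (\<lambda>z::complex. (z ^ Suc N * Lfun \<mu> (inc n j) z) / (z ^ N * Lfun \<mu> n z))"
  have "(r \<longlongrightarrow> 1 / 1) at_infinity"
    unfolding r_def using Lfun_asymptotics[of n] Lfun_asymptotics[of "inc n j"] n
    by (intro tendsto_divide) (auto simp: N_def)
  then have "eventually (\<lambda>z. dist (r z) 1 < 1) at_infinity" by (auto simp: tendsto_iff)
  then obtain R where R: "\<And>z. R \<le> norm z \<Longrightarrow> dist (r z) 1 < 1" by (auto simp: eventually_at_infinity)
  define y where "y = max 1 R"
  define z1 where "z1 = Complex 0 y"
  have z1: "0 < Im z1" "R \<le> norm z1" by (auto simp: z1_def y_def cmod_def)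
  have "0 < Re (r z1)"
    using R[OF z1(2)] abs_Re_le_cmod[of "r z1 - 1"] by (simp add: dist_norm)
  have l1: "Lfun \<mu> n z1 \<noteq> 0" using Lfun_nonzero n z1 by simp
  have "z1 \<noteq> 0" using z1 by auto
  then have "r z1 = z1 * Lfun \<mu> (inc n j) z1 / Lfun \<mu> n z1" by (simp add: r_def)
  then have "Lfun \<mu> (inc n j) z1 = r z1 * Lfun \<mu> n z1 / z1" using l1 \<open>z1 \<noteq> 0\<close> by simp
  then have "Lfun \<mu> (inc n j) z1 * cnj (Lfun \<mu> n z1) = r z1 / z1 * (Lfun \<mu> n z1 * cnj (Lfun \<mu> n z1))"
    by simp
  then have "W z1 = Im (r z1 / z1 * (Lfun \<mu> n z1 * cnj (Lfun \<mu> n z1)))"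
    by (simp only: W_def)
  also have "\<dots> = Im (r z1 / z1) * (cmod (Lfun \<mu> n z1))\<^sup>2"
    unfolding complex_norm_square[symmetric]
    by (simp only: times_complex.sel Im_complex_of_real Re_complex_of_real mult_zero_right add_0_right add_0_left)
  also have "Im (r z1 / z1) = - Re (r z1) / y"
    by (simp add: z1_def Im_divide power2_eq_square y_def)
  finally have "W z1 < 0"
    using \<open>0 < Re (r z1)\<close> l1 by (simp add: y_def mult_neg_pos divide_neg_pos)
  moreover have "W z < 0" if "W z1 < 0"
  proof (rule ccontr)
    assume "\<not> W z < 0"
    define g where "g = (\<lambda>t::real. W (linepath z1 z t))"
    have seg: "0 < Im (linepath z1 z t)" if "t \<in> {0..1}" for t
    proof -
      have "linepath z1 z t \<in> closed_segment z1 z" using that by (rule linepath_in_path)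
      moreover have "closed_segment z1 z \<subseteq> {z. 0 < Im z}"
        using z1 z by (intro closed_segment_subset convex_halfspace_Im_gt) auto
      ultimately show ?thesis by auto
    qed
    have cL: "continuous_on {0..1} (\<lambda>t. Lfun \<mu> m (linepath z1 z t))" for m
      using seg by (intro continuous_on_compose2[OF holomorphic_on_imp_continuous_on[OF holomorphic_Lfun]])
        (force intro!: continuous_intros)+
    have "continuous_on {0..1} g"
      unfolding g_def W_def by (intro continuous_intros cL)
    moreover have "g 0 \<le> 0" "0 \<le> g 1"
      using that \<open>\<not> W z < 0\<close> by (auto simp: g_def linepath_0' linepath_1')
    ultimately obtain t where t: "0 \<le> t" "t \<le> 1" "g t = 0" using IVT'[of g 0 0 1] by auto
    then show False
      using Lfun_Wronskian_nonzero[of "linepath z1 z t" n j] seg[of t] n by (auto simp: g_def W_def)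
  qed
  ultimately show ?thesis by (simp add: W_def)
qed

end

section \<open>The operator on the tree\<close>

lemma proj_pos: "0 < proj Y k"
  by (induction Y) (auto simp: inc_def)

lemma msize_proj: "2 \<le> msize (proj Y)"
  using proj_pos[of Y One] proj_pos[of Y Two] by (simp add: msize_alt)

lemma dec_one: "dec (\<lambda>_. 1) One = unit_ix Two" "dec (\<lambda>_. 1) Two = unit_ix One"
  by (auto simp: dec_def unit_ix_def fun_eq_iff) (metis other.cases)+

lemma finite_level: "finite {Y :: vertex. length Y = N}" and finite_ball_level: "finite {Y :: vertex. length Y \<le> N}"
  using finite_lists_length_eq[of "UNIV :: ix set" N] finite_lists_length_le[of "UNIV :: ix set" N] by simp_all

lemma sum_level_Suc:
  "(\<Sum>Y\<in>{Y :: vertex. length Y = Suc N}. g Y) = (\<Sum>Y\<in>{Y. length Y = N}. \<Sum>i\<in>UNIV. g (i # Y))"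
proof -
  have "{Y :: vertex. length Y = Suc N} = (\<lambda>(Y, i). i # Y) ` ({Y. length Y = N} \<times> UNIV)"
    by (auto simp: length_Suc_conv image_iff)
  then have "(\<Sum>Y\<in>{Y :: vertex. length Y = Suc N}. g Y) = (\<Sum>(Y, i)\<in>{Y. length Y = N} \<times> UNIV. g (i # Y))"
    by (simp add: sum.reindex inj_on_def case_prod_unfold)
  then show ?thesis by (simp add: sum.cartesian_product)
qed

lemma sum_ball_Suc:
  "(\<Sum>Y\<in>{Y :: vertex. length Y \<le> Suc N}. g Y) = (\<Sum>Y\<in>{Y. length Y \<le> N}. g Y) + (\<Sum>Y\<in>{Y. length Y = Suc N}. g Y)"
proof -
  have "{Y :: vertex. length Y \<le> Suc N} = {Y. length Y \<le> N} \<union> {Y. length Y = Suc N}" by auto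
  then show ?thesis by (simp add: sum.union_disjoint finite_level finite_ball_level disjoint_iff)
qed

context angelesco_system
begin

lemma Wpot_pos: "0 < Wpot \<mu> Y"
  by (simp add: Wpot_def rec_a_eq rc_a_pos proj_pos)

lemma mfac_pos: "0 < mfac \<mu> Y"
  by (induction Y) (auto simp: Wpot_pos)

lemma inverse_mfac_Cons: "1 / mfac \<mu> (i # Y) = sqrt (Wpot \<mu> (i # Y)) / mfac \<mu> Y"
  by simp

lemma Wpot_Cons: "Wpot \<mu> (i # Y) = rc_a (proj Y) i"
  by (simp add: Wpot_def rec_a_eq)

lemma mfac_Nil [simp]: "mfac \<mu> [] = 1"
  by (simp add: Wpot_def)

text \<open>Conjugation by \<open>mfac\<close> turns the nearest-neighbour recurrences into the action of the operator;
  at the root the recurrences in the two directions are averaged.\<close>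

lemma jacobi_lift:
  fixes F :: "mindex \<Rightarrow> 'b::real_vector"
  assumes \<kappa>: "\<kappa> One + \<kappa> Two = 1"
    and rec: "\<And>n j. (\<And>k. 0 < n k) \<Longrightarrow>
      X n = F (dec n j) + rc_b (dec n j) j *\<^sub>R F n + (\<Sum>i\<in>UNIV. rc_a n i *\<^sub>R F (inc n i))"
  shows "jacobi \<mu> \<kappa> (\<lambda>Y. (1 / mfac \<mu> Y) *\<^sub>R F (proj Y)) Y = (1 / mfac \<mu> Y) *\<^sub>R X (proj Y) -
    (if Y = [] then \<kappa> One *\<^sub>R F (unit_ix Two) + \<kappa> Two *\<^sub>R F (unit_ix One) else 0)"
proof -
  have child: "sqrt (Wpot \<mu> (i # Y)) *\<^sub>R ((1 / mfac \<mu> (i # Y)) *\<^sub>R F (proj (i # Y))) =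
      (1 / mfac \<mu> Y) *\<^sub>R (rc_a (proj Y) i *\<^sub>R F (inc (proj Y) i))" for i
  proof -
    have "sqrt (Wpot \<mu> (i # Y)) * sqrt (Wpot \<mu> (i # Y)) = rc_a (proj Y) i"
      using Wpot_pos[of "i # Y"] by (simp add: Wpot_Cons flip: power2_eq_square)
    then have "sqrt (Wpot \<mu> (i # Y)) * (1 / mfac \<mu> (i # Y)) = 1 / mfac \<mu> Y * rc_a (proj Y) i"
      unfolding inverse_mfac_Cons by (metis times_divide_eq_right mult.commute mult.left_neutral times_divide_eq_left)
    then show ?thesis by (simp only: scaleR_scaleR proj.simps)
  qed
  have children: "(\<Sum>i\<in>UNIV. sqrt (Wpot \<mu> (i # Y)) *\<^sub>R ((1 / mfac \<mu> (i # Y)) *\<^sub>R F (proj (i # Y)))) =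
      (1 / mfac \<mu> Y) *\<^sub>R (\<Sum>i\<in>UNIV. rc_a (proj Y) i *\<^sub>R F (inc (proj Y) i))"
    by (simp only: child scaleR_sum_right)
  show ?thesis
  proof (cases Y)
    case Nil
    define S where "S = (\<Sum>i\<in>UNIV. rc_a (\<lambda>_. 1) i *\<^sub>R F (inc (\<lambda>_. 1) i))"
    have "X (\<lambda>_. 1) = F (unit_ix Two) + rc_b (unit_ix Two) One *\<^sub>R F (\<lambda>_. 1) + S"
      "X (\<lambda>_. 1) = F (unit_ix One) + rc_b (unit_ix One) Two *\<^sub>R F (\<lambda>_. 1) + S"
      using rec[of "\<lambda>_. 1" One] rec[of "\<lambda>_. 1" Two] by (simp_all only: dec_one S_def)
    then have "(\<kappa> One + \<kappa> Two) *\<^sub>R X (\<lambda>_. 1) =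
        \<kappa> One *\<^sub>R (F (unit_ix Two) + rc_b (unit_ix Two) One *\<^sub>R F (\<lambda>_. 1) + S) +
        \<kappa> Two *\<^sub>R (F (unit_ix One) + rc_b (unit_ix One) Two *\<^sub>R F (\<lambda>_. 1) + S)"
      by (metis scaleR_add_left)
    also have "\<dots> = (\<kappa> One *\<^sub>R F (unit_ix Two) + \<kappa> Two *\<^sub>R F (unit_ix One)) +
        (\<kappa> One * rc_b (unit_ix Two) One + \<kappa> Two * rc_b (unit_ix One) Two) *\<^sub>R F (\<lambda>_. 1) + (\<kappa> One + \<kappa> Two) *\<^sub>R S"
      by (simp add: scaleR_add_left scaleR_add_right)
    finally show ?thesis
      using children by (simp add: Nil jacobi_def Vpot_def rec_b_eq \<kappa> S_def del: mfac.simps)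
  next
    case (Cons j Z)
    have "sqrt (Wpot \<mu> Y) *\<^sub>R ((1 / mfac \<mu> Z) *\<^sub>R F (proj Z)) = (1 / mfac \<mu> Y) *\<^sub>R F (dec (proj Y) j)"
      unfolding Cons inverse_mfac_Cons by simp
    moreover have "Vpot \<mu> \<kappa> Y = rc_b (dec (proj Y) j) j"
      by (simp add: Cons Vpot_def rec_b_eq)
    moreover have "X (proj Y) = F (dec (proj Y) j) + rc_b (dec (proj Y) j) j *\<^sub>R F (proj Y) + (\<Sum>i\<in>UNIV. rc_a (proj Y) i *\<^sub>R F (inc (proj Y) i))"
      by (rule rec) (rule proj_pos)
    ultimately show ?thesis
      using children by (simp add: Cons jacobi_def scaleR_add_right scaleR_left_commute add_ac del: mfac.simps proj.simps)
  qed
qed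

text \<open>The real diagonal drops out of the imaginary part, and every edge contributes with
  opposite signs at its two ends; only the edges that leave the ball remain.\<close>

lemma jacobi_Green_identity:
  fixes f :: "vertex \<Rightarrow> complex"
  shows "(\<Sum>Y\<in>{Y. length Y \<le> N}. Im (jacobi \<mu> \<kappa> f Y * cnj (f Y))) =
    (\<Sum>Y\<in>{Y. length Y = Suc N}. sqrt (Wpot \<mu> Y) * Im (f Y * cnj (f (tl Y))))"
proof -
  define b where "b = (\<lambda>Y. if Y = [] then 0 else sqrt (Wpot \<mu> Y) * Im (f Y * cnj (f (tl Y))))"
  have Im_J: "Im (jacobi \<mu> \<kappa> f Y * cnj (f Y)) = (\<Sum>i\<in>UNIV. b (i # Y)) - b Y" for Y
    by (auto simp: jacobi_def b_def sum_ix algebra_simps)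
  have level: "(\<Sum>Y\<in>{Y. length Y = M}. Im (jacobi \<mu> \<kappa> f Y * cnj (f Y))) =
      (\<Sum>Y\<in>{Y. length Y = Suc M}. b Y) - (\<Sum>Y\<in>{Y. length Y = M}. b Y)" for M
    unfolding Im_J sum_level_Suc by (rule sum_subtractf)
  have "(\<Sum>Y\<in>{Y. length Y \<le> N}. Im (jacobi \<mu> \<kappa> f Y * cnj (f Y))) = (\<Sum>Y\<in>{Y. length Y = Suc N}. b Y)"
  proof (induction N)
    case 0
    show ?case using level[of 0] by (simp add: b_def)
  next
    case (Suc N)
    then show ?case unfolding sum_ball_Suc level by simp
  qed
  also have "\<dots> = (\<Sum>Y\<in>{Y. length Y = Suc N}. sqrt (Wpot \<mu> Y) * Im (f Y * cnj (f (tl Y))))"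
    by (intro sum.cong) (auto simp: b_def)
  finally show ?thesis .
qed

text \<open>The boundary terms of Green's identity tend to zero for square summable functions, because the
  off-diagonal coefficients are bounded.\<close>

lemma jacobi_eigenfunction_zero:
  assumes f: "f \<in> ell2" and z: "Im z \<noteq> 0" and eig: "\<And>Y. jacobi \<mu> \<kappa> f Y = z * f Y"
  shows "f Y = 0"
proof -
  obtain C where C: "rc_a n k \<le> C" for n k using rc_a_bounded by blast
  define s where "s = (\<lambda>N. \<Sum>Y\<in>{Y. length Y = N}. (cmod (f Y))\<^sup>2)"
  define t where "t = (\<lambda>N. \<Sum>Y\<in>{Y. length Y \<le> N}. (cmod (f Y))\<^sup>2)"
  have sm: "(\<lambda>Y. (cmod (f Y))\<^sup>2) summable_on UNIV" using f by (simp add: ell2_def)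
  have "t N \<le> (\<Sum>\<^sub>\<infinity>Y. (cmod (f Y))\<^sup>2)" for N
    unfolding t_def by (rule finite_sum_le_infsum[OF sm finite_ball_level]) auto
  moreover have "incseq t"
    unfolding incseq_def t_def by (auto intro!: sum_mono2 finite_ball_level)
  ultimately obtain l where l: "t \<longlonglongrightarrow> l"
    by (meson incseq_convergent)
  have ts: "t (Suc N) = t N + s (Suc N)" for N by (simp add: t_def s_def sum_ball_Suc)
  have s0: "(\<lambda>N. s (Suc N)) \<longlonglongrightarrow> 0"
    using tendsto_diff[OF LIMSEQ_Suc[OF l] l] by (simp add: ts)
  have bound: "\<bar>Im z\<bar> * t N \<le> sqrt C * (s (Suc N) + 2 * s N)" for N
  proof -
    have "Im z * t N = (\<Sum>Y\<in>{Y. length Y \<le> N}. Im (jacobi \<mu> \<kappa> f Y * cnj (f Y)))"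
      unfolding t_def sum_distrib_left
    proof (rule sum.cong[OF refl])
      fix Y
      have "z * f Y * cnj (f Y) = z * of_real ((cmod (f Y))\<^sup>2)"
        by (simp only: complex_norm_square mult.assoc)
      then show "Im z * (cmod (f Y))\<^sup>2 = Im (jacobi \<mu> \<kappa> f Y * cnj (f Y))"
        unfolding eig by (simp only: times_complex.sel Im_complex_of_real Re_complex_of_real mult_zero_right add_0_right add_0_left)
    qed
    also have "\<dots> = (\<Sum>Y\<in>{Y. length Y = Suc N}. sqrt (Wpot \<mu> Y) * Im (f Y * cnj (f (tl Y))))"
      by (rule jacobi_Green_identity)
    finally have eq: "Im z * t N = (\<Sum>Y\<in>{Y. length Y = Suc N}. sqrt (Wpot \<mu> Y) * Im (f Y * cnj (f (tl Y))))" .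
    have "0 \<le> t N" by (simp add: t_def sum_nonneg)
    then have "\<bar>Im z\<bar> * t N = \<bar>Im z * t N\<bar>" by (simp add: abs_mult)
    also have "\<dots> = \<bar>\<Sum>Y\<in>{Y. length Y = Suc N}. sqrt (Wpot \<mu> Y) * Im (f Y * cnj (f (tl Y)))\<bar>" by (simp only: eq)
    also have "\<dots> \<le> (\<Sum>Y\<in>{Y. length Y = Suc N}. sqrt C * ((cmod (f Y))\<^sup>2 + (cmod (f (tl Y)))\<^sup>2))"
    proof (rule order_trans[OF sum_abs sum_mono])
      fix Y :: vertex assume "Y \<in> {Y. length Y = Suc N}"
      then obtain i Z where Y: "Y = i # Z" by (auto simp: length_Suc_conv)
      have a: "\<bar>sqrt (Wpot \<mu> Y)\<bar> \<le> sqrt C" using C Wpot_pos[of Y] by (simp add: Y Wpot_Cons)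
      moreover have "\<bar>Im (f Y * cnj (f (tl Y)))\<bar> \<le> (cmod (f Y))\<^sup>2 + (cmod (f (tl Y)))\<^sup>2"
      proof -
        have "\<bar>Im (f Y * cnj (f (tl Y)))\<bar> \<le> cmod (f Y) * cmod (f (tl Y))"
          using abs_Im_le_cmod[of "f Y * cnj (f (tl Y))"] by (simp add: norm_mult)
        also have "\<dots> \<le> (cmod (f Y))\<^sup>2 + (cmod (f (tl Y)))\<^sup>2"
          using sum_squares_bound[of "cmod (f Y)" "cmod (f (tl Y))"]
            mult_nonneg_nonneg[OF norm_ge_zero[of "f Y"] norm_ge_zero[of "f (tl Y)"]] by linarith
        finally show ?thesis .
      qed
      ultimately show "\<bar>sqrt (Wpot \<mu> Y) * Im (f Y * cnj (f (tl Y)))\<bar> \<le> sqrt C * ((cmod (f Y))\<^sup>2 + (cmod (f (tl Y)))\<^sup>2)"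
        unfolding abs_mult by (intro mult_mono[OF _ _ order_trans[OF abs_ge_zero a] abs_ge_zero])
    qed
    also have "\<dots> = sqrt C * (s (Suc N) + 2 * s N)"
    proof -
      \<comment> \<open>The factor 2 counts the two children of each vertex of level N.\<close>
      have "(\<Sum>Y\<in>{Y. length Y = Suc N}. (cmod (f (tl Y)))\<^sup>2) = 2 * s N"
        unfolding sum_level_Suc sum_ix by (simp add: s_def sum_distrib_left)
      then show ?thesis by (simp add: s_def sum.distrib flip: sum_distrib_left)
    qed
    finally show ?thesis .
  qed
  have "(\<lambda>N. sqrt C * (s (Suc (Suc N)) + 2 * s (Suc N))) \<longlonglongrightarrow> sqrt C * (0 + 2 * 0)"
    using s0 by (intro tendsto_intros LIMSEQ_Suc[OF s0])
  moreover have "(\<lambda>N. \<bar>Im z\<bar> * t (Suc N)) \<longlonglongrightarrow> \<bar>Im z\<bar> * l"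
    by (intro tendsto_intros LIMSEQ_Suc l)
  ultimately have "\<bar>Im z\<bar> * l \<le> 0"
    using bound by (intro LIMSEQ_le) auto
  then have "l \<le> 0" using z by (simp add: mult_le_0_iff)
  moreover have "(cmod (f Y))\<^sup>2 \<le> t (length Y)"
    unfolding t_def by (rule member_le_sum[of Y _ "\<lambda>Y. (cmod (f Y))\<^sup>2"]) (auto simp: finite_ball_level)
  moreover have "t (length Y) \<le> l" using \<open>incseq t\<close> l by (rule incseq_le)
  ultimately have "(cmod (f Y))\<^sup>2 \<le> 0" by linarith
  then show ?thesis by simp
qed

definition lc :: "complex \<Rightarrow> vertex \<Rightarrow> complex" where
  "lc z Y = (1 / mfac \<mu> Y) *\<^sub>R Lfun \<mu> (proj Y) z"

text \<open>The indices (1,0) and (0,1) precede (1,1) and lie outside the tree; these are the values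
  that enter the defect of \<open>jacobi_lift\<close> at the root.\<close>

lemma unit_ix_type_I: "A (unit_ix i) k = (if k = i then [:1 / mass \<mu> i:] else 0)"
proof -
  have deg1: "deg_less (A (unit_ix i) k) (if k = i then 1 else 0)" for k
    using deg_less_A[of "unit_ix i" k] by (simp add: unit_ix_def)
  have deg: "A (unit_ix i) k = (if k = i then [:coeff (A (unit_ix i) i) 0:] else 0)" for k
  proof (cases "k = i")
    case True
    have "deg_less (A (unit_ix i) i) 1" using deg1[of i] by simp
    then have "degree (A (unit_ix i) i) = 0" by (auto simp: deg_less_iff)
    then show ?thesis using True by (metis coeff_pCons_0 degree_eq_zeroE)
  qed (use deg1[of k] in \<open>simp add: deg_less_iff\<close>)
  have sz: "msize (unit_ix i) = 1" by (cases i) (auto simp: msize_alt unit_ix_def)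
  then have "pairing (A (unit_ix i)) 1 = 1"
    by (subst pairing_A) (auto simp: deg_less_def coeff_1)
  moreover have "pairing (A (unit_ix i)) 1 = mom i (A (unit_ix i) i)"
  proof -
    have "A (unit_ix i) j = 0" if "j \<noteq> i" for j
      using deg_less_A[of "unit_ix i" j] that by (simp add: unit_ix_def deg_less_iff)
    then show ?thesis by (cases i) (auto simp: pairing_def sum_ix mom_linear)
  qed
  moreover have "mom i (A (unit_ix i) i) = coeff (A (unit_ix i) i) 0 * mass \<mu> i"
    by (subst deg) (simp add: mom_def mass_def)
  ultimately have "coeff (A (unit_ix i) i) 0 * mass \<mu> i = 1" by simp
  then have "coeff (A (unit_ix i) i) 0 = 1 / mass \<mu> i" by (metis nonzero_eq_divide_eq mult_zero_right zero_neq_one)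
  with deg[of k] show ?thesis by simp
qed

lemma mass_pos: "0 < mass \<mu> k"
  using integral_mu_pos[of k "\<lambda>_. 1"] by (simp add: mass_def)

lemma Lfun_unit: "Lfun \<mu> (unit_ix i) z = of_real (1 / mass \<mu> i) * markov (\<mu> i) z"
proof -
  have "cint k [:c:] z = of_real c * markov (\<mu> k) z" for k c
    using cint_linear(3)[of k c 1 z] by (simp add: markov_eq_cint)
  then show ?thesis by (cases i) (auto simp: Lfun_eq_cint sum_ix unit_ix_type_I cint_linear)
qed

text \<open>This explains the exchange of the two weights in \<open>vkappa\<close>: lowering (1,1)
  in direction One gives (0,1), so \<open>\<kappa> One\<close> multiplies the transform of the
  second measure.\<close>

lemma Lkap_eq:
  fixes \<kappa> :: "ix \<Rightarrow> real"
  shows "Lkap \<mu> \<kappa> z = \<kappa> One *\<^sub>R Lfun \<mu> (unit_ix Two) z + \<kappa> Two *\<^sub>R Lfun \<mu> (unit_ix One) z"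
  by (simp add: Lkap_def Lfun_unit sum_ix vkappa_def scaleR_conv_of_real)

lemma jacobi_lc:
  fixes \<kappa> :: "ix \<Rightarrow> real"
  assumes \<kappa>: "\<kappa> One + \<kappa> Two = 1" and z: "\<And>k. z \<notin> of_real ` \<Delta> k"
  shows "jacobi \<mu> \<kappa> (lc z) Y = z * lc z Y - (if Y = [] then Lkap \<mu> \<kappa> z else 0)"
proof -
  have "jacobi \<mu> \<kappa> (\<lambda>Y. (1 / mfac \<mu> Y) *\<^sub>R Lfun \<mu> (proj Y) z) Y = (1 / mfac \<mu> Y) *\<^sub>R (z * Lfun \<mu> (proj Y) z) -
    (if Y = [] then \<kappa> One *\<^sub>R Lfun \<mu> (unit_ix Two) z + \<kappa> Two *\<^sub>R Lfun \<mu> (unit_ix One) z else 0)"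
  proof (rule jacobi_lift[OF \<kappa>])
    fix n :: mindex and j assume n: "\<And>k. 0 < n k"
    have "2 \<le> msize n" using n[of One] n[of Two] by (simp add: msize_alt)
    from Lfun_recurrence[OF n this z, of j]
    show "z * Lfun \<mu> n z = Lfun \<mu> (dec n j) z + rc_b (dec n j) j *\<^sub>R Lfun \<mu> n z + (\<Sum>i\<in>UNIV. rc_a n i *\<^sub>R Lfun \<mu> (inc n i) z)"
      by (simp add: scaleR_conv_of_real)
  qed
  then show ?thesis by (simp add: lc_def[abs_def] Lkap_eq)
qed

text \<open>In Green's identity on a ball the boundary terms are nonpositive by the sign of
  \<open>Lfun_Wronskian_neg\<close>, so the sum of squares is bounded by the source term B at the
  root, whatever the radius.\<close>

lemma lc_ell2_upper:
  fixes \<kappa> :: "ix \<Rightarrow> real"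
  assumes \<kappa>: "\<kappa> One + \<kappa> Two = 1" and z: "0 < Im z"
  shows "lc z \<in> ell2"
proof -
  define B where "B = Im (Lkap \<mu> \<kappa> z * cnj (lc z [])) / Im z"
  have bound: "(\<Sum>Y\<in>{Y. length Y \<le> N}. (cmod (lc z Y))\<^sup>2) \<le> B" for N
  proof -
    have J: "jacobi \<mu> \<kappa> (lc z) Y = z * lc z Y - (if Y = [] then Lkap \<mu> \<kappa> z else 0)" for Y
      using z by (intro jacobi_lc \<kappa> not_in_Delta_complex) simp
    have "Im (jacobi \<mu> \<kappa> (lc z) Y * cnj (lc z Y)) = Im z * (cmod (lc z Y))\<^sup>2 - (if Y = [] then Im z * B else 0)" for Y
    proof -
      have "z * lc z Y * cnj (lc z Y) = z * of_real ((cmod (lc z Y))\<^sup>2)"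
        by (simp only: complex_norm_square mult.assoc)
      then have "Im (z * lc z Y * cnj (lc z Y)) = Im z * (cmod (lc z Y))\<^sup>2"
        by (simp only: times_complex.sel Im_complex_of_real Re_complex_of_real mult_zero_right add_0_right add_0_left)
      moreover have "Im z * B = Im (Lkap \<mu> \<kappa> z * cnj (lc z []))" using z by (simp add: B_def)
      ultimately show ?thesis
        unfolding J left_diff_distrib minus_complex.sel by (cases "Y = []") (simp_all del: times_complex.sel)
    qed
    then have "(\<Sum>Y\<in>{Y. length Y \<le> N}. Im (jacobi \<mu> \<kappa> (lc z) Y * cnj (lc z Y))) =
        Im z * (\<Sum>Y\<in>{Y. length Y \<le> N}. (cmod (lc z Y))\<^sup>2) - Im z * B"
      by (simp add: sum_subtractf sum_distrib_left finite_ball_level sum.delta)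
    moreover have "(\<Sum>Y\<in>{Y. length Y \<le> N}. Im (jacobi \<mu> \<kappa> (lc z) Y * cnj (lc z Y))) \<le> 0"
      unfolding jacobi_Green_identity
    proof (rule sum_nonpos)
      fix Y :: vertex assume "Y \<in> {Y. length Y = Suc N}"
      then obtain i Z where Y: "Y = i # Z" by (auto simp: length_Suc_conv)
      have "Im (lc z Y * cnj (lc z Z)) = (1 / mfac \<mu> Y * (1 / mfac \<mu> Z)) * Im (Lfun \<mu> (inc (proj Z) i) z * cnj (Lfun \<mu> (proj Z) z))"
        by (simp add: lc_def Y algebra_simps scaleR_conv_of_real diff_divide_distrib del: mfac.simps)
      moreover have "Im (Lfun \<mu> (inc (proj Z) i) z * cnj (Lfun \<mu> (proj Z) z)) < 0"
        using msize_proj[of Z] by (intro Lfun_Wronskian_neg z) simp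
      ultimately have "Im (lc z Y * cnj (lc z Z)) \<le> 0"
        using mfac_pos[of Y] mfac_pos[of Z] by (metis divide_nonneg_nonneg less_eq_real_def mult_nonneg_nonneg mult_nonneg_nonpos zero_le_one)
      then show "sqrt (Wpot \<mu> Y) * Im (lc z Y * cnj (lc z (tl Y))) \<le> 0"
        using Wpot_pos[of Y] by (simp add: Y mult_nonneg_nonpos)
    qed
    ultimately have "Im z * (\<Sum>Y\<in>{Y. length Y \<le> N}. (cmod (lc z Y))\<^sup>2) \<le> Im z * B" by linarith
    then show ?thesis using z by simp
  qed
  have "sum (\<lambda>Y. (cmod (lc z Y))\<^sup>2) F \<le> B" if F: "finite F" for F
  proof -
    have "F \<subseteq> {Y. length Y \<le> Max (insert 0 (length ` F))}" using F by auto
    then have "sum (\<lambda>Y. (cmod (lc z Y))\<^sup>2) F \<le> (\<Sum>Y\<in>{Y. length Y \<le> Max (insert 0 (length ` F))}. (cmod (lc z Y))\<^sup>2)"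
      by (intro sum_mono2 finite_ball_level) auto
    with bound show ?thesis by (rule order_trans[rotated])
  qed
  then have "(\<lambda>Y. (cmod (lc z Y))\<^sup>2) summable_on UNIV"
    by (intro nonneg_bdd_above_summable_on) (auto intro!: bdd_aboveI2)
  then show ?thesis by (simp add: ell2_def)
qed

lemma lc_ell2:
  fixes \<kappa> :: "ix \<Rightarrow> real"
  assumes \<kappa>: "\<kappa> One + \<kappa> Two = 1" and z: "Im z \<noteq> 0"
  shows "lc z \<in> ell2"
proof (cases "0 < Im z")
  case False
  then have "lc (cnj z) \<in> ell2" using z by (intro lc_ell2_upper[OF \<kappa>]) simp
  moreover have "cmod (lc (cnj z) Y) = cmod (lc z Y)" for Y by (simp add: lc_def Lfun_cnj)
  ultimately show ?thesis by (simp add: ell2_def)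
qed (use lc_ell2_upper[OF \<kappa>] in blast)

lemma ell2_scale: "f \<in> ell2 \<Longrightarrow> (\<lambda>Y. c * f Y) \<in> ell2"
  by (auto simp: ell2_def norm_mult power_mult_distrib intro: summable_on_cmult_right)

lemma ell2_diff:
  assumes "f \<in> ell2" "g \<in> ell2"
  shows "(\<lambda>Y. f Y - g Y) \<in> ell2"
proof -
  have "(\<lambda>Y. 2 * (cmod (f Y))\<^sup>2 + 2 * (cmod (g Y))\<^sup>2) summable_on UNIV"
    using assms by (intro summable_on_add summable_on_cmult_right) (auto simp: ell2_def)
  moreover have "(cmod (f Y - g Y))\<^sup>2 \<le> 2 * (cmod (f Y))\<^sup>2 + 2 * (cmod (g Y))\<^sup>2" for Y
  proof -
    have "(cmod (f Y - g Y))\<^sup>2 \<le> (cmod (f Y) + cmod (g Y))\<^sup>2"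
      by (intro power_mono norm_triangle_ineq4) auto
    also have "\<dots> \<le> 2 * (cmod (f Y))\<^sup>2 + 2 * (cmod (g Y))\<^sup>2"
      using sum_squares_bound[of "cmod (f Y)" "cmod (g Y)"] by (simp add: power2_sum)
    finally show ?thesis .
  qed
  ultimately show ?thesis
    unfolding ell2_def by (auto intro: summable_on_comparison_test)
qed

lemma jacobi_linear:
  fixes f g :: "vertex \<Rightarrow> complex"
  shows "jacobi \<mu> \<kappa> (\<lambda>Y. f Y - g Y) Y = jacobi \<mu> \<kappa> f Y - jacobi \<mu> \<kappa> g Y"
    "jacobi \<mu> \<kappa> (\<lambda>Y. c * f Y) Y = c * jacobi \<mu> \<kappa> f Y"
  by (simp_all add: jacobi_def sum_ix algebra_simps)

text \<open>\<open>the_inv_into\<close> is evaluated from an explicit square-summable preimage of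
  the delta at the root together with injectivity, which is the absence of square-summable
  eigenfunctions for nonreal z.\<close>

lemma Green_eq:
  fixes \<kappa> :: "ix \<Rightarrow> real"
  assumes \<kappa>: "\<kappa> One + \<kappa> Two = 1" and z: "Im z \<noteq> 0" and L: "Lkap \<mu> \<kappa> z \<noteq> 0"
  shows "Green \<mu> \<kappa> Y [] z = - lc z Y / Lkap \<mu> \<kappa> z"
proof -
  define R where "R = (\<lambda>(f :: vertex \<Rightarrow> complex) Y. jacobi \<mu> \<kappa> f Y - z * f Y)"
  define f where "f = (\<lambda>Y. (- 1 / Lkap \<mu> \<kappa> z) * lc z Y)"
  have f: "f \<in> ell2" unfolding f_def by (rule ell2_scale[OF lc_ell2[OF \<kappa> z]])
  have Rf: "R f = kron []"
  proof
    fix Y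
    have J: "jacobi \<mu> \<kappa> (lc z) Y = z * lc z Y - (if Y = [] then Lkap \<mu> \<kappa> z else 0)"
      by (intro jacobi_lc \<kappa> not_in_Delta_complex z)
    show "R f Y = kron [] Y"
      unfolding R_def f_def jacobi_linear J using L by (simp add: kron_def field_simps)
  qed
  have "inj_on R ell2"
  proof (rule inj_onI)
    fix g h assume gh: "g \<in> ell2" "h \<in> ell2" "R g = R h"
    have "jacobi \<mu> \<kappa> (\<lambda>Y. g Y - h Y) Y = z * (g Y - h Y)" for Y
      using fun_cong[OF gh(3), of Y] by (simp add: R_def jacobi_linear algebra_simps)
    from jacobi_eigenfunction_zero[OF ell2_diff[OF gh(1,2)] z this] show "g = h"
      by (simp add: fun_eq_iff)
  qed
  then have "resolvent \<mu> \<kappa> z (kron []) = f"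
    unfolding resolvent_def R_def[symmetric] Rf[symmetric] using f by (rule the_inv_into_f_f)
  then have "Green \<mu> \<kappa> Y [] z = (\<Sum>\<^sub>\<infinity>Z. f Z * cnj (kron Y Z))"
    by (simp add: Green_def ell2_inner_def)
  also have "\<dots> = (\<Sum>\<^sub>\<infinity>Z\<in>{Y}. f Z * cnj (kron Y Z))"
    by (rule infsum_cong_neutral) (auto simp: kron_def)
  also have "\<dots> = f Y" by (simp add: kron_def)
  finally show ?thesis by (simp add: f_def)
qed

end

section \<open>Markov functions without zeros, and explicit formulas at the index (1,1)\<close>

context angelesco_system
begin

lemma real_off_Delta: "x \<notin> \<Delta> k \<Longrightarrow> x < lo k \<or> hi k < x"
  by (auto simp: Delta_eq)

lemma integral_constant_sign_nonzero:
  assumes "continuous_on (\<Delta> k) f" "f \<in> borel_measurable borel"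
    "(\<forall>x\<in>\<Delta> k. 0 < f x) \<or> (\<forall>x\<in>\<Delta> k. f x < 0)"
  shows "(LINT x|\<mu> k. f x) \<noteq> (0 :: real)"
  using assms(3)
proof
  assume *: "\<forall>x\<in>\<Delta> k. 0 < f x"
  then have "{x \<in> \<Delta> k. f x = 0} = {}" by auto
  with * integral_mu_pos[OF assms(1,2)] show ?thesis by (metis finite.emptyI less_eq_real_def less_irrefl)
next
  assume *: "\<forall>x\<in>\<Delta> k. f x < 0"
  then have "{x \<in> \<Delta> k. - f x = 0} = {}" by auto
  then have "finite {x \<in> \<Delta> k. - f x = 0}" by (simp only: finite.emptyI)
  moreover have "continuous_on (\<Delta> k) (\<lambda>x. - f x)" "(\<lambda>x. - f x) \<in> borel_measurable borel"
    using assms(1,2) by (auto intro!: continuous_intros)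
  ultimately have "0 < (LINT x|\<mu> k. - f x)"
    using * by (intro integral_mu_pos) (auto intro: less_imp_le)
  then show ?thesis by simp
qed

lemma markov_nonzero_real:
  assumes "x \<notin> \<Delta> k" shows "markov (\<mu> k) x \<noteq> (0 :: real)"
  unfolding markov_def
proof (rule integral_constant_sign_nonzero)
  show "continuous_on (\<Delta> k) (\<lambda>s. 1 / (x - of_real s))" using assms by (intro continuous_intros) auto
  show "(\<forall>s\<in>\<Delta> k. 0 < 1 / (x - of_real s)) \<or> (\<forall>s\<in>\<Delta> k. 1 / (x - of_real s) < 0)"
    using real_off_Delta[OF assms] by (auto simp: Delta_eq)
qed measurable

lemma markov_of_real: "markov (\<mu> k) (complex_of_real x) = of_real (markov (\<mu> k) x)"
  by (simp add: markov_eq_cint cint_of_real)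

lemma msize_unit [simp]: "msize (unit_ix i) = 1"
  by (cases i) (auto simp: msize_alt unit_ix_def)

lemma markov_nonzero:
  assumes "z \<notin> of_real ` \<Delta> k" shows "markov (\<mu> k) z \<noteq> (0 :: complex)"
proof (cases "Im z = 0")
  case True
  then have "z = of_real (Re z)" by (simp add: complex_eq_iff)
  then show ?thesis using assms markov_nonzero_real[of "Re z" k] markov_of_real by (metis image_eqI of_real_eq_0_iff)
next
  case False
  then show ?thesis using Lfun_nonzero[OF False, of "unit_ix k"] by (auto simp: Lfun_unit)
qed

definition mean :: "ix \<Rightarrow> real" where "mean k = (LINT t|\<mu> k. t) / mass \<mu> k"

lemma mean_bounds: "lo k \<le> mean k" "mean k \<le> hi k"
proof -
  have i: "integrable (\<mu> k) (\<lambda>t. t)" by (intro integrable_mu_continuous continuous_intros)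
  have "AE t in \<mu> k. lo k \<le> t" "AE t in \<mu> k. t \<le> hi k"
    using AE_mu[of k] by (auto elim!: eventually_mono simp: Delta_eq)
  from integral_mono_AE[OF fin.integrable_const i this(1)] integral_mono_AE[OF i fin.integrable_const this(2)]
  have "(LINT t|\<mu> k. lo k) \<le> (LINT t|\<mu> k. t)" "(LINT t|\<mu> k. t) \<le> (LINT t|\<mu> k. hi k)" .
  then show "lo k \<le> mean k" "mean k \<le> hi k"
    using mass_pos[of k] by (simp_all add: mean_def field_simps mass_def)
qed

lemma Xi_pos: "0 < Xi \<mu>"
  using mean_bounds(2)[of One] mean_bounds(1)[of Two] hi_less_lo by (simp add: Xi_def mean_def)

text \<open>Both components are constants; the zeroth moment makes their masses opposite, and the
  first moment, a difference of means, normalises by \<open>Xi\<close>.\<close>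

lemma type_I_one:
  "A (\<lambda>_. 1) One = [:- 1 / (Xi \<mu> * mass \<mu> One):]" "A (\<lambda>_. 1) Two = [:1 / (Xi \<mu> * mass \<mu> Two):]"
proof -
  define B where "B = (\<lambda>k. case k of One \<Rightarrow> [:- 1 / (Xi \<mu> * mass \<mu> One):] | Two \<Rightarrow> [:1 / (Xi \<mu> * mass \<mu> Two):])"
  have m: "mom k (monom 1 0 * [:c:]) = c * mass \<mu> k" for k c
    by (simp add: mom_def mass_def)
  have "mom k (monom 1 (Suc 0) * [:c:]) = (LINT x|\<mu> k. c * x)" for k c
    by (simp add: mom_def poly_monom mult.commute)
  also have "\<dots> k c = c * mean k * mass \<mu> k" for k c using mass_pos[of k] by (simp add: mean_def)
  finally have m1: "mom k (monom 1 (Suc 0) * [:c:]) = c * mean k * mass \<mu> k" for k c .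
  have X: "Xi \<mu> = mean Two - mean One" by (simp add: Xi_def mean_def)
  have "is_type_I' (\<lambda>_. 1) B"
    unfolding is_type_I'_def
  proof (intro conjI allI impI)
    fix k show "deg_less (B k) 1" by (cases k) (auto simp: B_def deg_less_iff)
    fix m assume "m < msize (\<lambda>_. 1)"
    then consider "m = 0" | "m = Suc 0" by (fastforce simp: msize_alt)
    then show "pairing B (monom 1 m) = (if Suc m = msize (\<lambda>_. 1) then 1 else 0)"
    proof cases
      case 1
      have "pairing B (monom 1 0) = - 1 / (Xi \<mu> * mass \<mu> One) * mass \<mu> One + 1 / (Xi \<mu> * mass \<mu> Two) * mass \<mu> Two"
        by (simp only: pairing_def sum_ix B_def ix.case m)
      also have "\<dots> = 0" using mass_pos[of One] mass_pos[of Two] by simp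
      finally show ?thesis by (simp add: 1 msize_alt)
    next
      case 2
      have "pairing B (monom 1 (Suc 0)) = - 1 / (Xi \<mu> * mass \<mu> One) * mean One * mass \<mu> One + 1 / (Xi \<mu> * mass \<mu> Two) * mean Two * mass \<mu> Two"
        by (simp only: pairing_def sum_ix B_def ix.case m1)
      also have "\<dots> = (mean Two - mean One) / Xi \<mu>"
        using mass_pos[of One] mass_pos[of Two] by (simp add: diff_divide_distrib)
      finally show ?thesis using Xi_pos by (simp add: 2 msize_alt X)
    qed
  qed
  with is_type_I'_A have "A (\<lambda>_. 1) = B" by (rule is_type_I'_unique)
  then show "A (\<lambda>_. 1) One = [:- 1 / (Xi \<mu> * mass \<mu> One):]" "A (\<lambda>_. 1) Two = [:1 / (Xi \<mu> * mass \<mu> Two):]"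
    by (simp_all add: B_def)
qed

lemma Lfun_one:
  "Lfun \<mu> (\<lambda>_. 1) z = of_real (1 / Xi \<mu>) * (of_real (1 / mass \<mu> Two) * markov (\<mu> Two) z - of_real (1 / mass \<mu> One) * markov (\<mu> One) z)"
proof -
  have "cint k [:c:] z = of_real c * markov (\<mu> k) z" for k c
    using cint_linear(3)[of k c 1 z] by (simp add: markov_eq_cint)
  then show ?thesis by (simp add: Lfun_eq_cint sum_ix type_I_one algebra_simps del: One_nat_def)
qed

lemma Lkap_alt:
  "Lkap \<mu> \<kappa> z = of_real (\<kappa> Two / mass \<mu> One) * markov (\<mu> One) z + of_real (\<kappa> One / mass \<mu> Two) * markov (\<mu> Two) z"
  by (simp add: Lkap_def sum_ix vkappa_def)

lemma Lkap_of_real: "Lkap \<mu> \<kappa> (complex_of_real x) = of_real (Lkap \<mu> \<kappa> x)"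
  by (simp add: Lkap_alt markov_of_real)

lemma holomorphic_markov: "(markov (\<mu> k) :: complex \<Rightarrow> complex) holomorphic_on - (of_real ` \<Delta> k)"
  using holomorphic_cint[of k 1] by (simp add: markov_eq_cint[abs_def])

lemma holomorphic_Lkap: "(Lkap \<mu> \<kappa> :: complex \<Rightarrow> complex) holomorphic_on - (of_real ` (\<Delta> One \<union> \<Delta> Two))"
  unfolding Lkap_alt[abs_def]
  by (intro holomorphic_intros holomorphic_on_subset[OF holomorphic_markov]) auto

end

section \<open>The function \<open>Lkap\<close> and its zero set\<close>

locale angelesco_kappa = angelesco_system +
  fixes \<kappa> :: "ix \<Rightarrow> real"
  assumes kappa_sum: "\<kappa> One + \<kappa> Two = 1"
begin

abbreviation "D \<equiv> \<Delta> One \<union> \<Delta> Two"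
abbreviation "E \<equiv> Eset \<mu> \<kappa>"

text \<open>As a real combination of the functions for the consecutive indices (1,0) and (1,1),
  \<open>Lkap\<close> has no nonreal zeros. It also follows that \<open>Lfun\<close> at (1,1) cannot
  vanish at a point of E, where the Markov function of the first measure is nonzero.\<close>

lemma Lkap_eq_combination: "Lkap \<mu> \<kappa> z = Lfun \<mu> (unit_ix One) z + of_real (\<kappa> One * Xi \<mu>) * Lfun \<mu> (\<lambda>_. 1) z"
proof -
  have "of_real (\<kappa> One * Xi \<mu>) * of_real (1 / Xi \<mu>) = (of_real (\<kappa> One) :: 'a)"
    using Xi_pos by (subst of_real_mult[symmetric]) simp
  moreover have k2: "\<kappa> Two = 1 - \<kappa> One" using kappa_sum by simp
  ultimately have "of_real (\<kappa> One * Xi \<mu>) * Lfun \<mu> (\<lambda>_. 1) z = of_real (\<kappa> One) * (of_real (1 / mass \<mu> Two) * markov (\<mu> Two) z - of_real (1 / mass \<mu> One) * markov (\<mu> One) z)"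
    unfolding Lfun_one by (simp only: mult.assoc[symmetric])
  then show ?thesis
    unfolding Lkap_alt Lfun_unit k2 by (simp add: algebra_simps diff_divide_distrib)
qed

lemma inc_unit: "inc (unit_ix One) Two = (\<lambda>_. 1)"
proof
  show "inc (unit_ix One) Two k = 1" for k by (cases k) (simp_all add: inc_def unit_ix_def)
qed

lemma Lkap_nonzero: "Im z \<noteq> 0 \<Longrightarrow> Lkap \<mu> \<kappa> z \<noteq> (0 :: complex)"
  using Lfun_combination_nonzero[of z 1 "\<kappa> One * Xi \<mu>" "unit_ix One" Two]
  by (simp add: Lkap_eq_combination inc_unit)

lemma Lfun_one_nonzero_at_E: "x \<in> E \<Longrightarrow> Lfun \<mu> (\<lambda>_. 1) x \<noteq> (0 :: real)"
  using markov_nonzero_real[of x One] mass_pos[of One]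
  by (auto simp: Eset_def Lkap_eq_combination Lfun_unit)

text \<open>With w(s) = 1/((x-s)(y-s)), two zeros x and y make the combination of the integrals with
  coefficients q vanish on w and on (s-c)w. On each interval w has constant sign, while s - c
  changes sign from one interval to the other; hence the 2 by 2 determinant is nonzero and q = 0,
  against the normalisation of \<open>\<kappa>\<close>.\<close>

lemma Eset_unique:
  assumes "x \<in> E" "y \<in> E" shows "x = y"
proof (rule ccontr)
  assume "x \<noteq> y"
  define w where "w = (\<lambda>s. 1 / ((x - s) * (y - s)))"
  define q where "q = (\<lambda>k. \<kappa> (other k) / mass \<mu> k)"
  define c where "c = (hi One + lo Two) / 2"
  have c: "hi One < c" "c < lo Two" using hi_less_lo by (auto simp: c_def field_simps)
  have xy: "x \<notin> \<Delta> k" "y \<notin> \<Delta> k" for k using assms by (cases k; auto simp: Eset_def)+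
  have wsign: "(\<forall>s\<in>\<Delta> k. 0 < w s) \<or> (\<forall>s\<in>\<Delta> k. w s < 0)" for k
    using real_off_Delta[OF xy(1)[of k]] real_off_Delta[OF xy(2)[of k]]
    by (auto simp: Delta_eq w_def divide_less_0_iff mult_less_0_iff zero_less_mult_iff)
  define \<epsilon> :: "ix \<Rightarrow> real" where "\<epsilon> = (\<lambda>k. if \<forall>s\<in>\<Delta> k. 0 < w s then 1 else - 1)"
  have \<epsilon>: "0 < \<epsilon> k * w s" if "s \<in> \<Delta> k" for k s using wsign[of k] that by (auto simp: \<epsilon>_def)
  have cw: "continuous_on (\<Delta> k) w" for k
    unfolding w_def using xy[of k] by (intro continuous_intros) auto
  have mw [measurable]: "w \<in> borel_measurable borel" unfolding w_def by measurable
  define I where "I = (\<lambda>k. LINT s|\<mu> k. w s)"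
  define J where "J = (\<lambda>k. LINT s|\<mu> k. (s - c) * w s)"
  have iw: "integrable (\<mu> k) w" for k by (intro integrable_mu cw mw)
  have isw: "integrable (\<mu> k) (\<lambda>s. (s - c) * w s)" for k
    by (intro integrable_mu continuous_intros cw) measurable
  have pos: "0 < (LINT s|\<mu> k. f s * (\<epsilon> k * w s))"
    if "continuous_on UNIV f" "\<And>s. s \<in> \<Delta> k \<Longrightarrow> 0 < f s" for k and f :: "real \<Rightarrow> real"
  proof (rule integral_mu_pos)
    show "continuous_on (\<Delta> k) (\<lambda>s. f s * (\<epsilon> k * w s))"
      using that(1) by (intro continuous_intros cw) (auto intro: continuous_on_subset)
    have [measurable]: "f \<in> borel_measurable borel" using that(1) by (rule borel_measurable_continuous_onI)
    show "(\<lambda>s. f s * (\<epsilon> k * w s)) \<in> borel_measurable borel" by measurable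
    have p: "0 < f s * (\<epsilon> k * w s)" if "s \<in> \<Delta> k" for s
      using \<epsilon>[OF that] \<open>\<And>s. s \<in> \<Delta> k \<Longrightarrow> 0 < f s\<close>[OF that] by simp
    then show "0 \<le> f s * (\<epsilon> k * w s)" if "s \<in> \<Delta> k" for s using that by (simp add: less_imp_le)
    have "False" if "s \<in> \<Delta> k" "f s * (\<epsilon> k * w s) = 0" for s using p[OF that(1)] that(2) by linarith
    then have "{s \<in> \<Delta> k. f s * (\<epsilon> k * w s) = 0} = {}" by blast
    then show "finite {s \<in> \<Delta> k. f s * (\<epsilon> k * w s) = 0}" by (simp only: finite.emptyI)
  qed
  have I: "0 < \<epsilon> k * I k" for k using pos[of "\<lambda>_. 1" k] by (simp add: I_def)
  have J2: "0 < \<epsilon> Two * J Two"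
    using pos[of "\<lambda>s. s - c" Two] c by (simp add: J_def Delta_eq mult.left_commute continuous_on_diff)
  have J1: "0 < - (\<epsilon> One * J One)"
  proof -
    have "(LINT s|\<mu> One. (c - s) * (\<epsilon> One * w s)) = (LINT s|\<mu> One. - \<epsilon> One * ((s - c) * w s))"
      by (intro Bochner_Integration.integral_cong) (auto simp: algebra_simps)
    then show ?thesis using pos[of "\<lambda>s. c - s" One] c by (simp add: J_def Delta_eq continuous_on_diff)
  qed
  \<comment> \<open>The difference of the two values yields the integral of w, the value at y yields
    that of (x-s)w, written relative to the point c in the gap.\<close>
  have frac: "1 / (x - s) - 1 / (y - s) = (y - x) * w s" "1 / (y - s) = (x - c) * w s - (s - c) * w s"
    if "s \<in> \<Delta> k" for s k
  proof -
    have "x - s \<noteq> 0" "y - s \<noteq> 0" using that xy[of k] by auto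
    then show "1 / (x - s) - 1 / (y - s) = (y - x) * w s" "1 / (y - s) = (x - c) * w s - (s - c) * w s"
      by (simp_all add: w_def divide_simps) (simp_all add: algebra_simps)?
  qed
  have [measurable]: "(\<lambda>s. 1 / (x - s)) \<in> borel_measurable borel" for x :: real by measurable
  have mx: "markov (\<mu> k) x - markov (\<mu> k) y = (y - x) * I k" for k
  proof -
    have "markov (\<mu> k) x - markov (\<mu> k) y = (LINT s|\<mu> k. 1 / (x - s) - 1 / (y - s))"
      using integrable_cint[of x k 1] integrable_cint[of y k 1] xy[of k] by (simp add: markov_def)
    also have "\<dots> = (LINT s|\<mu> k. (y - x) * w s)"
      using frac(1)[of _ k] AE_mu[of k] by (intro integral_cong_AE) (auto elim!: eventually_mono)
    finally show ?thesis by (simp add: I_def)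
  qed
  have my: "markov (\<mu> k) y = (x - c) * I k - J k" for k
  proof -
    have "markov (\<mu> k) y = (LINT s|\<mu> k. (x - c) * w s - (s - c) * w s)"
      unfolding markov_def using frac(2)[of _ k] AE_mu[of k]
      by (intro integral_cong_AE) (auto elim!: eventually_mono)
    then show ?thesis using iw[of k] isw[of k] by (simp add: I_def J_def)
  qed
  have L: "q One * markov (\<mu> One) x + q Two * markov (\<mu> Two) x = 0" "q One * markov (\<mu> One) y + q Two * markov (\<mu> Two) y = 0"
    using assms by (simp_all add: Eset_def Lkap_alt q_def)
  then have "q One * (markov (\<mu> One) x - markov (\<mu> One) y) + q Two * (markov (\<mu> Two) x - markov (\<mu> Two) y) = 0"
    by (simp add: algebra_simps)
  then have "(y - x) * (q One * I One + q Two * I Two) = 0" by (simp add: mx algebra_simps)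
  then have e1: "q One * I One + q Two * I Two = 0" using \<open>x \<noteq> y\<close> by simp
  have "(x - c) * (q One * I One + q Two * I Two) - (q One * J One + q Two * J Two) = 0"
    using L(2) by (simp add: my algebra_simps)
  then have e2: "q One * J One + q Two * J Two = 0" by (simp add: e1)
  have det: "(\<epsilon> One * I One) * (\<epsilon> Two * J Two) + (\<epsilon> Two * I Two) * (- (\<epsilon> One * J One)) > 0"
    by (rule add_pos_pos[OF mult_pos_pos[OF I J2] mult_pos_pos[OF I J1]])
  have d: "I One * J Two - I Two * J One \<noteq> 0"
  proof
    assume 0: "I One * J Two - I Two * J One = 0"
    have "(\<epsilon> One * I One) * (\<epsilon> Two * J Two) + (\<epsilon> Two * I Two) * (- (\<epsilon> One * J One)) =
        \<epsilon> One * \<epsilon> Two * (I One * J Two - I Two * J One)"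
      by (simp add: algebra_simps)
    with det show False unfolding 0 by simp
  qed
  have "q One * (I One * J Two - I Two * J One) = (q One * I One + q Two * I Two) * J Two - (q One * J One + q Two * J Two) * I Two"
    by (simp add: algebra_simps)
  then have "q One = 0" using e1 e2 d by simp
  moreover have "q Two * (I One * J Two - I Two * J One) = (q One * J One + q Two * J Two) * I One - (q One * I One + q Two * I Two) * J One"
    by (simp add: algebra_simps)
  then have "q Two = 0" using e1 e2 d by simp
  ultimately show False using kappa_sum mass_pos[of One] mass_pos[of Two] by (simp add: q_def)
qed

lemma finite_E: "finite E"
proof (cases "E = {}")
  case False
  then obtain x where "E = {x}" using Eset_unique by blast
  then show ?thesis by simp
qed simp

lemma compact_DE: "compact (D \<union> E)"
  by (intro compact_Un compact_Delta finite_imp_compact finite_E)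

lemma Green_root: "Im z \<noteq> 0 \<Longrightarrow> Green \<mu> \<kappa> [] [] z = - Lfun \<mu> (\<lambda>_. 1) z / Lkap \<mu> \<kappa> z"
  using Green_eq[OF kappa_sum, of z "[]"] Lkap_nonzero[of z] by (simp add: lc_def del: mfac.simps One_nat_def)

text \<open>Off \<open>D \<union> E\<close>, where everything is analytic; on the two intervals only boundary values make sense.\<close>

lemma holomorphic_Green:
  "(\<lambda>z::complex. lc z Y / Lkap \<mu> \<kappa> z) holomorphic_on - (of_real ` (D \<union> E))"
proof -
  have "Lkap \<mu> \<kappa> z \<noteq> 0" if "z \<in> - (of_real ` (D \<union> E))" for z :: complex
  proof (cases "Im z = 0")
    case True
    then have z: "z = of_real (Re z)" by (simp add: complex_eq_iff)
    then have "Re z \<notin> D" "Re z \<notin> E" using that by (metis ComplD UnCI image_eqI)+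
    then have "Lkap \<mu> \<kappa> (Re z) \<noteq> 0" by (auto simp: Eset_def)
    then show ?thesis using z Lkap_of_real[of \<kappa> "Re z"] by (metis of_real_eq_0_iff)
  qed (rule Lkap_nonzero)
  moreover have "(\<lambda>z. lc z Y) holomorphic_on - (of_real ` (D \<union> E))"
    unfolding lc_def scaleR_conv_of_real
    by (intro holomorphic_intros holomorphic_on_subset[OF holomorphic_Lfun]) auto
  moreover have "(Lkap \<mu> \<kappa> :: complex \<Rightarrow> complex) holomorphic_on - (of_real ` (D \<union> E))"
    by (rule holomorphic_on_subset[OF holomorphic_Lkap]) auto
  ultimately show ?thesis by (intro holomorphic_on_divide) auto
qed

end

section \<open>The spectral measure\<close>

lemma closed_msupport: "closed (msupport M)"
proof -
  have "- msupport M = \<Union>{U. open U \<and> emeasure M U = 0}"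
    by (auto simp: msupport_def zero_less_iff_neq_zero)
  then have "open (- msupport M)" by (simp add: open_Union)
  then show ?thesis by (simp add: closed_def)
qed

locale angelesco_spectral = angelesco_kappa +
  fixes \<rho> :: "real measure"
  assumes spectral: "is_spectral_measure \<mu> \<kappa> [] \<rho>"
begin

sublocale rho: borel_finite_measure \<rho>
  using spectral by (simp add: is_spectral_measure_def borel_finite_measure_def borel_finite_measure_axioms_def)

text \<open>The formula for the Green's function at the root, which also makes sense and is analytic
  at the real points off D and E.\<close>

definition GO :: "complex \<Rightarrow> complex" where
  "GO z = - Lfun \<mu> (\<lambda>_. 1) z / Lkap \<mu> \<kappa> z"

lemma GO_spectral: "Im z \<noteq> 0 \<Longrightarrow> GO z = (LINT x|\<rho>. 1 / (of_real x - z))"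
  using spectral Green_root[of z] by (simp add: is_spectral_measure_def GO_def)

lemma holomorphic_GO: "GO holomorphic_on - (of_real ` (D \<union> E))"
proof -
  have "GO = (\<lambda>z. - (lc z [] / Lkap \<mu> \<kappa> z))"
    by (simp add: GO_def lc_def fun_eq_iff del: mfac.simps One_nat_def)
  then show ?thesis by (simp only: holomorphic_on_minus[OF holomorphic_Green])
qed

lemma Im_GO:
  assumes "0 < y" shows "Im (GO (Complex x y)) = (LINT t|\<rho>. poisson y (t - x))"
proof -
  have i: "integrable \<rho> (\<lambda>t. 1 / (of_real t - Complex x y))"
  proof (rule rho.integrable_const_bound[of _ "1 / y"])
    show "AE t in \<rho>. norm (1 / (of_real t - Complex x y)) \<le> 1 / y"
    proof (rule AE_I2)
      fix t
      have "y \<le> cmod (of_real t - Complex x y)"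
        using abs_Im_le_cmod[of "of_real t - Complex x y"] assms by simp
      then show "norm (1 / (of_real t - Complex x y)) \<le> 1 / y"
        using assms by (simp add: norm_divide frac_le)
    qed
  qed measurable
  have "Im (GO (Complex x y)) = Im (LINT t|\<rho>. 1 / (of_real t - Complex x y))"
    using assms by (simp add: GO_spectral)
  also have "\<dots> = (LINT t|\<rho>. Im (1 / (of_real t - Complex x y)))"
    using i by (rule integral_Im[symmetric])
  finally show ?thesis by (simp only: Im_inverse_diff)
qed

lemma GO_real: "x \<notin> D \<union> E \<Longrightarrow> Im (GO (of_real x)) = 0"
  by (simp add: GO_def Lfun_of_real Lkap_of_real Im_divide)

text \<open>Near such a point \<open>GO\<close> is analytic and real on the real axis, so Stieltjes
  inversion applies on a ball with density 0.\<close>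

lemma rho_null_off:
  assumes "x \<notin> D \<union> E"
  obtains U where "open U" "x \<in> U" "emeasure \<rho> U = 0"
proof -
  have "open (- (D \<union> E))" using compact_DE by (intro open_Compl compact_imp_closed)
  then obtain e where e: "0 < e" "ball x e \<subseteq> - (D \<union> E)"
    using assms open_contains_ball by blast
  have c: "continuous_on (UNIV \<times> ball x e) (\<lambda>(y, x). Im (GO (Complex x y)))"
  proof -
    have "continuous_on (UNIV \<times> ball x e) (\<lambda>p. Im (GO (Complex (snd p) (fst p))))"
      using e(2)
      by (intro continuous_intros continuous_on_compose2[OF holomorphic_on_imp_continuous_on[OF holomorphic_GO]])
         (auto simp: Complex_eq intro!: continuous_intros simp: complex_eq_iff)
    then show ?thesis by (simp add: case_prod_unfold)
  qed
  have "emeasure \<rho> (UNIV \<inter> ball x e) = (\<integral>\<^sup>+t. indicator (UNIV \<inter> ball x e) t * ennreal (Im (GO (Complex t 0)) / pi) \<partial>lborel)"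
    by (rule rho.stieltjes_inversion[OF Im_GO open_ball bounded_ball continuous_on_subset[OF c]]) auto
  also have "\<dots> = (\<integral>\<^sup>+t. 0 \<partial>(lborel :: real measure))"
  proof (rule nn_integral_cong)
    fix t
    show "indicator (UNIV \<inter> ball x e) t * ennreal (Im (GO (Complex t 0)) / pi) = 0"
    proof (cases "t \<in> ball x e")
      case True
      then have "t \<notin> D \<union> E" using e(2) by blast
      from GO_real[OF this] have "Im (GO (Complex t 0)) = 0" by (simp add: complex_of_real_def)
      then show ?thesis by simp
    qed simp
  qed
  finally show ?thesis using that[of "ball x e"] e(1) by simp
qed

lemma msupport_rho: "msupport \<rho> \<subseteq> D \<union> E"
proof
  fix x assume x: "x \<in> msupport \<rho>"
  show "x \<in> D \<union> E"
  proof (rule ccontr)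
    assume "x \<notin> D \<union> E"
    then obtain U where "open U" "x \<in> U" "emeasure \<rho> U = 0" by (rule rho_null_off)
    with x show False by (auto simp: msupport_def)
  qed
qed

lemma DE_borel [measurable]: "D \<union> E \<in> sets borel" "E \<in> sets borel" "\<Delta> k \<in> sets borel"
  by (intro borel_closed compact_imp_closed compact_DE finite_imp_closed finite_E closed_Delta)+

lemma AE_rho: "AE x in \<rho>. x \<in> D \<union> E"
proof -
  have "- msupport \<rho> \<in> sets \<rho>" using closed_msupport by (auto intro: borel_open open_Compl)
  moreover have "emeasure \<rho> (- msupport \<rho>) = 0" by (rule msupport_complement_null) simp
  ultimately have "AE x in \<rho>. x \<in> msupport \<rho>"
    by (intro AE_I[of _ _ "- msupport \<rho>"]) blast+
  then show ?thesis by (rule eventually_mono) (use msupport_rho in blast)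
qed

text \<open>\<open>transfer U K b\<close>: multiplication by \<open>b\<close> commutes with the Cauchy transform on \<open>K\<close> up to a
  function that is holomorphic on all of \<open>U\<close>, also across \<open>K\<close>.\<close>

definition supported :: "real set \<Rightarrow> (real \<Rightarrow> complex) \<Rightarrow> bool" where
  "supported K g \<longleftrightarrow> g \<in> borel_measurable borel \<and> (\<exists>B. \<forall>x. norm (g x) \<le> B) \<and> (\<forall>x. x \<notin> K \<longrightarrow> g x = 0)"

definition transfer :: "complex set \<Rightarrow> real set \<Rightarrow> (complex \<Rightarrow> complex) \<Rightarrow> bool" where
  "transfer U K b \<longleftrightarrow> b holomorphic_on U \<and> (\<forall>g. supported K g \<longrightarrow>
     (\<exists>h. h holomorphic_on U \<and> (\<forall>z. Im z \<noteq> 0 \<longrightarrow>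
        b z * cauchy_trans \<rho> g z - cauchy_trans \<rho> (\<lambda>x. b (of_real x) * g x) z = h z)))"

lemma supported_integrable:
  assumes "supported K g" shows "integrable \<rho> g"
proof -
  obtain B where "\<And>x. norm (g x) \<le> B" using assms by (auto simp: supported_def)
  then show ?thesis using assms by (intro rho.integrable_const_bound[of _ B]) (auto simp: supported_def)
qed

lemma supported_mult:
  assumes g: "supported K g" and K: "compact K" "of_real ` K \<subseteq> U" and b: "b holomorphic_on U"
  shows "supported K (\<lambda>x. b (of_real x) * g x)"
proof -
  have c: "continuous_on K (\<lambda>x. b (of_real x))"
    using K(2) by (intro continuous_on_compose2[OF holomorphic_on_imp_continuous_on[OF b]] continuous_intros) auto
  then have "bounded ((\<lambda>x. b (of_real x)) ` K)"
    using K(1) by (intro compact_imp_bounded compact_continuous_image)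
  then obtain B where B: "\<And>x. x \<in> K \<Longrightarrow> norm (b (of_real x)) \<le> B" by (auto simp: bounded_iff)
  obtain C where C: "\<And>x. norm (g x) \<le> C" using g by (auto simp: supported_def)
  have K0: "g x = 0" if "x \<notin> K" for x using g that by (auto simp: supported_def)
  have "norm (b (of_real x) * g x) \<le> \<bar>B\<bar> * C" for x
    using B[of x] C[of x] K0[of x] order_trans[OF norm_ge_zero C] 
    by (cases "x \<in> K") (auto simp: norm_mult intro!: mult_mono order_trans[OF B abs_ge_self])
  moreover have [measurable]: "K \<in> sets borel" using K(1) by (simp add: borel_compact)
  have "(\<lambda>x. indicator K x *\<^sub>R b (of_real x)) \<in> borel_measurable borel"
    by (rule borel_measurable_continuous_on_indicator[OF _ c]) simp
  then have "(\<lambda>x. (indicator K x *\<^sub>R b (of_real x)) * g x) \<in> borel_measurable borel"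
    using g by (intro borel_measurable_times) (simp_all add: supported_def)
  then have "(\<lambda>x. b (of_real x) * g x) \<in> borel_measurable borel"
    by (rule measurable_cong[THEN iffD1, rotated]) (use K0 in \<open>auto simp: indicator_def\<close>)
  ultimately show ?thesis using K0 unfolding supported_def by auto
qed

lemma integrable_cauchy_rho:
  assumes "integrable \<rho> g" "Im z \<noteq> 0"
  shows "integrable \<rho> (\<lambda>x. g x / (z - of_real x))"
  by (rule integrable_cauchy_trans[OF rho.sets_rho assms(1) closed_UNIV]) (use assms(2) in auto)

lemma cauchy_rho_add:
  assumes "integrable \<rho> f" "integrable \<rho> g" "Im z \<noteq> 0"
  shows "cauchy_trans \<rho> (\<lambda>x. f x + g x) z = cauchy_trans \<rho> f z + cauchy_trans \<rho> g z"
  using integrable_cauchy_rho[OF assms(1,3)] integrable_cauchy_rho[OF assms(2,3)]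
  by (simp add: cauchy_trans_def add_divide_distrib)

lemma transfer_const: "transfer U K (\<lambda>_. c)"
proof -
  have "cauchy_trans \<rho> (\<lambda>x. c * g x) z = c * cauchy_trans \<rho> g z" for g z
    by (simp add: cauchy_trans_def flip: times_divide_eq_right)
  then show ?thesis by (auto simp: transfer_def intro!: exI[of _ "\<lambda>_. 0"])
qed

lemma transfer_id: "compact K \<Longrightarrow> transfer U K (\<lambda>z. z)"
  unfolding transfer_def
proof (intro conjI allI impI)
  fix g assume K: "compact K" and g: "supported K g"
  have ig: "integrable \<rho> g" using g by (rule supported_integrable)
  have ixg: "integrable \<rho> (\<lambda>x. of_real x * g x)"
    by (rule supported_integrable[OF supported_mult[OF g K, of UNIV "\<lambda>z. z"]]) (auto intro: holomorphic_intros)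
  show "\<exists>h. h holomorphic_on U \<and> (\<forall>z. Im z \<noteq> 0 \<longrightarrow>
        z * cauchy_trans \<rho> g z - cauchy_trans \<rho> (\<lambda>x. of_real x * g x) z = h z)"
  proof (intro exI[of _ "\<lambda>_. LINT x|\<rho>. g x"] conjI allI impI)
    fix z :: complex assume z: "Im z \<noteq> 0"
    have "z * cauchy_trans \<rho> g z - cauchy_trans \<rho> (\<lambda>x. of_real x * g x) z =
        (LINT x|\<rho>. z * (g x / (z - of_real x)) - of_real x * g x / (z - of_real x))"
      using integrable_cauchy_rho[OF ig z] integrable_cauchy_rho[OF ixg z]
      by (simp add: cauchy_trans_def del: times_divide_eq_right)
    also have "\<dots> = (LINT x|\<rho>. g x)"
    proof (rule Bochner_Integration.integral_cong[OF refl])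
      fix x
      have "z - of_real x \<noteq> 0" using z by (auto simp: complex_eq_iff)
      then show "z * (g x / (z - of_real x)) - of_real x * g x / (z - of_real x) = g x"
        by (simp add: divide_simps) (simp add: algebra_simps)
    qed
    finally show "z * cauchy_trans \<rho> g z - cauchy_trans \<rho> (\<lambda>x. of_real x * g x) z = (LINT x|\<rho>. g x)" .
  qed (auto intro: holomorphic_intros)
qed (auto intro: holomorphic_intros)

lemma transfer_add:
  assumes b: "transfer U K b" and c: "transfer U K c" and K: "compact K" "of_real ` K \<subseteq> U"
  shows "transfer U K (\<lambda>z. b z + c z)"
  unfolding transfer_def
proof (intro conjI allI impI)
  have hb: "b holomorphic_on U" and hc: "c holomorphic_on U" using b c by (auto simp: transfer_def)
  then show "(\<lambda>z. b z + c z) holomorphic_on U" by (intro holomorphic_intros)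
  fix g assume g: "supported K g"
  obtain h where h: "h holomorphic_on U" "\<And>z. Im z \<noteq> 0 \<Longrightarrow> b z * cauchy_trans \<rho> g z - cauchy_trans \<rho> (\<lambda>x. b (of_real x) * g x) z = h z"
    using b g unfolding transfer_def by blast
  obtain k where k: "k holomorphic_on U" "\<And>z. Im z \<noteq> 0 \<Longrightarrow> c z * cauchy_trans \<rho> g z - cauchy_trans \<rho> (\<lambda>x. c (of_real x) * g x) z = k z"
    using c g unfolding transfer_def by blast
  have "(b z + c z) * cauchy_trans \<rho> g z - cauchy_trans \<rho> (\<lambda>x. (b (of_real x) + c (of_real x)) * g x) z = h z + k z" if z: "Im z \<noteq> 0" for z
    using cauchy_rho_add[OF supported_integrable[OF supported_mult[OF g K hb]] supported_integrable[OF supported_mult[OF g K hc]] z]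
      h(2)[OF z] k(2)[OF z] by (simp add: distrib_right algebra_simps)
  then show "\<exists>h. h holomorphic_on U \<and> (\<forall>z. Im z \<noteq> 0 \<longrightarrow>
      (b z + c z) * cauchy_trans \<rho> g z - cauchy_trans \<rho> (\<lambda>x. (b (of_real x) + c (of_real x)) * g x) z = h z)"
    using h(1) k(1) by (intro exI[of _ "\<lambda>z. h z + k z"] conjI holomorphic_intros) auto
qed

lemma transfer_mult:
  assumes b: "transfer U K b" and c: "transfer U K c" and K: "compact K" "of_real ` K \<subseteq> U"
  shows "transfer U K (\<lambda>z. b z * c z)"
  unfolding transfer_def
proof (intro conjI allI impI)
  have hb: "b holomorphic_on U" and hc: "c holomorphic_on U" using b c by (auto simp: transfer_def)
  then show "(\<lambda>z. b z * c z) holomorphic_on U" by (intro holomorphic_intros)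
  fix g assume g: "supported K g"
  obtain k where k: "k holomorphic_on U" "\<And>z. Im z \<noteq> 0 \<Longrightarrow> c z * cauchy_trans \<rho> g z - cauchy_trans \<rho> (\<lambda>x. c (of_real x) * g x) z = k z"
    using c g unfolding transfer_def by blast
  obtain h where h: "h holomorphic_on U" "\<And>z. Im z \<noteq> 0 \<Longrightarrow> b z * cauchy_trans \<rho> (\<lambda>x. c (of_real x) * g x) z - cauchy_trans \<rho> (\<lambda>x. b (of_real x) * (c (of_real x) * g x)) z = h z"
    using b supported_mult[OF g K hc] unfolding transfer_def by blast
  have "(b z * c z) * cauchy_trans \<rho> g z - cauchy_trans \<rho> (\<lambda>x. (b (of_real x) * c (of_real x)) * g x) z = b z * k z + h z" if z: "Im z \<noteq> 0" for z
    unfolding h(2)[OF z, symmetric] k(2)[OF z, symmetric] by (simp add: algebra_simps)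
  then show "\<exists>h. h holomorphic_on U \<and> (\<forall>z. Im z \<noteq> 0 \<longrightarrow>
      (b z * c z) * cauchy_trans \<rho> g z - cauchy_trans \<rho> (\<lambda>x. (b (of_real x) * c (of_real x)) * g x) z = h z)"
    using h(1) k(1) hb by (intro exI[of _ "\<lambda>z. b z * k z + h z"] conjI holomorphic_intros) auto
qed

text \<open>The property of b is applied to the density g/b, which multiplication by b turns back
  into g; dividing by b(z) gives the claim.\<close>

lemma transfer_inverse:
  assumes b: "transfer U K b" and K: "compact K" "of_real ` K \<subseteq> U" and nz: "\<And>z. z \<in> U \<Longrightarrow> b z \<noteq> 0"
    and U: "\<And>z. Im z \<noteq> 0 \<Longrightarrow> z \<in> U"
  shows "transfer U K (\<lambda>z. inverse (b z))"
  unfolding transfer_def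
proof (intro conjI allI impI)
  have hb: "b holomorphic_on U" using b by (auto simp: transfer_def)
  then show hi: "(\<lambda>z. inverse (b z)) holomorphic_on U" using nz by (intro holomorphic_intros)
  fix g assume g: "supported K g"
  obtain h where h: "h holomorphic_on U" "\<And>z. Im z \<noteq> 0 \<Longrightarrow> b z * cauchy_trans \<rho> (\<lambda>x. inverse (b (of_real x)) * g x) z -
      cauchy_trans \<rho> (\<lambda>x. b (of_real x) * (inverse (b (of_real x)) * g x)) z = h z"
    using b supported_mult[OF g K hi] unfolding transfer_def by blast
  have "b (of_real x) * (inverse (b (of_real x)) * g x) = g x" for x
    using nz[of "of_real x"] K(2) g by (cases "x \<in> K") (auto simp: supported_def)
  then have "(\<lambda>x. b (of_real x) * (inverse (b (of_real x)) * g x)) = g" by (rule ext)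
  then have h': "b z * cauchy_trans \<rho> (\<lambda>x. inverse (b (of_real x)) * g x) z - cauchy_trans \<rho> g z = h z" if "Im z \<noteq> 0" for z
    using h(2)[OF that] by (simp only:)
  have "inverse (b z) * cauchy_trans \<rho> g z - cauchy_trans \<rho> (\<lambda>x. inverse (b (of_real x)) * g x) z = - inverse (b z) * h z" if z: "Im z \<noteq> 0" for z
    unfolding h'[OF z, symmetric] using nz[OF U[OF z]] by (simp add: algebra_simps)
  then show "\<exists>h. h holomorphic_on U \<and> (\<forall>z. Im z \<noteq> 0 \<longrightarrow>
      inverse (b z) * cauchy_trans \<rho> g z - cauchy_trans \<rho> (\<lambda>x. inverse (b (of_real x)) * g x) z = h z)"
    by (intro exI[of _ "\<lambda>z. - inverse (b z) * h z"] conjI holomorphic_on_mult holomorphic_on_minus h(1) hi) auto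
qed

lemma transfer_poly:
  assumes K: "compact K" "of_real ` K \<subseteq> U"
  shows "transfer U K (poly p)"
proof (induction p)
  case 0
  show ?case using transfer_const[of U K 0] by (simp add: poly_0[abs_def])
next
  case (pCons a p)
  have "transfer U K (\<lambda>z. a + z * poly p z)"
    by (intro transfer_add transfer_mult transfer_const transfer_id K pCons.IH)
  moreover have "poly (pCons a p) = (\<lambda>z. a + z * poly p z)" by (simp add: fun_eq_iff)
  ultimately show ?case by (simp only:)
qed

text \<open>In 1/(x-s) - 1/(z-s) the numerator z - x cancels the Cauchy kernel. By Fubini the
  discrepancy is minus the Cauchy transform, against \<open>\<mu> k\<close>, of G(s), the integral
  of g(x)/(x-s); G is bounded because K keeps a distance from the interval.\<close>

lemma transfer_markov:
  assumes K: "compact K" "K \<inter> \<Delta> k = {}"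
  shows "transfer (- (of_real ` \<Delta> k)) K (markov (\<mu> k))"
  unfolding transfer_def
proof (intro conjI allI impI)
  show "(markov (\<mu> k) :: complex \<Rightarrow> complex) holomorphic_on - of_real ` \<Delta> k" by (rule holomorphic_markov)
  fix g assume g: "supported K g"
  have sub: "of_real ` K \<subseteq> - (of_real ` \<Delta> k :: complex set)" using K(2) by auto
  have [measurable]: "g \<in> borel_measurable borel" using g by (simp add: supported_def)
  have [measurable]: "K \<in> sets borel" using K by (simp add: borel_compact)
  obtain B where B: "\<And>x. norm (g x) \<le> B" using g by (auto simp: supported_def)
  have B0: "0 \<le> B" using order_trans[OF norm_ge_zero B] .
  have K0: "g x = 0" if "x \<notin> K" for x using g that by (auto simp: supported_def)
  obtain d where d: "0 < d" "\<And>x s. x \<in> K \<Longrightarrow> s \<in> \<Delta> k \<Longrightarrow> d \<le> dist x s"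
    using separate_compact_closed[OF K(1) closed_Delta K(2)] by blast
  \<comment> \<open>The indicator keeps the kernel bounded for every s; it is 1 almost everywhere
    for \<open>\<mu> k\<close>.\<close>
  define G where "G = (\<lambda>s. LINT x|\<rho>. indicator (\<Delta> k) s *\<^sub>R (g x / of_real (x - s)))"
  have gb: "norm (indicator (\<Delta> k) s *\<^sub>R (g x / of_real (x - s))) \<le> B / d" for x s
  proof (cases "x \<in> K \<and> s \<in> \<Delta> k")
    case True
    then have "d \<le> \<bar>x - s\<bar>" using d(2)[of x s] by (simp add: dist_real_def)
    then have "norm (g x) / \<bar>x - s\<bar> \<le> B / d" using B[of x] B0 d(1) by (intro frac_le) auto
    then show ?thesis using True by (simp add: norm_divide flip: of_real_diff)
  qed (use B0 d(1) K0 in \<open>auto simp: indicator_def\<close>)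
  have GM: "integrable (\<mu> k) G"
  proof (rule fin.integrable_const_bound[where B = "measure \<rho> UNIV * (B / d)"])
    show "AE s in \<mu> k. norm (G s) \<le> measure \<rho> UNIV * (B / d)"
    proof (rule AE_I2)
      fix s
      have "norm (G s) \<le> (LINT x|\<rho>. norm (indicator (\<Delta> k) s *\<^sub>R (g x / of_real (x - s))))"
        unfolding G_def by (rule integral_norm_bound)
      also have "\<dots> \<le> (LINT x|\<rho>. B / d)"
        using gb B0 d(1) by (intro integral_mono' rho.integrable_const) auto
      finally show "norm (G s) \<le> measure \<rho> UNIV * (B / d)" by simp
    qed
    have "(\<lambda>(s, x). indicator (\<Delta> k) s *\<^sub>R (g x / of_real (x - s))) \<in> borel_measurable (\<mu> k \<Otimes>\<^sub>M \<rho>)"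
      by measurable
    then show "G \<in> borel_measurable (\<mu> k)"
      unfolding G_def by (rule rho.borel_measurable_lebesgue_integral)
  qed
  show "\<exists>h. h holomorphic_on - of_real ` \<Delta> k \<and> (\<forall>z. Im z \<noteq> 0 \<longrightarrow>
      markov (\<mu> k) z * cauchy_trans \<rho> g z - cauchy_trans \<rho> (\<lambda>x. markov (\<mu> k) (of_real x) * g x) z = h z)"
  proof (intro exI[of _ "\<lambda>z. - cauchy_trans (\<mu> k) G z"] conjI allI impI)
    show "(\<lambda>z. - cauchy_trans (\<mu> k) G z) holomorphic_on - of_real ` \<Delta> k"
      by (intro holomorphic_intros holomorphic_cauchy_trans[OF sets_mu GM closed_Delta AE_mu])
    fix z :: complex assume z: "Im z \<noteq> 0"
    define f where "f = (\<lambda>(x, s). indicator (\<Delta> k) s *\<^sub>R (g x / of_real (x - s)) / (z - of_real s))"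
    have fb: "norm (f (x, s)) \<le> B / d / \<bar>Im z\<bar>" for x s
    proof -
      have "\<bar>Im z\<bar> \<le> norm (z - of_real s)" using abs_Im_le_cmod[of "z - of_real s"] by simp
      then have "norm (indicator (\<Delta> k) s *\<^sub>R (g x / of_real (x - s))) / norm (z - of_real s) \<le> B / d / \<bar>Im z\<bar>"
        using gb[of s x] B0 d(1) z by (intro frac_le) auto
      then show ?thesis by (simp only: f_def case_prod_conv norm_divide)
    qed
    interpret pair_sigma_finite \<rho> "\<mu> k" by unfold_locales
    have [measurable]: "f \<in> borel_measurable (\<rho> \<Otimes>\<^sub>M \<mu> k)" unfolding f_def by measurable
    have fin2: "finite_measure (\<rho> \<Otimes>\<^sub>M \<mu> k)"
      by (intro finite_measure_pair_measure rho.finite_measure_axioms finite_measure_mu)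
    have int: "integrable (\<rho> \<Otimes>\<^sub>M \<mu> k) f"
      using fb by (intro finite_measure.integrable_const_bound[OF fin2, of _ "B / d / \<bar>Im z\<bar>"]) auto
    have "cauchy_trans (\<mu> k) G z = (LINT s|\<mu> k. LINT x|\<rho>. f (x, s))"
      unfolding cauchy_trans_def G_def f_def by simp
    also have "\<dots> = (LINT x|\<rho>. LINT s|\<mu> k. f (x, s))"
      using Fubini_integral[of "\<lambda>x s. f (x, s)"] int by simp
    also have "\<dots> = (LINT x|\<rho>. markov (\<mu> k) (of_real x) * g x / (z - of_real x) - markov (\<mu> k) z * (g x / (z - of_real x)))"
    proof (rule Bochner_Integration.integral_cong[OF refl])
      fix x
      show "(LINT s|\<mu> k. f (x, s)) = markov (\<mu> k) (of_real x) * g x / (z - of_real x) - markov (\<mu> k) z * (g x / (z - of_real x))"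
      proof (cases "x \<in> K")
        case False
        then show ?thesis by (simp add: f_def K0)
      next
        case True
        then have xk: "complex_of_real x \<notin> of_real ` \<Delta> k" using K(2) by auto
        have zx: "z - of_real x \<noteq> 0" using z by (auto simp: complex_eq_iff)
        have i1: "integrable (\<mu> k) (\<lambda>s. 1 / (complex_of_real x - of_real s))"
          using integrable_cint[OF xk, of 1] by simp
        have i2: "integrable (\<mu> k) (\<lambda>s. 1 / (z - of_real s))"
          using integrable_cint[of z k 1] z by (simp add: not_in_Delta_complex)
        have "(LINT s|\<mu> k. f (x, s)) = (LINT s|\<mu> k. g x / (z - of_real x) * (1 / (of_real x - of_real s) - 1 / (z - of_real s)))"
        proof (rule integral_cong_AE)
          show "AE s in \<mu> k. f (x, s) = g x / (z - of_real x) * (1 / (of_real x - of_real s) - 1 / (z - of_real s))"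
            using AE_mu[of k]
          proof eventually_elim
            case (elim s)
            have "complex_of_real x - of_real s \<noteq> 0" "z - of_real s \<noteq> 0"
              using xk elim z by (auto simp: complex_eq_iff)
            then have "1 / (of_real x - of_real s) - 1 / (z - of_real s) = (z - of_real x) / ((of_real x - of_real s) * (z - of_real s))"
              by (subst diff_frac_eq) auto
            then show ?case using zx elim by (simp add: f_def)
          qed
          show "(\<lambda>s. f (x, s)) \<in> borel_measurable (\<mu> k)" unfolding f_def case_prod_conv by measurable
        qed measurable
        also have "\<dots> = g x / (z - of_real x) * (markov (\<mu> k) (of_real x) - markov (\<mu> k) z)"
          using i1 i2 by (simp add: markov_def)
        finally show ?thesis by (simp add: algebra_simps)
      qed
    qed
    also have "\<dots> = cauchy_trans \<rho> (\<lambda>x. markov (\<mu> k) (of_real x) * g x) z - markov (\<mu> k) z * cauchy_trans \<rho> g z"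
      using integrable_cauchy_rho[OF supported_integrable[OF g] z]
        integrable_cauchy_rho[OF supported_integrable[OF supported_mult[OF g K(1) sub holomorphic_markov]] z]
      by (simp add: cauchy_trans_def del: times_divide_eq_right)
    finally show "markov (\<mu> k) z * cauchy_trans \<rho> g z - cauchy_trans \<rho> (\<lambda>x. markov (\<mu> k) (of_real x) * g x) z = - cauchy_trans (\<mu> k) G z"
      by simp
  qed
qed

end

text \<open>The two extensions agree off both real sets by continuity from above, so together they
  form an entire function. F is assumed equal to them only at nonreal points, so the decay at real
  points has to be recovered as a limit.\<close>

lemma liouville_glue:
  fixes F :: "complex \<Rightarrow> complex" and S T :: "real set"
  assumes f: "f holomorphic_on - (of_real ` S)" "g holomorphic_on - (of_real ` T)"
    and ST: "compact S" "compact T" "S \<inter> T = {}"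
    and eq: "\<And>z. Im z \<noteq> 0 \<Longrightarrow> F z = f z" "\<And>z. Im z \<noteq> 0 \<Longrightarrow> F z = g z"
    and lim: "(F \<longlongrightarrow> 0) at_infinity" and z: "Im z \<noteq> 0"
  shows "F z = 0"
proof -
  have op: "open (- (complex_of_real ` S))" "open (- (complex_of_real ` T))"
    using ST by (auto intro!: open_Compl compact_imp_closed compact_continuous_image continuous_intros)
  \<comment> \<open>A vertical approach keeps the real part, so for real z the modulus does not fall
    below |z| and the bound on F near infinity still applies.\<close>
  define s where "s = (\<lambda>z n. z + \<i> * of_real (1 / real (Suc n)))"
  have s: "s z \<longlonglongrightarrow> z" for z
  proof -
    have "(\<lambda>n. z + \<i> * of_real (1 / real (Suc n))) \<longlonglongrightarrow> z + \<i> * of_real 0"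
      by (intro tendsto_intros LIMSEQ_Suc[OF lim_inverse_n'])
    then show ?thesis by (simp add: s_def)
  qed
  have Im_s: "Im (s z n) = 1 / real (Suc n)" if "Im z = 0" for z n
    using that by (simp add: s_def)
  have fg: "f z = g z" if "z \<notin> of_real ` S" "z \<notin> of_real ` T" for z
  proof (cases "Im z = 0")
    case True
    have "isCont f z" "isCont g z"
      using that f op holomorphic_on_imp_continuous_on continuous_on_eq_continuous_at by blast+
    then have "(\<lambda>n. f (s z n)) \<longlonglongrightarrow> f z" "(\<lambda>n. g (s z n)) \<longlonglongrightarrow> g z"
      using isCont_tendsto_compose s by blast+
    moreover have "f (s z n) = g (s z n)" for n
      using eq[of "s z n"] Im_s[OF True, of n] by simp
    ultimately show ?thesis using LIMSEQ_unique by simp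
  next
    case False
    with eq show ?thesis by metis
  qed
  define H where "H = (\<lambda>z. if z \<in> of_real ` S then g z else f z)"
  have "H holomorphic_on - (of_real ` S)"
    by (rule holomorphic_transform[OF f(1)]) (auto simp: H_def)
  moreover have "H holomorphic_on - (of_real ` T)"
    by (rule holomorphic_transform[OF f(2)]) (use fg in \<open>auto simp: H_def\<close>)
  ultimately have "H holomorphic_on - (of_real ` S) \<union> - (of_real ` T)"
    using op by (intro holomorphic_on_Un)
  moreover have "- (of_real ` S) \<union> - (of_real ` T) = (UNIV :: complex set)"
    using ST(3) by auto
  ultimately have H: "H holomorphic_on UNIV" by simp
  have HF: "H z = F z" if "Im z \<noteq> 0" for z
    using that eq by (auto simp: H_def)
  have limH: "(H \<longlongrightarrow> 0) at_infinity"
    unfolding tendsto_iff eventually_at_infinity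
  proof (intro allI impI)
    fix e :: real assume e: "0 < e"
    have "eventually (\<lambda>z. dist (F z) 0 < e / 2) at_infinity" using tendstoD[OF lim, of "e / 2"] e by simp
    then obtain R where R: "\<And>z. R \<le> norm z \<Longrightarrow> norm (F z) < e / 2" by (auto simp: eventually_at_infinity)
    have "norm (H z) < e" if "R \<le> norm z" for z
    proof (cases "Im z = 0")
      case False
      then show ?thesis using R[OF that] e HF by simp
    next
      case True
      have "isCont H z" using H holomorphic_on_imp_continuous_on continuous_on_eq_continuous_at by blast
      then have l: "(\<lambda>n. norm (H (s z n))) \<longlonglongrightarrow> norm (H z)"
        by (intro tendsto_norm isCont_tendsto_compose[OF _ s])
      have "norm (H (s z n)) \<le> e / 2" for n
      proof -
        have "Re (s z n) = Re z" by (simp add: s_def)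
        then have "norm z \<le> norm (s z n)"
          using True abs_Re_le_cmod[of "s z n"] by (simp add: cmod_eq_Re)
        then have "norm (F (s z n)) < e / 2" using that R by simp
        then show ?thesis using Im_s[OF True, of n] HF by simp
      qed
      then have "norm (H z) \<le> e / 2" using LIMSEQ_le_const2[OF l] by blast
      with e show ?thesis by simp
    qed
    then show "\<exists>b. \<forall>x. b \<le> norm x \<longrightarrow> dist (H x) 0 < e" by auto
  qed
  have "H z = 0" by (rule Liouville_weak_0[OF H limH])
  then show ?thesis using HF[OF z] by simp
qed

text \<open>Both identities say that the Green's function is an affine function of the one at the root, with
  coefficients that are analytic across one of the two intervals.\<close>

lemma Green_affine_algebra:
  fixes u v p0 p1 p2 X m1 m2 c :: complex
  assumes "X \<noteq> 0" "m1 \<noteq> 0" "m2 \<noteq> 0"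
  shows "v \<noteq> 0 \<Longrightarrow> - (p1 * u + p2 * v - p0) = (m2 * p0 / v - m1 * p1 - m2 * p2) * ((1 - c) / m1 * u + c / m2 * v) -
      (inverse (- 1 / (X * m1 * m2) * v) * (p0 * ((1 - c) / m1) + - 1 * v * (p2 * ((1 - c) / m1) + p1 * - (c / m2)))) *
      (1 / X * (1 / m2 * v - 1 / m1 * u))"
    and "u \<noteq> 0 \<Longrightarrow> - (p1 * u + p2 * v - p0) = (m1 * p0 / u - m1 * p1 - m2 * p2) * ((1 - c) / m1 * u + c / m2 * v) -
      (inverse (1 / (X * m1 * m2) * u) * (p0 * (c / m2) + 1 * u * (p2 * ((1 - c) / m1) + p1 * - (c / m2)))) *
      (1 / X * (1 / m2 * v - 1 / m1 * u))"
  using assms by (simp_all add: field_simps)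

lemma poly_map_poly_of_real: "poly (map_poly of_real p) (of_real x) = complex_of_real (poly p x)"
  by (induction p) (simp_all add: map_poly_pCons)

section \<open>The affine relation to the root and the integral representation of the Green's
  function\<close>

context angelesco_spectral
begin

definition pk :: "vertex \<Rightarrow> ix \<Rightarrow> complex poly" where
  "pk Y k = smult (of_real (1 / mfac \<mu> Y)) (map_poly of_real (A (proj Y) k))"

definition p0 :: "vertex \<Rightarrow> complex poly" where
  "p0 Y = smult (of_real (1 / mfac \<mu> Y)) (map_poly of_real (T0 (proj Y)))"

lemma poly_pk: "poly (pk Y k) (of_real x) = of_real (Lam \<mu> k x Y)"
  by (simp add: pk_def Lam_def poly_map_poly_of_real)

lemma poly_p0: "poly (p0 Y) (of_real x) = of_real (Lam0 \<mu> x Y)"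
  by (simp add: p0_def Lam0_def T0 poly_map_poly_of_real)

lemma lc_eq:
  assumes "\<And>k. z \<notin> of_real ` \<Delta> k"
  shows "lc z Y = poly (pk Y One) z * markov (\<mu> One) z + poly (pk Y Two) z * markov (\<mu> Two) z - poly (p0 Y) z"
  using assms by (simp add: lc_def Lfun_eq_complex sum_ix pk_def p0_def scaleR_conv_of_real algebra_simps diff_divide_distrib add_divide_distrib del: mfac.simps)

definition sg :: "ix \<Rightarrow> real" where "sg k = (- 1) ^ ix_num k"

text \<open>The analytic continuation of \<open>Psi_on\<close> from \<open>\<Delta> k\<close>: on
  that interval \<open>S_O\<close> is a constant multiple of the Markov function of the other
  measure.\<close>

definition \<beta> :: "vertex \<Rightarrow> ix \<Rightarrow> complex \<Rightarrow> complex" where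
  "\<beta> Y k z = inverse (of_real (sg k / (Xi \<mu> * mass \<mu> One * mass \<mu> Two)) * markov (\<mu> (other k)) z) *
     (poly (p0 Y) z * of_real (vkappa \<kappa> k / mass \<mu> k) + of_real (sg k) * markov (\<mu> (other k)) z *
       (poly (pk Y Two) z * of_real (vkappa \<kappa> One / mass \<mu> One) + poly (pk Y One) z * of_real (- (vkappa \<kappa> Two / mass \<mu> Two))))"

text \<open>What remains after the Markov function of \<open>\<mu> k\<close> is eliminated between
  \<open>lc\<close>, \<open>Lkap\<close> and \<open>Lfun\<close> at (1,1); like
  \<open>\<beta>\<close> it is singular only on the other interval.\<close>

definition \<alpha> :: "vertex \<Rightarrow> ix \<Rightarrow> complex \<Rightarrow> complex" where
  "\<alpha> Y k z = of_real (mass \<mu> (other k)) * poly (p0 Y) z / markov (\<mu> (other k)) z -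
     of_real (mass \<mu> One) * poly (pk Y One) z - of_real (mass \<mu> Two) * poly (pk Y Two) z"

lemma Green_affine:
  assumes z: "\<And>k. z \<notin> of_real ` \<Delta> k"
  shows "- lc z Y = \<alpha> Y k z * Lkap \<mu> \<kappa> z - \<beta> Y k z * Lfun \<mu> (\<lambda>_. 1) z"
proof -
  have nz: "complex_of_real (Xi \<mu>) \<noteq> 0" "complex_of_real (mass \<mu> One) \<noteq> 0" "complex_of_real (mass \<mu> Two) \<noteq> 0"
    using Xi_pos mass_pos[of One] mass_pos[of Two] by auto
  have k2: "\<kappa> Two = 1 - \<kappa> One" using kappa_sum by simp
  show ?thesis
  proof (cases k)
    case One
    show ?thesis
      using Green_affine_algebra(1)[OF nz markov_nonzero[OF z[of Two]], of "poly (pk Y One) z" "markov (\<mu> One) z" "poly (pk Y Two) z" "poly (p0 Y) z" "of_real (\<kappa> One)"]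
      by (simp only: One lc_eq[OF z] \<alpha>_def \<beta>_def Lfun_one Lkap_alt sg_def vkappa_def other.simps ix_num.simps k2
        of_real_diff of_real_divide of_real_1 of_real_minus of_real_mult power_one_right)
  next
    case Two
    have "(- 1) ^ 2 = (1 :: real)" by simp
    then show ?thesis
      using Green_affine_algebra(2)[OF nz markov_nonzero[OF z[of One]], of "poly (pk Y One) z" "poly (pk Y Two) z" "markov (\<mu> Two) z" "poly (p0 Y) z" "of_real (\<kappa> One)"]
      by (simp only: Two lc_eq[OF z] \<alpha>_def \<beta>_def Lfun_one Lkap_alt sg_def vkappa_def other.simps ix_num.simps k2
        of_real_diff of_real_divide of_real_1 of_real_minus of_real_mult)
  qed
qed

lemma Delta_other_disjoint: "\<Delta> k \<inter> \<Delta> (other k) = {}"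
  using Delta_disjoint by (cases k) auto

lemma E_off: "x \<in> E \<Longrightarrow> x \<notin> \<Delta> k"
  by (cases k) (auto simp: Eset_def)

text \<open>At a point of E the term with \<open>Lkap\<close> drops out of the affine relation, so
  both versions of \<open>\<beta>\<close> reduce there to the quotient that defines
  \<open>Psi\<close>.\<close>

lemma Psi_eq_\<beta>:
  assumes "x \<in> \<Delta> k \<union> E"
  shows "\<beta> Y k (of_real x) = of_real (Psi \<mu> \<kappa> x Y)"
proof (cases "x \<in> E")
  case False
  then have x: "x \<in> \<Delta> k" using assms by simp
  have "Psi \<mu> \<kappa> x Y = Psi_on \<mu> \<kappa> k x Y"
    using False x Delta_disjoint by (cases k) (auto simp: Psi_def)
  moreover have "x \<notin> \<Delta> (other k)" using x Delta_other_disjoint[of k] by blast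
  then have "S_O \<mu> x = sg k / (Xi \<mu> * mass \<mu> One * mass \<mu> Two) * markov (\<mu> (other k)) x"
    using x by (cases k) (simp_all add: S_O_def sg_def)
  ultimately have "Psi \<mu> \<kappa> x Y = inverse (sg k / (Xi \<mu> * mass \<mu> One * mass \<mu> Two) * markov (\<mu> (other k)) x) *
     (Lam0 \<mu> x Y * (vkappa \<kappa> k / mass \<mu> k) + sg k * markov (\<mu> (other k)) x *
        (Lam \<mu> Two x Y * (vkappa \<kappa> One / mass \<mu> One) + Lam \<mu> One x Y * - (vkappa \<kappa> Two / mass \<mu> Two)))"
    by (simp only: Psi_on_def sg_def[symmetric]) simp
  then show ?thesis
    unfolding \<beta>_def poly_pk poly_p0 markov_of_real
    by (simp only: of_real_mult of_real_add of_real_inverse)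
next
  case True
  then have off: "complex_of_real x \<notin> of_real ` \<Delta> k" for k using E_off by auto
  have "Lkap \<mu> \<kappa> x = 0" using True by (simp add: Eset_def)
  then have "Lkap \<mu> \<kappa> (complex_of_real x) = 0" by (simp add: Lkap_of_real)
  then have "lc (of_real x) Y = \<beta> Y k (of_real x) * Lfun \<mu> (\<lambda>_. 1) (of_real x)"
    using Green_affine[OF off, of Y k] by (simp del: One_nat_def)
  moreover have "lc (of_real x) Y = of_real (lfun \<mu> x Y)"
    by (simp add: lc_def lfun_def Lfun_of_real scaleR_conv_of_real del: mfac.simps)
  ultimately have e: "of_real (lfun \<mu> x Y) = \<beta> Y k (of_real x) * of_real (Lfun \<mu> (\<lambda>_. 1) x)"
    by (simp add: Lfun_of_real del: One_nat_def)
  have "Psi \<mu> \<kappa> x Y = lfun \<mu> x Y / Lfun \<mu> (\<lambda>_. 1) x" using True by (simp add: Psi_def)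
  then show ?thesis
    using Lfun_one_nonzero_at_E[OF True] by (simp add: e del: One_nat_def)
qed

text \<open>The point of E is attached to \<open>\<Delta> k\<close>, so that the other summand lives
  on \<open>\<Delta> (other k)\<close> alone and its Cauchy transform is analytic off that
  interval.\<close>

lemma Psi_split:
  "of_real (Psi \<mu> \<kappa> x Y) = \<beta> Y k (of_real x) * indicator (\<Delta> k \<union> E) x + \<beta> Y (other k) (of_real x) * indicator (\<Delta> (other k)) x"
proof -
  consider "x \<in> \<Delta> k \<union> E" | "x \<in> \<Delta> (other k)" "x \<notin> \<Delta> k \<union> E" | "x \<notin> D \<union> E"
    by (cases k) auto
  then show ?thesis
  proof cases
    case 1
    then have "x \<notin> \<Delta> (other k)" using Delta_other_disjoint[of k] E_off by auto
    with 1 show ?thesis by (simp add: Psi_eq_\<beta>)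
  next
    case 2
    then show ?thesis using Psi_eq_\<beta>[of x "other k" Y] by simp
  next
    case 3
    then have "Psi \<mu> \<kappa> x Y = 0" "x \<notin> \<Delta> k" "x \<notin> \<Delta> (other k)" "x \<notin> E"
      by (cases k; auto simp: Psi_def)+
    then show ?thesis by simp
  qed
qed

lemma compact_K: "compact (\<Delta> k \<union> E)"
  by (intro compact_Un compact_Delta finite_imp_compact finite_E)

lemma K_disjoint: "(\<Delta> k \<union> E) \<inter> \<Delta> (other k) = {}"
  using Delta_other_disjoint[of k] E_off by auto

lemma K_sub: "of_real ` (\<Delta> k \<union> E) \<subseteq> - (complex_of_real ` \<Delta> (other k))"
  using K_disjoint[of k] by auto

lemma transfer_\<beta>: "transfer (- (of_real ` \<Delta> (other k))) (\<Delta> k \<union> E) (\<beta> Y k)"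
proof -
  note K = compact_K[of k] K_sub[of k]
  have "sg k / (Xi \<mu> * mass \<mu> One * mass \<mu> Two) \<noteq> 0"
    using Xi_pos mass_pos[of One] mass_pos[of Two] by (simp add: sg_def)
  then have nz: "of_real (sg k / (Xi \<mu> * mass \<mu> One * mass \<mu> Two)) * markov (\<mu> (other k)) z \<noteq> 0"
    if "z \<in> - (of_real ` \<Delta> (other k))" for z :: complex
    using markov_nonzero[of z "other k"] that by (metis ComplD mult_eq_0_iff of_real_eq_0_iff)
  have m: "transfer (- (of_real ` \<Delta> (other k))) (\<Delta> k \<union> E) (markov (\<mu> (other k)))"
    by (rule transfer_markov[OF K(1) K_disjoint])
  show ?thesis
    unfolding \<beta>_def
    by (intro transfer_mult[OF _ _ K] transfer_inverse[OF _ K nz] transfer_add[OF _ _ K] transfer_const transfer_poly[OF K] m)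
       (auto simp: not_in_Delta_complex)
qed

lemma holomorphic_\<beta>: "\<beta> Y k holomorphic_on - (of_real ` \<Delta> (other k))"
  using transfer_\<beta> by (simp add: transfer_def)

lemma supported_indicator:
  assumes "S \<in> sets borel" shows "supported S (indicator S)"
proof -
  have "norm (indicator S x :: complex) \<le> 1" for x by (simp add: indicator_def)
  moreover have "(indicator S :: real \<Rightarrow> complex) \<in> borel_measurable borel" using assms by simp
  ultimately show ?thesis by (auto simp: supported_def)
qed

lemma supported_\<beta>: "supported (\<Delta> k \<union> E) (\<lambda>x. \<beta> Y k (of_real x) * indicator (\<Delta> k \<union> E) x)"
  "supported (\<Delta> k) (\<lambda>x. \<beta> Y k (of_real x) * indicator (\<Delta> k) x)"
proof -
  have b: "\<Delta> k \<union> E \<in> sets borel" using DE_borel by auto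
  show "supported (\<Delta> k \<union> E) (\<lambda>x. \<beta> Y k (of_real x) * indicator (\<Delta> k \<union> E) x)"
    by (rule supported_mult[OF supported_indicator[OF b] compact_K K_sub holomorphic_\<beta>])
  have "of_real ` \<Delta> k \<subseteq> - (complex_of_real ` \<Delta> (other k))" using K_sub[of k] by auto
  then show "supported (\<Delta> k) (\<lambda>x. \<beta> Y k (of_real x) * indicator (\<Delta> k) x)"
    by (rule supported_mult[OF supported_indicator[OF DE_borel(3)] compact_Delta _ holomorphic_\<beta>])
qed

lemma integrable_\<beta>:
  "integrable \<rho> (\<lambda>x. \<beta> Y k (of_real x) * indicator (\<Delta> k \<union> E) x)"
  "integrable \<rho> (\<lambda>x. \<beta> Y k (of_real x) * indicator (\<Delta> k) x)"
  by (rule supported_integrable[OF supported_\<beta>(1)], rule supported_integrable[OF supported_\<beta>(2)])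

lemma integrable_Psi_complex: "integrable \<rho> (\<lambda>x. complex_of_real (Psi \<mu> \<kappa> x Y))"
  unfolding Psi_split[of _ Y One] by (intro Bochner_Integration.integrable_add integrable_\<beta>)

lemma integrable_Psi: "integrable \<rho> (\<lambda>x. Psi \<mu> \<kappa> x Y)"
  using integrable_Re[OF integrable_Psi_complex[of Y]] by simp

lemma GO_cauchy: "Im z \<noteq> 0 \<Longrightarrow> GO z = - cauchy_trans \<rho> (\<lambda>_. 1) z"
proof -
  assume "Im z \<noteq> 0"
  then have "GO z = (LINT x|\<rho>. 1 / (of_real x - z))" by (rule GO_spectral)
  also have "\<dots> = (LINT x|\<rho>. - (1 / (z - of_real x)))"
    by (intro Bochner_Integration.integral_cong refl) (metis minus_diff_eq minus_divide_right)
  finally show ?thesis by (simp add: cauchy_trans_def)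
qed

text \<open>On the part of \<open>\<rho>\<close> carried by \<open>\<Delta> k\<close> and E,
  \<open>transfer\<close> moves \<open>\<beta>\<close> under the integral at the cost of a function
  analytic there; the part on the other interval is analytic there in any case. Hence all
  singularities on \<open>\<Delta> k\<close> and E cancel.\<close>

lemma Green_extension:
  "\<exists>f. f holomorphic_on - (of_real ` \<Delta> (other k)) \<and> (\<forall>z. Im z \<noteq> 0 \<longrightarrow>
     - lc z Y / Lkap \<mu> \<kappa> z + cauchy_trans \<rho> (\<lambda>x. of_real (Psi \<mu> \<kappa> x Y)) z = f z)"
proof -
  have b: "\<Delta> k \<union> E \<in> sets borel" using DE_borel by auto
  obtain h where h: "h holomorphic_on - (of_real ` \<Delta> (other k))"
    "\<And>z. Im z \<noteq> 0 \<Longrightarrow> \<beta> Y k z * cauchy_trans \<rho> (indicator (\<Delta> k \<union> E)) z -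
      cauchy_trans \<rho> (\<lambda>x. \<beta> Y k (of_real x) * indicator (\<Delta> k \<union> E) x) z = h z"
    using transfer_\<beta>[of k Y] supported_indicator[OF b] unfolding transfer_def by blast
  define c1 where "c1 = cauchy_trans \<rho> (indicator (\<Delta> (other k)))"
  define c2 where "c2 = cauchy_trans \<rho> (\<lambda>x. \<beta> Y (other k) (of_real x) * indicator (\<Delta> (other k)) x)"
  have hol: "cauchy_trans \<rho> g holomorphic_on - (of_real ` \<Delta> (other k))" if g: "supported (\<Delta> (other k)) g" for g
  proof -
    \<comment> \<open>The restricted measure lives on \<open>\<Delta> (other k)\<close>, as the
      holomorphy lemma requires; the transform is unchanged because g vanishes elsewhere.\<close>
    define M where "M = density \<rho> (indicator (\<Delta> (other k)))"
    have m [measurable]: "\<Delta> (other k) \<in> sets \<rho>" using DE_borel(3) by simp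
    have [measurable]: "g \<in> borel_measurable borel" using g by (simp add: supported_def)
    have dens: "density \<rho> (indicator (\<Delta> (other k))) = density \<rho> (\<lambda>x. ennreal (indicator (\<Delta> (other k)) x))"
      by (rule density_cong) (auto simp: ennreal_indicator)
    have M: "sets M = sets borel" by (simp add: M_def)
    have gM: "integrable M g"
      unfolding M_def dens using supported_integrable[OF g]
      by (subst integrable_density) (auto intro!: integrable_real_mult_indicator simp: integrable_mult_indicator)
    have AE: "AE x in M. x \<in> \<Delta> (other k)"
      unfolding M_def by (subst AE_density) (auto simp: indicator_def)
    have "cauchy_trans M g z = cauchy_trans \<rho> g z" for z
      unfolding cauchy_trans_def M_def dens
    proof (subst integral_density)
      show "(LINT x|\<rho>. indicat_real (\<Delta> (other k)) x *\<^sub>R (g x / (z - of_real x))) = (LINT x|\<rho>. g x / (z - of_real x))"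
        using g by (intro Bochner_Integration.integral_cong) (auto simp: supported_def indicator_def)
    qed auto
    then have "cauchy_trans M g = cauchy_trans \<rho> g" by (rule ext)
    with holomorphic_cauchy_trans[OF M gM closed_Delta AE] show ?thesis by simp
  qed
  have hc1: "c1 holomorphic_on - (of_real ` \<Delta> (other k))"
    unfolding c1_def by (rule hol[OF supported_indicator[OF DE_borel(3)]])
  have hc2: "c2 holomorphic_on - (of_real ` \<Delta> (other k))"
    unfolding c2_def by (rule hol[OF supported_\<beta>(2)])
  have h\<alpha>: "\<alpha> Y k holomorphic_on - (of_real ` \<Delta> (other k))"
    unfolding \<alpha>_def using markov_nonzero
    by (intro holomorphic_intros holomorphic_markov) auto
  define f where "f = (\<lambda>z. \<alpha> Y k z - \<beta> Y k z * c1 z + c2 z - h z)"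
  have "f holomorphic_on - (of_real ` \<Delta> (other k))"
    unfolding f_def by (intro holomorphic_on_add holomorphic_on_diff holomorphic_on_mult h\<alpha> holomorphic_\<beta> hc1 hc2 h(1))
  moreover have "- lc z Y / Lkap \<mu> \<kappa> z + cauchy_trans \<rho> (\<lambda>x. of_real (Psi \<mu> \<kappa> x Y)) z = f z" if z: "Im z \<noteq> 0" for z
  proof -
    have L: "Lkap \<mu> \<kappa> z \<noteq> 0" using Lkap_nonzero[OF z] .
    have "- lc z Y / Lkap \<mu> \<kappa> z = \<alpha> Y k z + \<beta> Y k z * GO z"
      using Green_affine[OF not_in_Delta_complex[OF z], of Y k] L by (simp add: GO_def field_simps del: One_nat_def)
    moreover have "cauchy_trans \<rho> (\<lambda>x. of_real (Psi \<mu> \<kappa> x Y)) z =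
        cauchy_trans \<rho> (\<lambda>x. \<beta> Y k (of_real x) * indicator (\<Delta> k \<union> E) x) z + c2 z"
      unfolding Psi_split[of _ Y k] c2_def by (rule cauchy_rho_add[OF integrable_\<beta> z])
    moreover have "GO z = - (cauchy_trans \<rho> (indicator (\<Delta> k \<union> E)) z + c1 z)"
    proof -
      have "cauchy_trans \<rho> (indicator (\<Delta> k \<union> E)) z + c1 z = cauchy_trans \<rho> (\<lambda>x. indicator (\<Delta> k \<union> E) x + indicator (\<Delta> (other k)) x) z"
        unfolding c1_def
        by (rule cauchy_rho_add[symmetric, OF supported_integrable[OF supported_indicator[OF b]] supported_integrable[OF supported_indicator[OF DE_borel(3)]] z])
      also have "\<dots> = cauchy_trans \<rho> (\<lambda>_. 1) z"
        unfolding cauchy_trans_def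
      proof (rule integral_cong_AE)
        have "x \<in> D \<union> E \<Longrightarrow> indicator (\<Delta> k \<union> E) x + indicator (\<Delta> (other k)) x = (1 :: complex)" for x
          using K_disjoint[of k] by (cases k) (auto simp: indicator_def)
        then show "AE x in \<rho>. (indicator (\<Delta> k \<union> E) x + indicator (\<Delta> (other k)) x) / (z - of_real x) = 1 / (z - of_real x)"
          using AE_rho by (auto elim!: eventually_mono)
        show "(\<lambda>x. (indicator (\<Delta> k \<union> E) x + indicator (\<Delta> (other k)) x) / (z - of_real x)) \<in> borel_measurable \<rho>"
          using b DE_borel(3) by measurable
      qed measurable
      finally show ?thesis using GO_cauchy[OF z] by simp
    qed
    ultimately show ?thesis
      unfolding f_def h(2)[OF z, symmetric] by (simp add: algebra_simps)
  qed
  ultimately show ?thesis by blast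
qed

lemma Lkap_asymptotics: "((\<lambda>z::complex. z * Lkap \<mu> \<kappa> z) \<longlongrightarrow> 1) at_infinity"
proof -
  have "((\<lambda>z::complex. of_real (\<kappa> One) * (z * Lfun \<mu> (unit_ix Two) z) + of_real (\<kappa> Two) * (z * Lfun \<mu> (unit_ix One) z)) \<longlongrightarrow>
      of_real (\<kappa> One) * 1 + of_real (\<kappa> Two) * 1) at_infinity"
    using Lfun_asymptotics[of "unit_ix One"] Lfun_asymptotics[of "unit_ix Two"]
    by (intro tendsto_add tendsto_mult tendsto_const) simp_all
  also have "of_real (\<kappa> One) * 1 + of_real (\<kappa> Two) * 1 = (1 :: complex)"
    using kappa_sum by (simp flip: of_real_add)
  also have "(\<lambda>z::complex. of_real (\<kappa> One) * (z * Lfun \<mu> (unit_ix Two) z) + of_real (\<kappa> Two) * (z * Lfun \<mu> (unit_ix One) z)) =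
      (\<lambda>z. z * Lkap \<mu> \<kappa> z)"
    by (simp add: Lkap_eq scaleR_conv_of_real fun_eq_iff algebra_simps)
  finally show ?thesis .
qed

lemma msize_proj_eq: "msize (proj Y) = length Y + 2"
proof (induction Y)
  case Nil
  show ?case by (simp add: msize_alt)
qed simp

text \<open>The index of Y has size length Y + 2, so \<open>lc\<close> decays like z^(-length Y - 2)
  against 1/z for \<open>Lkap\<close>; after the factor z only the root keeps a nonzero
  limit.\<close>

lemma Green_asymptotics: "((\<lambda>z::complex. z * (lc z Y / Lkap \<mu> \<kappa> z)) \<longlongrightarrow> (if Y = [] then 1 else 0)) at_infinity"
proof -
  have inf: "((\<lambda>z::complex. inverse z ^ length Y) \<longlongrightarrow> (if Y = [] then 1 else 0)) at_infinity"
  proof (cases Y)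
    case (Cons i Z)
    have "((\<lambda>z::complex. inverse z * inverse z ^ length Z) \<longlongrightarrow> 0 * 0 ^ length Z) at_infinity"
      by (intro tendsto_intros tendsto_inverse_0)
    then show ?thesis by (simp add: Cons)
  qed simp
  have l: "((\<lambda>z::complex. z ^ (length Y + 2) * Lfun \<mu> (proj Y) z) \<longlongrightarrow> 1) at_infinity"
    using Lfun_asymptotics[of "proj Y"] by (simp add: msize_proj_eq)
  have "((\<lambda>z::complex. of_real (1 / mfac \<mu> Y) * ((z ^ (length Y + 2) * Lfun \<mu> (proj Y) z) / (z * Lkap \<mu> \<kappa> z)) * inverse z ^ length Y) \<longlongrightarrow>
      of_real (1 / mfac \<mu> Y) * (1 / 1) * (if Y = [] then 1 else 0)) at_infinity"
    using l inf Lkap_asymptotics by (intro tendsto_intros) auto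
  moreover have "of_real (1 / mfac \<mu> Y) * (1 / 1) * (if Y = [] then 1 else 0) = (if Y = [] then 1 else (0::complex))"
    by (simp del: mfac.simps)
  moreover have "eventually (\<lambda>z::complex. of_real (1 / mfac \<mu> Y) * ((z ^ (length Y + 2) * Lfun \<mu> (proj Y) z) / (z * Lkap \<mu> \<kappa> z)) * inverse z ^ length Y =
      z * (lc z Y / Lkap \<mu> \<kappa> z)) at_infinity"
    unfolding eventually_at_infinity
  proof (intro exI[of _ 1] allI impI)
    fix z :: complex assume "1 \<le> norm z"
    then have "z \<noteq> 0" by auto
    then show "of_real (1 / mfac \<mu> Y) * ((z ^ (length Y + 2) * Lfun \<mu> (proj Y) z) / (z * Lkap \<mu> \<kappa> z)) * inverse z ^ length Y =
        z * (lc z Y / Lkap \<mu> \<kappa> z)"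
      by (simp add: lc_def scaleR_conv_of_real power_inverse power_add power2_eq_square del: mfac.simps)
  qed
  ultimately show ?thesis by (simp only: Lim_transform_eventually)
qed

lemma integrable_supported_DE: "integrable \<rho> g \<Longrightarrow> (cauchy_trans \<rho> g \<longlongrightarrow> 0) at_infinity"
  using compact_DE by (intro cauchy_trans_tendsto_0[OF _ _ _ _ AE_rho] compact_imp_closed compact_imp_bounded) auto

lemma Green_representation:
  assumes z: "Im z \<noteq> 0"
  shows "lc z Y / Lkap \<mu> \<kappa> z = cauchy_trans \<rho> (\<lambda>x. of_real (Psi \<mu> \<kappa> x Y)) z"
proof -
  define F where "F = (\<lambda>z. - lc z Y / Lkap \<mu> \<kappa> z + cauchy_trans \<rho> (\<lambda>x. of_real (Psi \<mu> \<kappa> x Y)) z)"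
  obtain f where f: "f holomorphic_on - (of_real ` \<Delta> Two)" "\<And>z. Im z \<noteq> 0 \<Longrightarrow> F z = f z"
    using Green_extension[of One Y] unfolding F_def by auto
  obtain g where g: "g holomorphic_on - (of_real ` \<Delta> One)" "\<And>z. Im z \<noteq> 0 \<Longrightarrow> F z = g z"
    using Green_extension[of Two Y] unfolding F_def by auto
  have "((\<lambda>z. - (inverse z * (z * (lc z Y / Lkap \<mu> \<kappa> z))) + cauchy_trans \<rho> (\<lambda>x. of_real (Psi \<mu> \<kappa> x Y)) z) \<longlongrightarrow>
      - (0 * (if Y = [] then 1 else 0)) + 0) at_infinity"
    by (intro tendsto_add tendsto_minus tendsto_mult tendsto_inverse_0 Green_asymptotics integrable_supported_DE integrable_Psi_complex)
  moreover have "eventually (\<lambda>z. - (inverse z * (z * (lc z Y / Lkap \<mu> \<kappa> z))) + cauchy_trans \<rho> (\<lambda>x. of_real (Psi \<mu> \<kappa> x Y)) z = F z) at_infinity"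
    unfolding eventually_at_infinity
  proof (intro exI[of _ 1] allI impI)
    fix z :: complex assume "1 \<le> norm z"
    then have "inverse z * (z * c) = c" for c by (cases "z = 0") auto
    then show "- (inverse z * (z * (lc z Y / Lkap \<mu> \<kappa> z))) + cauchy_trans \<rho> (\<lambda>x. of_real (Psi \<mu> \<kappa> x Y)) z = F z"
      by (simp only: F_def minus_divide_left)
  qed
  ultimately have "(F \<longlongrightarrow> 0) at_infinity" by (simp add: Lim_transform_eventually)
  from liouville_glue[OF f(1) g(1) compact_Delta compact_Delta _ f(2) g(2) this z] Delta_disjoint
  have "F z = 0" by auto
  then show ?thesis by (simp add: F_def)
qed

lemma Green_poisson:
  assumes "0 < y"
  shows "Im (Green \<mu> \<kappa> Y [] (Complex x y)) = (LINT t|\<rho>. Psi \<mu> \<kappa> t Y * poisson y (t - x))"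
proof -
  have z: "Im (Complex x y) \<noteq> 0" using assms by simp
  have "Green \<mu> \<kappa> Y [] (Complex x y) = - cauchy_trans \<rho> (\<lambda>t. of_real (Psi \<mu> \<kappa> t Y)) (Complex x y)"
    using Green_eq[OF kappa_sum z Lkap_nonzero[OF z], of Y] Green_representation[OF z, of Y] by simp
  also have "\<dots> = (LINT t|\<rho>. - (of_real (Psi \<mu> \<kappa> t Y) / (Complex x y - of_real t)))"
    by (simp add: cauchy_trans_def)
  finally have "Im (Green \<mu> \<kappa> Y [] (Complex x y)) = (LINT t|\<rho>. Im (- (of_real (Psi \<mu> \<kappa> t Y) / (Complex x y - of_real t))))"
    using integrable_cauchy_rho[OF integrable_Psi_complex z, of Y] by (simp only: integral_Im Bochner_Integration.integrable_minus)
  also have "\<dots> = (LINT t|\<rho>. Psi \<mu> \<kappa> t Y * poisson y (t - x))"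
  proof (intro Bochner_Integration.integral_cong refl)
    fix t
    have "- (of_real (Psi \<mu> \<kappa> t Y) / (Complex x y - of_real t)) = of_real (Psi \<mu> \<kappa> t Y) * (1 / (of_real t - Complex x y))"
      by (metis minus_diff_eq minus_divide_right mult.right_neutral times_divide_eq_right)
    then show "Im (- (of_real (Psi \<mu> \<kappa> t Y) / (Complex x y - of_real t))) = Psi \<mu> \<kappa> t Y * poisson y (t - x)"
      by (simp only: Im_inverse_diff[symmetric] times_complex.sel Im_complex_of_real Re_complex_of_real mult_zero_left add_0_right)
  qed
  finally show ?thesis .
qed

lemma weak_star_limit_Green:
  "weak_star_limit (\<lambda>y x. Im (Green \<mu> \<kappa> Y [] (Complex x y))) \<rho> (\<lambda>x. pi * Psi \<mu> \<kappa> x Y)"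
  by (rule rho.weak_star_limit_poisson[OF integrable_Psi Green_poisson])

text \<open>From z/(z-x) = 1 + x/(z-x), z times the Cauchy transform of \<open>Psi\<close> is its
  integral plus a Cauchy transform that tends to 0. The limit is taken along the imaginary axis,
  where the representation holds.\<close>

lemma integral_Psi: "(LINT x|\<rho>. Psi \<mu> \<kappa> x Y) = kron [] Y"
proof -
  define zn where "zn = (\<lambda>n. \<i> * of_nat (Suc n))"
  have Imz: "Im (zn n) \<noteq> 0" for n by (simp add: zn_def)
  have "norm (zn n) = real (Suc n)" for n
    by (simp only: zn_def norm_mult norm_ii norm_of_nat mult_1_left)
  then have "filterlim (\<lambda>n. norm (zn n)) at_top sequentially"
    using filterlim_compose[OF filterlim_real_sequentially filterlim_Suc] by (simp only:)
  then have fl: "filterlim zn at_infinity sequentially" by (rule filterlim_norm_at_top_imp_at_infinity)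
  have xi: "integrable \<rho> (\<lambda>x. of_real x * complex_of_real (Psi \<mu> \<kappa> x Y))"
  proof -
    have "of_real x * complex_of_real (Psi \<mu> \<kappa> x Y) = of_real x * (\<beta> Y One (of_real x) * indicator (\<Delta> One \<union> E) x) +
        of_real x * (\<beta> Y Two (of_real x) * indicator (\<Delta> Two) x)" for x
      unfolding Psi_split[of x Y One] by (simp add: distrib_left)
    moreover have "integrable \<rho> (\<lambda>x. of_real x * (\<beta> Y One (of_real x) * indicator (\<Delta> One \<union> E) x) +
        of_real x * (\<beta> Y Two (of_real x) * indicator (\<Delta> Two) x))"
      by (intro Bochner_Integration.integrable_add holomorphic_on_ident
         supported_integrable[OF supported_mult[OF supported_\<beta>(1) compact_K subset_UNIV, of "\<lambda>z. z"]]
         supported_integrable[OF supported_mult[OF supported_\<beta>(2) compact_Delta subset_UNIV, of "\<lambda>z. z"]])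
    ultimately show ?thesis by simp
  qed
  have eq: "zn n * (lc (zn n) Y / Lkap \<mu> \<kappa> (zn n)) = of_real (LINT x|\<rho>. Psi \<mu> \<kappa> x Y) +
      cauchy_trans \<rho> (\<lambda>x. of_real x * of_real (Psi \<mu> \<kappa> x Y)) (zn n)" for n
  proof -
    have "zn n * cauchy_trans \<rho> (\<lambda>x. of_real (Psi \<mu> \<kappa> x Y)) (zn n) = (LINT x|\<rho>. zn n * (of_real (Psi \<mu> \<kappa> x Y) / (zn n - of_real x)))"
      by (simp add: cauchy_trans_def del: times_divide_eq_right)
    also have "\<dots> = (LINT x|\<rho>. of_real (Psi \<mu> \<kappa> x Y) + of_real x * of_real (Psi \<mu> \<kappa> x Y) / (zn n - of_real x))"
    proof (intro Bochner_Integration.integral_cong refl)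
      fix x
      have "zn n - of_real x \<noteq> 0" using Imz[of n] by (auto simp: complex_eq_iff)
      then show "zn n * (of_real (Psi \<mu> \<kappa> x Y) / (zn n - of_real x)) = of_real (Psi \<mu> \<kappa> x Y) + of_real x * of_real (Psi \<mu> \<kappa> x Y) / (zn n - of_real x)"
        by (simp add: divide_simps) (simp add: algebra_simps)
    qed
    also have "\<dots> = of_real (LINT x|\<rho>. Psi \<mu> \<kappa> x Y) + cauchy_trans \<rho> (\<lambda>x. of_real x * of_real (Psi \<mu> \<kappa> x Y)) (zn n)"
      using integrable_Psi_complex[of Y] integrable_cauchy_rho[OF xi Imz[of n]]
      by (simp add: cauchy_trans_def)
    finally show ?thesis by (simp only: Green_representation[OF Imz])
  qed
  have "(\<lambda>n. zn n * (lc (zn n) Y / Lkap \<mu> \<kappa> (zn n))) \<longlonglongrightarrow> (if Y = [] then 1 else 0)"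
    using filterlim_compose[OF Green_asymptotics fl] .
  moreover have "(\<lambda>n. of_real (LINT x|\<rho>. Psi \<mu> \<kappa> x Y) + cauchy_trans \<rho> (\<lambda>x. of_real x * of_real (Psi \<mu> \<kappa> x Y)) (zn n)) \<longlonglongrightarrow> of_real (LINT x|\<rho>. Psi \<mu> \<kappa> x Y) + 0"
    by (intro tendsto_add tendsto_const filterlim_compose[OF integrable_supported_DE[OF xi] fl])
  ultimately have "complex_of_real (LINT x|\<rho>. Psi \<mu> \<kappa> x Y) = (if Y = [] then 1 else 0)"
    unfolding eq using LIMSEQ_unique by fastforce
  then show ?thesis by (cases "Y = []") (simp_all add: kron_def)
qed

end

section \<open>The eigenvalue equation for \<open>Psi\<close>\<close>

context angelesco_kappa
begin

lemma jacobi_Lam: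
  "jacobi \<mu> \<kappa> (Lam \<mu> k x) Y = x * Lam \<mu> k x Y - (if Y = [] then \<kappa> (other k) / mass \<mu> k else 0)"
proof -
  have "jacobi \<mu> \<kappa> (\<lambda>Y. (1 / mfac \<mu> Y) *\<^sub>R poly (A (proj Y) k) x) Y = (1 / mfac \<mu> Y) *\<^sub>R (x * poly (A (proj Y) k) x) -
    (if Y = [] then \<kappa> One *\<^sub>R poly (A (unit_ix Two) k) x + \<kappa> Two *\<^sub>R poly (A (unit_ix One) k) x else 0)"
  proof (rule jacobi_lift[OF kappa_sum])
    fix n :: mindex and j assume n: "\<And>k. 0 < n k"
    have "2 \<le> msize n" using n[of One] n[of Two] by (simp add: msize_alt)
    from arg_cong[OF A_recurrence[OF n this, where j = j and k = k], of "\<lambda>p. poly p x"]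
    show "x * poly (A n k) x = poly (A (dec n j) k) x + rc_b (dec n j) j *\<^sub>R poly (A n k) x + (\<Sum>i\<in>UNIV. rc_a n i *\<^sub>R poly (A (inc n i) k) x)"
      by (simp add: poly_sum)
  qed
  then show ?thesis
    by (cases k) (simp_all add: Lam_def[abs_def] unit_ix_type_I del: mfac.simps)
qed

text \<open>There is no defect at the root: at the two neighbouring indices the type I polynomials
  are constant, and divided differences of constants vanish.\<close>

lemma jacobi_Lam0: "jacobi \<mu> \<kappa> (Lam0 \<mu> x) Y = x * Lam0 \<mu> x Y"
proof -
  have "jacobi \<mu> \<kappa> (\<lambda>Y. (1 / mfac \<mu> Y) *\<^sub>R type_I_0 \<mu> (proj Y) x) Y = (1 / mfac \<mu> Y) *\<^sub>R (x * type_I_0 \<mu> (proj Y) x) -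
    (if Y = [] then \<kappa> One *\<^sub>R type_I_0 \<mu> (unit_ix Two) x + \<kappa> Two *\<^sub>R type_I_0 \<mu> (unit_ix One) x else 0)"
  proof (rule jacobi_lift[OF kappa_sum])
    fix n :: mindex and j assume n: "\<And>k. 0 < n k"
    have "2 \<le> msize n" using n[of One] n[of Two] by (simp add: msize_alt)
    from type_I_0_recurrence[OF n this, where j = j and z = x]
    show "x * type_I_0 \<mu> n x = type_I_0 \<mu> (dec n j) x + rc_b (dec n j) j *\<^sub>R type_I_0 \<mu> n x + (\<Sum>i\<in>UNIV. rc_a n i *\<^sub>R type_I_0 \<mu> (inc n i) x)"
      by simp
  qed
  moreover have "type_I_0 \<mu> (unit_ix i) x = 0" for i
  proof -
    have "div_diff [:c:] x = (\<lambda>_. 0)" "div_diff 0 x = (\<lambda>_. 0)" for c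
      by (simp_all add: fun_eq_iff div_diff_def pderiv_pCons)
    then show ?thesis by (cases i) (simp_all add: type_I_0_def sum_ix unit_ix_type_I)
  qed
  ultimately show ?thesis by (simp add: Lam0_def[abs_def] del: mfac.simps)
qed

lemma jacobi_lfun:
  assumes "x \<notin> D"
  shows "jacobi \<mu> \<kappa> (lfun \<mu> x) Y = x * lfun \<mu> x Y - (if Y = [] then Lkap \<mu> \<kappa> x else 0)"
proof -
  have off: "x \<notin> of_real ` \<Delta> k" for k using assms by (cases k) auto
  have "jacobi \<mu> \<kappa> (\<lambda>Y. (1 / mfac \<mu> Y) *\<^sub>R Lfun \<mu> (proj Y) x) Y = (1 / mfac \<mu> Y) *\<^sub>R (x * Lfun \<mu> (proj Y) x) -
    (if Y = [] then \<kappa> One *\<^sub>R Lfun \<mu> (unit_ix Two) x + \<kappa> Two *\<^sub>R Lfun \<mu> (unit_ix One) x else 0)"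
  proof (rule jacobi_lift[OF kappa_sum])
    fix n :: mindex and j assume n: "\<And>k. 0 < n k"
    have "2 \<le> msize n" using n[of One] n[of Two] by (simp add: msize_alt)
    from Lfun_recurrence[OF n this off, of j]
    show "x * Lfun \<mu> n x = Lfun \<mu> (dec n j) x + rc_b (dec n j) j *\<^sub>R Lfun \<mu> n x + (\<Sum>i\<in>UNIV. rc_a n i *\<^sub>R Lfun \<mu> (inc n i) x)"
      by simp
  qed
  then show ?thesis by (simp add: lfun_def[abs_def] Lkap_eq del: mfac.simps)
qed

lemma jacobi_real_linear:
  fixes f g :: "vertex \<Rightarrow> real"
  shows "jacobi \<mu> \<kappa> (\<lambda>Y. f Y + g Y) Y = jacobi \<mu> \<kappa> f Y + jacobi \<mu> \<kappa> g Y"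
    "jacobi \<mu> \<kappa> (\<lambda>Y. c * f Y) Y = c * jacobi \<mu> \<kappa> f Y"
  by (simp_all add: jacobi_def sum_ix algebra_simps)

text \<open>\<open>Lam One\<close> and \<open>Lam Two\<close> each have a defect at the root; the
  coefficients in \<open>Psi_on\<close> are exactly those for which the two defects cancel.\<close>

lemma jacobi_Psi_on: "jacobi \<mu> \<kappa> (Psi_on \<mu> \<kappa> k x) Y = x * Psi_on \<mu> \<kappa> k x Y"
proof -
  define s where "s = inverse (S_O \<mu> x)"
  define t where "t = s * ((- 1) ^ ix_num k * markov (\<mu> (other k)) x)"
  define c1 where "c1 = vkappa \<kappa> One / mass \<mu> One"
  define c2 where "c2 = vkappa \<kappa> Two / mass \<mu> Two"
  define c0 where "c0 = vkappa \<kappa> k / mass \<mu> k"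
  have eq: "Psi_on \<mu> \<kappa> k x = (\<lambda>Y. (s * c0) * Lam0 \<mu> x Y + ((t * c1) * Lam \<mu> Two x Y + (- t * c2) * Lam \<mu> One x Y))"
    unfolding Psi_on_def s_def[symmetric] c0_def[symmetric] c1_def[symmetric] c2_def[symmetric] t_def
    by (simp add: fun_eq_iff algebra_simps)
  have "t * c1 * (\<kappa> One / mass \<mu> Two) = t * c2 * (\<kappa> Two / mass \<mu> One)"
    by (simp add: c1_def c2_def vkappa_def mult_ac)
  then show ?thesis
    unfolding eq jacobi_real_linear jacobi_Lam jacobi_Lam0
    by (cases "Y = []") (simp_all add: algebra_simps)
qed

lemma jacobi_Psi: "jacobi \<mu> \<kappa> (Psi \<mu> \<kappa> x) Y = x * Psi \<mu> \<kappa> x Y"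
proof -
  consider "x \<in> E" | "x \<notin> E" "x \<in> \<Delta> One" | "x \<notin> E" "x \<notin> \<Delta> One" "x \<in> \<Delta> Two" | "x \<notin> E" "x \<notin> \<Delta> One" "x \<notin> \<Delta> Two"
    by blast
  then show ?thesis
  proof cases
    case 1
    then have "Psi \<mu> \<kappa> x = (\<lambda>Y. inverse (Lfun \<mu> (\<lambda>_. 1) x) * lfun \<mu> x Y)"
      by (simp add: Psi_def fun_eq_iff divide_inverse mult.commute del: One_nat_def)
    moreover have "x \<notin> D" "Lkap \<mu> \<kappa> x = 0" using 1 by (auto simp: Eset_def)
    ultimately show ?thesis by (simp add: jacobi_real_linear(2) jacobi_lfun del: One_nat_def)
  next
    case 2
    then have "Psi \<mu> \<kappa> x = Psi_on \<mu> \<kappa> One x" by (simp add: Psi_def fun_eq_iff)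
    then show ?thesis by (simp add: jacobi_Psi_on)
  next
    case 3
    then have "Psi \<mu> \<kappa> x = Psi_on \<mu> \<kappa> Two x" by (simp add: Psi_def fun_eq_iff)
    then show ?thesis by (simp add: jacobi_Psi_on)
  next
    case 4
    then have "Psi \<mu> \<kappa> x = (\<lambda>_. 0)" by (simp add: Psi_def fun_eq_iff)
    then show ?thesis by (simp add: jacobi_def)
  qed
qed

end

section \<open>Boundary values for Dini-continuous densities\<close>

text \<open>W is the density extended by zero to the whole line. The bound \<open>\<omega>\<close>
  is required only for small s, where the singular kernel 1/s has to be controlled; elsewhere
  boundedness of W suffices.\<close>

locale dini_density =
  fixes a b :: real and W \<omega> :: "real \<Rightarrow> real"
  assumes ab: "a < b"
    and W0: "\<And>x. x \<notin> {a<..<b} \<Longrightarrow> W x = 0"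
    and W_\<omega>: "\<And>x y s. 0 < s \<Longrightarrow> s < 1/2 \<Longrightarrow> \<bar>x - y\<bar> \<le> s \<Longrightarrow> \<bar>W x - W y\<bar> \<le> \<omega> s"
    and \<omega>_int: "integrable lborel (\<lambda>s. indicator {0<..<1/2} s * (\<omega> s / s))"
    and \<omega>_lim: "(\<omega> \<longlongrightarrow> 0) (at_right 0)"

text \<open>Since w vanishes at the endpoints, a point outside the interval may be replaced by the
  endpoint nearest to it, so the zero extension has no larger modulus.\<close>

lemma dini_density_extension:
  assumes ab: "a < b" and dini: "Dini_on {a..b} w" and w: "w a = 0" "w b = 0"
  shows "\<exists>\<omega>. dini_density a b (\<lambda>x. indicator {a..b} x * w x) \<omega>"
proof -
  define m where "m = modulus {a..b} w"
  define I where "I = (\<integral>\<^sup>+t\<in>{0<..1}. (m t / ennreal t) \<partial>lborel)"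
  have I: "I < \<infinity>" using dini by (simp add: Dini_on_def I_def m_def)
  have mono_m: "m s \<le> m t" if "s \<le> t" for s t
    unfolding m_def modulus_def using that by (intro SUP_subset_mono) auto
  have w_m: "ennreal \<bar>w x - w y\<bar> \<le> m t" if "x \<in> {a..b}" "y \<in> {a..b}" "\<bar>x - y\<bar> \<le> t" for x y t
    unfolding m_def modulus_def using that by (intro SUP_upper2[of "(x, y)"]) auto
  \<comment> \<open>On [1/2, 1] the Dini integrand is at least \<open>m (1/2)\<close>, by
    monotonicity and 1/t being at least 1.\<close>
  have fin: "m (1/2) < \<infinity>"
  proof -
    have "m (1/2) * ennreal (1/2) = (\<integral>\<^sup>+t. m (1/2) * indicator {1/2..1::real} t \<partial>lborel)"
      by (simp add: nn_integral_cmult_indicator)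
    also have "\<dots> \<le> I"
      unfolding I_def
    proof (intro nn_integral_mono)
      fix t :: real
      show "m (1/2) * indicator {1/2..1} t \<le> m t / ennreal t * indicator {0<..1} t"
      proof (cases "t \<in> {1/2..1}")
        case True
        then have "m (1/2) * 1 \<le> m t * inverse (ennreal t)"
        proof (intro mult_mono mono_m)
          have "ennreal t * 1 \<le> ennreal t * inverse (ennreal t)"
            using True by (simp add: ennreal_le_1 inverse_ennreal flip: ennreal_mult)
          have "1 \<le> inverse t" using True by (simp add: one_le_inverse)
          then show "1 \<le> inverse (ennreal t)" using True by (subst inverse_ennreal) (auto simp: ennreal_leI simp flip: ennreal_1)
        qed auto
        then show ?thesis using True by (simp add: divide_ennreal_def)
      qed simp
    qed
    finally have "m (1/2) * ennreal (1/2) < \<infinity>" using I by (rule le_less_trans)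
    then show ?thesis by (auto simp: ennreal_mult_less_top)
  qed
  \<comment> \<open>Capping the argument at 1/2 keeps the value finite and the function monotone on
    the whole line, hence measurable.\<close>
  define \<omega> where "\<omega> = (\<lambda>s. enn2real (m (min s (1/2))))"
  have e\<omega>: "ennreal (\<omega> s) = m (min s (1/2))" for s
    using mono_m[of "min s (1/2)" "1/2"] fin by (simp add: \<omega>_def ennreal_enn2real_if top_unique) (metis fin infinity_ennreal_def le_less_trans less_irrefl mono_m min.cobounded2)
  have \<omega>0: "0 \<le> \<omega> s" for s by (simp add: \<omega>_def)
  have mono\<omega>: "mono \<omega>"
    by (rule monoI) (metis e\<omega> \<omega>0 ennreal_le_iff min.mono mono_m order_refl)
  have [measurable]: "\<omega> \<in> borel_measurable borel" using mono\<omega> by (rule borel_measurable_mono)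
  have w\<omega>: "\<bar>w x - w y\<bar> \<le> \<omega> s" if "x \<in> {a..b}" "y \<in> {a..b}" "\<bar>x - y\<bar> \<le> s" "s < 1/2" for x y s
  proof -
    have "min s (1/2) = s" using that(4) by simp
    then have "ennreal \<bar>w x - w y\<bar> \<le> ennreal (\<omega> s)" using w_m[OF that(1-3)] by (simp only: e\<omega>)
    then show ?thesis by (simp only: ennreal_le_iff[OF \<omega>0])
  qed
  define W where "W = (\<lambda>x. indicator {a..b} x * w x)"
  have W\<omega>: "\<bar>W x - W y\<bar> \<le> \<omega> s" if s: "0 < s" "s < 1/2" and xy: "\<bar>x - y\<bar> \<le> s" for x y s
  proof -
    have edge: "\<bar>W x - W y\<bar> \<le> \<omega> s" if "x \<in> {a..b}" "y \<notin> {a..b}" "\<bar>x - y\<bar> \<le> s" for x y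
    proof -
      define c where "c = (if y < a then a else b)"
      have "c \<in> {a..b}" "w c = 0" "\<bar>x - c\<bar> \<le> s" using that ab w by (auto simp: c_def)
      then show ?thesis using w\<omega>[of x c s] that s by (simp add: W_def)
    qed
    show ?thesis
    proof (cases "x \<in> {a..b}")
      case True
      then show ?thesis using edge[OF True _ xy] w\<omega>[OF True _ xy s(2)] by (cases "y \<in> {a..b}") (auto simp: W_def)
    next
      case False
      then show ?thesis using edge[of y x] xy \<omega>0[of s] by (cases "y \<in> {a..b}") (auto simp: W_def abs_minus_commute)
    qed
  qed
  have int: "integrable lborel (\<lambda>s. indicator {0<..<1/2} s * (\<omega> s / s))"
  proof (rule integrableI_nonneg)
    show "AE s in lborel. 0 \<le> indicator {0<..<1/2} s * (\<omega> s / s)" using \<omega>0 by (auto simp: indicator_def)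
    have "(\<integral>\<^sup>+s. ennreal (indicator {0<..<1/2} s * (\<omega> s / s)) \<partial>lborel) \<le> I"
      unfolding I_def
    proof (intro nn_integral_mono)
      fix s :: real
      show "ennreal (indicator {0<..<1/2} s * (\<omega> s / s)) \<le> m s / ennreal s * indicator {0<..1} s"
      proof (cases "s \<in> {0<..<1/2}")
        case True
        then have "ennreal (\<omega> s / s) = m s / ennreal s"
          using \<omega>0[of s] e\<omega>[of s] by (simp add: min_def flip: divide_ennreal)
        with True show ?thesis by simp
      qed simp
    qed
    then show "(\<integral>\<^sup>+s. ennreal (indicator {0<..<1/2} s * (\<omega> s / s)) \<partial>lborel) < \<infinity>" using I by (rule le_less_trans)
  qed measurable
  have "(\<omega> \<longlongrightarrow> 0) (at_right 0)"
  proof (rule tendstoI)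
    fix e :: real assume e: "0 < e"
    have "\<exists>s. 0 < s \<and> s < 1/2 \<and> \<omega> s < e"
    proof (rule ccontr)
      assume neg: "\<not> ?thesis"
      define J where "J = (LINT s|lborel. indicator {0<..<1/2} s * (\<omega> s / s))"
      \<comment> \<open>Chosen so that the integral of e/s from d to 1/4 equals |J| + 1, which
        exceeds the assumed Dini integral J.\<close>
      define d where "d = exp (- ((\<bar>J\<bar> + 1) / e)) / 4"
      have d: "0 < d" "d \<le> 1/4" using e by (auto simp: d_def)
      have D: "((\<lambda>s. e * ln s) has_real_derivative e / s) (at s)" if "d \<le> s" "s \<le> 1/4" for s
        using that d by (auto intro!: derivative_eq_intros simp: field_simps)
      have C: "isCont (\<lambda>s. e / s) s" if "d \<le> s" "s \<le> 1/4" for s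
        using that d by (intro continuous_intros) auto
      have "e * ln (1/4) - e * ln d = (LINT s|lborel. (e / s) * indicator {d..1/4} s)"
        by (rule integral_FTC_Icc_real[OF d(2) D C, symmetric])
      also have "\<dots> \<le> J"
        unfolding J_def
      proof (rule integral_mono)
        show "integrable lborel (\<lambda>s. (e / s) * indicator {d..1/4} s)"
          using has_bochner_integral_FTC_Icc_real[OF d(2) D C] by (simp add: has_bochner_integral_iff)
        fix s :: real
        show "(e / s) * indicator {d..1/4} s \<le> indicator {0<..<1/2} s * (\<omega> s / s)"
        proof (cases "s \<in> {d..1/4}")
          case True
          then have "0 < s" "s < 1/2" using d by auto
          then have "e \<le> \<omega> s" using neg by (meson not_le)
          then show ?thesis using True d by (simp add: divide_right_mono)
        qed (use \<omega>0 in \<open>auto simp: indicator_def\<close>)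
      qed (rule int)
      also have "e * ln (1/4) - e * ln d = \<bar>J\<bar> + 1"
        using e by (simp add: d_def ln_div field_simps)
      finally show False by linarith
    qed
    then obtain s where s: "0 < s" "s < 1/2" "\<omega> s < e" by blast
    have "\<forall>t>0. t < s \<longrightarrow> dist (\<omega> t) 0 < e"
      using monoD[OF mono\<omega>] s(3) \<omega>0 by (auto intro: le_less_trans[OF _ s(3)])
    then show "eventually (\<lambda>t. dist (\<omega> t) 0 < e) (at_right 0)"
      using s(1) by (auto simp: eventually_at_right_field)
  qed
  then have "dini_density a b W \<omega>"
    using ab W\<omega> int w by unfold_locales (auto simp: W_def indicator_def)
  then show ?thesis by (auto simp: W_def)
qed

context dini_density
begin

lemma W_uniform: "0 < e \<Longrightarrow> \<exists>d>0. \<forall>x y. \<bar>x - y\<bar> \<le> d \<longrightarrow> \<bar>W x - W y\<bar> < e"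
proof -
  assume e: "0 < e"
  have "eventually (\<lambda>s. \<omega> s < e) (at_right 0)" using \<omega>_lim e by (rule order_tendstoD)
  then obtain t where t: "0 < t" "\<And>s. 0 < s \<Longrightarrow> s < t \<Longrightarrow> \<omega> s < e"
    by (auto simp: eventually_at_right_field)
  define d where "d = min (t / 2) (1/4)"
  have "0 < d" "d < t" "d < 1/2" using t(1) by (auto simp: d_def)
  then show ?thesis using W_\<omega>[of d] t(2)[of d] by (meson le_less_trans)
qed

lemma W_continuous: "continuous_on UNIV W"
proof (rule continuous_onI)
  fix x e :: real assume "0 < e"
  from W_uniform[OF this] obtain d where "d > 0" "\<And>x y. \<bar>x - y\<bar> \<le> d \<Longrightarrow> \<bar>W x - W y\<bar> < e" by blast
  then show "\<exists>d>0. \<forall>x'\<in>UNIV. dist x' x < d \<longrightarrow> dist (W x') (W x) \<le> e"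
    by (intro exI[of _ d]) (auto simp: dist_real_def less_imp_le)
qed

lemma W_measurable [measurable]: "W \<in> borel_measurable borel"
  using W_continuous by (rule borel_measurable_continuous_onI)

lemma W_tendsto: "(f \<longlongrightarrow> x) F \<Longrightarrow> ((\<lambda>t. W (f t)) \<longlongrightarrow> W x) F"
  using W_continuous by (auto intro: isCont_tendsto_compose simp: continuous_on_eq_continuous_at)

definition B :: real where "B = (SOME B. 0 < B \<and> (\<forall>x. \<bar>W x\<bar> \<le> B))"

lemma B: "0 < B" "\<bar>W x\<bar> \<le> B"
proof -
  have "bounded (W ` {a..b})"
    using W_continuous by (intro compact_imp_bounded compact_continuous_image) (auto intro: continuous_on_subset)
  then obtain C where C: "0 < C" "\<And>x. x \<in> {a..b} \<Longrightarrow> \<bar>W x\<bar> \<le> C" by (auto simp: bounded_pos)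
  have "\<bar>W x\<bar> \<le> C" for x using C W0[of x] by (cases "x \<in> {a..b}") auto
  with C(1) have "\<exists>B. 0 < B \<and> (\<forall>x. \<bar>W x\<bar> \<le> B)" by blast
  from someI_ex[OF this] show "0 < B" "\<bar>W x\<bar> \<le> B" by (auto simp: B_def)
qed

lemma W_integrable: "integrable lborel W"
proof (rule Bochner_Integration.integrable_bound)
  show "integrable lborel (\<lambda>x. B * indicator {a..b} x)" using ab by (simp add: integrable_real_indicator)
  show "AE x in lborel. norm (W x) \<le> norm (B * indicator {a..b} x)"
    using B W0 by (intro AE_I2) (force simp: indicator_def)
qed measurable

text \<open>The real part of the Cauchy transform, symmetrised about x: the difference of W tames
  the kernel s/(s^2 + y^2), so the integral still converges for y = 0, where it is a principal
  value.\<close>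

definition H :: "real \<Rightarrow> real \<Rightarrow> real" where
  "H y x = (LINT s|lborel. (1/2) * ((W (x - s) - W (x + s)) * (s / (s\<^sup>2 + y\<^sup>2))))"

definition P :: "real \<Rightarrow> real \<Rightarrow> real" where
  "P y x = (LINT s|lborel. W (x + y * s) * inverse (1 + s\<^sup>2))"

definition U :: "real \<Rightarrow> real \<Rightarrow> complex" where
  "U y x = Complex (H y x) (- P y x)"

lemma P_0: "P 0 x = pi * W x"
  using poisson_kernel_integral by (simp add: P_def)

lemma P_continuous: "continuous_on UNIV (\<lambda>(y, x). P y x)"
  unfolding continuous_on_def
proof
  fix p :: "real \<times> real"
  have "((\<lambda>q. LINT s|lborel. W (snd q + fst q * s) * inverse (1 + s\<^sup>2)) \<longlongrightarrow> (LINT s|lborel. W (snd p + fst p * s) * inverse (1 + s\<^sup>2))) (at p within UNIV)"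
  proof (rule integral_tendsto_at)
    show "integrable lborel (\<lambda>s::real. B * inverse (1 + s\<^sup>2))" using poisson_kernel_integral by simp
    show "AE s in lborel. ((\<lambda>q. W (snd q + fst q * s) * inverse (1 + s\<^sup>2)) \<longlongrightarrow> W (snd p + fst p * s) * inverse (1 + s\<^sup>2)) (at p within UNIV)"
      by (intro AE_I2 tendsto_mult tendsto_const W_tendsto) (auto intro!: tendsto_intros)
    show "AE s in lborel. norm (W (snd q + fst q * s) * inverse (1 + s\<^sup>2)) \<le> B * inverse (1 + s\<^sup>2)" for q
      using B by (intro AE_I2) (auto simp: abs_mult intro!: mult_right_mono)
  qed measurable
  then show "((\<lambda>(y, x). P y x) \<longlongrightarrow> (case p of (y, x) \<Rightarrow> P y x)) (at p within UNIV)"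
    by (simp add: P_def case_prod_unfold)
qed

lemma H_continuous: "continuous_on ({0..} \<times> {- c<..<c}) (\<lambda>(y, x). H y x)"
  unfolding continuous_on_def
proof
  fix p :: "real \<times> real" assume p: "p \<in> {0..} \<times> {- c<..<c}"
  \<comment> \<open>For |x| < c and |s| > R both x - s and x + s lie outside the interval, so the
    integrand vanishes.\<close>
  define R where "R = c + \<bar>a\<bar> + \<bar>b\<bar>"
  define f where "f = (\<lambda>s::real. indicator {0<..<1/2} s * (\<omega> s / s))"
  define g where "g = (\<lambda>q s. (1/2) * ((W (snd q - s) - W (snd q + s)) * (s / (s\<^sup>2 + (fst q)\<^sup>2))))"
  \<comment> \<open>Near 0 the Dini bound divided by |s| dominates, for both signs of s; further out
    the kernel is at most 2 and W is bounded.\<close>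
  have dom: "\<bar>g q s\<bar> \<le> f s + f (- s) + 2 * B * indicator {- R..R} s" if q: "q \<in> {0..} \<times> {- c<..<c}" for q s
  proof -
    obtain y x where qq: "q = (y, x)" by (cases q)
    have x: "\<bar>x\<bar> < c" using q by (auto simp: qq)
    have gq: "\<bar>g q s\<bar> = 1/2 * \<bar>(W (x - s) - W (x + s)) * (s / (s\<^sup>2 + y\<^sup>2))\<bar>"
      unfolding g_def qq fst_conv snd_conv by (subst abs_mult) simp
    have ker: "\<bar>s / (s\<^sup>2 + y\<^sup>2)\<bar> \<le> 1 / \<bar>s\<bar>" if "s \<noteq> 0"
    proof -
      have "\<bar>s\<bar> / (s\<^sup>2 + y\<^sup>2) \<le> \<bar>s\<bar> / s\<^sup>2" using that by (intro divide_left_mono mult_pos_pos add_pos_nonneg) auto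
      also have "\<dots> = 1 / \<bar>s\<bar>" using that by (simp add: power2_eq_square divide_simps flip: abs_mult)
      finally show ?thesis by simp
    qed
    consider "s = 0" | "s \<noteq> 0" "\<bar>s\<bar> < 1/2" | "1/2 \<le> \<bar>s\<bar>" "\<bar>s\<bar> \<le> R" | "1/2 \<le> \<bar>s\<bar>" "R < \<bar>s\<bar>" by linarith
    then show ?thesis
    proof cases
      case 1
      then show ?thesis using B(1) by (simp add: g_def f_def indicator_def)
    next
      case 2
      have "\<bar>W (x - s) - W x\<bar> \<le> \<omega> \<bar>s\<bar>" "\<bar>W x - W (x + s)\<bar> \<le> \<omega> \<bar>s\<bar>"
        using 2 by (auto intro!: W_\<omega>)
      then have w: "\<bar>W (x - s) - W (x + s)\<bar> \<le> 2 * \<omega> \<bar>s\<bar>" by linarith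
      have "\<bar>(W (x - s) - W (x + s)) * (s / (s\<^sup>2 + y\<^sup>2))\<bar> \<le> (2 * \<omega> \<bar>s\<bar>) * (1 / \<bar>s\<bar>)"
        unfolding abs_mult[of "W (x - s) - W (x + s)"]
        using w ker[OF 2(1)] by (intro mult_mono) (auto intro: order_trans[OF abs_ge_zero w])
      moreover have "(2 * \<omega> \<bar>s\<bar>) * (1 / \<bar>s\<bar>) = 2 * (\<omega> \<bar>s\<bar> / \<bar>s\<bar>)" by simp
      ultimately have "\<bar>g q s\<bar> \<le> \<omega> \<bar>s\<bar> / \<bar>s\<bar>" using gq by linarith
      also have "\<dots> = f s + f (- s)" using 2 by (cases "0 < s") (auto simp: f_def indicator_def)
      finally show ?thesis using B(1) by (simp add: indicator_def)
    next
      case 3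
      have "\<bar>W (x - s) - W (x + s)\<bar> \<le> 2 * B" using B(2)[of "x - s"] B(2)[of "x + s"] by linarith
      moreover have "1 / \<bar>s\<bar> \<le> 2" using 3 by (simp add: field_simps)
      then have "\<bar>s / (s\<^sup>2 + y\<^sup>2)\<bar> \<le> 2" using ker 3 by fastforce
      ultimately have "\<bar>(W (x - s) - W (x + s)) * (s / (s\<^sup>2 + y\<^sup>2))\<bar> \<le> (2 * B) * 2"
        unfolding abs_mult[of "W (x - s) - W (x + s)"] using B(1) by (intro mult_mono) auto
      then have "\<bar>g q s\<bar> \<le> 2 * B" using gq by linarith
      moreover have "s \<in> {- R..R}" using 3 by auto
      moreover have "f s = 0" "f (- s) = 0" using 3 by (auto simp: f_def indicator_def)
      ultimately show ?thesis by simp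
    next
      case 4
      have "W (x - s) = 0" "W (x + s) = 0" using 4 x ab by (auto simp: R_def intro!: W0)
      then have "g q s = 0" by (simp add: g_def qq)
      moreover have "f s = 0" "f (- s) = 0" using 4 by (auto simp: f_def indicator_def)
      ultimately show ?thesis using B(1) by simp
    qed
  qed
  have fi: "integrable lborel f" unfolding f_def by (rule \<omega>_int)
  have fi': "integrable lborel (\<lambda>s. f (- s))"
    using lborel_integrable_real_affine[OF fi, of "-1" 0] by simp
  have domi: "integrable lborel (\<lambda>s. f s + f (- s) + 2 * B * indicator {- R..R} s)"
    using fi fi' emeasure_compact_finite[OF compact_Icc, of "- R" R]
    by (intro Bochner_Integration.integrable_add integrable_mult_right integrable_real_indicator) (auto simp: top.not_eq_extremum)
  have "((\<lambda>q. LINT s|lborel. g q s) \<longlongrightarrow> (LINT s|lborel. g p s)) (at p within {0..} \<times> {- c<..<c})"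
  proof (rule integral_tendsto_at[OF _ _ domi])
    show "AE s in lborel. ((\<lambda>q. g q s) \<longlongrightarrow> g p s) (at p within {0..} \<times> {- c<..<c})"
    proof (rule AE_I2)
      fix s :: real
      show "((\<lambda>q. g q s) \<longlongrightarrow> g p s) (at p within {0..} \<times> {- c<..<c})"
      proof (cases "s = 0")
        case False
        then have "s\<^sup>2 + (fst p)\<^sup>2 \<noteq> 0" by (simp add: add_nonneg_eq_0_iff)
        then show ?thesis unfolding g_def
          by (intro tendsto_mult tendsto_const tendsto_diff tendsto_divide W_tendsto tendsto_add tendsto_power tendsto_fst tendsto_snd tendsto_ident_at)
      qed (simp add: g_def)
    qed
    show "AE s in lborel. norm (g q s) \<le> f s + f (- s) + 2 * B * indicator {- R..R} s" if "q \<in> {0..} \<times> {- c<..<c}" for q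
      using dom[OF that] by simp
  qed (simp_all add: g_def)
  then show "((\<lambda>(y, x). H y x) \<longlongrightarrow> (case p of (y, x) \<Rightarrow> H y x)) (at p within {0..} \<times> {- c<..<c})"
    by (simp add: H_def g_def case_prod_unfold)
qed

lemma U_continuous: "continuous_on ({0..} \<times> {- c<..<c}) (\<lambda>(y, x). U y x)"
proof -
  have "continuous_on ({0..} \<times> {- c<..<c}) (\<lambda>p. complex_of_real (case p of (y, x) \<Rightarrow> H y x) - \<i> * of_real (case p of (y, x) \<Rightarrow> P y x))"
    by (intro continuous_intros H_continuous continuous_on_subset[OF P_continuous]) auto
  then show ?thesis by (simp add: U_def Complex_eq case_prod_unfold)
qed

text \<open>The symmetrised real part is the average of the two substitutions t = x + s and t = x -
  s, legitimate because for y > 0 each integral converges by itself.\<close>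

lemma U_eq:
  assumes y: "0 < y"
  shows "(LINT t|lborel. of_real (W t) / (Complex x y - of_real t)) = U y x"
proof -
  have int: "integrable lborel (\<lambda>t. complex_of_real (W t) / (Complex x y - of_real t))"
  proof (rule Bochner_Integration.integrable_bound)
    show "integrable lborel (\<lambda>t. W t / y)" using W_integrable by simp
    show "AE t in lborel. norm (complex_of_real (W t) / (Complex x y - of_real t)) \<le> norm (W t / y)"
    proof (rule AE_I2)
      fix t
      have "y \<le> cmod (Complex x y - of_real t)"
        using abs_Im_le_cmod[of "Complex x y - of_real t"] y by simp
      then show "norm (complex_of_real (W t) / (Complex x y - of_real t)) \<le> norm (W t / y)"
        using y by (simp add: norm_divide frac_le)
    qed
  qed measurable
  define k where "k = (\<lambda>s::real. s / (s\<^sup>2 + y\<^sup>2))"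
  have re: "Re (complex_of_real (W t) / (Complex x y - of_real t)) = W t * k (x - t)" for t
    by (simp add: Re_divide k_def)
  have im: "Im (complex_of_real (W t) / (Complex x y - of_real t)) = - (W t * poisson y (x - t))" for t
    by (simp add: Im_divide poisson_def)
  have "(LINT t|lborel. W t * poisson y (x - t)) = P y x"
    using poisson_convolution(1)[OF y, of W x] by (simp add: P_def)
  then have Im: "Im (LINT t|lborel. of_real (W t) / (Complex x y - of_real t)) = - P y x"
    using integral_Im[OF int] by (simp add: im)
  have ri: "integrable lborel (\<lambda>t. W t * k (x - t))" using integrable_Re[OF int] by (simp add: re)
  have 1: "(LINT t|lborel. W t * k (x - t)) = (LINT s|lborel. W (x + s) * k (- s))"
    by (subst lborel_integral_real_affine[where c = 1 and t = x]) auto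
  have 2: "(LINT t|lborel. W t * k (x - t)) = (LINT s|lborel. W (x - s) * k s)"
    by (subst lborel_integral_real_affine[where c = "-1" and t = x]) auto
  have i1: "integrable lborel (\<lambda>s. W (x + s) * k (- s))"
    using lborel_integrable_real_affine[OF ri, of 1 x] by simp
  have i2: "integrable lborel (\<lambda>s. W (x - s) * k s)"
    using lborel_integrable_real_affine[OF ri, of "-1" x] by simp
  have k_odd: "k (- s) = - k s" and kk: "s / (s\<^sup>2 + y\<^sup>2) = k s" for s by (simp_all add: k_def)
  have "2 * (LINT t|lborel. W t * k (x - t)) = (LINT s|lborel. W (x + s) * k (- s)) + (LINT s|lborel. W (x - s) * k s)"
    using 1 2 by simp
  also have "\<dots> = (LINT s|lborel. W (x + s) * k (- s) + W (x - s) * k s)"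
    using i1 i2 by simp
  also have "\<dots> = (LINT s|lborel. 2 * ((1/2) * ((W (x - s) - W (x + s)) * (s / (s\<^sup>2 + y\<^sup>2)))))"
    by (intro Bochner_Integration.integral_cong refl) (simp only: k_odd kk, simp add: algebra_simps)
  also have "\<dots> = 2 * H y x" unfolding H_def by (rule integral_mult_right_zero)
  finally have "(LINT t|lborel. W t * k (x - t)) = H y x" by simp
  then have "Re (LINT t|lborel. of_real (W t) / (Complex x y - of_real t)) = H y x"
    using integral_Re[OF int] by (simp add: re)
  with Im show ?thesis by (simp add: U_def complex_eq_iff)
qed

text \<open>The integrability of \<open>1/W\<close> enters through \<open>W/A + 1/W \<ge> 1/r\<close> for \<open>A \<le> 4r\<^sup>2\<close>, a form of the
  inequality between arithmetic and geometric means.\<close>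

lemma endpoint_blowup:
  assumes pos: "\<And>x. x \<in> {a<..<b} \<Longrightarrow> 0 < W x" and inv: "integrable lborel (\<lambda>x. inverse (W x))"
    and c: "c = a \<or> c = b" and y: "0 < y" "y < b - a"
  shows "ln (b - a) - ln y - (LINT x|lborel. inverse (W x)) \<le> (LINT t|lborel. W t / ((c - t)\<^sup>2 + y\<^sup>2))"
proof -
  \<comment> \<open>The part of the interval at distance at least y from the endpoint c. There
    (c-t)^2 + y^2 is at most twice the squared distance, and 1/distance integrates to the logarithm
    in the claim.\<close>
  define S where "S = (if c = a then {a + y..b} else {a..b - y})"
  define r where "r = (\<lambda>t. \<bar>t - c\<bar>)"
  have Wnn: "0 \<le> W t" for t using pos[of t] W0[of t] by (cases "t \<in> {a<..<b}") (auto simp: less_imp_le)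
  have Ai: "integrable lborel (\<lambda>t. W t / ((c - t)\<^sup>2 + y\<^sup>2))"
  proof (rule Bochner_Integration.integrable_bound)
    show "integrable lborel (\<lambda>t. W t / y\<^sup>2)" using W_integrable by simp
    show "AE t in lborel. norm (W t / ((c - t)\<^sup>2 + y\<^sup>2)) \<le> norm (W t / y\<^sup>2)"
      using y(1) by (intro AE_I2) (auto simp: intro!: divide_left_mono mult_pos_pos add_nonneg_pos)
  qed measurable
  have S: "integrable lborel (\<lambda>t. 1 / r t * indicator S t)" "(LINT t|lborel. 1 / r t * indicator S t) = ln (b - a) - ln y"
  proof -
    have "has_bochner_integral lborel (\<lambda>t. 1 / r t * indicator S t) (ln (b - a) - ln y)"
    proof (cases "c = a")
      case True
      have D: "((\<lambda>t. ln (t - a)) has_real_derivative 1 / r t) (at t)" if "a + y \<le> t" "t \<le> b" for t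
        using that y by (auto intro!: derivative_eq_intros simp: r_def True)
      have C: "isCont (\<lambda>t. 1 / r t) t" if "a + y \<le> t" "t \<le> b" for t
        using that y unfolding r_def by (intro continuous_intros) (auto simp: True)
      have "a + y \<le> b" using y by simp
      from has_bochner_integral_FTC_Icc_real[OF this D C] show ?thesis by (simp add: S_def True)
    next
      case False
      then have cb: "c = b" using c by simp
      have D: "((\<lambda>t. - ln (b - t)) has_real_derivative 1 / r t) (at t)" if "a \<le> t" "t \<le> b - y" for t
        using that y by (auto intro!: derivative_eq_intros simp: r_def cb)
      have C: "isCont (\<lambda>t. 1 / r t) t" if "a \<le> t" "t \<le> b - y" for t
        using that y unfolding r_def by (intro continuous_intros) (auto simp: cb)
      have "a \<le> b - y" using y by simp
      from has_bochner_integral_FTC_Icc_real[OF this D C] show ?thesis using False by (simp add: S_def)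
    qed
    then show "integrable lborel (\<lambda>t. 1 / r t * indicator S t)" "(LINT t|lborel. 1 / r t * indicator S t) = ln (b - a) - ln y"
      by (auto simp: has_bochner_integral_iff)
  qed
  have "(LINT t|lborel. 1 / r t * indicator S t) \<le> (LINT t|lborel. W t / ((c - t)\<^sup>2 + y\<^sup>2) + inverse (W t))"
  proof (rule integral_mono_AE[OF S(1)])
    show "integrable lborel (\<lambda>t. W t / ((c - t)\<^sup>2 + y\<^sup>2) + inverse (W t))" using Ai inv by simp
    have "AE t in lborel. t \<noteq> a" "AE t in lborel. t \<noteq> b" by (rule AE_lborel_singleton)+
    then show "AE t in lborel. 1 / r t * indicator S t \<le> W t / ((c - t)\<^sup>2 + y\<^sup>2) + inverse (W t)"
    proof eventually_elim
      case (elim t)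
      show ?case
      proof (cases "t \<in> S")
        case False
        then show ?thesis using Wnn[of t] by (simp add: add_nonneg_nonneg)
      next
        case True
        then have t: "t \<in> {a<..<b}" using elim y by (auto simp: S_def split: if_splits)
        then have Wp: "0 < W t" by (rule pos)
        have ry: "y \<le> r t" using True c by (auto simp: S_def r_def split: if_splits)
        define A where "A = (c - t)\<^sup>2 + y\<^sup>2"
        have A0: "0 < A" using y(1) by (simp add: A_def add_nonneg_pos)
        have "y\<^sup>2 \<le> (r t)\<^sup>2" using ry y(1) by (intro power_mono) auto
        moreover have "(c - t)\<^sup>2 = (r t)\<^sup>2" by (simp add: r_def power2_commute)
        ultimately have A: "A \<le> 4 * (r t)\<^sup>2" unfolding A_def using zero_le_power2[of "r t"] by linarith
        have r0: "0 < r t" using ry y(1) by linarith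
        \<comment> \<open>A completed square plus a term that is nonnegative by A at most 4 r^2;
          expanding it and dividing by 4 r gives the inequality between the means.\<close>
        have "0 \<le> (2 * r t * W t - A)\<^sup>2 + A * (4 * (r t)\<^sup>2 - A)"
          using A A0 by (intro add_nonneg_nonneg mult_nonneg_nonneg) auto
        also have "\<dots> = 4 * r t * (r t * (W t * W t + A) - A * W t)"
          by (simp add: power2_eq_square algebra_simps)
        finally have "A * W t \<le> r t * (W t * W t + A)" using r0 by (simp add: zero_le_mult_iff)
        then have "1 / r t \<le> (W t * W t + A) / (A * W t)"
          using r0 A0 Wp by (simp add: divide_le_eq pos_le_divide_eq mult.commute)
        also have "\<dots> = W t / A + inverse (W t)" using A0 Wp by (simp add: field_simps)
        finally show ?thesis using True by (simp add: A_def)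
      qed
    qed
  qed
  also have "\<dots> = (LINT t|lborel. W t / ((c - t)\<^sup>2 + y\<^sup>2)) + (LINT x|lborel. inverse (W x))"
    using Ai inv by simp
  finally show ?thesis unfolding S(2) by simp
qed

end

section \<open>The spectral measure of a regular system\<close>

text \<open>The coefficients of L add up to 1, so Im((u - v) cnj L) does not depend on c; this is
  why \<open>\<kappa>\<close> enters the density only through the modulus of
  \<open>Lkap\<close>.\<close>

lemma Im_quotient_algebra:
  fixes u v :: complex and c X :: real
  assumes "L = of_real (1 - c) * u + of_real c * v"
  shows "Im (- (of_real (1 / X) * (v - u)) / L) = Im (u * cnj v) / (X * (cmod L)\<^sup>2)"
proof -
  have "Im (a / L) = Im (a * cnj L) / (cmod L)\<^sup>2" for a
    by (subst complex_div_cnj) (simp only: Im_divide_of_real)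
  then have "Im (- (of_real (1 / X) * (v - u)) / L) = Im (- (of_real (1 / X) * (v - u)) * cnj L) / (cmod L)\<^sup>2" .
  also have "- (of_real (1 / X) * (v - u)) * cnj L = of_real (1 / X) * ((u - v) * cnj L)" by (simp add: algebra_simps diff_divide_distrib)
  also have "Im (of_real (1 / X) * ((u - v) * cnj L)) = (1 / X) * Im ((u - v) * cnj L)"
    by (simp only: times_complex.sel Im_complex_of_real Re_complex_of_real mult_zero_left add_0_right)
  also have "Im ((u - v) * cnj L) = Im (u * cnj v)"
    unfolding assms by (simp add: algebra_simps)
  finally show ?thesis by simp
qed

lemma upper_half_plane_limit: "at (complex_of_real x) within {z. 0 < Im z} \<noteq> bot"
proof -
  have "(\<lambda>n. of_real x + \<i> * of_real (1 / real (Suc n))) \<longlonglongrightarrow> of_real x + \<i> * of_real 0"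
    by (intro tendsto_intros LIMSEQ_Suc[OF lim_inverse_n'])
  then have "complex_of_real x islimpt {z. 0 < Im z}"
    unfolding islimpt_sequential
    by (intro exI[of _ "\<lambda>n. of_real x + \<i> * of_real (1 / real (Suc n))"]) (auto simp: complex_eq_iff)
  then show ?thesis using trivial_limit_within[of "complex_of_real x" "{z. 0 < Im z}"] by (simp add: trivial_limit_def)
qed

section \<open>Positivity of \<open>S_O\<close> and the point masses of the spectral measure\<close>

context angelesco_spectral
begin

lemma markov_sign: "x < lo k \<Longrightarrow> markov (\<mu> k) x < (0 :: real)" "hi k < x \<Longrightarrow> 0 < markov (\<mu> k) (x :: real)"
proof -
  have c: "continuous_on (\<Delta> k) (\<lambda>s. 1 / (x - s))" "(\<lambda>s. 1 / (x - s)) \<in> borel_measurable borel" if "x \<notin> \<Delta> k"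
    using that by (auto intro!: continuous_intros)
  show "0 < markov (\<mu> k) x" if "hi k < x"
  proof -
    have off: "x \<notin> \<Delta> k" using that by (auto simp: Delta_eq)
    have "{s \<in> \<Delta> k. 1 / (x - s) = 0} = {}" using off by auto
    then have "0 < (LINT s|\<mu> k. 1 / (x - s))"
      using that by (intro integral_mu_pos c off) (auto simp: Delta_eq)
    then show ?thesis by (simp add: markov_def)
  qed
  show "markov (\<mu> k) x < 0" if "x < lo k"
  proof -
    have off: "x \<notin> \<Delta> k" using that by (auto simp: Delta_eq)
    have "{s \<in> \<Delta> k. - (1 / (x - s)) = 0} = {}" using off by auto
    then have "0 < (LINT s|\<mu> k. - (1 / (x - s)))"
      using that c[OF off] by (intro integral_mu_pos continuous_intros borel_measurable_uminus) (auto simp: Delta_eq divide_nonneg_neg)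
    then show ?thesis by (simp add: markov_def)
  qed
qed

lemma S_O_eq:
  assumes x: "x \<in> \<Delta> k"
  shows "S_O \<mu> x = sg k / (Xi \<mu> * mass \<mu> One * mass \<mu> Two) * markov (\<mu> (other k)) x"
proof -
  have "x \<notin> \<Delta> (other k)" using x Delta_other_disjoint[of k] by blast
  then show ?thesis using x by (cases k) (simp_all add: S_O_def sg_def)
qed

lemma S_O_pos: "x \<in> \<Delta> k \<Longrightarrow> 0 < S_O \<mu> x"
proof -
  assume x: "x \<in> \<Delta> k"
  have "0 < sg k * markov (\<mu> (other k)) x"
    using x hi_less_lo markov_sign(1)[of x "other k"] markov_sign(2)[of "other k" x] by (cases k) (auto simp: sg_def Delta_eq)
  then show ?thesis
    using Xi_pos mass_pos[of One] mass_pos[of Two] by (simp add: S_O_eq[OF x] zero_less_divide_iff)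
qed

text \<open>y times the Poisson kernel is bounded by 1 and tends to the indicator of the
  centre.\<close>

lemma atom_limit: "((\<lambda>y. y * Im (GO (Complex c y))) \<longlongrightarrow> measure \<rho> {c}) (at_right 0)"
proof -
  have "((\<lambda>y. LINT t|\<rho>. y * poisson y (t - c)) \<longlongrightarrow> (LINT t|\<rho>. indicator {c} t)) (at_right 0)"
  proof (rule integral_tendsto_at)
    show "integrable \<rho> (\<lambda>_. 1 :: real)" by simp
    show "AE t in \<rho>. ((\<lambda>y. y * poisson y (t - c)) \<longlongrightarrow> indicator {c} t) (at_right 0)"
    proof (rule AE_I2)
      fix t
      show "((\<lambda>y. y * poisson y (t - c)) \<longlongrightarrow> indicator {c} t) (at_right 0)"
      proof (cases "t = c")
        case True
        have "eventually (\<lambda>y. y * poisson y (t - c) = indicator {c} t) (at_right 0)"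
          unfolding eventually_at_filter by (intro always_eventually) (auto simp: True poisson_def power2_eq_square)
        then show ?thesis by (rule tendsto_eventually)
      next
        case False
        have "((\<lambda>y. y * (y / ((t - c)\<^sup>2 + y\<^sup>2))) \<longlongrightarrow> 0 * (0 / ((t - c)\<^sup>2 + 0\<^sup>2))) (at_right 0)"
          using False by (intro tendsto_intros) auto
        then show ?thesis using False by (simp add: poisson_def)
      qed
    qed
    show "AE t in \<rho>. norm (y * poisson y (t - c)) \<le> 1" if "y \<in> {0<..}" for y
    proof (rule AE_I2)
      fix t
      have "0 < (t - c)\<^sup>2 + y\<^sup>2" using that by (simp add: add_nonneg_pos)
      then have "y\<^sup>2 / ((t - c)\<^sup>2 + y\<^sup>2) \<le> 1" by (simp add: pos_divide_le_eq)
      then show "norm (y * poisson y (t - c)) \<le> 1" using that by (simp add: poisson_def power2_eq_square)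
    qed
  qed measurable
  moreover have "(LINT t|\<rho>. indicator {c} t) = measure \<rho> {c}" by simp
  moreover have "eventually (\<lambda>y. (LINT t|\<rho>. y * poisson y (t - c)) = y * Im (GO (Complex c y))) (at_right 0)"
    unfolding eventually_at_filter by (intro always_eventually) (simp add: Im_GO)
  ultimately show ?thesis by (simp add: Lim_transform_eventually)
qed

text \<open>Isolated singularities of \<open>GO\<close> on the real axis are thus at most simple
  poles; at a point of E this makes the zero of \<open>Lkap\<close> simple.\<close>

lemma GO_bound:
  assumes "0 < y" shows "norm (of_real y * GO (Complex x y)) \<le> measure \<rho> UNIV"
proof -
  have le: "norm (1 / (of_real t - Complex x y)) \<le> 1 / y" for t
  proof -
    have "y \<le> cmod (of_real t - Complex x y)"
      using abs_Im_le_cmod[of "of_real t - Complex x y"] assms by simp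
    then show ?thesis using assms by (simp add: norm_divide frac_le)
  qed
  have "norm (GO (Complex x y)) \<le> (LINT t|\<rho>. norm (1 / (of_real t - Complex x y)))"
    using assms by (subst GO_spectral) (auto intro: integral_norm_bound)
  also have "\<dots> \<le> (LINT t|\<rho>. 1 / y)"
    using le assms by (intro integral_mono') auto
  also have "\<dots> = measure \<rho> UNIV / y" by simp
  finally show ?thesis using assms by (simp add: norm_mult field_simps)
qed

text \<open>With q the difference quotient of \<open>Lkap\<close> along the vertical direction, y
  GO(e+iy) q(y) = i \<open>Lfun\<close> at (1,1); letting y tend to 0 gives the residue.\<close>

lemma atom_at_E:
  assumes e: "e \<in> E"
  shows "measure \<rho> {e} = Lfun \<mu> (\<lambda>_. 1) e / deriv (Lkap \<mu> \<kappa>) e"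
proof -
  define L1 where "L1 = Lfun \<mu> (\<lambda>_. 1) e"
  have L1: "L1 \<noteq> 0" using Lfun_one_nonzero_at_E[OF e] by (simp add: L1_def)
  have off: "complex_of_real e \<in> - (of_real ` D)" using e by (auto simp: Eset_def)
  have op: "open (- (complex_of_real ` D))"
    by (intro open_Compl compact_imp_closed compact_continuous_image continuous_intros compact_Un compact_Delta)
  have zero: "Lkap \<mu> \<kappa> e = 0" using e by (simp add: Eset_def)
  obtain d where d: "((Lkap \<mu> \<kappa> :: complex \<Rightarrow> complex) has_field_derivative d) (at (of_real e))"
    using holomorphic_Lkap off op by (metis field_differentiable_def holomorphic_on_imp_differentiable_at)
  then have dl: "((\<lambda>h. Lkap \<mu> \<kappa> (of_real e + h) / h) \<longlongrightarrow> d) (at 0)"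
    by (simp add: DERIV_def Lkap_of_real zero)
  have fr: "filterlim (of_real :: real \<Rightarrow> complex) (at 0) (at 0)"
    by (auto simp: filterlim_at eventually_at_filter intro!: tendsto_eq_intros)
  \<comment> \<open>Along the real axis the difference quotient is real, so the complex derivative d
    is real and coincides with the real \<open>deriv\<close> of the statement.\<close>
  have ql: "((\<lambda>t. of_real (Lkap \<mu> \<kappa> (e + t) / t)) \<longlongrightarrow> d) (at (0 :: real))"
    using filterlim_compose[OF dl fr] by (simp add: Lkap_of_real flip: of_real_add of_real_divide)
  have "((\<lambda>t. Lkap \<mu> \<kappa> (e + t) / t) \<longlongrightarrow> Re d) (at 0)" using tendsto_Re[OF ql] by simp
  then have "(Lkap \<mu> \<kappa> has_real_derivative Re d) (at e)" by (simp add: DERIV_def zero)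
  then have dR: "deriv (Lkap \<mu> \<kappa>) e = Re d" by (rule DERIV_imp_deriv)
  have "((\<lambda>t::real. 0) \<longlongrightarrow> Im d) (at (0::real))" using tendsto_Im[OF ql] by simp
  then have "Im d = 0" by (simp add: tendsto_const_iff)
  then have d_real: "d = of_real (Re d)" by (simp add: complex_eq_iff)
  have fi: "filterlim (\<lambda>y::real. \<i> * of_real y) (at 0) (at_right 0)"
    by (auto simp: filterlim_at eventually_at_filter intro!: tendsto_eq_intros)
  define q where "q = (\<lambda>y::real. Lkap \<mu> \<kappa> (Complex e y) / (\<i> * of_real y))"
  have q: "(q \<longlongrightarrow> d) (at_right 0)"
    using filterlim_compose[OF dl fi] by (simp add: q_def Complex_eq)
  define l where "l = (\<lambda>y::real. Lfun \<mu> (\<lambda>_. 1) (Complex e y))"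
  have l: "(l \<longlongrightarrow> of_real L1) (at_right 0)"
  proof -
    have "isCont (Lfun \<mu> (\<lambda>_. 1)) (complex_of_real e)"
      using holomorphic_Lfun off op holomorphic_on_imp_continuous_on continuous_on_eq_continuous_at by blast
    moreover have "((\<lambda>y. Complex e y) \<longlongrightarrow> of_real e) (at_right 0)"
      unfolding Complex_eq by (auto intro!: tendsto_eq_intros)
    ultimately have "((\<lambda>y. Lfun \<mu> (\<lambda>_. 1) (Complex e y)) \<longlongrightarrow> Lfun \<mu> (\<lambda>_. 1) (of_real e)) (at_right 0)"
      by (rule isCont_tendsto_compose)
    then show ?thesis by (simp add: l_def L1_def Lfun_of_real del: One_nat_def)
  qed
  have rel: "of_real y * GO (Complex e y) * q y = \<i> * l y" if "0 < y" for y
    using that Lkap_nonzero[of "Complex e y"] by (simp add: GO_def q_def l_def field_simps del: One_nat_def)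
  \<comment> \<open>If d were 0, the bounded factor y GO would force the product to 0, although it
    tends to i L1 with L1 nonzero.\<close>
  have d0: "d \<noteq> 0"
  proof
    assume "d = 0"
    have "((\<lambda>y. of_real y * GO (Complex e y) * q y) \<longlongrightarrow> 0) (at_right 0)"
    proof (rule Lim_null_comparison)
      show "eventually (\<lambda>y. norm (of_real y * GO (Complex e y) * q y) \<le> measure \<rho> UNIV * norm (q y)) (at_right 0)"
        unfolding eventually_at_filter
        by (intro always_eventually) (auto simp: norm_mult[of _ "q _"] intro!: mult_right_mono GO_bound)
      show "((\<lambda>y. measure \<rho> UNIV * norm (q y)) \<longlongrightarrow> 0) (at_right 0)"
        using tendsto_mult_right_zero[OF tendsto_norm_zero] q \<open>d = 0\<close> by blast
    qed
    moreover have "((\<lambda>y. of_real y * GO (Complex e y) * q y) \<longlongrightarrow> \<i> * of_real L1) (at_right 0)"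
    proof (rule Lim_transform_eventually)
      show "((\<lambda>y. \<i> * l y) \<longlongrightarrow> \<i> * of_real L1) (at_right 0)" by (intro tendsto_intros l)
      show "eventually (\<lambda>y. \<i> * l y = of_real y * GO (Complex e y) * q y) (at_right 0)"
        unfolding eventually_at_filter by (intro always_eventually) (simp add: rel)
    qed
    ultimately have "\<i> * complex_of_real L1 = 0" using tendsto_unique[OF trivial_limit_at_right_real] by blast
    then show False using L1 by simp
  qed
  have "((\<lambda>y. \<i> * l y / q y) \<longlongrightarrow> \<i> * of_real L1 / d) (at_right 0)"
    using d0 by (intro tendsto_intros l q)
  moreover have "eventually (\<lambda>y. \<i> * l y / q y = of_real y * GO (Complex e y)) (at_right 0)"
    unfolding eventually_at_filter
  proof (intro always_eventually allI impI)
    fix y :: real assume "y \<noteq> 0" "y \<in> {0<..}"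
    then have "0 < y" by simp
    then have "q y \<noteq> 0" using Lkap_nonzero[of "Complex e y"] by (simp add: q_def)
    then show "\<i> * l y / q y = of_real y * GO (Complex e y)" unfolding rel[OF \<open>0 < y\<close>, symmetric] by simp
  qed
  ultimately have "((\<lambda>y. of_real y * GO (Complex e y)) \<longlongrightarrow> \<i> * of_real L1 / d) (at_right 0)"
    by (rule Lim_transform_eventually)
  from tendsto_Im[OF this] have "((\<lambda>y. y * Im (GO (Complex e y))) \<longlongrightarrow> Im (\<i> * of_real L1 / d)) (at_right 0)"
    by simp
  then have "measure \<rho> {e} = Im (\<i> * of_real L1 / d)"
    using atom_limit tendsto_unique[OF trivial_limit_at_right_real] by blast
  also have "\<dots> = L1 / Re d" by (subst d_real) (simp add: Im_divide_of_real)
  finally show ?thesis by (simp add: L1_def dR del: One_nat_def)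
qed

end

section \<open>Boundary values, interior density and endpoints for a regular system\<close>

locale angelesco_regular = angelesco_spectral +
  assumes regular: "\<And>k. regular_on (Delta \<mu> k) (\<mu> k)"
begin

definition good_density :: "ix \<Rightarrow> (real \<Rightarrow> real) \<times> (real \<Rightarrow> real) \<Rightarrow> bool" where
  "good_density k p \<longleftrightarrow> dini_density (lo k) (hi k) (fst p) (snd p) \<and>
     \<mu> k = density lborel (\<lambda>x. ennreal (fst p x)) \<and>
     (\<forall>x\<in>{lo k<..<hi k}. 0 < fst p x) \<and> integrable lborel (\<lambda>x. inverse (fst p x))"

text \<open>On the bounded interval 1/w is at most 1 + (1/w)^p, so the L^p condition yields an
  integrable reciprocal; off the interval the reciprocal of W is 0 by convention.\<close>

lemma good_density_exists: "\<exists>p. good_density k p"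
proof -
  obtain w p where w: "\<mu> k = density lborel (\<lambda>x. ennreal (indicator (\<Delta> k) x * w x))"
    "Dini_on (\<Delta> k) w" "\<forall>x \<in> frontier (\<Delta> k). w x = 0" "\<forall>x \<in> interior (\<Delta> k). w x > 0"
    and p: "1 < p" "set_integrable lborel (\<Delta> k) (\<lambda>x. inverse (w x) powr p)"
    using regular[of k] unfolding regular_on_def by blast
  have w0: "w (lo k) = 0" "w (hi k) = 0" using w(3) lo_less_hi[of k] by (auto simp: Delta_eq frontier_def)
  define W where "W = (\<lambda>x. indicator {lo k..hi k} x * w x)"
  obtain \<omega> where \<omega>: "dini_density (lo k) (hi k) W \<omega>"
    using dini_density_extension[OF lo_less_hi w(2)[unfolded Delta_eq] w0] unfolding W_def by blast
  have pos: "0 < W x" if "x \<in> {lo k<..<hi k}" for x using w(4) that by (auto simp: W_def Delta_eq)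
  have inv: "integrable lborel (\<lambda>x. inverse (W x))"
  proof (rule Bochner_Integration.integrable_bound)
    show "integrable lborel (\<lambda>x. indicator {lo k..hi k} x + indicator (\<Delta> k) x *\<^sub>R (inverse (w x) powr p))"
      using p(2) emeasure_compact_finite[OF compact_Icc, of "lo k" "hi k"]
      by (intro Bochner_Integration.integrable_add integrable_real_indicator) (auto simp: set_integrable_def top.not_eq_extremum)
    have "W \<in> borel_measurable borel" using dini_density.W_measurable[OF \<omega>] .
    then show "(\<lambda>x. inverse (W x)) \<in> borel_measurable lborel" by simp
    show "AE x in lborel. norm (inverse (W x)) \<le> norm (indicator {lo k..hi k} x + indicator (\<Delta> k) x *\<^sub>R (inverse (w x) powr p))"
    proof (rule AE_I2)
      fix x
      have "inverse r \<le> 1 + inverse r powr p" if "0 \<le> r" for r :: real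
      proof (cases "inverse r \<le> 1")
        case False
        then have "inverse r powr 1 \<le> inverse r powr p" using p(1) by (intro powr_mono) auto
        then show ?thesis using False that by simp
      qed (simp add: add_increasing2)
      moreover have "0 \<le> w x" if "x \<in> {lo k..hi k}"
        using that w0 pos[of x] by (cases "x \<in> {lo k<..<hi k}") (force simp: W_def)+
      ultimately show "norm (inverse (W x)) \<le> norm (indicator {lo k..hi k} x + indicator (\<Delta> k) x *\<^sub>R (inverse (w x) powr p))"
        by (cases "x \<in> {lo k..hi k}") (auto simp: W_def Delta_eq)
    qed
  qed
  have "\<mu> k = density lborel (\<lambda>x. ennreal (W x))" unfolding W_def using w(1) by (simp add: Delta_eq)
  with \<omega> pos inv have "good_density k (W, \<omega>)" by (simp add: good_density_def)
  then show ?thesis by blast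
qed

definition dens :: "ix \<Rightarrow> (real \<Rightarrow> real) \<times> (real \<Rightarrow> real)" where "dens k = (SOME p. good_density k p)"
definition Wd :: "ix \<Rightarrow> real \<Rightarrow> real" where "Wd k = fst (dens k)"
definition om :: "ix \<Rightarrow> real \<Rightarrow> real" where "om k = snd (dens k)"

lemma good: "good_density k (dens k)"
  unfolding dens_def by (rule someI_ex[OF good_density_exists])

lemma mu_density: "\<mu> k = density lborel (\<lambda>x. ennreal (Wd k x))"
  and Wd_pos: "x \<in> {lo k<..<hi k} \<Longrightarrow> 0 < Wd k x"
  and Wd_inv: "integrable lborel (\<lambda>x. inverse (Wd k x))"
  using good[of k] by (auto simp: good_density_def Wd_def)

sublocale dd: dini_density "lo k" "hi k" "Wd k" "om k" for k
  using good[of k] by (simp add: good_density_def Wd_def om_def)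

abbreviation I :: "ix \<Rightarrow> real set" where "I k \<equiv> {lo k<..<hi k}"

lemma Wd_nonneg: "0 \<le> Wd k x"
  using Wd_pos[of x k] dd.W0[of x k] by (cases "x \<in> I k") (auto simp: less_imp_le)

lemma markov_U:
  assumes "0 < y" shows "markov (\<mu> k) (Complex x y) = dd.U k y x"
proof -
  have "markov (\<mu> k) (Complex x y) = (LINT t|density lborel (\<lambda>x. ennreal (Wd k x)). 1 / (Complex x y - of_real t))"
    unfolding markov_def by (simp only: mu_density[of k, symmetric])
  also have "\<dots> = (LINT t|lborel. Wd k t *\<^sub>R (1 / (Complex x y - of_real t)))"
    using Wd_nonneg by (intro integral_density) auto
  also have "\<dots> = dd.U k y x"
    using dd.U_eq[OF assms, of k x] by (simp add: scaleR_conv_of_real)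
  finally show ?thesis .
qed

lemma U_tendsto: "((\<lambda>y. dd.U k y x) \<longlongrightarrow> dd.U k 0 x) (at_right 0)"
proof -
  have "continuous_on {0..} (\<lambda>y. case (y, x) of (y, x) \<Rightarrow> dd.U k y x)"
    by (rule continuous_on_compose2[OF dd.U_continuous[of "\<bar>x\<bar> + 1"]]) (auto intro!: continuous_intros)
  then have "((\<lambda>y. dd.U k y x) \<longlongrightarrow> dd.U k 0 x) (at 0 within {0..})"
    by (auto simp: continuous_on_def)
  then show ?thesis by (rule tendsto_within_subset) auto
qed

lemma U_off:
  assumes "x \<notin> \<Delta> k" shows "dd.U k 0 x = of_real (markov (\<mu> k) x)"
proof -
  have off: "complex_of_real x \<in> - (of_real ` \<Delta> k)" using assms by auto
  have op: "open (- (complex_of_real ` \<Delta> k))"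
    by (intro open_Compl compact_imp_closed compact_continuous_image continuous_intros compact_Delta)
  have "isCont (markov (\<mu> k)) (complex_of_real x)"
    using holomorphic_markov off op holomorphic_on_imp_continuous_on continuous_on_eq_continuous_at by blast
  moreover have "((\<lambda>y. Complex x y) \<longlongrightarrow> of_real x) (at_right 0)"
    unfolding Complex_eq by (auto intro!: tendsto_eq_intros)
  ultimately have "((\<lambda>y. markov (\<mu> k) (Complex x y)) \<longlongrightarrow> markov (\<mu> k) (of_real x)) (at_right 0)"
    by (rule isCont_tendsto_compose)
  then have "((\<lambda>y. dd.U k y x) \<longlongrightarrow> markov (\<mu> k) (of_real x)) (at_right 0)"
    by (rule Lim_transform_eventually) (auto simp: eventually_at_filter markov_U intro!: always_eventually)
  then show ?thesis
    using U_tendsto tendsto_unique[OF trivial_limit_at_right_real] by (metis markov_of_real)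
qed

lemma Im_U_0: "Im (dd.U k 0 x) = - pi * Wd k x"
  by (simp add: dd.U_def dd.P_0)

definition qc :: "ix \<Rightarrow> real" where "qc k = vkappa \<kappa> k / mass \<mu> k"

text \<open>Together with \<open>L1b\<close> this expresses \<open>Lkap\<close> and
  \<open>Lfun\<close> at (1,1) through the continuous extensions \<open>dd.U\<close>, which remain
  defined at y = 0.\<close>

definition Lb :: "real \<Rightarrow> real \<Rightarrow> complex" where
  "Lb y x = of_real (qc One) * dd.U One y x + of_real (qc Two) * dd.U Two y x"

definition L1b :: "real \<Rightarrow> real \<Rightarrow> complex" where
  "L1b y x = of_real (1 / Xi \<mu>) * (of_real (1 / mass \<mu> Two) * dd.U Two y x - of_real (1 / mass \<mu> One) * dd.U One y x)"

lemma Lb_sym: "Lb y x = of_real (qc k) * dd.U k y x + of_real (qc (other k)) * dd.U (other k) y x"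
  by (cases k) (simp_all add: Lb_def)

lemma Lkap_Lb: "0 < y \<Longrightarrow> Lkap \<mu> \<kappa> (Complex x y) = Lb y x"
  by (simp add: Lkap_alt Lb_def markov_U qc_def vkappa_def)

lemma Lfun_L1b: "0 < y \<Longrightarrow> Lfun \<mu> (\<lambda>_. 1) (Complex x y) = L1b y x"
  by (simp only: Lfun_one L1b_def markov_U)

lemma U_continuous': "continuous_on ({0..} \<times> {- c<..<c}) (\<lambda>p. dd.U k (fst p) (snd p))"
  using dd.U_continuous[of c k] by (simp add: case_prod_unfold)

lemma Lb_continuous: "continuous_on ({0..} \<times> {- c<..<c}) (\<lambda>p. Lb (fst p) (snd p))"
  unfolding Lb_def by (intro continuous_intros U_continuous')

lemma L1b_continuous: "continuous_on ({0..} \<times> {- c<..<c}) (\<lambda>p. L1b (fst p) (snd p))"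
  unfolding L1b_def by (intro continuous_intros U_continuous')

lemma upper_boundary_Lkap: "upper_boundary_value (Lkap \<mu> \<kappa>) x = Lb 0 x"
proof -
  define c where "c = \<bar>x\<bar> + 1"
  define T where "T = {z. 0 \<le> Im z \<and> Re z \<in> {- c<..<c}}"
  have "continuous_on T (\<lambda>z. Lb (fst (Im z, Re z)) (snd (Im z, Re z)))"
    by (rule continuous_on_compose2[OF Lb_continuous[of c]]) (auto simp: T_def intro!: continuous_intros)
  moreover have "complex_of_real x \<in> T" by (auto simp: T_def c_def)
  ultimately have "((\<lambda>z. Lb (Im z) (Re z)) \<longlongrightarrow> Lb 0 x) (at (of_real x) within T)"
    by (fastforce simp: continuous_on_def)
  then have "((\<lambda>z. Lb (Im z) (Re z)) \<longlongrightarrow> Lb 0 x) (at (of_real x) within {z. 0 < Im z} \<inter> T)"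
    by (rule tendsto_within_subset) auto
  then have "((\<lambda>z. Lb (Im z) (Re z)) \<longlongrightarrow> Lb 0 x) (at (of_real x) within {z. 0 < Im z})"
  proof (rule Lim_transform_within_set)
    have "eventually (\<lambda>z. dist z (complex_of_real x) < 1) (at (of_real x))"
      by (auto simp: eventually_at intro: exI[of _ 1])
    then show "eventually (\<lambda>z. z \<in> {z. 0 < Im z} \<inter> T \<longleftrightarrow> z \<in> {z. 0 < Im z}) (at (complex_of_real x))"
    proof eventually_elim
      case (elim z)
      have "\<bar>Re z - x\<bar> < 1" using elim abs_Re_le_cmod[of "z - of_real x"] by (simp add: dist_norm)
      then show ?case by (auto simp: T_def c_def)
    qed
  qed
  then have "(Lkap \<mu> \<kappa> \<longlongrightarrow> Lb 0 x) (at (of_real x) within {z. 0 < Im z})"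
  proof (rule Lim_transform_eventually)
    have "Lb (Im z) (Re z) = Lkap \<mu> \<kappa> z" if "0 < Im z" for z
      using Lkap_Lb[OF that, of "Re z"] by simp
    then show "eventually (\<lambda>z. Lb (Im z) (Re z) = Lkap \<mu> \<kappa> z) (at (of_real x) within {z. 0 < Im z})"
      unfolding eventually_at_filter by (intro always_eventually) auto
  qed
  then show ?thesis
    unfolding upper_boundary_value_def using upper_half_plane_limit by (intro tendsto_Lim)
qed

lemma I_sub: "x \<in> I k \<Longrightarrow> x \<in> \<Delta> k" "x \<in> \<Delta> k \<Longrightarrow> x \<notin> \<Delta> (other k)"
  using Delta_other_disjoint[of k] by (auto simp: Delta_eq)

lemma qc_other_nonzero: "qc k = 0 \<Longrightarrow> qc (other k) \<noteq> 0"
  using kappa_sum mass_pos[of One] mass_pos[of Two] by (cases k) (auto simp: qc_def vkappa_def)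

text \<open>The positive density gives a nonzero imaginary part unless the coefficient of this
  interval is 0; then only the other Markov function is left, which is real and nonzero
  here.\<close>

lemma Lb_0_nonzero:
  assumes x: "x \<in> I k" shows "Lb 0 x \<noteq> 0"
proof (cases "qc k = 0")
  case True
  have off: "x \<notin> \<Delta> (other k)" using I_sub x by blast
  then show ?thesis
    using qc_other_nonzero[OF True] markov_nonzero_real[OF off] by (simp add: Lb_sym[of 0 x k] True U_off)
next
  case False
  have off: "x \<notin> \<Delta> (other k)" using I_sub x by blast
  have "Im (Lb 0 x) = - (qc k * (pi * Wd k x))" by (simp add: Lb_sym[of 0 x k] U_off[OF off] Im_U_0)
  then have "Im (Lb 0 x) \<noteq> 0" using False Wd_pos[OF x] by simp
  then show ?thesis by auto
qed

definition \<phi> :: "ix \<Rightarrow> real \<Rightarrow> real" where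
  "\<phi> k x = S_O \<mu> x * Wd k x / (cmod (Lb 0 x))\<^sup>2"

lemma boundary_Im:
  assumes x: "x \<in> I k"
  shows "Im (- L1b 0 x / Lb 0 x) = pi * \<phi> k x"
proof -
  define u where "u = of_real (1 / mass \<mu> One) * dd.U One 0 x"
  define v where "v = of_real (1 / mass \<mu> Two) * dd.U Two 0 x"
  have k2: "\<kappa> Two = 1 - \<kappa> One" using kappa_sum by simp
  have L: "Lb 0 x = of_real (1 - \<kappa> One) * u + of_real (\<kappa> One) * v"
    by (simp add: Lb_def u_def v_def qc_def vkappa_def k2)
  have "- L1b 0 x / Lb 0 x = - (of_real (1 / Xi \<mu>) * (v - u)) / Lb 0 x"
    by (simp add: L1b_def u_def v_def)
  then have 1: "Im (- L1b 0 x / Lb 0 x) = Im (u * cnj v) / (Xi \<mu> * (cmod (Lb 0 x))\<^sup>2)"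
    using Im_quotient_algebra[OF L] by simp
  have off: "x \<notin> \<Delta> (other k)" using I_sub x by blast
  have "Im (u * cnj v) = pi * Wd k x * (sg k * markov (\<mu> (other k)) x) / (mass \<mu> One * mass \<mu> Two)"
    using U_off[OF off] Im_U_0[of k x] by (cases k) (simp_all add: u_def v_def sg_def)
  then show ?thesis
    unfolding 1 \<phi>_def S_O_eq[OF I_sub(1)[OF x]] by (simp add: field_simps)
qed

lemma \<phi>_nonneg: "x \<in> I k \<Longrightarrow> 0 \<le> \<phi> k x"
  using S_O_pos[OF I_sub(1)] Wd_nonneg by (simp add: \<phi>_def less_imp_le)

lemma I_bound: obtains c where "\<And>k. I k \<subseteq> {- c<..<c}"
proof
  show "I k \<subseteq> {- (\<bar>lo One\<bar> + \<bar>hi One\<bar> + \<bar>lo Two\<bar> + \<bar>hi Two\<bar> + 1)<..<\<bar>lo One\<bar> + \<bar>hi One\<bar> + \<bar>lo Two\<bar> + \<bar>hi Two\<bar> + 1}" for k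
    by (cases k) auto
qed

lemma rho_interior:
  assumes B: "B \<in> sets borel"
  shows "emeasure \<rho> (B \<inter> I k) = (\<integral>\<^sup>+x. indicator (B \<inter> I k) x * ennreal (\<phi> k x) \<partial>lborel)"
proof -
  define \<Phi> where "\<Phi> = (\<lambda>y x. Im (- L1b y x / Lb y x))"
  obtain c where c: "\<And>k. I k \<subseteq> {- c<..<c}" by (rule I_bound) blast
  have sub: "{0..} \<times> I k \<subseteq> {0..} \<times> {- c<..<c}" using c[of k] by auto
  have nz: "Lb (fst p) (snd p) \<noteq> 0" if "p \<in> {0..} \<times> I k" for p
  proof (cases "fst p = 0")
    case True
    then show ?thesis using Lb_0_nonzero[of "snd p" k] that by auto
  next
    case False
    then have "0 < fst p" using that by auto
    then show ?thesis using Lkap_nonzero[of "Complex (snd p) (fst p)"] Lkap_Lb[of "fst p" "snd p"] by simp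
  qed
  have "continuous_on ({0..} \<times> I k) (\<lambda>p. Im (- L1b (fst p) (snd p) / Lb (fst p) (snd p)))"
    using nz by (intro continuous_intros continuous_on_subset[OF Lb_continuous sub] continuous_on_subset[OF L1b_continuous sub]) auto
  then have cont: "continuous_on ({0..} \<times> I k) (\<lambda>(y, x). \<Phi> y x)" by (simp add: \<Phi>_def case_prod_unfold)
  have eq: "\<Phi> y x = Im (GO (Complex x y))" if "0 < y" for x y
    using that by (simp only: \<Phi>_def GO_def Lkap_Lb Lfun_L1b)
  have "emeasure \<rho> (B \<inter> I k) = (\<integral>\<^sup>+x. indicator (B \<inter> I k) x * ennreal (\<Phi> 0 x / pi) \<partial>lborel)"
    using cont eq B by (intro rho.stieltjes_inversion[OF Im_GO]) auto
  also have "\<dots> = (\<integral>\<^sup>+x. indicator (B \<inter> I k) x * ennreal (\<phi> k x) \<partial>lborel)"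
  proof (intro nn_integral_cong)
    fix x
    have "\<Phi> 0 x / pi = \<phi> k x" if "x \<in> I k" using boundary_Im[OF that] by (simp add: \<Phi>_def del: minus_divide_left)
    then show "indicator (B \<inter> I k) x * ennreal (\<Phi> 0 x / pi) = indicator (B \<inter> I k) x * ennreal (\<phi> k x)"
      by (auto simp: indicator_def)
  qed
  finally show ?thesis .
qed

lemma Im_U: "0 < y \<Longrightarrow> Im (dd.U k y x) = - (y * (LINT t|lborel. Wd k t / ((x - t)\<^sup>2 + y\<^sup>2)))"
proof -
  assume y: "0 < y"
  have "Im (dd.U k y x) = - (LINT t|lborel. Wd k t * poisson y (x - t))"
    using poisson_convolution(1)[OF y, of "Wd k" x] by (simp add: dd.U_def dd.P_def)
  also have "(LINT t|lborel. Wd k t * poisson y (x - t)) = (LINT t|lborel. y * (Wd k t / ((x - t)\<^sup>2 + y\<^sup>2)))"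
    by (intro Bochner_Integration.integral_cong refl) (simp add: poisson_def mult.commute)
  finally show ?thesis by (simp only: integral_mult_right_zero)
qed

text \<open>The density vanishes at c, so \<open>Lb 0 c\<close> may be 0 and only the rate counts:
  the imaginary part divided by y grows at least logarithmically by \<open>endpoint_blowup\<close>.
  If the coefficient of interval k is 0, \<open>Lb 0 c\<close> is nonzero and the claim is
  immediate.\<close>

lemma Lb_endpoint:
  assumes c: "c = lo k \<or> c = hi k"
  shows "((\<lambda>y. y / cmod (Lb y c)) \<longlongrightarrow> 0) (at_right 0)"
proof (cases "qc k = 0")
  case True
  have off: "c \<notin> \<Delta> (other k)" using c lo_less_hi[of k] by (intro I_sub(2)) (auto simp: Delta_eq)
  have "of_real (qc (other k)) * dd.U (other k) 0 c \<noteq> 0"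
    using qc_other_nonzero[OF True] markov_nonzero_real[OF off] by (simp add: U_off[OF off])
  then have "((\<lambda>y. y / cmod (of_real (qc (other k)) * dd.U (other k) y c)) \<longlongrightarrow> 0 / cmod (of_real (qc (other k)) * dd.U (other k) 0 c)) (at_right 0)"
    by (intro tendsto_intros U_tendsto) simp
  then show ?thesis by (simp add: Lb_sym[of _ c k] True)
next
  case False
  define j where "j = other k"
  have off: "c \<notin> \<Delta> j" using c lo_less_hi[of k] unfolding j_def by (intro I_sub(2)) (auto simp: Delta_eq)
  obtain d where d: "0 < d" "\<And>t. t \<in> \<Delta> j \<Longrightarrow> d \<le> dist c t"
    using separate_point_closed[OF closed_Delta off] by blast
  define K where "K = (\<lambda>i y. LINT t|lborel. Wd i t / ((c - t)\<^sup>2 + y\<^sup>2))"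
  \<comment> \<open>The other interval stays at distance d from c, so its contribution is bounded
    uniformly in y and cannot cancel the logarithm.\<close>
  define Cj where "Cj = (LINT t|lborel. Wd j t / d\<^sup>2)"
  have Kj: "\<bar>K j y\<bar> \<le> Cj" if "0 < y" for y
  proof -
    have "\<bar>K j y\<bar> \<le> (LINT t|lborel. \<bar>Wd j t / ((c - t)\<^sup>2 + y\<^sup>2)\<bar>)"
      unfolding K_def by (rule integral_abs_bound)
    also have "\<dots> \<le> Cj"
      unfolding Cj_def
    proof (rule integral_mono')
      show "integrable lborel (\<lambda>t. Wd j t / d\<^sup>2)" using dd.W_integrable[of j] by simp
      fix t
      show "0 \<le> Wd j t / d\<^sup>2" using Wd_nonneg by simp
      show "\<bar>Wd j t / ((c - t)\<^sup>2 + y\<^sup>2)\<bar> \<le> Wd j t / d\<^sup>2"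
      proof (cases "t \<in> \<Delta> j")
        case True
        then have "d\<^sup>2 \<le> (c - t)\<^sup>2" using d(2)[OF True] d(1) by (simp add: dist_real_def abs_le_square_iff[symmetric])
        then have "d\<^sup>2 \<le> (c - t)\<^sup>2 + y\<^sup>2" by (simp add: add_increasing2)
        then have "Wd j t / ((c - t)\<^sup>2 + y\<^sup>2) \<le> Wd j t / d\<^sup>2"
          using d(1) Wd_nonneg[of j t] that by (intro divide_left_mono mult_pos_pos add_nonneg_pos) auto
        then show ?thesis using Wd_nonneg[of j t] by simp
      next
        case False
        then have "Wd j t = 0" by (intro dd.W0) (auto simp: Delta_eq)
        then show ?thesis by simp
      qed
    qed
    finally show ?thesis .
  qed
  define C where "C = (LINT x|lborel. inverse (Wd k x))"
  define l where "l = hi k - lo k"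
  have l: "0 < l" using lo_less_hi by (simp add: l_def)
  have Kk: "ln l - ln y - C \<le> K k y" if "0 < y" "y < l" for y
    using dd.endpoint_blowup[OF Wd_pos Wd_inv c that(1)] that(2) by (simp add: K_def C_def l_def)
  define R where "R = (\<lambda>y. \<bar>qc k\<bar> * (ln l - ln y - C) - \<bar>qc j\<bar> * Cj)"
  have "filterlim R at_top (at_right 0)"
  proof -
    have "filterlim (\<lambda>y::real. - ln y) at_top (at_right 0)"
      using ln_at_0 by (simp add: filterlim_uminus_at_top)
    then have "filterlim (\<lambda>y. (ln l - C) + - ln y) at_top (at_right 0)"
      by (intro filterlim_tendsto_add_at_top[OF tendsto_const])
    then have "filterlim (\<lambda>y. \<bar>qc k\<bar> * ((ln l - C) + - ln y)) at_top (at_right 0)"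
      using False by (intro filterlim_tendsto_pos_mult_at_top[OF tendsto_const]) auto
    then have "filterlim (\<lambda>y. - (\<bar>qc j\<bar> * Cj) + \<bar>qc k\<bar> * ((ln l - C) + - ln y)) at_top (at_right 0)"
      by (intro filterlim_tendsto_add_at_top[OF tendsto_const])
    then show ?thesis by (simp add: R_def algebra_simps)
  qed
  moreover have "eventually (\<lambda>y. R y \<le> cmod (Lb y c) / y) (at_right 0)"
    unfolding eventually_at_right_field
  proof (intro exI[of _ l] conjI l allI impI)
    fix y assume y: "0 < y" "y < l"
    have "Im (Lb y c) = - (y * (qc k * K k y + qc j * K j y))"
      using y(1) by (simp add: Lb_sym[of y c k] Im_U K_def j_def algebra_simps)
    then have "y * \<bar>qc k * K k y + qc j * K j y\<bar> \<le> cmod (Lb y c)"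
      using abs_Im_le_cmod[of "Lb y c"] y(1) by (simp add: abs_mult)
    then have 1: "\<bar>qc k * K k y + qc j * K j y\<bar> \<le> cmod (Lb y c) / y"
      using y(1) by (simp add: pos_le_divide_eq mult.commute)
    have "\<bar>qc k\<bar> * (ln l - ln y - C) \<le> \<bar>qc k\<bar> * K k y" using Kk[OF y] by (intro mult_left_mono) auto
    also have "\<dots> \<le> \<bar>qc k * K k y\<bar>" by (simp add: abs_mult mult_left_mono)
    finally have 2: "\<bar>qc k\<bar> * (ln l - ln y - C) \<le> \<bar>qc k * K k y\<bar>" .
    have 3: "\<bar>qc j * K j y\<bar> \<le> \<bar>qc j\<bar> * Cj" using Kj[OF y(1)] by (simp add: abs_mult mult_left_mono)
    show "R y \<le> cmod (Lb y c) / y" unfolding R_def using 1 2 3 by linarith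
  qed
  ultimately have "filterlim (\<lambda>y. cmod (Lb y c) / y) at_top (at_right 0)"
    by (rule filterlim_at_top_mono)
  then have "((\<lambda>y. inverse (cmod (Lb y c) / y)) \<longlongrightarrow> 0) (at_right 0)"
    by (rule tendsto_inverse_0_at_top)
  then show ?thesis by simp
qed

lemma atom_endpoint:
  assumes c: "c = lo k \<or> c = hi k"
  shows "measure \<rho> {c} = 0"
proof -
  have l: "((\<lambda>y. L1b y c) \<longlongrightarrow> L1b 0 c) (at_right 0)"
    unfolding L1b_def by (intro tendsto_intros U_tendsto)
  have "((\<lambda>y. y * Im (GO (Complex c y))) \<longlongrightarrow> 0) (at_right 0)"
  proof (rule Lim_null_comparison)
    show "eventually (\<lambda>y. norm (y * Im (GO (Complex c y))) \<le> cmod (L1b y c) * (y / cmod (Lb y c))) (at_right 0)"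
      unfolding eventually_at_filter
    proof (intro always_eventually allI impI)
      fix y :: real assume "y \<noteq> 0" "y \<in> {0<..}"
      then have y: "0 < y" by simp
      have "\<bar>Im (GO (Complex c y))\<bar> \<le> cmod (L1b y c) / cmod (Lb y c)"
        using abs_Im_le_cmod[of "GO (Complex c y)"] y by (simp add: GO_def Lkap_Lb Lfun_L1b norm_divide del: One_nat_def)
      then have "y * \<bar>Im (GO (Complex c y))\<bar> \<le> y * (cmod (L1b y c) / cmod (Lb y c))" using y by (intro mult_left_mono) auto
      then show "norm (y * Im (GO (Complex c y))) \<le> cmod (L1b y c) * (y / cmod (Lb y c))" using y by (simp add: abs_mult mult.commute)
    qed
    have "((\<lambda>y. cmod (L1b y c) * (y / cmod (Lb y c))) \<longlongrightarrow> cmod (L1b 0 c) * 0) (at_right 0)"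
      by (intro tendsto_mult tendsto_norm l Lb_endpoint[OF c])
    then show "((\<lambda>y. cmod (L1b y c) * (y / cmod (Lb y c))) \<longlongrightarrow> 0) (at_right 0)" by simp
  qed
  then show ?thesis using atom_limit[of c] tendsto_unique[OF trivial_limit_at_right_real] by blast
qed

lemma mu_star_density: "mu_star \<mu> = density lborel (\<lambda>x. ennreal (Wd One x + Wd Two x))"
proof -
  define M where "M = density lborel (\<lambda>x. ennreal (Wd One x + Wd Two x))"
  have em: "emeasure (\<mu> k) (B \<inter> \<Delta> k) = (\<integral>\<^sup>+x. ennreal (Wd k x) * indicator B x \<partial>lborel)" if B: "B \<in> sets borel" for B k
  proof -
    have "emeasure (\<mu> k) (B \<inter> \<Delta> k) = emeasure (density lborel (\<lambda>x. ennreal (Wd k x))) (B \<inter> \<Delta> k)"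
      by (simp only: mu_density[of k, symmetric])
    also have "\<dots> = (\<integral>\<^sup>+x. ennreal (Wd k x) * indicator (B \<inter> \<Delta> k) x \<partial>lborel)"
      using B DE_borel(3)[of k] by (intro emeasure_density) auto
    also have "\<dots> = (\<integral>\<^sup>+x. ennreal (Wd k x) * indicator B x \<partial>lborel)"
    proof (intro nn_integral_cong)
      fix x
      have "Wd k x = 0" if "x \<notin> \<Delta> k" using that by (intro dd.W0) (auto simp: Delta_eq)
      then show "ennreal (Wd k x) * indicator (B \<inter> \<Delta> k) x = ennreal (Wd k x) * indicator B x"
        by (auto simp: indicator_def)
    qed
    finally show ?thesis .
  qed
  have "(\<Sum>k\<in>UNIV. emeasure (\<mu> k) (B \<inter> \<Delta> k)) = emeasure M B" if B: "B \<in> sets borel" for B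
  proof -
    have "emeasure M B = (\<integral>\<^sup>+x. ennreal (Wd One x) * indicator B x + ennreal (Wd Two x) * indicator B x \<partial>lborel)"
      using B Wd_nonneg by (simp add: M_def emeasure_density distrib_right)
    also have "\<dots> = (\<integral>\<^sup>+x. ennreal (Wd One x) * indicator B x \<partial>lborel) + (\<integral>\<^sup>+x. ennreal (Wd Two x) * indicator B x \<partial>lborel)"
      using B by (intro nn_integral_add) auto
    finally show ?thesis by (simp add: sum_ix em[OF B])
  qed
  then have "mu_star \<mu> = measure_of UNIV (sets borel) (emeasure M)"
    unfolding mu_star_def by (intro measure_of_eq) (auto simp: sets.sigma_sets_eq[of borel, simplified])
  also have "\<dots> = measure_of (space M) (sets M) (emeasure M)" by (simp add: M_def)
  also have "\<dots> = M" by (rule measure_of_of_measure)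
  finally show ?thesis by (simp add: M_def)
qed

definition g :: "real \<Rightarrow> real" where
  "g x = S_O \<mu> x / (cmod (upper_boundary_value (Lkap \<mu> \<kappa>) x))\<^sup>2"

lemma g_measurable [measurable]: "g \<in> borel_measurable borel"
proof -
  have "continuous_on UNIV (Lb 0)"
    unfolding continuous_on_eq_continuous_within
  proof
    fix x :: real
    have "continuous_on {- (\<bar>x\<bar> + 1)<..<\<bar>x\<bar> + 1} ((\<lambda>p. Lb (fst p) (snd p)) \<circ> Pair 0)"
      by (intro continuous_on_compose continuous_on_subset[OF Lb_continuous[of "\<bar>x\<bar> + 1"]] continuous_intros) auto
    then have "continuous_on {- (\<bar>x\<bar> + 1)<..<\<bar>x\<bar> + 1} (Lb 0)" by (simp add: comp_def)
    then show "isCont (Lb 0) x"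
      by (rule continuous_on_interior) (auto simp: interior_open)
  qed
  then have [measurable]: "Lb 0 \<in> borel_measurable borel" by (rule borel_measurable_continuous_onI)
  have [measurable]: "(\<lambda>x. markov (\<mu> k) x :: real) \<in> borel_measurable borel" for k
  proof -
    have "(\<lambda>(x, s). 1 / (x - of_real s) :: real) \<in> borel_measurable (borel \<Otimes>\<^sub>M \<mu> k)" by measurable
    then show ?thesis unfolding markov_def by (rule fin.borel_measurable_lebesgue_integral)
  qed
  note [measurable] = DE_borel(3)
  show ?thesis unfolding g_def upper_boundary_Lkap S_O_def by measurable
qed

lemma gW: "(Wd One x + Wd Two x) * g x = (\<Sum>k\<in>UNIV. indicator (I k) x * \<phi> k x)"
proof -
  have "Wd k x * g x = indicator (I k) x * \<phi> k x" for k
    using dd.W0[of x k] by (cases "x \<in> I k") (auto simp: \<phi>_def g_def upper_boundary_Lkap mult.commute)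
  then show ?thesis by (simp add: sum_ix distrib_right)
qed

text \<open>Stieltjes inversion identifies the extended integral with a value of the finite measure
  \<open>\<rho>\<close>; finiteness is thus inherited, without any estimate of \<open>\<phi>\<close>
  near the endpoints.\<close>

lemma \<phi>_integrable: "integrable lborel (\<lambda>x. indicator (B \<inter> I k) x * \<phi> k x)"
  and \<phi>_integral: "(LINT x|lborel. indicator (B \<inter> I k) x * \<phi> k x) = measure \<rho> (B \<inter> I k)"
  if B: "B \<in> sets borel" for B
proof -
  have eq: "indicator (B \<inter> I k) x * \<phi> k x = indicator (B \<inter> I k) x * (Wd k x * g x)" for x
    by (auto simp: \<phi>_def g_def upper_boundary_Lkap)
  have m: "(\<lambda>x. indicator (B \<inter> I k) x * \<phi> k x) \<in> borel_measurable lborel"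
    unfolding eq using B by measurable
  have nonneg: "0 \<le> indicator (B \<inter> I k) x * \<phi> k x" for x
    using \<phi>_nonneg[of x k] by (auto simp: indicator_def)
  have "(\<integral>\<^sup>+x. ennreal (indicator (B \<inter> I k) x * \<phi> k x) \<partial>lborel) = (\<integral>\<^sup>+x. indicator (B \<inter> I k) x * ennreal (\<phi> k x) \<partial>lborel)"
    by (intro nn_integral_cong) (auto simp: indicator_def)
  also have "\<dots> = emeasure \<rho> (B \<inter> I k)" using rho_interior[OF B] by simp
  finally have nn: "(\<integral>\<^sup>+x. ennreal (indicator (B \<inter> I k) x * \<phi> k x) \<partial>lborel) = ennreal (measure \<rho> (B \<inter> I k))"
    by (simp add: rho.emeasure_eq_measure)
  show int: "integrable lborel (\<lambda>x. indicator (B \<inter> I k) x * \<phi> k x)"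
    using m nonneg nn by (intro integrableI_nonneg) auto
  show "(LINT x|lborel. indicator (B \<inter> I k) x * \<phi> k x) = measure \<rho> (B \<inter> I k)"
    using nn_integral_eq_integral[OF int] nonneg nn by (simp add: integral_nonneg_AE)
qed

lemma g_integrable: "integrable (mu_star \<mu>) g"
proof -
  have "integrable lborel (\<lambda>x. (Wd One x + Wd Two x) *\<^sub>R g x)"
    using \<phi>_integrable[of UNIV] by (simp add: gW sum_ix)
  then show ?thesis
    unfolding mu_star_density using Wd_nonneg by (subst integrable_density) auto
qed

text \<open>Up to the endpoints, which carry no mass, \<open>\<rho>\<close> lives on the two open
  intervals and E; Stieltjes inversion handles the intervals and the residue formula the point of
  E.\<close>

lemma rho_formula:
  assumes B: "B \<in> sets borel"
  shows "measure \<rho> B = (LINT x:B|mu_star \<mu>. g x) + (\<Sum>e\<in>E \<inter> B. Lfun \<mu> (\<lambda>_. 1) e / deriv (Lkap \<mu> \<kappa>) e)"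
proof -
  have "(LINT x:B|mu_star \<mu>. g x) = (LINT x|lborel. (Wd One x + Wd Two x) *\<^sub>R (indicator B x *\<^sub>R g x))"
    unfolding set_lebesgue_integral_def mu_star_density
    using B Wd_nonneg by (intro integral_density) auto
  also have "\<dots> = (LINT x|lborel. indicator (B \<inter> I One) x * \<phi> One x + indicator (B \<inter> I Two) x * \<phi> Two x)"
  proof (intro Bochner_Integration.integral_cong refl)
    fix x
    have "(Wd One x + Wd Two x) *\<^sub>R (indicator B x *\<^sub>R g x) = indicator B x * ((Wd One x + Wd Two x) * g x)" by simp
    also have "\<dots> = indicator (B \<inter> I One) x * \<phi> One x + indicator (B \<inter> I Two) x * \<phi> Two x"
      unfolding gW by (simp add: sum_ix indicator_inter_arith distrib_left)
    finally show "(Wd One x + Wd Two x) *\<^sub>R (indicator B x *\<^sub>R g x) = indicator (B \<inter> I One) x * \<phi> One x + indicator (B \<inter> I Two) x * \<phi> Two x" .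
  qed
  also have "\<dots> = measure \<rho> (B \<inter> I One) + measure \<rho> (B \<inter> I Two)"
    using \<phi>_integrable[OF B] \<phi>_integral[OF B] by simp
  finally have int: "(LINT x:B|mu_star \<mu>. g x) = measure \<rho> (B \<inter> I One) + measure \<rho> (B \<inter> I Two)" .
  have "(\<Sum>e\<in>E \<inter> B. Lfun \<mu> (\<lambda>_. 1) e / deriv (Lkap \<mu> \<kappa>) e) = (\<Sum>e\<in>E \<inter> B. measure \<rho> {e})"
    by (intro sum.cong) (simp_all add: atom_at_E del: One_nat_def)
  also have "\<dots> = measure \<rho> (E \<inter> B)"
    using finite_E by (intro rho.finite_measure_eq_sum_singleton[symmetric]) auto
  finally have atoms: "(\<Sum>e\<in>E \<inter> B. Lfun \<mu> (\<lambda>_. 1) e / deriv (Lkap \<mu> \<kappa>) e) = measure \<rho> (E \<inter> B)" .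
  have ne: "AE x in \<rho>. x \<noteq> lo k \<and> x \<noteq> hi k" for k
  proof -
    have "AE x in \<rho>. x \<noteq> c" if "c = lo k \<or> c = hi k" for c
    proof (rule AE_I[of _ _ "{c}"])
      show "emeasure \<rho> {c} = 0" using atom_endpoint[OF that] by (simp add: rho.emeasure_eq_measure)
    qed auto
    then show ?thesis by simp
  qed
  have "AE x in \<rho>. x \<in> B \<longleftrightarrow> x \<in> (B \<inter> I One \<union> B \<inter> I Two) \<union> E \<inter> B"
    using AE_rho ne[of One] ne[of Two]
  proof eventually_elim
    case (elim x)
    then show ?case by (auto simp: Delta_eq)
  qed
  then have "measure \<rho> B = measure \<rho> ((B \<inter> I One \<union> B \<inter> I Two) \<union> E \<inter> B)"
    using B DE_borel(2) by (intro measure_eq_AE) auto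
  also have "\<dots> = measure \<rho> (B \<inter> I One \<union> B \<inter> I Two) + measure \<rho> (E \<inter> B)"
  proof (rule rho.finite_measure_Union)
    have "I k \<inter> E = {}" for k using I_sub(1)[of _ k] E_off by blast
    then show "(B \<inter> I One \<union> B \<inter> I Two) \<inter> (E \<inter> B) = {}" by blast
  qed (use B DE_borel(2) in auto)
  also have "measure \<rho> (B \<inter> I One \<union> B \<inter> I Two) = measure \<rho> (B \<inter> I One) + measure \<rho> (B \<inter> I Two)"
    using B hi_less_lo by (intro rho.finite_measure_Union) auto
  finally show ?thesis unfolding int atoms .
qed

end

theorem proposition3p3p2:
  fixes \<mu> :: "ix \<Rightarrow> real measure" and \<kappa> :: "ix \<Rightarrow> real" and \<rho> :: "real measure"
  assumes "angelesco \<mu>"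
    and "\<kappa> One + \<kappa> Two = 1"
    and "is_spectral_measure \<mu> \<kappa> [] \<rho>"
  shows "msupport \<rho> \<subseteq> Delta \<mu> One \<union> Delta \<mu> Two \<union> Eset \<mu> \<kappa> \<and>
    (\<forall>Y. weak_star_limit (\<lambda>y x. Im (Green \<mu> \<kappa> Y [] (Complex x y))) \<rho> (\<lambda>x. pi * Psi \<mu> \<kappa> x Y)) \<and>
    (\<forall>x Y. jacobi \<mu> \<kappa> (Psi \<mu> \<kappa> x) Y = x * Psi \<mu> \<kappa> x Y) \<and>
    (\<forall>Y. integrable \<rho> (\<lambda>x. Psi \<mu> \<kappa> x Y) \<and> kron [] Y = (LINT x|\<rho>. Psi \<mu> \<kappa> x Y)) \<and>
    ((\<forall>k. regular_on (Delta \<mu> k) (\<mu> k)) \<longrightarrow>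
      (let g = (\<lambda>x. S_O \<mu> x / (cmod (upper_boundary_value (Lkap \<mu> \<kappa>) x))\<^sup>2)
       in integrable (mu_star \<mu>) g \<and>
          (\<forall>B \<in> sets borel. measure \<rho> B =
             (LINT x:B|mu_star \<mu>. g x) +
             (\<Sum>E \<in> Eset \<mu> \<kappa> \<inter> B. Lfun \<mu> (\<lambda>_. 1) E / deriv (Lkap \<mu> \<kappa>) E))))"
proof -
  interpret angelesco_spectral \<mu> \<kappa> \<rho>
    using assms by unfold_locales
  have "let g = (\<lambda>x. S_O \<mu> x / (cmod (upper_boundary_value (Lkap \<mu> \<kappa>) x))\<^sup>2)
       in integrable (mu_star \<mu>) g \<and>
          (\<forall>B \<in> sets borel. measure \<rho> B =
             (LINT x:B|mu_star \<mu>. g x) +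
             (\<Sum>E \<in> Eset \<mu> \<kappa> \<inter> B. Lfun \<mu> (\<lambda>_. 1) E / deriv (Lkap \<mu> \<kappa>) E))"
    if "\<forall>k. regular_on (Delta \<mu> k) (\<mu> k)"
  proof -
    interpret angelesco_regular \<mu> \<kappa> \<rho>
      using that by unfold_locales blast
    show ?thesis
      unfolding Let_def g_def[symmetric, abs_def] using g_integrable rho_formula by blast
  qed
  then show ?thesis
    using msupport_rho weak_star_limit_Green jacobi_Psi integrable_Psi integral_Psi by simp
qed

end
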